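(* Let $\mathbb K$ be a field of characteristic $0$, let $\mathfrak g$ be a finite-dimensional Lie algebra over $\mathbb K$, and let $r\in\Lambda^2\mathfrak g$ be a classical $r$-matrix (possibly degenerate). Then there exists a formal twist $\mathcal F\in(\mathscr U(\mathfrak g)\otimes\mathscr U(\mathfrak g))[[t]]$ such that $$\mathcal F=1\otimes1+\frac t2\,r+\mathcal O(t^2).$$
   Context: A classical $r$-matrix is an element $r\in\Lambda^2\mathfrak g$ (viewed as an antisymmetric tensor in $\mathfrak g\otimes\mathfrak g\subseteq\mathscr U(\mathfrak g)\otimes\mathscr U(\mathfrak g)$) with $[[r,r]]=0$, where $[[\cdot,\cdot]]$ is the unique extension of the Lie bracket to $\Lambda^\bullet\mathfrak g$ making it a Gerstenhaber algebra. A formal twist is an invertible $\mathcal F\in(\mathscr U(\mathfrak g)\otimes\mathscr U(\mathfrak g))[[t]]$ with $(\Delta\otimes\mathrm{id})(\mathcal F)(\mathcal F\otimes1)=(\mathrm{id}\otimes\Delta)(\mathcal F)(1\otimes\mathcal F)$, $(\epsilon\otimes\mathrm{id})\mathcal F=1=(\mathrm{id}\otimes\epsilon)\mathcal F$ and $\mathcal F=1\otimes1+\mathcal O(t)$, where $\Delta,\epsilon$ are the coproduct and counit of the universal enveloping algebra $\mathscr U(\mathfrak g)$. *)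

theory Defs
  imports Complex_Main "HOL-Library.Poly_Mapping" "HOL-Algebra.QuotRing" "HOL-Algebra.Module"
begin

section \<open>Lie algebras\<close>

text \<open>Every vector space, hence every Lie algebra, occurs with the whole type \<open>'g\<close> as its carrier.\<close>

locale lie_algebra = vector_space scale
  for scale :: "'k::field \<Rightarrow> 'g::ab_group_add \<Rightarrow> 'g" +
  fixes bracket :: "'g \<Rightarrow> 'g \<Rightarrow> 'g"
  assumes bracket_linear_left: "Vector_Spaces.linear scale scale (\<lambda>x. bracket x y)"
    and bracket_linear_right: "Vector_Spaces.linear scale scale (bracket x)"
    and bracket_alternating: "bracket x x = 0"
    and bracket_jacobi:
      "bracket x (bracket y z) + bracket y (bracket z x) + bracket z (bracket x y) = 0"

locale finite_dimensional_lie_algebra = lie_algebra +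
  assumes finite_dimensional: "\<exists>B. finite B \<and> span B = UNIV"


section \<open>Algebras over a field\<close>

text \<open>
  An associative unital algebra over the field \<open>'k\<close> is presented by a record of type
  \<open>('k, 'a) module\<close>: the ring operations of HOL-Algebra together with the scalar
  multiplication \<open>\<odot>\<close>. Free vector spaces are the types \<open>'m \<Rightarrow>\<^sub>0 'k\<close>.
\<close>

definition ground_field :: "('k::field, 'k) module" where
  "ground_field =
    \<lparr>carrier = UNIV, mult = (*), one = 1, zero = 0, add = (+), smult = (*)\<rparr>"

definition linear_map ::
  "('k::field, 'a) module \<Rightarrow> ('k, 'b) module \<Rightarrow> ('a \<Rightarrow> 'b) \<Rightarrow> bool" where
  "linear_map A B f \<longleftrightarrow>
    f \<in> carrier A \<rightarrow> carrier B \<and>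
    (\<forall>x\<in>carrier A. \<forall>y\<in>carrier A. f (x \<oplus>\<^bsub>A\<^esub> y) = f x \<oplus>\<^bsub>B\<^esub> f y) \<and>
    (\<forall>c. \<forall>x\<in>carrier A. f (c \<odot>\<^bsub>A\<^esub> x) = c \<odot>\<^bsub>B\<^esub> f x)"

definition pm_scale :: "'k::field \<Rightarrow> ('m \<Rightarrow>\<^sub>0 'k) \<Rightarrow> ('m \<Rightarrow>\<^sub>0 'k)" where
  "pm_scale c = Poly_Mapping.map ((*) c)"

text \<open>The monoid algebra of \<open>M\<close>: the free vector space on \<open>carrier M\<close> with the bilinear
  extension of the multiplication of \<open>M\<close>.\<close>

definition monoid_algebra :: "('m, 'x) monoid_scheme \<Rightarrow> ('k::field, 'm \<Rightarrow>\<^sub>0 'k) module" where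
  "monoid_algebra M =
    \<lparr>carrier = {p. Poly_Mapping.keys p \<subseteq> carrier M},
     mult = (\<lambda>p q. \<Sum>u\<in>Poly_Mapping.keys p. \<Sum>v\<in>Poly_Mapping.keys q.
       Poly_Mapping.single (u \<otimes>\<^bsub>M\<^esub> v) (Poly_Mapping.lookup p u * Poly_Mapping.lookup q v)),
     one = Poly_Mapping.single \<one>\<^bsub>M\<^esub> 1,
     zero = 0,
     add = (+),
     smult = pm_scale\<rparr>"

text \<open>Linear extension of a map \<open>f\<close> from basis elements to \<open>A\<close>.\<close>

definition lin_ext :: "('k::field, 'a) module \<Rightarrow> ('m \<Rightarrow> 'a) \<Rightarrow> ('m \<Rightarrow>\<^sub>0 'k) \<Rightarrow> 'a" where
  "lin_ext A f p =
    (\<Oplus>\<^bsub>A\<^esub>w\<in>Poly_Mapping.keys p. Poly_Mapping.lookup p w \<odot>\<^bsub>A\<^esub> f w)"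

text \<open>The quotient of \<open>A\<close> by a two-sided ideal \<open>I\<close>; its elements are the cosets of \<open>I\<close>.\<close>

definition quotient_algebra ::
  "('k::field, 'a) module \<Rightarrow> 'a set \<Rightarrow> ('k, 'a set) module" where
  "quotient_algebra A I =
    \<lparr>carrier = carrier (A Quot I), mult = mult (A Quot I), one = one (A Quot I),
     zero = zero (A Quot I), add = add (A Quot I),
     smult = (\<lambda>c X. \<Union>x\<in>X. I +>\<^bsub>A\<^esub> (c \<odot>\<^bsub>A\<^esub> x))\<rparr>"


section \<open>Algebras generated by a vector space\<close>

definition word_monoid :: "'g list monoid" where
  "word_monoid = \<lparr>carrier = UNIV, mult = (@), one = []\<rparr>"

abbreviation free_algebra :: "('k::field, 'g list \<Rightarrow>\<^sub>0 'k) module" where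
  "free_algebra \<equiv> monoid_algebra word_monoid"

abbreviation word :: "'g list \<Rightarrow> ('g list \<Rightarrow>\<^sub>0 'k::field)" where
  "word w \<equiv> Poly_Mapping.single w 1"

text \<open>The relations that turn the free algebra on the set \<open>'g\<close> into the tensor algebra of the
  vector space \<open>'g\<close>.\<close>

definition linear_relations ::
  "('k::field \<Rightarrow> 'g::ab_group_add \<Rightarrow> 'g) \<Rightarrow> ('g list \<Rightarrow>\<^sub>0 'k) set" where
  "linear_relations scale =
    {word [x + y] - word [x] - word [y] | x y. True} \<union>
    {word [scale c x] - pm_scale c (word [x]) | c x. True}"

text \<open>The quotient of the tensor algebra of \<open>'g\<close> by the two-sided ideal generated by \<open>R\<close>.\<close>

definition relation_ideal ::
  "('k::field \<Rightarrow> 'g::ab_group_add \<Rightarrow> 'g) \<Rightarrow> ('g list \<Rightarrow>\<^sub>0 'k) set \<Rightarrow> ('g list \<Rightarrow>\<^sub>0 'k) set" where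
  "relation_ideal scale R = genideal free_algebra (linear_relations scale \<union> R)"

definition tensor_algebra_mod ::
  "('k::field \<Rightarrow> 'g::ab_group_add \<Rightarrow> 'g) \<Rightarrow> ('g list \<Rightarrow>\<^sub>0 'k) set
    \<Rightarrow> ('k, ('g list \<Rightarrow>\<^sub>0 'k) set) module" where
  "tensor_algebra_mod scale R = quotient_algebra free_algebra (relation_ideal scale R)"

definition tensor_algebra_class ::
  "('k::field \<Rightarrow> 'g::ab_group_add \<Rightarrow> 'g) \<Rightarrow> ('g list \<Rightarrow>\<^sub>0 'k) set
    \<Rightarrow> ('g list \<Rightarrow>\<^sub>0 'k) \<Rightarrow> ('g list \<Rightarrow>\<^sub>0 'k) set" where
  "tensor_algebra_class scale R p = relation_ideal scale R +>\<^bsub>free_algebra\<^esub> p"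

text \<open>The algebra homomorphism into \<open>A\<close> given by \<open>f\<close> on generators, and the map it induces on a
  quotient (an element of which is a set \<open>X\<close> of representatives).\<close>

definition free_algebra_lift ::
  "('k::field, 'a) module \<Rightarrow> ('g \<Rightarrow> 'a) \<Rightarrow> ('g list \<Rightarrow>\<^sub>0 'k) \<Rightarrow> 'a" where
  "free_algebra_lift A f = lin_ext A (\<lambda>w. foldr (\<lambda>x a. f x \<otimes>\<^bsub>A\<^esub> a) w \<one>\<^bsub>A\<^esub>)"

definition quotient_lift ::
  "('k::field, 'a) module \<Rightarrow> ('g \<Rightarrow> 'a) \<Rightarrow> ('g list \<Rightarrow>\<^sub>0 'k) set \<Rightarrow> 'a" where
  "quotient_lift A f X = the_elem (free_algebra_lift A f ` X)"


section \<open>Tensor products\<close>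

definition tensor_relations ::
  "('k::field, 'a) module \<Rightarrow> ('k, 'b) module \<Rightarrow> ('a \<times> 'b \<Rightarrow>\<^sub>0 'k) set" where
  "tensor_relations A B =
    {Poly_Mapping.single (a \<oplus>\<^bsub>A\<^esub> a', b) 1
      - Poly_Mapping.single (a, b) 1 - Poly_Mapping.single (a', b) 1
      | a a' b. a \<in> carrier A \<and> a' \<in> carrier A \<and> b \<in> carrier B} \<union>
    {Poly_Mapping.single (a, b \<oplus>\<^bsub>B\<^esub> b') 1
      - Poly_Mapping.single (a, b) 1 - Poly_Mapping.single (a, b') 1
      | a b b'. a \<in> carrier A \<and> b \<in> carrier B \<and> b' \<in> carrier B} \<union>
    {Poly_Mapping.single (c \<odot>\<^bsub>A\<^esub> a, b) 1 - pm_scale c (Poly_Mapping.single (a, b) 1)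
      | c a b. a \<in> carrier A \<and> b \<in> carrier B} \<union>
    {Poly_Mapping.single (a, c \<odot>\<^bsub>B\<^esub> b) 1 - pm_scale c (Poly_Mapping.single (a, b) 1)
      | c a b. a \<in> carrier A \<and> b \<in> carrier B}"

definition tensor_kernel ::
  "('k::field, 'a) module \<Rightarrow> ('k, 'b) module \<Rightarrow> ('a \<times> 'b \<Rightarrow>\<^sub>0 'k) set" where
  "tensor_kernel A B = Modules.module.span pm_scale (tensor_relations A B)"

text \<open>The free vector space on \<open>carrier A \<times> carrier B\<close> modulo the bilinearity relations, with
  the product \<open>(a \<otimes> b) (a' \<otimes> b') = a a' \<otimes> b b'\<close>. The latter comes from the monoid algebra of
  the direct product of the multiplicative monoids, in which the span of the relations is an
  ideal.\<close>

definition tensor_product ::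
  "('k::field, 'a) module \<Rightarrow> ('k, 'b) module \<Rightarrow> ('k, ('a \<times> 'b \<Rightarrow>\<^sub>0 'k) set) module" where
  "tensor_product A B = quotient_algebra (monoid_algebra (A \<times>\<times> B)) (tensor_kernel A B)"

definition tensor ::
  "('k::field, 'a) module \<Rightarrow> ('k, 'b) module \<Rightarrow> 'a \<Rightarrow> 'b \<Rightarrow> ('a \<times> 'b \<Rightarrow>\<^sub>0 'k) set" where
  "tensor A B a b =
    tensor_kernel A B +>\<^bsub>monoid_algebra (A \<times>\<times> B)\<^esub> Poly_Mapping.single (a, b) 1"

text \<open>The linear map out of a tensor product induced by a bilinear map \<open>f\<close> into \<open>C\<close>.\<close>

definition tensor_lift ::
  "('k::field, 'c) module \<Rightarrow> ('a \<Rightarrow> 'b \<Rightarrow> 'c) \<Rightarrow> ('a \<times> 'b \<Rightarrow>\<^sub>0 'k) set \<Rightarrow> 'c" where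
  "tensor_lift C f X = the_elem (lin_ext C (\<lambda>(a, b). f a b) ` X)"

text \<open>\<open>f \<otimes> g\<close> as a map into \<open>C \<otimes> D\<close>.\<close>

definition tensor_map ::
  "('k::field, 'c) module \<Rightarrow> ('k, 'd) module \<Rightarrow> ('a \<Rightarrow> 'c) \<Rightarrow> ('b \<Rightarrow> 'd)
    \<Rightarrow> ('a \<times> 'b \<Rightarrow>\<^sub>0 'k) set \<Rightarrow> ('c \<times> 'd \<Rightarrow>\<^sub>0 'k) set" where
  "tensor_map C D f g =
    tensor_lift (tensor_product C D) (\<lambda>a b. tensor C D (f a) (g b))"

text \<open>The associativity isomorphism from \<open>A \<otimes> (B \<otimes> C)\<close> to \<open>(A \<otimes> B) \<otimes> C\<close>.\<close>

definition tensor_assoc ::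
  "('k::field, 'a) module \<Rightarrow> ('k, 'b) module \<Rightarrow> ('k, 'c) module
    \<Rightarrow> ('a \<times> ('b \<times> 'c \<Rightarrow>\<^sub>0 'k) set \<Rightarrow>\<^sub>0 'k) set
    \<Rightarrow> (('a \<times> 'b \<Rightarrow>\<^sub>0 'k) set \<times> 'c \<Rightarrow>\<^sub>0 'k) set" where
  "tensor_assoc A B C =
    (let T = tensor_product (tensor_product A B) C in
     tensor_lift T (\<lambda>a. tensor_lift T (\<lambda>b c. tensor (tensor_product A B) C (tensor A B a b) c)))"


section \<open>Formal power series\<close>

definition power_series_ring :: "('k::field, 'a) module \<Rightarrow> (nat \<Rightarrow> 'a) ring" where
  "power_series_ring A =
    \<lparr>carrier = UNIV \<rightarrow> carrier A,
     mult = (\<lambda>F G n. \<Oplus>\<^bsub>A\<^esub>i\<in>{..n}. F i \<otimes>\<^bsub>A\<^esub> G (n - i)),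
     one = (\<lambda>n. if n = 0 then \<one>\<^bsub>A\<^esub> else \<zero>\<^bsub>A\<^esub>),
     zero = (\<lambda>n. \<zero>\<^bsub>A\<^esub>),
     add = (\<lambda>F G n. F n \<oplus>\<^bsub>A\<^esub> G n)\<rparr>"


section \<open>The universal enveloping algebra\<close>

definition lie_relations :: "('g \<Rightarrow> 'g \<Rightarrow> 'g) \<Rightarrow> ('g list \<Rightarrow>\<^sub>0 'k::field) set" where
  "lie_relations bracket = {word [x, y] - word [y, x] - word [bracket x y] | x y. True}"

definition uea ::
  "('k::field \<Rightarrow> 'g::ab_group_add \<Rightarrow> 'g) \<Rightarrow> ('g \<Rightarrow> 'g \<Rightarrow> 'g)
    \<Rightarrow> ('k, ('g list \<Rightarrow>\<^sub>0 'k) set) module" where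
  "uea scale bracket = tensor_algebra_mod scale (lie_relations bracket)"

definition uea_incl ::
  "('k::field \<Rightarrow> 'g::ab_group_add \<Rightarrow> 'g) \<Rightarrow> ('g \<Rightarrow> 'g \<Rightarrow> 'g)
    \<Rightarrow> 'g \<Rightarrow> ('g list \<Rightarrow>\<^sub>0 'k) set" where
  "uea_incl scale bracket x = tensor_algebra_class scale (lie_relations bracket) (word [x])"

definition uea_coproduct ::
  "('k::field \<Rightarrow> 'g::ab_group_add \<Rightarrow> 'g) \<Rightarrow> ('g \<Rightarrow> 'g \<Rightarrow> 'g)
    \<Rightarrow> ('g list \<Rightarrow>\<^sub>0 'k) set \<Rightarrow> (('g list \<Rightarrow>\<^sub>0 'k) set \<times> ('g list \<Rightarrow>\<^sub>0 'k) set \<Rightarrow>\<^sub>0 'k) set" where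
  "uea_coproduct scale bracket =
    (let U = uea scale bracket; UU = tensor_product U U; \<iota> = uea_incl scale bracket in
     quotient_lift UU (\<lambda>x. tensor U U (\<iota> x) \<one>\<^bsub>U\<^esub> \<oplus>\<^bsub>UU\<^esub> tensor U U \<one>\<^bsub>U\<^esub> (\<iota> x)))"

definition uea_counit :: "('g list \<Rightarrow>\<^sub>0 'k::field) set \<Rightarrow> 'k" where
  "uea_counit = quotient_lift ground_field (\<lambda>x. 0)"


section \<open>Formal twists\<close>

text \<open>Linear maps act on power series coefficientwise. The twist equation is read in
  \<open>(U \<otimes> U) \<otimes> U\<close>, and \<open>\<epsilon> \<otimes> id\<close>, \<open>id \<otimes> \<epsilon>\<close> take values in \<open>U\<close> through the identifications of
  \<open>K \<otimes> U\<close> and \<open>U \<otimes> K\<close> with \<open>U\<close>.\<close>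

definition formal_twist ::
  "('k::field \<Rightarrow> 'g::ab_group_add \<Rightarrow> 'g) \<Rightarrow> ('g \<Rightarrow> 'g \<Rightarrow> 'g)
    \<Rightarrow> (nat \<Rightarrow> (('g list \<Rightarrow>\<^sub>0 'k) set \<times> ('g list \<Rightarrow>\<^sub>0 'k) set \<Rightarrow>\<^sub>0 'k) set) \<Rightarrow> bool" where
  "formal_twist scale bracket F \<longleftrightarrow>
    (let U = uea scale bracket;
         UU = tensor_product U U;
         UUU = tensor_product UU U;
         \<Delta> = uea_coproduct scale bracket;
         assoc = tensor_assoc U U U
     in
       F \<in> Units (power_series_ring UU) \<and>
       (\<lambda>n. tensor_map UU U \<Delta> id (F n)) \<otimes>\<^bsub>power_series_ring UUU\<^esub> (\<lambda>n. tensor UU U (F n) \<one>\<^bsub>U\<^esub>)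
       = (\<lambda>n. assoc (tensor_map U UU id \<Delta> (F n)))
           \<otimes>\<^bsub>power_series_ring UUU\<^esub> (\<lambda>n. assoc (tensor U UU \<one>\<^bsub>U\<^esub> (F n))) \<and>
       (\<lambda>n. tensor_lift U (\<lambda>a b. uea_counit a \<odot>\<^bsub>U\<^esub> b) (F n)) = \<one>\<^bsub>power_series_ring U\<^esub> \<and>
       (\<lambda>n. tensor_lift U (\<lambda>a b. uea_counit b \<odot>\<^bsub>U\<^esub> a) (F n)) = \<one>\<^bsub>power_series_ring U\<^esub> \<and>
       F 0 = \<one>\<^bsub>UU\<^esub>)"


section \<open>The exterior algebra and classical r-matrices\<close>

definition alternating_relations :: "('g list \<Rightarrow>\<^sub>0 'k::field) set" where
  "alternating_relations = {word [x, x] | x. True}"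

definition exterior_algebra ::
  "('k::field \<Rightarrow> 'g::ab_group_add \<Rightarrow> 'g) \<Rightarrow> ('k, ('g list \<Rightarrow>\<^sub>0 'k) set) module" where
  "exterior_algebra scale = tensor_algebra_mod scale alternating_relations"

definition exterior_incl ::
  "('k::field \<Rightarrow> 'g::ab_group_add \<Rightarrow> 'g) \<Rightarrow> 'g \<Rightarrow> ('g list \<Rightarrow>\<^sub>0 'k) set" where
  "exterior_incl scale x = tensor_algebra_class scale alternating_relations (word [x])"

definition exterior_power ::
  "('k::field \<Rightarrow> 'g::ab_group_add \<Rightarrow> 'g) \<Rightarrow> nat \<Rightarrow> ('g list \<Rightarrow>\<^sub>0 'k) set set" where
  "exterior_power scale k =
    tensor_algebra_class scale alternating_relations
      ` {p. \<forall>w\<in>Poly_Mapping.keys p. length w = k}"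

text \<open>A Gerstenhaber bracket on a graded algebra \<open>A\<close> with homogeneous components \<open>G k\<close>, \<open>k \<ge> 0\<close>:
  a bilinear bracket of degree \<open>-1\<close> which is a graded Lie bracket for the degrees shifted by one
  and satisfies the graded Leibniz rule. The signs use \<open>k + 1\<close> in place of \<open>k - 1\<close>, which has the
  same parity.\<close>

definition gerstenhaber_bracket ::
  "('k::field, 'a) module \<Rightarrow> (nat \<Rightarrow> 'a set) \<Rightarrow> ('a \<Rightarrow> 'a \<Rightarrow> 'a) \<Rightarrow> bool" where
  "gerstenhaber_bracket A G B \<longleftrightarrow>
    (\<forall>a\<in>carrier A. linear_map A A (B a) \<and> linear_map A A (\<lambda>b. B b a)) \<and>
    (\<forall>k l. \<forall>a\<in>G k. \<forall>b\<in>G l. B a b \<in> (if k + l = 0 then {\<zero>\<^bsub>A\<^esub>} else G (k + l - 1))) \<and>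
    (\<forall>k l. \<forall>a\<in>G k. \<forall>b\<in>G l.
       B a b = (- ((- 1) ^ ((k + 1) * (l + 1)))) \<odot>\<^bsub>A\<^esub> B b a) \<and>
    (\<forall>k l. \<forall>a\<in>G k. \<forall>b\<in>G l. \<forall>c\<in>carrier A.
       B a (B b c) = B (B a b) c \<oplus>\<^bsub>A\<^esub> ((- 1) ^ ((k + 1) * (l + 1))) \<odot>\<^bsub>A\<^esub> B b (B a c)) \<and>
    (\<forall>k l. \<forall>a\<in>G k. \<forall>b\<in>G l. \<forall>c\<in>carrier A.
       B a (b \<otimes>\<^bsub>A\<^esub> c) =
         (B a b \<otimes>\<^bsub>A\<^esub> c) \<oplus>\<^bsub>A\<^esub> (((- 1) ^ ((k + 1) * l)) \<odot>\<^bsub>A\<^esub> (b \<otimes>\<^bsub>A\<^esub> B a c)))"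

definition schouten_bracket ::
  "('k::field \<Rightarrow> 'g::ab_group_add \<Rightarrow> 'g) \<Rightarrow> ('g \<Rightarrow> 'g \<Rightarrow> 'g)
    \<Rightarrow> (('g list \<Rightarrow>\<^sub>0 'k) set \<Rightarrow> ('g list \<Rightarrow>\<^sub>0 'k) set \<Rightarrow> ('g list \<Rightarrow>\<^sub>0 'k) set) \<Rightarrow> bool" where
  "schouten_bracket scale bracket B \<longleftrightarrow>
    gerstenhaber_bracket (exterior_algebra scale) (exterior_power scale) B \<and>
    (\<forall>x y. B (exterior_incl scale x) (exterior_incl scale y) = exterior_incl scale (bracket x y))"

text \<open>On the exterior algebra of a Lie algebra there is exactly one such bracket, so the
  existential quantifier does not express a choice.\<close>

definition classical_r_matrix ::
  "('k::field \<Rightarrow> 'g::ab_group_add \<Rightarrow> 'g) \<Rightarrow> ('g \<Rightarrow> 'g \<Rightarrow> 'g)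
    \<Rightarrow> ('g list \<Rightarrow>\<^sub>0 'k) set \<Rightarrow> bool" where
  "classical_r_matrix scale bracket r \<longleftrightarrow>
    r \<in> exterior_power scale 2 \<and>
    (\<exists>B. schouten_bracket scale bracket B \<and> B r r = \<zero>\<^bsub>exterior_algebra scale\<^esub>)"

text \<open>The antisymmetric tensor in \<open>U \<otimes> U\<close> of an element of the second exterior power, with the
  convention \<open>x \<and> y = x \<otimes> y - y \<otimes> x\<close>. Since \<open>[[c r, c r]] = c\<^sup>2 [[r, r]]\<close>, the choice of the
  nonzero factor does not matter for statements about all classical r-matrices.\<close>

definition antisymmetric_tensor ::
  "('k::field \<Rightarrow> 'g::ab_group_add \<Rightarrow> 'g) \<Rightarrow> ('g \<Rightarrow> 'g \<Rightarrow> 'g) \<Rightarrow> ('g list \<Rightarrow>\<^sub>0 'k) set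
    \<Rightarrow> (('g list \<Rightarrow>\<^sub>0 'k) set \<times> ('g list \<Rightarrow>\<^sub>0 'k) set \<Rightarrow>\<^sub>0 'k) set" where
  "antisymmetric_tensor scale bracket r =
    (let U = uea scale bracket; UU = tensor_product U U; \<iota> = uea_incl scale bracket in
     the_elem (lin_ext UU
       (\<lambda>w. case w of
          [x, y] \<Rightarrow> tensor U U (\<iota> x) (\<iota> y) \<ominus>\<^bsub>UU\<^esub> tensor U U (\<iota> y) (\<iota> x)
        | _ \<Rightarrow> \<zero>\<^bsub>UU\<^esub>) ` r))"

end

theory Submission
  imports Defs "HOL-Computational_Algebra.Formal_Power_Series" "HOL-Algebra.UnivPoly"
begin

text \<open>
  Write \<open>r = \<Sum>i,j. R\<^sub>i\<^sub>j y\<^sub>i \<otimes> y\<^sub>j\<close> with as few \<open>y\<^sub>i\<close> as possible. Then the \<open>y\<^sub>i\<close> and the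
  \<open>x\<^sub>j = \<Sum>i. R\<^sub>i\<^sub>j y\<^sub>i\<close> are two bases of the same space \<open>h\<close>; by the classical Yang--Baxter equation \<open>h\<close> is
  a subalgebra, and the inverse \<open>\<omega>\<close> of \<open>r\<close> is a two-cocycle on it. On words in the \<open>x\<^sub>i\<close> let \<open>\<lambda>\<close> be a
  functional with values in \<open>K[[t]]\<close> that kills the relations
  \<open>x\<^sub>i x\<^sub>j - x\<^sub>j x\<^sub>i = t ([x\<^sub>i, x\<^sub>j] + \<omega>(x\<^sub>i, x\<^sub>j))\<close>. The enveloping algebra of \<open>h\<close> acts on these words from
  the right through the derivations \<open>x \<cdot> y = [x, y] + \<omega>(x, y)\<close>, which respect the relations, and
  for \<open>t = 0\<close> the pairing \<open>(u, a) \<mapsto> \<lambda>(a \<cdot> u)\<close> becomes a perfect pairing of \<open>U(h)\<close> with the symmetric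
  algebra. Hence there is a unique \<open>F = \<Sum>n. t\<^sup>n F\<^sub>n\<close> with \<open>\<lambda>(a b) = \<Sum> \<lambda>(a \<cdot> u) \<lambda>(b \<cdot> v)\<close> summed over the
  tensors \<open>u \<otimes> v\<close> in \<open>F\<close>. Both sides of the twist equation represent \<open>(a, b, c) \<mapsto> \<lambda>(a b c)\<close> in the same
  way, so they are equal; and \<open>F\<^sub>1\<close> is read off from the values of \<open>\<lambda>\<close> on words of length two.
\<close>

section \<open>Straightening words\<close>

text \<open>The origin is geometric. The cocycle \<omega> defines a central extension of h. At t = 0
  the words in the x are polynomial functions on the hyperplane in the dual of that extension where
  the central element equals 1, and the derivations are the coadjoint vector fields. At the origin
  these take the values \<omega>(x, y); as \<omega> is nondegenerate, the orbit of the origin is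
  open, and differentiating and then evaluating there pairs U(h) with polynomials. The relations
  deform the product of functions invariantly, so the new product is given by invariant
  bidifferential operators, that is, by elements of U(h) \<otimes> U(h). The factor t in the
  relations costs a power of t for every two letters removed; hence each coefficient of \<lambda>
  sees words of bounded length only, and each coefficient of F is a finite tensor. Two obstacles
  shape the proof. Existence of \<lambda> is a Poincare-Birkhoff-Witt statement, settled over K[[t]]
  by the diamond lemma. Equality in the triple tensor power is derived from scalars: combinations of
  words killed by the pairing at t = 0 vanish wherever the relations of U(h) hold. Characteristic 0
  inverts the factorials on the diagonal of this pairing.\<close>

locale straightening =
  fixes d :: nat and G :: "nat \<Rightarrow> nat \<Rightarrow> nat \<Rightarrow> 'r::comm_ring_1" and R :: "nat \<Rightarrow> nat \<Rightarrow> 'r"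
    and b :: "nat list \<Rightarrow> 'r"
  assumes G_anti: "G j i l = - G i j l" and G_diag: "G i i l = 0"
    and R_anti: "R j i = - R i j" and R_diag: "R i i = 0"
    and G_jacobi: "(\<Sum>m<d. G i j m * G m k l) + (\<Sum>m<d. G j k m * G m i l)
        + (\<Sum>m<d. G k i m * G m j l) = 0"
    and R_cocycle: "(\<Sum>m<d. G i j m * R m k) + (\<Sum>m<d. G j k m * R m i)
        + (\<Sum>m<d. G k i m * R m j) = 0"
begin

text \<open>Stands for \<open>f\<close> of \<open>u [x_i, x_j] v\<close>: the relation trades the
  commutator for linear terms and a constant.\<close>

definition corr :: "(nat list \<Rightarrow> 'r) \<Rightarrow> nat list \<Rightarrow> nat \<Rightarrow> nat \<Rightarrow> nat list \<Rightarrow> 'r" where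
  "corr f u i j v = (\<Sum>l<d. G i j l * f (u @ l # v)) + R i j * f (u @ v)"

text \<open>An arbitrary choice, made only to have a recursion; that the result does not depend on
  it is the diamond lemma.\<close>

definition descent :: "nat list \<Rightarrow> nat list \<times> nat \<times> nat \<times> nat list" where
  "descent w = (SOME (u, i, j, v). w = u @ i # j # v \<and> j < i)"

lemma descent:
  assumes "\<not> sorted w"
  shows "case descent w of (u, i, j, v) \<Rightarrow> w = u @ i # j # v \<and> j < i"
proof -
  have "\<exists>p. case p of (u, i, j, v) \<Rightarrow> w = u @ i # j # v \<and> j < i"
    using assms
  proof (induction w)
    case (Cons x w)
    show ?case
    proof (cases "sorted w")
      case True
      with Cons.prems obtain y v where "w = y # v" "y < x"
        by (cases w) (auto simp: not_le intro: order_le_less_trans)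
      then show ?thesis by (intro exI[of _ "([], x, y, v)"]) auto
    next
      case False
      with Cons.IH obtain u i j v where "w = u @ i # j # v" "j < i" by auto
      then show ?thesis by (intro exI[of _ "(x # u, i, j, v)"]) auto
    qed
  qed simp
  then show ?thesis unfolding descent_def by (rule someI_ex)
qed

text \<open>Length first, then lexicographic: undoing a descent keeps the length and lowers the
  word, and the words in the corrections are shorter, so all recursive calls of \<open>lam\<close>
  decrease.\<close>

abbreviation "smaller \<equiv> lenlex {(x::nat, y). x < y}"

lemma wf_smaller: "wf smaller"
  by (intro wf_lenlex wf)

lemma smaller_swap: "j < i \<Longrightarrow> (u @ j # i # v, u @ i # j # v) \<in> smaller"
  by (auto simp: lenlex_conv intro!: lex_append_leftI)

lemma smaller_length: "length x < length y \<Longrightarrow> (x, y) \<in> smaller"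
  by (simp add: lenlex_conv)

lemma smaller_trans: "(x, y) \<in> smaller \<Longrightarrow> (y, z) \<in> smaller \<Longrightarrow> (x, z) \<in> smaller"
  by (erule (1) lenlex_trans) (auto intro: transI)

text \<open>Straightening read as a recursion for values: \<open>b\<close> prescribes them freely on
  sorted words, and the relation at one descent determines the others.\<close>

function lam :: "nat list \<Rightarrow> 'r" where
  "lam w = (if sorted w then b w else
     (let (u, i, j, v) = descent w in
      lam (u @ j # i # v) + ((\<Sum>l<d. G i j l * lam (u @ l # v)) + R i j * lam (u @ v))))"
  by auto
termination
proof (relation smaller)
  show "wf smaller" by (rule wf_smaller)
qed (use descent in \<open>fastforce intro: smaller_swap smaller_length\<close>)+

declare lam.simps[simp del]

lemma lam_sorted: "sorted w \<Longrightarrow> lam w = b w"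
  by (simp add: lam.simps)

section \<open>Confluence of straightening\<close>

abbreviation "rel_at f u i j v \<equiv> f (u @ i # j # v) = f (u @ j # i # v) + corr f u i j v"

lemma rel_at_sym: "rel_at f u i j v \<longleftrightarrow> rel_at f u j i v"
proof -
  have "corr f u j i v = - corr f u i j v"
    unfolding corr_def by (subst R_anti, subst G_anti) (simp add: sum_negf)
  then show ?thesis by (auto simp: algebra_simps)
qed

lemma rel_at_diag: "rel_at f u i i v"
  unfolding corr_def by (simp add: G_diag R_diag)

text \<open>Exchanging \<open>i\<close> and \<open>j\<close> changes the sign of the correction and
  equal letters have none, so descents are the only case to check.\<close>

lemma rel_at_shorter:
  assumes "\<And>u i j v. length (u @ i # j # v) = n \<Longrightarrow> j < i \<Longrightarrow> rel_at f u i j v"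
    and "length (u @ i # j # v) = n"
  shows "rel_at f u i j v"
proof (cases i j rule: linorder_cases)
  case less
  then show ?thesis using assms(1)[of u j i v] assms(2) rel_at_sym[of f u i j v] by simp
next
  case equal
  then show ?thesis using rel_at_diag by simp
next
  case greater
  then show ?thesis using assms by blast
qed

text \<open>Both ways around the square of two independent swaps leave the same double correction, a
  double sum whose order of summation is immaterial. The hypotheses are relations at words already
  shortened by one correction.\<close>

lemma corr_disjoint:
  assumes "\<And>l. rel_at f (u @ l # u') i j v" and "rel_at f (u @ u') i j v"
    and "\<And>l. rel_at f u p q (u' @ l # v)" and "rel_at f u p q (u' @ v)"
  shows "corr f u p q (u' @ i # j # v) + corr f (u @ q # p # u') i j v
       = corr f (u @ p # q # u') i j v + corr f u p q (u' @ j # i # v)"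
proof -
  have 1: "corr f u p q (u' @ i # j # v) =
     (\<Sum>l<d. G p q l * (f (u @ l # u' @ j # i # v) + corr f (u @ l # u') i j v))
     + R p q * (f (u @ u' @ j # i # v) + corr f (u @ u') i j v)"
    using assms(1,2) by (simp add: corr_def)
  have 2: "corr f (u @ p # q # u') i j v =
     (\<Sum>l<d. G i j l * (f (u @ q # p # u' @ l # v) + corr f u p q (u' @ l # v)))
     + R i j * (f (u @ q # p # u' @ v) + corr f u p q (u' @ v))"
    using assms(3,4) by (simp add: corr_def)
  \<comment> \<open>The mixed terms: one correction applied inside the other.\<close>
  have 3: "(\<Sum>l<d. G p q l * corr f (u @ l # u') i j v) + R p q * corr f (u @ u') i j v
      = (\<Sum>l<d. G i j l * corr f u p q (u' @ l # v)) + R i j * corr f u p q (u' @ v)"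
    unfolding corr_def
    by (simp add: distrib_left sum.distrib sum_distrib_left mult_ac add_ac,
        subst sum.swap, simp)
  have a: "corr f u p q (u' @ j # i # v) =
     (\<Sum>l<d. G p q l * f (u @ l # u' @ j # i # v)) + R p q * f (u @ u' @ j # i # v)"
    and b: "corr f (u @ q # p # u') i j v =
     (\<Sum>l<d. G i j l * f (u @ q # p # u' @ l # v)) + R i j * f (u @ q # p # u' @ v)"
    by (simp_all add: corr_def)
  show ?thesis unfolding 1 2 a b using 3
    by (simp add: distrib_left sum.distrib algebra_simps)
qed

lemma sum_sum_mult_jacobi:
  assumes "\<And>l. (\<Sum>m<d. A m * G m k l) + (\<Sum>m<d. B m * G m i l) + (\<Sum>m<d. C m * G m j l) = 0"
  shows "(\<Sum>m<d. A m * (\<Sum>l<d. G m k l * g l)) + (\<Sum>m<d. B m * (\<Sum>l<d. G m i l * g l))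
    + (\<Sum>m<d. C m * (\<Sum>l<d. G m j l * g l)) = 0"
proof -
  have "(\<Sum>m<d. A m * (\<Sum>l<d. H m l * g l)) = (\<Sum>l<d. (\<Sum>m<d. A m * H m l) * g l)" for A H
    by (subst sum_distrib_right, subst sum.swap, simp add: sum_distrib_left mult_ac)
  then show ?thesis using assms
    by (simp add: sum.distrib[symmetric] distrib_right[symmetric])
qed

text \<open>The two sides are the accumulated corrections along the two ways to reverse
  \<open>p q k\<close> to \<open>k q p\<close>. Their difference collects the commutators of
  [x_p, x_q], [x_q, x_k], [x_k, x_p] with the remaining letter. Expanding these by the relation
  leaves a linear part, zero by Jacobi, and a constant part, zero by the cocycle condition.\<close>

lemma corr_overlap:
  assumes "\<And>l p. rel_at f u l p v"
  shows "corr f u p q (k # v) + corr f (u @ [q]) p k v + corr f u q k (p # v)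
       = corr f (u @ [p]) q k v + corr f u p k (q # v) + corr f (u @ [k]) p q v"
proof -
  have swap: "f (u @ m # k # v) - f (u @ k # m # v) = corr f u m k v" for m k
    by (subst assms) simp
  have key: "(\<Sum>m<d. G i j m * f (u @ m # k # v)) - (\<Sum>m<d. G i j m * f (u @ k # m # v))
     = (\<Sum>m<d. G i j m * (\<Sum>l<d. G m k l * f (u @ l # v))) + (\<Sum>m<d. G i j m * R m k) * f (u @ v)"
    for i j k
    by (simp only: sum_subtractf[symmetric] right_diff_distrib[symmetric] swap corr_def
        distrib_left sum.distrib sum_distrib_right mult.assoc)
  have jac: "(\<Sum>m<d. G p q m * (\<Sum>l<d. G m k l * f (u @ l # v))) 
     + (\<Sum>m<d. G q k m * (\<Sum>l<d. G m p l * f (u @ l # v)))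
     + (\<Sum>m<d. G k p m * (\<Sum>l<d. G m q l * f (u @ l # v))) = 0"
    by (rule sum_sum_mult_jacobi) (rule G_jacobi)
  have coc: "(\<Sum>m<d. G p q m * R m k) * f (u @ v) + (\<Sum>m<d. G q k m * R m p) * f (u @ v)
     + (\<Sum>m<d. G k p m * R m q) * f (u @ v) = 0"
    by (simp only: distrib_right[symmetric] R_cocycle mult_zero_left)
  \<comment> \<open>Turns the pair \<open>p\<close>, \<open>k\<close> around so that the three terms
    become cyclic.\<close>
  have neg: "(\<Sum>m<d. G p k m * x m) = - (\<Sum>m<d. G k p m * x m)" for x
    unfolding sum_negf[symmetric] by (rule sum.cong) (simp_all add: G_anti[of k p])
  have 0: "s1 - s2 + (s3 - s4) + (s5 - s6) = 0"
    if "s1 - s2 = j1 + c1" "s3 - s4 = j2 + c2" "s5 - s6 = j3 + c3"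
      "j1 + j2 + j3 = 0" "c1 + c2 + c3 = 0" for s1 s2 s3 s4 s5 s6 j1 j2 j3 c1 c2 c3 :: 'r
    unfolding that(1-3) using that(4,5) by (simp add: algebra_simps)
  have final: "a + x1 + (- b' + x2) + (c' + x3) = (d' + x3) + (- e + x2) + (g + x1)"
    if "a - g + (c' - d') + (e - b') = 0" for a b' c' d' e g x1 x2 x3 :: 'r
    using that by (simp add: algebra_simps)
  show ?thesis
    unfolding corr_def append_Cons append_Nil append.assoc neg
    by (rule final, rule 0[OF key[of p q k] key[of q k p] key[of k p q] jac coc])
qed

text \<open>The diamond lemma: two descents of a word are either disjoint or overlap in one letter, and
  the corresponding corrections agree by \<open>corr_disjoint\<close> and \<open>corr_overlap\<close>. Only the latter uses
  the Jacobi identity and the cocycle condition.\<close>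

lemma lam_rel_descent: "w = u @ i # j # v \<Longrightarrow> j < i \<Longrightarrow> rel_at lam u i j v"
proof (induction w arbitrary: u i j v rule: wf_induct_rule[OF wf_smaller])
  case (1 w)
  have IH: "rel_at lam u i j v" if "(u @ i # j # v, w) \<in> smaller" "j < i" for u i j v
    using 1(1) that by blast
  \<comment> \<open>Shorter words are smaller whatever their letters, so here the relation is
    available at all pairs and not only at descents.\<close>
  have short: "rel_at lam u i j v" if "length (u @ i # j # v) < length w" for u i j v
  proof (rule rel_at_shorter[OF _ refl])
    fix u' v' :: "nat list" and i' j' :: nat
    assume "length (u' @ i' # j' # v') = length (u @ i # j # v)" "j' < i'"
    with that show "rel_at lam u' i' j' v'" by (intro IH smaller_length) simp_all
  qed
  \<comment> \<open>Confluence at \<open>w\<close>: the two descents coincide, share one letter, or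
    are disjoint, and the relations met on the way down belong to words smaller than
    \<open>w\<close>.\<close>
  have conf: "lam (u @ q # p # v) + corr lam u p q v = lam (u' @ j # i # v') + corr lam u' i j v'"
    if "w = u @ p # q # v" "q < p" "w = u' @ i # j # v'" "j < i" "length u \<le> length u'"
    for u p q v u' i j v'
  proof -
    from that have eq: "u @ p # q # v = u' @ i # j # v'" by simp
    consider "u' = u" "p = i" "q = j" "v' = v" | "u' = u @ [p]" "q = i" "v = j # v'"
      | m where "u' = u @ p # q # m" "v = m @ i # j # v'"
    proof -
      from eq \<open>length u \<le> length u'\<close> obtain x where x: "u' = u @ x" "p # q # v = x @ i # j # v'"
        by (auto simp: append_eq_append_conv2)
      show ?thesis
      proof (cases x)
        case Nil
        then show ?thesis using x that(1) by auto
      next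
        case (Cons p' x')
        then show ?thesis using x that by (cases x') auto
      qed
    qed
    then show ?thesis
    proof cases
      case 1
      then show ?thesis by simp
    next
      case 2
      have w: "w = u @ p # i # j # v'" using that(1) 2 by simp
      have ji: "j < i" "i < p" using that 2 by auto
      have a: "rel_at lam (u @ [i]) p j v'"
        using IH[of "u @ [i]" p j v'] smaller_swap[of i p u "j # v'"] ji w by simp
      \<comment> \<open>Two swaps below \<open>w\<close>, on the route that first moves
        \<open>p\<close> to the right; in \<open>e\<close> the letter \<open>j\<close> first moves
        to the left.\<close>
      have b: "rel_at lam u i j (p # v')"
      proof -
        have "(u @ i # j # p # v', u @ i # p # j # v') \<in> smaller" 
          using smaller_swap[of j p "u @ [i]" v'] ji by simp
        moreover have "(u @ i # p # j # v', w) \<in> smaller" 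
          using smaller_swap[of i p "u" "j # v'"] ji w by simp
        ultimately have "(u @ i # j # p # v', w) \<in> smaller"
          by (rule smaller_trans)
        then show ?thesis using IH ji by blast
      qed
      have c: "rel_at lam u p j (i # v')"
        using IH[of u p j "i # v'"] smaller_swap[of j i "u @ [p]" "v'"] ji w by simp
      have e: "rel_at lam (u @ [j]) p i v'"
      proof -
        have "(u @ j # p # i # v', u @ p # j # i # v') \<in> smaller" 
          using smaller_swap[of j p "u" "i # v'"] ji by simp
        moreover have "(u @ p # j # i # v', w) \<in> smaller" 
          using smaller_swap[of j i "u @ [p]" "v'"] ji w by simp
        ultimately have "(u @ j # p # i # v', w) \<in> smaller"
          by (rule smaller_trans)
        then show ?thesis using IH[of "u @ [j]" p i v'] ji by simp
      qed
      have "corr lam u p i (j # v') + corr lam (u @ [i]) p j v' + corr lam u i j (p # v')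
       = corr lam (u @ [p]) i j v' + corr lam u p j (i # v') + corr lam (u @ [j]) p i v'"
        by (rule corr_overlap) (rule short, simp add: w)
      then show ?thesis using a b c e 2 by (simp add: add_ac)
    next
      case 3
      have w: "w = u @ p # q # m @ i # j # v'" using that(1) 3 by simp
      have "rel_at lam (u @ q # p # m) i j v'"
        using IH[of "u @ q # p # m" i j v'] smaller_swap[of q p u "m @ i # j # v'"] that(2,4) w by simp
      moreover have "rel_at lam u p q (m @ j # i # v')"
        using IH[of u p q "m @ j # i # v'"] smaller_swap[of j i "u @ p # q # m" "v'"] that(2,4) w by simp
      moreover have "corr lam u p q (m @ i # j # v') + corr lam (u @ q # p # m) i j v'
       = corr lam (u @ p # q # m) i j v' + corr lam u p q (m @ j # i # v')"
        by (rule corr_disjoint) (rule short, simp add: w)+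
      ultimately show ?thesis using 3 by (simp add: add_ac)
    qed
  qed
  have ns: "\<not> sorted w" using "1.prems" by (auto simp: sorted_append)
  obtain u' i' j' v' where d: "descent w = (u', i', j', v')" by (cases "descent w") 
  with descent[OF ns] have d': "w = u' @ i' # j' # v'" "j' < i'" by auto
  \<comment> \<open>\<open>lam\<close> is computed at the chosen descent; \<open>conf\<close>
    carries this over to the given one, whichever of the two starts further left.\<close>
  have lw: "lam w = lam (u' @ j' # i' # v') + corr lam u' i' j' v'"
    by (subst lam.simps) (simp add: ns d corr_def)
  show ?case
  proof (cases "length u \<le> length u'")
    case True
    then show ?thesis using conf[OF "1.prems" d'] lw "1.prems" by simp
  next
    case False
    then show ?thesis using conf[OF d' "1.prems"] lw "1.prems" by simp
  qed
qed

lemma lam_rel: "lam (u @ i # j # v) = lam (u @ j # i # v) + (\<Sum>l<d. G i j l * lam (u @ l # v)) + R i j * lam (u @ v)"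
  using rel_at_shorter[OF lam_rel_descent[OF refl] refl, of u i j v] by (simp add: corr_def add_ac)

end

section \<open>The right action by derivations\<close>

text \<open>Let \<open>C x y l\<close> be the coefficients of \<open>[x, y]\<close> for letters \<open>x\<close> and acting elements \<open>y\<close>. Then
  \<open>act d C y f a\<close> is \<open>f (a \<cdot> y)\<close>, where \<open>\<cdot> y\<close> is the derivation of the free algebra with
  \<open>x \<cdot> y = [x, y] + \<delta>\<^sub>x\<^sub>y\<close>, and \<open>acts d C u f a\<close> is \<open>f (a \<cdot> u)\<close>.\<close>

fun act :: "nat \<Rightarrow> (nat \<Rightarrow> nat \<Rightarrow> nat \<Rightarrow> 'r) \<Rightarrow> nat \<Rightarrow> (nat list \<Rightarrow> 'r::comm_ring_1) \<Rightarrow> nat list \<Rightarrow> 'r"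
  where
    "act d C y f [] = 0"
  | "act d C y f (x # a) = (\<Sum>l<d. C x y l * f (l # a)) + (if x = y then f a else 0)
      + act d C y (\<lambda>v. f (x # v)) a"

abbreviation acts :: "nat \<Rightarrow> (nat \<Rightarrow> nat \<Rightarrow> nat \<Rightarrow> 'r) \<Rightarrow> nat list \<Rightarrow> (nat list \<Rightarrow> 'r::comm_ring_1) \<Rightarrow> nat list \<Rightarrow> 'r"
  where "acts d C u f \<equiv> foldr (act d C) u f"

lemma act_add: "act d C y (\<lambda>w. f w + g w) a = act d C y f a + act d C y g a"
  by (induction a arbitrary: f g) (simp_all add: distrib_left sum.distrib)

lemma act_mult: "act d C y (\<lambda>w. r * f w) a = r * act d C y f a"
  by (induction a arbitrary: f) (simp_all add: distrib_left sum_distrib_left mult_ac)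

lemma act_mult_right: "act d C y (\<lambda>w. f w * r) a = act d C y f a * r"
  using act_mult[of d C y r f a] by (simp add: mult.commute)

lemma act_zero: "act d C y (\<lambda>w. 0) a = 0"
  using act_mult[of d C y 0] by simp

lemma act_diff: "act d C y (\<lambda>w. f w - g w) a = act d C y f a - act d C y g a"
  using act_add[of d C y f "\<lambda>w. (- 1) * g w" a] act_mult[of d C y "- 1" g a] by simp

lemma act_sum: "act d C y (\<lambda>w. \<Sum>i\<in>I. f i w) a = (\<Sum>i\<in>I. act d C y (f i) a)"
proof (induction I rule: infinite_finite_induct)
  case (insert i I)
  then show ?case by (simp add: act_add)
qed (simp_all add: act_zero)

lemma act_sum_list: "act d C y (\<lambda>w. \<Sum>i\<leftarrow>is. f i w) a = (\<Sum>i\<leftarrow>is. act d C y (f i) a)"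
  by (induction "is") (simp_all add: act_add act_zero)

text \<open>Letters created by the action are below \<open>d\<close>, which confines the words at
  which \<open>f\<close> is evaluated.\<close>

lemma act_cong:
  "(\<And>w. set w \<subseteq> set a \<union> {..<d} \<Longrightarrow> f w = g w) \<Longrightarrow> act d C y f a = act d C y g a"
proof (induction a arbitrary: f g)
  case (Cons x a)
  have "act d C y (\<lambda>v. f (x # v)) a = act d C y (\<lambda>v. g (x # v)) a"
    by (rule Cons.IH, rule Cons.prems) auto
  moreover have "f (l # a) = g (l # a)" if "l < d" for l
    using that by (intro Cons.prems) auto
  moreover have "f a = g a" by (rule Cons.prems) auto
  ultimately show ?case by simp
qed simp

lemma act_dvd:
  assumes "\<And>w. set w \<subseteq> set a \<union> {..<d} \<Longrightarrow> p dvd f w"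
  shows "p dvd act d C y f a"
proof -
  \<comment> \<open>A quotient function; its values at other words are arbitrary because
    \<open>act_cong\<close> does not look at them.\<close>
  define q where "q w = (if p dvd f w then (SOME q. f w = p * q) else 0)" for w
  have q: "f w = p * q w" if "p dvd f w" for w
  proof -
    have "\<exists>q. f w = p * q" using that by auto
    then show ?thesis unfolding q_def using that by (auto intro: someI_ex)
  qed
  have "act d C y f a = act d C y (\<lambda>w. p * q w) a"
    by (rule act_cong) (use assms q in auto)
  then show ?thesis by (simp add: act_mult)
qed

text \<open>The Leibniz rule.\<close>

lemma act_append:
  "act d C y f (a @ b) = act d C y (\<lambda>w. f (w @ b)) a + act d C y (\<lambda>w. f (a @ w)) b"
  by (induction a arbitrary: f) (simp_all add: algebra_simps)

text \<open>The terms of the coproduct of a product of primitive elements: every letter goes to the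
  left or to the right factor, and each factor keeps the order.\<close>

fun splits :: "'a list \<Rightarrow> ('a list \<times> 'a list) list" where
  "splits [] = [([], [])]"
| "splits (x # u) = map (\<lambda>(v, w). (x # v, w)) (splits u) @ map (\<lambda>(v, w). (v, x # w)) (splits u)"

lemma set_splits: "(v, w) \<in> set (splits u) \<Longrightarrow> set v \<subseteq> set u \<and> set w \<subseteq> set u"
  by (induction u arbitrary: v w) fastforce+

text \<open>The Leibniz rule iterated: a product formula for \<open>f\<close> is inherited after
  acting by \<open>u\<close>, whose coproduct distributes over the two factors. Divisibility
  replaces equality because the formula for the twist is an infinite series in t, used modulo powers
  of t.\<close>

lemma acts_append_dvd:
  assumes "\<And>a b. a \<in> lists {..<d} \<Longrightarrow> b \<in> lists {..<d} \<Longrightarrow>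
      p dvd f (a @ b) - (\<Sum>q\<in>Q. r q * (g q a * h q b))"
    and "a \<in> lists {..<d}" "b \<in> lists {..<d}"
  shows "p dvd acts d C u f (a @ b)
     - (\<Sum>q\<in>Q. r q * (\<Sum>(v, w)\<leftarrow>splits u. acts d C v (g q) a * acts d C w (h q) b))"
  using assms(2,3)
proof (induction u arbitrary: a b)
  case Nil
  then show ?case using assms(1) by simp
next
  case (Cons i u)
  define S where "S a b = (\<Sum>q\<in>Q. r q * (\<Sum>(v, w)\<leftarrow>splits u. acts d C v (g q) a * acts d C w (h q) b))"
    for a b
  have IH: "p dvd acts d C u f (a @ b) - S a b" if "a \<in> lists {..<d}" "b \<in> lists {..<d}" for a b
    unfolding S_def using that by (rule Cons.IH)
  have "p dvd act d C i (\<lambda>a. acts d C u f (a @ b) - S a b) a"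
    by (rule act_dvd, rule IH) (use Cons.prems in \<open>auto simp: in_lists_conv_set\<close>)
  moreover have "p dvd act d C i (\<lambda>b. acts d C u f (a @ b) - S a b) b"
    by (rule act_dvd, rule IH) (use Cons.prems in \<open>auto simp: in_lists_conv_set\<close>)
  ultimately have "p dvd (act d C i (\<lambda>a. acts d C u f (a @ b)) a - act d C i (\<lambda>a. S a b) a)
     + (act d C i (\<lambda>b. acts d C u f (a @ b)) b - act d C i (S a) b)"
    unfolding act_diff by (rule dvd_add)
  moreover have "act d C i (\<lambda>a. S a b) a + act d C i (\<lambda>b. S a b) b
    = (\<Sum>q\<in>Q. r q * (\<Sum>(v, w)\<leftarrow>splits (i # u). acts d C v (g q) a * acts d C w (h q) b))"
    by (simp add: S_def act_sum act_mult act_sum_list case_prod_unfold act_mult_right sum_list_addf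
        sum.distrib[symmetric] distrib_left[symmetric] o_def)
  ultimately show ?case
    by (simp add: act_append algebra_simps)
qed

lemma sum_mult_sum_swap:
  fixes B :: "nat \<Rightarrow> nat \<Rightarrow> 'r::comm_ring_1"
  shows "(\<Sum>l<d. A l * (\<Sum>m<d. B l m * g m)) = (\<Sum>m<d. (\<Sum>l<d. A l * B l m) * g m)"
  by (simp add: sum_distrib_left sum_distrib_right mult_ac) (subst sum.swap, simp)

text \<open>The commutator of two derivations is a derivation, so letters decide. On a letter the
  linear part says that \<open>C\<close> is a right representation, and the constant part is the
  cocycle identity for \<omega>.\<close>

lemma act_commute:
  assumes "\<And>x y z m. m < d \<Longrightarrow> (\<Sum>l<d. C x y l * C l z m) - (\<Sum>l<d. C x z l * C l y m) = (\<Sum>l<d. c y z l * C x l m)"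
    and "\<And>x y z. C x y z - C x z y = c y z x"
    and "\<And>x y z. z \<ge> d \<Longrightarrow> C x y z = 0" and "\<And>x y z. z \<ge> d \<Longrightarrow> c x y z = 0"
  shows "act d C y (act d C z f) a - act d C z (act d C y f) a = (\<Sum>m<d. c y z m * act d C m f a)"
proof (induction a arbitrary: f)
  case (Cons x a)
  have delta: "(\<Sum>l<d. C x y l * (if l = z then t else 0)) = C x y z * t" for x y z t
    using assms(3)[of z x y] by (cases "z < d") (simp_all add: sum.If_cases[of "{..<d}"] if_distrib cong: if_cong)
  have delta2: "(\<Sum>m<d. c y z m * (if x = m then t else 0)) = c y z x * t" for t
    using assms(4)[of x y z] by (cases "x < d") (simp_all add: sum.If_cases[of "{..<d}"] if_distrib cong: if_cong)
  have expand: "act d C y (act d C z f) (x # a) =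
     (\<Sum>l<d. C x y l * (\<Sum>m<d. C l z m * f (m # a))) + C x y z * f a
     + (\<Sum>l<d. C x y l * act d C z (\<lambda>v. f (l # v)) a) + (if x = y then act d C z f a else 0)
     + (\<Sum>l<d. C x z l * act d C y (\<lambda>v. f (l # v)) a) + (if x = z then act d C y f a else 0)
     + act d C y (act d C z (\<lambda>v. f (x # v))) a" for y z
    by (simp add: act_add act_sum act_mult act_zero distrib_left sum.distrib delta add_ac)
  have 1: "(\<Sum>l<d. C x y l * (\<Sum>m<d. C l z m * f (m # a))) - (\<Sum>l<d. C x z l * (\<Sum>m<d. C l y m * f (m # a)))
      = (\<Sum>l<d. c y z l * (\<Sum>m<d. C x l m * f (m # a)))"
    unfolding sum_mult_sum_swap sum_subtractf[symmetric] left_diff_distrib[symmetric]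
    by (rule sum.cong) (simp_all only: sum_subtractf assms(1) lessThan_iff)
  have 2: "C x y z * f a - C x z y * f a = c y z x * f a"
    by (simp add: assms(2)[symmetric] left_diff_distrib)
  have 3: "(\<Sum>m<d. c y z m * act d C m f (x # a)) =
     (\<Sum>l<d. c y z l * (\<Sum>m<d. C x l m * f (m # a))) + c y z x * f a
     + (\<Sum>m<d. c y z m * act d C m (\<lambda>v. f (x # v)) a)"
    by (simp add: distrib_left sum.distrib delta2)
  show ?case unfolding expand 3 1[symmetric] 2[symmetric] Cons.IH[symmetric]
    by (simp add: algebra_simps)
qed simp

text \<open>The derivation maps the ideal of the relations into itself: applied to a relator it
  yields relators with one of the two letters replaced, and \<open>der\<close>, \<open>der0\<close>
  say that the linear and the constant terms match.\<close>

lemma act_rel: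
  assumes der: "\<And>i j y m. m < d \<Longrightarrow> (\<Sum>l<d. C i y l * G l j m) + (\<Sum>l<d. C j y l * G i l m) = (\<Sum>l<d. G i j l * C l y m)"
    and der0: "\<And>i j y. (\<Sum>l<d. C i y l * R l j) + (\<Sum>l<d. C j y l * R i l) = G i j y"
    and G0: "\<And>i j y. y \<ge> d \<Longrightarrow> G i j y = 0"
    and f: "\<And>u i j v. f (u @ i # j # v) = f (u @ j # i # v) + (\<Sum>l<d. G i j l * f (u @ l # v)) + R i j * f (u @ v)"
  shows "act d C y f (u @ i # j # v) = act d C y f (u @ j # i # v)
    + (\<Sum>l<d. G i j l * act d C y f (u @ l # v)) + R i j * act d C y f (u @ v)"
proof -
  have fd: "f (u @ i # j # v) - f (u @ j # i # v) = (\<Sum>l<d. G i j l * f (u @ l # v)) + R i j * f (u @ v)"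
    for u i j v using f[of u i j v] by (simp add: algebra_simps)
  have delta: "(\<Sum>l<d. G i j l * (if l = y then t else 0)) = G i j y * t" for t
    using G0[of y i j] by (cases "y < d") (simp_all add: sum.If_cases[of "{..<d}"] if_distrib cong: if_cong)
  have two: "act d C y f (u @ i # j # v) = act d C y (\<lambda>u. f (u @ i # j # v)) u
     + (\<Sum>l<d. C i y l * f (u @ l # j # v)) + (if i = y then f (u @ j # v) else 0)
     + (\<Sum>l<d. C j y l * f (u @ i # l # v)) + (if j = y then f (u @ i # v) else 0)
     + act d C y (\<lambda>v. f (u @ i # j # v)) v" for i j
    by (simp add: act_append algebra_simps)
  have one: "act d C y f (u @ l # v) = act d C y (\<lambda>u. f (u @ l # v)) u
     + (\<Sum>m<d. C l y m * f (u @ m # v)) + (if l = y then f (u @ v) else 0)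
     + act d C y (\<lambda>v. f (u @ l # v)) v" for l
    by (simp add: act_append algebra_simps)
  \<comment> \<open>The derivation hits the left context; \<open>Rt\<close> treats the right context
    and \<open>M\<close> the two letters themselves.\<close>
  have L: "act d C y (\<lambda>u. f (u @ i # j # v)) u - act d C y (\<lambda>u. f (u @ j # i # v)) u
      = (\<Sum>l<d. G i j l * act d C y (\<lambda>u. f (u @ l # v)) u) + R i j * act d C y (\<lambda>u. f (u @ v)) u"
    by (simp add: act_diff[symmetric] fd act_add act_sum act_mult)
  have Rt: "act d C y (\<lambda>v. f (u @ i # j # v)) v - act d C y (\<lambda>v. f (u @ j # i # v)) v
      = (\<Sum>l<d. G i j l * act d C y (\<lambda>v. f (u @ l # v)) v) + R i j * act d C y (\<lambda>v. f (u @ v)) v"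
    by (simp add: act_diff[symmetric] fd act_add act_sum act_mult)
  have M: "(\<Sum>l<d. C i y l * f (u @ l # j # v)) - (\<Sum>l<d. C i y l * f (u @ j # l # v))
     + ((\<Sum>l<d. C j y l * f (u @ i # l # v)) - (\<Sum>l<d. C j y l * f (u @ l # i # v)))
     = (\<Sum>l<d. G i j l * (\<Sum>m<d. C l y m * f (u @ m # v))) + G i j y * f (u @ v)"
  proof -
    have "(\<Sum>l<d. C i y l * f (u @ l # j # v)) - (\<Sum>l<d. C i y l * f (u @ j # l # v))
     + ((\<Sum>l<d. C j y l * f (u @ i # l # v)) - (\<Sum>l<d. C j y l * f (u @ l # i # v)))
     = (\<Sum>l<d. C i y l * (\<Sum>m<d. G l j m * f (u @ m # v))) + (\<Sum>l<d. C j y l * (\<Sum>m<d. G i l m * f (u @ m # v)))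
      + ((\<Sum>l<d. C i y l * R l j) + (\<Sum>l<d. C j y l * R i l)) * f (u @ v)"
      by (simp add: sum_subtractf[symmetric] right_diff_distrib[symmetric] fd)
         (simp only: distrib_left distrib_right sum.distrib sum_distrib_right mult.assoc add_ac)
    also have "\<dots> = (\<Sum>l<d. G i j l * (\<Sum>m<d. C l y m * f (u @ m # v))) + G i j y * f (u @ v)"
      unfolding sum_mult_sum_swap sum.distrib[symmetric] distrib_right[symmetric]
      by (intro arg_cong2[where f = "(+)"] sum.cong refl)
        (simp_all only: der[unfolded sum.distrib[symmetric]] der0[unfolded sum.distrib[symmetric]] lessThan_iff)
    finally show ?thesis .
  qed
  have Rh: "(\<Sum>l<d. G i j l * act d C y f (u @ l # v)) + R i j * act d C y f (u @ v) =
     ((\<Sum>l<d. G i j l * act d C y (\<lambda>u. f (u @ l # v)) u) + R i j * act d C y (\<lambda>u. f (u @ v)) u)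
     + ((\<Sum>l<d. G i j l * (\<Sum>m<d. C l y m * f (u @ m # v))) + G i j y * f (u @ v))
     + ((\<Sum>l<d. G i j l * act d C y (\<lambda>v. f (u @ l # v)) v) + R i j * act d C y (\<lambda>v. f (u @ v)) v)"
    by (simp add: one act_append[of d C y f u v] distrib_left sum.distrib delta algebra_simps)
  show ?thesis unfolding add.assoc Rh L[symmetric] Rt[symmetric] M[symmetric] unfolding two
    by (simp add: algebra_simps)
qed

text \<open>One letter above the top degree of \<open>f\<close> only the constant part of the
  derivation survives, so it acts as the partial derivative by x_i. The function
  \<open>\<phi>\<close> expresses that in top degree \<open>f\<close> does not see the order of the
  letters.\<close>

lemma act_top:
  assumes "\<And>w. length w > n \<Longrightarrow> f w = 0" and "\<And>w. length w = n \<Longrightarrow> f w = \<phi> (mset w)"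
    and "length w \<ge> Suc n"
  shows "act d C i f w =
    (if length w = Suc n then of_nat (count (mset w) i) * \<phi> (mset w - {#i#}) else 0)"
  using assms
proof (induction w arbitrary: n f \<phi>)
  case (Cons x a)
  have z: "f (l # a) = 0" for l using Cons.prems by simp
  show ?case
  proof (cases n)
    case 0
    have "act d C i (\<lambda>v. f (x # v)) a = act d C i (\<lambda>v. 0) a"
      using Cons.prems(1) 0 by (intro act_cong) simp
    then have "act d C i f (x # a) = (if x = i then f a else 0)"
      using z by (simp add: act_zero)
    then show ?thesis using Cons.prems(1)[of a] Cons.prems(2)[of a] 0 by auto
  next
    case (Suc k)
    define \<psi> where "\<psi> M = \<phi> (add_mset x M)" for M
    have IH: "act d C i (\<lambda>v. f (x # v)) a =
        (if length a = Suc k then of_nat (count (mset a) i) * \<psi> (mset a - {#i#}) else 0)"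
      by (rule Cons.IH) (use Cons.prems Suc in \<open>auto simp: \<psi>_def\<close>)
    have 1: "of_nat (count (mset a) i) * \<psi> (mset a - {#i#})
       = of_nat (count (mset a) i) * \<phi> (add_mset x (mset a) - {#i#})"
    proof (cases "i \<in># mset a")
      case False
      then have "count (mset a) i = 0" by (simp only: count_eq_zero_iff not_False_eq_True)
      then show ?thesis by (simp only: of_nat_0 mult_zero_left)
    qed (simp add: \<psi>_def)
    show ?thesis using Cons.prems(1)[of a] Cons.prems(2)[of a] Cons.prems(3) z IH 1 Suc
      by (auto simp: algebra_simps)
  qed
qed simp

lemma acts_rel_u:
  assumes comm: "\<And>y z f a. act d C y (act d C z f) a - act d C z (act d C y f) a = (\<Sum>m<d. c y z m * act d C m f a)"
  shows "acts d C (u @ i # j # v) f a = acts d C (u @ j # i # v) f a + (\<Sum>m<d. c i j m * acts d C (u @ m # v) f a)"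
proof (induction u arbitrary: a)
  case Nil
  then show ?case using comm[of i j "acts d C v f" a] by (simp add: algebra_simps)
next
  case (Cons x u)
  have "act d C x (acts d C (u @ i # j # v) f) a
      = act d C x (\<lambda>a. acts d C (u @ j # i # v) f a + (\<Sum>m<d. c i j m * acts d C (u @ m # v) f a)) a"
    by (rule act_cong) (rule Cons.IH)
  then show ?case by (simp add: act_add act_sum act_mult)
qed

section \<open>Linear combinations\<close>

text \<open>The counterpart of \<open>lin_ext\<close> for vector spaces carried by a whole type,
  such as the ground field, power series, or formal combinations of words.\<close>

definition lc :: "('k::field \<Rightarrow> 'm::ab_group_add \<Rightarrow> 'm) \<Rightarrow> ('x \<Rightarrow> 'm) \<Rightarrow> ('x \<Rightarrow>\<^sub>0 'k) \<Rightarrow> 'm" where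
  "lc s E p = (\<Sum>x\<in>Poly_Mapping.keys p. s (Poly_Mapping.lookup p x) (E x))"

lemma lookup_pm_scale [simp]: "Poly_Mapping.lookup (pm_scale c p) x = c * Poly_Mapping.lookup p x"
  by (simp add: pm_scale_def Poly_Mapping.map.rep_eq when_def)

lemma keys_pm_scale: "Poly_Mapping.keys (pm_scale c p) \<subseteq> Poly_Mapping.keys p"
  by (auto simp: in_keys_iff)

lemma pm_scale_single [simp]: "pm_scale c (Poly_Mapping.single x r) = Poly_Mapping.single x (c * r)"
  by (rule poly_mapping_eqI) (simp add: lookup_single when_def)

interpretation pm: vector_space "pm_scale :: 'k::field \<Rightarrow> ('x \<Rightarrow>\<^sub>0 'k) \<Rightarrow> _"
  by unfold_locales (auto intro!: poly_mapping_eqI simp: lookup_add algebra_simps)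

lemma poly_mapping_sum_single:
  "p = (\<Sum>x\<in>Poly_Mapping.keys p. Poly_Mapping.single x (Poly_Mapping.lookup p x))"
  by (rule poly_mapping_eqI) (auto simp: lookup_sum lookup_single when_def in_keys_iff)

context vector_space begin

lemma lc_superset:
  "finite A \<Longrightarrow> Poly_Mapping.keys p \<subseteq> A \<Longrightarrow> lc scale E p = (\<Sum>x\<in>A. scale (Poly_Mapping.lookup p x) (E x))"
  unfolding lc_def by (rule sum.mono_neutral_left) (auto simp: in_keys_iff)

lemma lc_add: "lc scale E (p + q) = lc scale E p + lc scale E q"
proof -
  let ?A = "Poly_Mapping.keys p \<union> Poly_Mapping.keys q"
  have "lc scale E p = (\<Sum>x\<in>?A. scale (Poly_Mapping.lookup p x) (E x))"
    "lc scale E q = (\<Sum>x\<in>?A. scale (Poly_Mapping.lookup q x) (E x))"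
    "lc scale E (p + q) = (\<Sum>x\<in>?A. scale (Poly_Mapping.lookup (p + q) x) (E x))"
    using Poly_Mapping.keys_add[of p q] by (intro lc_superset; auto)+
  then show ?thesis by (simp add: lookup_add scale_left_distrib sum.distrib)
qed

lemma lc_scale: "lc scale E (pm_scale c p) = scale c (lc scale E p)"
  using lc_superset[of "Poly_Mapping.keys p" "pm_scale c p" E] keys_pm_scale[of c p]
  by (simp add: lc_def scale_sum_right)

lemma lc_zero [simp]: "lc scale E 0 = 0"
  by (simp add: lc_def)

lemma lc_single [simp]: "lc scale E (Poly_Mapping.single x c) = scale c (E x)"
  by (simp add: lc_def)

lemma lc_diff: "lc scale E (p - q) = lc scale E p - lc scale E q"
  using lc_add[of E "p - q" q] by simp

lemma lc_sum: "lc scale E (\<Sum>i\<in>I. p i) = (\<Sum>i\<in>I. lc scale E (p i))"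
  by (induction I rule: infinite_finite_induct) (simp_all add: lc_add)

lemma lc_sum_list: "lc scale E (\<Sum>i\<leftarrow>is. p i) = (\<Sum>i\<leftarrow>is. lc scale E (p i))"
  by (induction "is") (simp_all add: lc_add)

lemma lc_cong: "(\<And>x. x \<in> Poly_Mapping.keys p \<Longrightarrow> E x = E' x) \<Longrightarrow> lc scale E p = lc scale E' p"
  by (simp add: lc_def)

lemma lc_add_fun: "lc scale (\<lambda>x. E x + E' x) p = lc scale E p + lc scale E' p"
  by (simp add: lc_def scale_right_distrib sum.distrib)

lemma lc_diff_fun: "lc scale (\<lambda>x. E x - E' x) p = lc scale E p - lc scale E' p"
  by (simp add: lc_def scale_right_diff_distrib sum_subtractf)

lemma lc_sum_fun: "lc scale (\<lambda>x. \<Sum>i\<in>I. E i x) p = (\<Sum>i\<in>I. lc scale (E i) p)"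
  unfolding lc_def scale_sum_right by (rule sum.swap)

lemma lc_scale_fun: "lc scale (\<lambda>x. scale c (E x)) p = scale c (lc scale E p)"
  unfolding lc_def scale_sum_right by (simp add: mult.commute)

lemma lc_scaled_fun: "lc scale (\<lambda>x. scale (g x) m) p = scale (lc (*) g p) m"
  unfolding lc_def scale_sum_left by simp

lemma subspace_lc: "subspace N \<Longrightarrow> (\<And>x. x \<in> Poly_Mapping.keys p \<Longrightarrow> E x \<in> N) \<Longrightarrow> lc scale E p \<in> N"
  unfolding lc_def by (intro subspace_sum subspace_scale) auto

end

interpretation fld: vector_space "(*) :: 'k::field \<Rightarrow> 'k \<Rightarrow> 'k"
  by unfold_locales (auto simp: algebra_simps)

interpretation fps: vector_space "\<lambda>(c::'k::field) f. fps_const c * f"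
  by unfold_locales (auto simp: algebra_simps simp flip: fps_const_add fps_const_mult)

text \<open>These rewrite in the opposite direction to associativity of multiplication.\<close>

declare fld.scale_scale [simp del] fps.scale_scale [simp del]

lemma fps_nth_lc: "fps_nth (lc (\<lambda>c f. fps_const c * f) E p) n = lc (*) (\<lambda>x. fps_nth (E x) n) p"
  by (simp add: lc_def fps_sum_nth)

lemma lc_mult_fps: "lc (\<lambda>c f. fps_const c * f) (\<lambda>x. g * E x) p = g * lc (\<lambda>c f. fps_const c * f) E p"
  by (simp add: lc_def sum_distrib_left mult_ac)

lemma fps_const_sum: "fps_const (\<Sum>i\<in>I. f i) = (\<Sum>i\<in>I. fps_const (f i))"
  by (rule fps_ext) (simp add: fps_sum_nth)

text \<open>Adjacent transpositions generate all permutations.\<close>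

lemma swap_closed_mset:
  assumes swap: "\<And>u i j v. set (u @ i # j # v) \<subseteq> A \<Longrightarrow> Q (u @ i # j # v) \<Longrightarrow> Q (u @ j # i # v)"
    and "mset w = mset w'" "set w \<subseteq> A" "Q w"
  shows "Q w'"
proof -
  \<comment> \<open>Bubbles \<open>x\<close> to the front, past \<open>v\<close>.\<close>
  have move: "Q (u @ x # v @ v')" if "Q (u @ v @ x # v')" "set (u @ v @ x # v') \<subseteq> A" for u v x v'
    using that
  proof (induction v arbitrary: v' rule: rev_induct)
    case (snoc y v)
    then show ?case using swap[of "u @ v" y x v'] by auto
  qed simp
  have "Q (u @ w')" if "mset w = mset w'" "Q (u @ w)" "set (u @ w) \<subseteq> A" for u
    using that
  proof (induction w' arbitrary: w u)
    case (Cons x w')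
    then have "x \<in> set w" by (metis list.set_intros(1) mset_eq_setD)
    then obtain v v' where w: "w = v @ x # v'" by (meson split_list)
    have "Q ((u @ [x]) @ v @ v')" using move[of u v x v'] Cons.prems w by simp
    moreover have "mset (v @ v') = mset w'" using Cons.prems(1) w by simp
    ultimately have "Q ((u @ [x]) @ w')" using Cons.IH[of "v @ v'" "u @ [x]"] Cons.prems(3) w by simp
    then show ?case by simp
  qed simp
  from this[of "[]"] show ?thesis using assms by simp
qed

lemma keys_sum_subset: "(\<And>i. i \<in> I \<Longrightarrow> Poly_Mapping.keys (f i) \<subseteq> A) \<Longrightarrow> Poly_Mapping.keys (\<Sum>i\<in>I. f i) \<subseteq> A"
proof (induction I rule: infinite_finite_induct)
  case (insert x F)
  then show ?case using Poly_Mapping.keys_add[of "f x" "sum f F"] by auto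
qed simp_all

section \<open>Twist data\<close>

text \<open>Structure constants of a Lie algebra with two bases \<open>x\<close>, \<open>y\<close> and a two-cocycle \<open>\<omega>\<close> such that
  \<open>\<omega>(x\<^sub>k, y\<^sub>i) = \<delta>\<^sub>k\<^sub>i\<close> and \<open>\<omega>(x\<^sub>i, x\<^sub>j) = R i j\<close>: the brackets \<open>[x\<^sub>i, y\<^sub>j]\<close>, \<open>[x\<^sub>i, x\<^sub>j]\<close> have the coordinates
  \<open>C i j\<close>, \<open>\<Gamma> i j\<close> in the basis \<open>x\<close>, and \<open>[y\<^sub>i, y\<^sub>j]\<close> has the coordinates \<open>c i j\<close> in the basis \<open>y\<close>.\<close>

locale twist_data =
  fixes d :: nat and C c \<Gamma> :: "nat \<Rightarrow> nat \<Rightarrow> nat \<Rightarrow> 'k::field_char_0" and R :: "nat \<Rightarrow> nat \<Rightarrow> 'k"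
  assumes C_bound: "z \<ge> d \<Longrightarrow> C x y z = 0" and c_bound: "z \<ge> d \<Longrightarrow> c x y z = 0"
    and \<Gamma>_bound: "z \<ge> d \<Longrightarrow> \<Gamma> x y z = 0"
    and C_rep: "m < d \<Longrightarrow> (\<Sum>l<d. C x y l * C l z m) - (\<Sum>l<d. C x z l * C l y m) = (\<Sum>l<d. c y z l * C x l m)"
    and C_cocycle: "C x y z - C x z y = c y z x"
    and C_der: "m < d \<Longrightarrow> (\<Sum>l<d. C i y l * \<Gamma> l j m) + (\<Sum>l<d. C j y l * \<Gamma> i l m) = (\<Sum>l<d. \<Gamma> i j l * C l y m)"
    and R_der: "(\<Sum>l<d. C i y l * R l j) + (\<Sum>l<d. C j y l * R i l) = \<Gamma> i j y"
    and \<Gamma>_anti: "\<Gamma> j i l = - \<Gamma> i j l" and R_anti: "R j i = - R i j"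
    and \<Gamma>_jacobi: "(\<Sum>m<d. \<Gamma> i j m * \<Gamma> m k l) + (\<Sum>m<d. \<Gamma> j k m * \<Gamma> m i l)
        + (\<Sum>m<d. \<Gamma> k i m * \<Gamma> m j l) = 0"
    and R_cocycle: "(\<Sum>m<d. \<Gamma> i j m * R m k) + (\<Sum>m<d. \<Gamma> j k m * R m i)
        + (\<Sum>m<d. \<Gamma> k i m * R m j) = 0"
begin

abbreviation "W \<equiv> lists {..<d}"

abbreviation "CF x y l \<equiv> fps_const (C x y l)"
definition "GF i j l = fps_X * fps_const (\<Gamma> i j l)"
definition "RF i j = fps_X * fps_const (R i j)"

text \<open>The value on \<open>[i, j]\<close>, \<open>i \<le> j\<close>, makes \<open>lam\<close> antisymmetric on words of length two, which gives
  the twist its linear term \<open>r / 2\<close>.\<close>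

definition base :: "nat list \<Rightarrow> 'k fps" where
  "base w = (case w of [] \<Rightarrow> 1 | [i, j] \<Rightarrow> fps_X * fps_const (R i j / 2) | _ \<Rightarrow> 0)"

lemma base_bound: "2 * k < length w \<Longrightarrow> fps_nth (base w) k = 0"
  by (auto simp: base_def split: list.splits)

lemma GF_sum: "(\<Sum>m<d. GF i j m * GF m k l) = fps_X\<^sup>2 * fps_const (\<Sum>m<d. \<Gamma> i j m * \<Gamma> m k l)"
  by (simp add: GF_def sum_distrib_left power2_eq_square mult_ac fps_const_sum flip: fps_const_mult)

lemma GR_sum: "(\<Sum>m<d. GF i j m * RF m k) = fps_X\<^sup>2 * fps_const (\<Sum>m<d. \<Gamma> i j m * R m k)"
  by (simp add: GF_def RF_def sum_distrib_left power2_eq_square mult_ac fps_const_sum flip: fps_const_mult)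

sublocale str: straightening d GF RF base
proof
  fix i j k l
  show "GF j i l = - GF i j l" "RF j i = - RF i j"
    using \<Gamma>_anti[of j i l] R_anti[of j i] by (simp_all add: GF_def RF_def flip: fps_const_neg)
  show "GF i i l = 0" "RF i i = 0"
    using \<Gamma>_anti[of i i l] R_anti[of i i] by (simp_all add: GF_def RF_def)
  show "(\<Sum>m<d. GF i j m * GF m k l) + (\<Sum>m<d. GF j k m * GF m i l) + (\<Sum>m<d. GF k i m * GF m j l) = 0"
    unfolding GF_sum using \<Gamma>_jacobi[of i j k l] 
    by (simp add: distrib_left[symmetric])
  show "(\<Sum>m<d. GF i j m * RF m k) + (\<Sum>m<d. GF j k m * RF m i) + (\<Sum>m<d. GF k i m * RF m j) = 0"
    unfolding GR_sum using R_cocycle[of i j k] 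
    by (simp add: distrib_left[symmetric])
qed

section \<open>The functional and its pairing with words\<close>

abbreviation "lam \<equiv> str.lam"

definition L :: "nat list \<Rightarrow> nat list \<Rightarrow> 'k fps" where
  "L u a = acts d CF u lam a"

definition eps :: "nat list \<Rightarrow> 'k" where
  "eps w = (if w = [] then 1 else 0)"

text \<open>The value of \<open>L\<close> at t = 0, see \<open>L_nth_0\<close>: differentiate the
  polynomial \<open>a\<close> by \<open>u\<close> and evaluate at the origin, which is what
  \<open>eps\<close> does.\<close>

definition P :: "nat list \<Rightarrow> nat list \<Rightarrow> 'k" where
  "P u a = acts d C u eps a"

lemma fps_nth_act: "fps_nth (act d CF y f a) k = act d C y (\<lambda>w. fps_nth (f w) k) a"
  by (induction a arbitrary: f) (simp_all add: fps_sum_nth)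

lemma fps_nth_acts: "fps_nth (acts d CF u f a) k = acts d C u (\<lambda>w. fps_nth (f w) k) a"
  by (induction u arbitrary: a) (simp_all add: fps_nth_act cong: act_cong)

text \<open>A correction removes at most two letters and contributes a factor t, and
  \<open>base\<close> obeys the same bound.\<close>

lemma lam_bound: "2 * k < length w \<Longrightarrow> fps_nth (lam w) k = 0"
proof (induction w arbitrary: k rule: wf_induct_rule[OF str.wf_smaller])
  case (1 w)
  show ?case
  proof (cases "sorted w")
    case True
    then show ?thesis using "1.prems" by (simp add: str.lam_sorted base_bound)
  next
    case False
    obtain u i j v where d: "str.descent w = (u, i, j, v)" by (cases "str.descent w")
    with str.descent[OF False] have w: "w = u @ i # j # v" "j < i" by auto
    have "fps_nth (lam (u @ j # i # v)) k = 0"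
      using "1.IH"[of "u @ j # i # v" k] str.smaller_swap[OF w(2), of u v] "1.prems" w(1) by simp
    \<comment> \<open>The corrections carry a factor t, so only their coefficients at
      \<open>k - 1\<close> enter.\<close>
    moreover have "fps_nth (lam (u @ l # v)) (k - 1) = 0" "fps_nth (lam (u @ v)) (k - 1) = 0" if "k > 0" for l
      using "1.IH"[OF str.smaller_length, of _ "k - 1"] "1.prems" w that by simp_all
    ultimately show ?thesis
      by (subst str.lam_rel[of u i j v, folded w(1)])
        (simp add: GF_def RF_def fps_sum_nth mult.assoc)
  qed
qed

lemma lam_Nil: "lam [] = 1"
  by (subst str.lam_sorted) (simp_all add: base_def)

lemma lam_nth_0: "fps_nth (lam w) 0 = eps w"
  using lam_bound[of 0 w] by (cases w) (auto simp: eps_def lam_Nil)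

lemma L_nth_0: "fps_nth (L u a) 0 = P u a"
  by (simp add: L_def P_def fps_nth_acts lam_nth_0 eps_def[abs_def])

text \<open>For i > j the relation adds \<open>R i j\<close> to \<open>R j i / 2\<close>; the linear
  terms drop out because \<open>lam\<close> of a single letter has no constant term.\<close>

lemma lam_two: "fps_nth (lam [i, j]) 1 = R i j / 2"
proof (cases "i \<le> j")
  case True
  then show ?thesis by (subst str.lam_sorted) (simp_all add: base_def)
next
  case False
  have "fps_nth (lam [l]) 0 = 0" for l using lam_nth_0[of "[l]"] by (simp add: eps_def)
  moreover have "lam [j, i] = fps_X * fps_const (R j i / 2)"
    using False by (subst str.lam_sorted) (simp_all add: base_def)
  ultimately show ?thesis using R_anti[of j i] str.lam_rel[of "[]" i j "[]"]
    by (simp add: lam_Nil GF_def RF_def fps_sum_nth mult.assoc)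
qed

lemma L_Nil [simp]: "L [] a = lam a" by (simp add: L_def)
lemma P_Nil: "P [] a = eps a" by (simp add: P_def)

lemma acts_Nil: "acts d D u f [] = (if u = [] then f [] else 0)"
  by (cases u) auto

text \<open>Derivations kill the empty word, so pairing with it is the counit; the counit conditions
  of the twist rest on this.\<close>

lemma L_at_Nil: "L u [] = (if u = [] then 1 else 0)"
  by (simp add: L_def acts_Nil lam_Nil)

lemma P_at_Nil: "P u [] = eps u"
  by (simp add: P_def acts_Nil eps_def)

lemma L_rel: "L w (u @ i # j # v) = L w (u @ j # i # v) + (\<Sum>l<d. GF i j l * L w (u @ l # v)) + RF i j * L w (u @ v)"
proof (induction w arbitrary: u i j v)
  case Nil
  then show ?case unfolding L_Nil by (rule str.lam_rel)
next
  case (Cons x w)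
  have "act d CF x (L w) (u @ i # j # v) = act d CF x (L w) (u @ j # i # v)
    + (\<Sum>l<d. GF i j l * act d CF x (L w) (u @ l # v)) + RF i j * act d CF x (L w) (u @ v)"
  \<comment> \<open>The conditions of \<open>act_rel\<close> are \<open>C_der\<close> and
    \<open>R_der\<close> multiplied by t.\<close>
  proof (rule act_rel[OF _ _ _ Cons.IH])
    fix i j y m assume "m < d"
    show "(\<Sum>l<d. CF i y l * GF l j m) + (\<Sum>l<d. CF j y l * GF i l m) = (\<Sum>l<d. GF i j l * CF l y m)"
    proof -
      have "fps_const ((\<Sum>l<d. C i y l * \<Gamma> l j m) + (\<Sum>l<d. C j y l * \<Gamma> i l m))
          = fps_const (\<Sum>l<d. \<Gamma> i j l * C l y m)"
        using C_der[OF \<open>m < d\<close>, of i y j] by simp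
      from arg_cong[OF this, of "(*) fps_X"] show ?thesis
        by (simp add: GF_def fps_const_sum sum_distrib_left distrib_left mult_ac
            flip: fps_const_add fps_const_mult)
    qed
  next
    fix i j y
    show "(\<Sum>l<d. CF i y l * RF l j) + (\<Sum>l<d. CF j y l * RF i l) = GF i j y"
    proof -
      have "fps_const ((\<Sum>l<d. C i y l * R l j) + (\<Sum>l<d. C j y l * R i l)) = fps_const (\<Gamma> i j y)"
        using R_der[of i y j] by simp
      from arg_cong[OF this, of "(*) fps_X"] show ?thesis
        by (simp add: GF_def RF_def fps_const_sum sum_distrib_left distrib_left mult_ac
            flip: fps_const_add fps_const_mult)
    qed
  qed (simp add: GF_def \<Gamma>_bound)
  then show ?case by (simp add: L_def[abs_def])
qed

lemma act_comm_k: "act d C y (act d C z f) a - act d C z (act d C y f) a = (\<Sum>m<d. c y z m * act d C m f a)"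
  by (rule act_commute[OF C_rep C_cocycle C_bound c_bound])

lemma act_comm_fps: "act d CF y (act d CF z f) a - act d CF z (act d CF y f) a = (\<Sum>m<d. fps_const (c y z m) * act d CF m f a)"
  by (rule fps_ext) (simp add: fps_nth_act fps_sum_nth act_comm_k)

lemma L_left_rel: "L (u @ i # j # v) a = L (u @ j # i # v) a + (\<Sum>m<d. fps_const (c i j m) * L (u @ m # v) a)"
  unfolding L_def by (rule acts_rel_u[OF act_comm_fps])

lemma P_left_rel: "P (u @ i # j # v) a = P (u @ j # i # v) a + (\<Sum>m<d. c i j m * P (u @ m # v) a)"
  unfolding P_def by (rule acts_rel_u[OF act_comm_k])

subsection \<open>Dual elements\<close>

text \<open>The product of the factorials of the letter multiplicities, which is what
  differentiating a monomial by itself produces.\<close>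

fun fac :: "nat list \<Rightarrow> nat" where
  "fac [] = 1"
| "fac (i # w) = Suc (count (mset w) i) * fac w"

lemma fac_pos: "fac w > 0" by (induction w) auto

text \<open>With at least as many letters as derivations, the empty word is reached only if every
  derivation uses its constant part; the pairing is then that of monomials with differential
  operators with constant coefficients.\<close>

lemma P_top: "length u \<le> length a \<Longrightarrow> P u a = (if mset a = mset u then of_nat (fac u) else 0)"
proof (induction u arbitrary: a)
  case Nil
  then show ?case by (auto simp: P_Nil eps_def)
next
  case (Cons i u)
  have "P (i # u) a = act d C i (P u) a" by (simp add: P_def[abs_def])
  also have "\<dots> = (if length a = Suc (length u) then of_nat (count (mset a) i) *
      (if mset a - {#i#} = mset u then of_nat (fac u) else 0) else 0)"
    by (rule act_top[where \<phi> = "\<lambda>M. if M = mset u then of_nat (fac u) else 0"])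
      (use Cons in \<open>auto dest: mset_eq_length\<close>)
  also have "\<dots> = (if mset a = mset (i # u) then of_nat (fac (i # u)) else 0)"
  proof (cases "i \<in># mset a")
    case True
    then obtain M where "mset a = add_mset i M" by (metis mset_add)
    then show ?thesis by (auto dest: mset_eq_length arg_cong[of _ _ size] simp: algebra_simps)
  next
    case False
    then have "count (mset a) i = 0" by (simp only: count_eq_zero_iff not_False_eq_True)
    moreover have "mset a \<noteq> mset (i # u)"
    proof
      assume "mset a = mset (i # u)"
      then have "i \<in># mset a" by (simp only: mset.simps) simp
      with False show False ..
    qed
    ultimately show ?thesis by (simp only: of_nat_0 mult_zero_left if_cancel if_False)
  qed
  finally show ?case .
qed

definition SW :: "nat \<Rightarrow> nat list set" where
  "SW n = {w \<in> W. sorted w \<and> length w \<le> n}"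

lemma finite_SW: "finite (SW n)"
  by (rule finite_subset[OF _ finite_lists_length_le[of "{..<d}" n]]) (auto simp: SW_def)

lemma SW_mono: "m \<le> n \<Longrightarrow> SW m \<subseteq> SW n" by (auto simp: SW_def)

declare sum.cong[fundef_cong]

text \<open>On sorted words the pairing \<open>P\<close> is triangular with respect to the length, with diagonal
  entries \<open>fac\<close>; \<open>dual w\<close> is the combination of words with \<open>P (dual w) v = \<delta>\<^sub>w\<^sub>v\<close> for sorted \<open>v\<close>.\<close>

function dual :: "nat list \<Rightarrow> (nat list \<Rightarrow>\<^sub>0 'k)" where
  "dual w = pm_scale (inverse (of_nat (fac w))) (Poly_Mapping.single w 1 -
     (\<Sum>v\<in>{v \<in> SW (length w). length v < length w}. pm_scale (P w v) (dual v)))"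
  by auto
termination by (relation "measure length") auto

declare dual.simps [simp del]

lemma keys_dual: "w \<in> W \<Longrightarrow> Poly_Mapping.keys (dual w) \<subseteq> W"
proof (induction w rule: dual.induct)
  case (1 w)
  have "Poly_Mapping.keys (\<Sum>v\<in>{v \<in> SW (length w). length v < length w}. pm_scale (P w v) (dual v)) \<subseteq> W"
    by (rule keys_sum_subset, rule order_trans[OF keys_pm_scale], rule "1.IH") (auto simp: SW_def)
  then show ?case
    by (subst dual.simps) (use "1.prems" in \<open>auto dest!: keys_pm_scale[THEN subsetD] keys_diff[THEN subsetD]\<close>)
qed

text \<open>Inversion of a triangular matrix: the definition of \<open>dual w\<close>, solved for
  \<open>w\<close>, accounts for the sorted words shorter than \<open>w\<close>, and all others
  except \<open>w\<close> pair to zero with it by \<open>P_top\<close>.\<close>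

lemma lc_dual_sorted:
  assumes "vector_space s" "w \<in> W" "sorted w" "length w \<le> n"
  shows "(\<Sum>\<alpha>\<in>SW n. s (P w \<alpha>) (lc s E (dual \<alpha>))) = E w"
proof -
  interpret vector_space s by fact
  let ?D = "{v \<in> SW (length w). length v < length w}"
  have w: "w \<in> SW n" using assms by (simp add: SW_def)
  have "(\<Sum>\<alpha>\<in>SW n. s (P w \<alpha>) (lc s E (dual \<alpha>))) = (\<Sum>\<alpha>\<in>insert w ?D. s (P w \<alpha>) (lc s E (dual \<alpha>)))"
  proof (rule sum.mono_neutral_right)
    show "\<forall>\<alpha>\<in>SW n - insert w ?D. s (P w \<alpha>) (lc s E (dual \<alpha>)) = 0"
    proof
      fix \<alpha> assume a: "\<alpha> \<in> SW n - insert w ?D"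
      then have "length w \<le> length \<alpha>" by (auto simp: SW_def)
      \<comment> \<open>Sorted words with the same multiset of letters coincide.\<close>
      moreover have "mset \<alpha> \<noteq> mset w"
        using a assms(3) properties_for_sort[of \<alpha> w] sorted_sort_id[of w] by (auto simp: SW_def)
      ultimately show "s (P w \<alpha>) (lc s E (dual \<alpha>)) = 0" by (simp add: P_top)
    qed
  qed (use w in \<open>auto simp: finite_SW intro: SW_mono[THEN subsetD, OF assms(4)]\<close>)
  also have "\<dots> = s (of_nat (fac w)) (lc s E (dual w)) + (\<Sum>\<alpha>\<in>?D. s (P w \<alpha>) (lc s E (dual \<alpha>)))"
    by (subst sum.insert) (auto simp: finite_SW P_top)
  also have "s (of_nat (fac w)) (lc s E (dual w)) = E w - (\<Sum>\<alpha>\<in>?D. s (P w \<alpha>) (lc s E (dual \<alpha>)))"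
    by (subst dual.simps) (use fac_pos[of w] in \<open>simp add: lc_scale lc_diff lc_sum\<close>)
  finally show ?thesis by simp
qed

text \<open>Expansion of a word of U(h) in the dual elements, in the role of the spanning half of
  the Poincare-Birkhoff-Witt theorem. Sorted words are covered by \<open>lc_dual_sorted\<close>;
  since \<open>E\<close> modulo \<open>N\<close> and \<open>P\<close> obey the same relations, a
  swap changes the defect only by defects of shorter words.\<close>

lemma lc_dual:
  assumes "vector_space s" "module.subspace s N"
    and rel: "\<And>u i j v. u \<in> W \<Longrightarrow> v \<in> W \<Longrightarrow> i < d \<Longrightarrow> j < d \<Longrightarrow>
       E (u @ i # j # v) - E (u @ j # i # v) - (\<Sum>l<d. s (c i j l) (E (u @ l # v))) \<in> N"
    and "w \<in> W" "length w \<le> n"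
  shows "E w - (\<Sum>\<alpha>\<in>SW n. s (P w \<alpha>) (lc s E (dual \<alpha>))) \<in> N"
  using assms(4,5)
proof (induction "length w" arbitrary: w rule: less_induct)
  case less
  interpret vector_space s by fact
  define D where "D w = E w - (\<Sum>\<alpha>\<in>SW n. s (P w \<alpha>) (lc s E (dual \<alpha>)))" for w
  have swap: "D (u @ j # i # v) \<in> N"
    if "set (u @ i # j # v) \<subseteq> {..<d}" "length (u @ i # j # v) = length w \<and> D (u @ i # j # v) \<in> N" for u i j v
  proof -
    have "D (u @ i # j # v) - D (u @ j # i # v)
      = (E (u @ i # j # v) - E (u @ j # i # v) - (\<Sum>l<d. s (c i j l) (E (u @ l # v))))
        + (\<Sum>l<d. s (c i j l) (D (u @ l # v)))"
    proof -
      have "(\<Sum>\<alpha>\<in>SW n. s (\<Sum>m<d. c i j m * P (u @ m # v) \<alpha>) (lc s E (dual \<alpha>)))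
         = (\<Sum>l<d. s (c i j l) (\<Sum>\<alpha>\<in>SW n. s (P (u @ l # v) \<alpha>) (lc s E (dual \<alpha>))))"
        unfolding scale_sum_right scale_sum_left by (subst sum.swap) simp
      then show ?thesis
        by (simp add: D_def P_left_rel[of u i j v] scale_left_distrib sum.distrib
            scale_right_diff_distrib sum_subtractf algebra_simps)
    qed
    moreover have "(\<Sum>l<d. s (c i j l) (D (u @ l # v))) \<in> N"
    proof (intro subspace_sum subspace_scale assms(2))
      fix l assume "l \<in> {..<d}"
      then show "D (u @ l # v) \<in> N" unfolding D_def
        using that less.prems(2) by (intro less.hyps) auto
    qed
    moreover have "E (u @ i # j # v) - E (u @ j # i # v) - (\<Sum>l<d. s (c i j l) (E (u @ l # v))) \<in> N"
      using that(1) by (intro rel) auto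
    ultimately have "D (u @ i # j # v) - D (u @ j # i # v) \<in> N"
      by (simp add: subspace_add assms(2))
    from subspace_diff[OF assms(2) conjunct2[OF that(2)] this] show ?thesis using that(2) by simp
  qed
  have "length w = length w \<and> D w \<in> N"
  proof (rule swap_closed_mset[of "{..<d}" "\<lambda>v. length v = length w \<and> D v \<in> N" "sort w"])
    have "D (sort w) = 0"
      unfolding D_def using less.prems by (subst lc_dual_sorted[OF assms(1)]) auto
    then show "length (sort w) = length w \<and> D (sort w) \<in> N"
      by (simp add: subspace_0 assms(2))
  qed (use swap less.prems in auto)
  then show ?case by (simp add: D_def)
qed

text \<open>Follows the recursion for \<open>dual\<close>: subtracting the shorter dual elements
  cancels the pairings with shorter sorted words, and \<open>P_top\<close> settles the rest.\<close>

lemma P_dual: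
  assumes "\<alpha> \<in> W" "sorted \<alpha>" "\<beta> \<in> W" "sorted \<beta>"
  shows "lc (*) (\<lambda>w. P w \<beta>) (dual \<alpha>) = (if \<alpha> = \<beta> then 1 else 0)"
  using assms(1,2)
proof (induction \<alpha> rule: dual.induct)
  case (1 w)
  let ?D = "{v \<in> SW (length w). length v < length w}"
  have IH: "lc (*) (\<lambda>w. P w \<beta>) (dual v) = (if v = \<beta> then 1 else 0)" if "v \<in> ?D" for v
    using that by (intro "1.IH") (auto simp: SW_def)
  have "(\<Sum>v\<in>?D. P w v * lc (*) (\<lambda>w. P w \<beta>) (dual v)) = (\<Sum>v\<in>?D. if v = \<beta> then P w v else 0)"
    by (rule sum.cong) (auto simp: IH)
  also have "\<dots> = (if \<beta> \<in> ?D then P w \<beta> else 0)"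
    by (subst sum.delta) (simp_all add: finite_SW)
  finally have e: "lc (*) (\<lambda>w. P w \<beta>) (dual w) = inverse (of_nat (fac w)) * (P w \<beta> - (if \<beta> \<in> ?D then P w \<beta> else 0))"
    by (subst dual.simps) (simp only: fld.lc_scale fld.lc_diff fld.lc_sum fld.lc_single mult_1)
  show ?case
  proof (cases "length \<beta> < length w")
    case True
    then show ?thesis unfolding e using assms(3,4) by (auto simp: SW_def)
  next
    case False
    then have "mset \<beta> = mset w \<longleftrightarrow> w = \<beta>"
      using "1.prems" assms(4) properties_for_sort[of \<beta> w] sorted_sort_id[of w] by auto
    then show ?thesis unfolding e using False fac_pos[of w] by (auto simp: P_top)
  qed
qed

end

lemma fps_X_power_dvd_iff: "fps_X ^ n dvd (f :: 'k::field fps) \<longleftrightarrow> (\<forall>i<n. fps_nth f i = 0)"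
proof
  assume "fps_X ^ n dvd f"
  then obtain g where "f = fps_X ^ n * g" by auto
  then show "\<forall>i<n. fps_nth f i = 0" by (simp add: fps_X_power_mult_nth)
next
  assume "\<forall>i<n. fps_nth f i = 0"
  then have "f = fps_X ^ n * fps_shift n f"
    by (intro fps_ext) (simp add: fps_X_power_mult_nth)
  then show "fps_X ^ n dvd f" by (rule dvdI)
qed

lemma act_vanish:
  assumes "\<And>w. length w > n \<Longrightarrow> f w = 0" "length a > Suc n"
  shows "act d C y f a = 0"
  using assms
proof (induction a arbitrary: f n)
  case (Cons x a)
  have "act d C y (\<lambda>v. f (x # v)) a = 0"
  proof (cases n)
    case 0
    have "act d C y (\<lambda>v. f (x # v)) a = act d C y (\<lambda>v. 0) a"
      by (rule act_cong) (use Cons.prems 0 in auto)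
    then show ?thesis by (simp add: act_zero)
  next
    case (Suc k)
    show ?thesis by (rule Cons.IH[of k]) (use Cons.prems Suc in auto)
  qed
  then show ?case using Cons.prems by simp
qed simp

definition bil :: "('x \<Rightarrow> 'y \<Rightarrow> 'z \<Rightarrow>\<^sub>0 'k::field) \<Rightarrow> ('x \<Rightarrow>\<^sub>0 'k) \<Rightarrow> ('y \<Rightarrow>\<^sub>0 'k) \<Rightarrow> ('z \<Rightarrow>\<^sub>0 'k)" where
  "bil \<sigma> p q = (\<Sum>x\<in>Poly_Mapping.keys p. \<Sum>y\<in>Poly_Mapping.keys q.
     pm_scale (Poly_Mapping.lookup p x * Poly_Mapping.lookup q y) (\<sigma> x y))"

lemma (in vector_space) lc_bil: "lc scale E (bil \<sigma> p q) = lc scale (\<lambda>x. lc scale (\<lambda>y. lc scale E (\<sigma> x y)) q) p"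
  unfolding bil_def lc_sum lc_scale by (simp add: lc_def[of scale _ p] lc_def[of scale _ q] scale_sum_right)

lemma keys_bil:
  assumes "\<And>x y. x \<in> Poly_Mapping.keys p \<Longrightarrow> y \<in> Poly_Mapping.keys q \<Longrightarrow> Poly_Mapping.keys (\<sigma> x y) \<subseteq> A"
  shows "Poly_Mapping.keys (bil \<sigma> p q) \<subseteq> A"
  unfolding bil_def by (intro keys_sum_subset order_trans[OF keys_pm_scale] assms)

context twist_data begin

section \<open>Combinations of words seen through the pairing\<close>

abbreviation lcf :: "('x \<Rightarrow> 'k fps) \<Rightarrow> ('x \<Rightarrow>\<^sub>0 'k) \<Rightarrow> 'k fps" where
  "lcf \<equiv> lc (\<lambda>c f. fps_const c * f)"

text \<open>\<open>E\<close> respects, modulo \<open>N\<close>, the defining relations of U(h) in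
  the basis y. It is applied to one slot of a triple of words while the others are fixed.\<close>

definition slot_rel :: "('k \<Rightarrow> 'm::ab_group_add \<Rightarrow> 'm) \<Rightarrow> 'm set \<Rightarrow> (nat list \<Rightarrow> 'm) \<Rightarrow> bool" where
  "slot_rel s N E \<longleftrightarrow> (\<forall>u\<in>W. \<forall>v\<in>W. \<forall>i<d. \<forall>j<d.
     E (u @ i # j # v) - E (u @ j # i # v) - (\<Sum>l<d. s (c i j l) (E (u @ l # v))) \<in> N)"

lemma slot_rel_lc:
  assumes "vector_space s" "module.subspace s N" "\<And>x. x \<in> Poly_Mapping.keys p \<Longrightarrow> slot_rel s N (E x)"
  shows "slot_rel s N (\<lambda>w. lc s (\<lambda>x. E x w) p)"
  unfolding slot_rel_def
proof (intro ballI allI impI)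
  fix u v i j assume *: "u \<in> W" "v \<in> W" "i < d" "j < d"
  interpret vector_space s by fact
  have "lc s (\<lambda>x. E x (u @ i # j # v) - E x (u @ j # i # v) - (\<Sum>l<d. s (c i j l) (E x (u @ l # v)))) p \<in> N"
    by (rule subspace_lc[OF assms(2)]) (use assms(3) * in \<open>auto simp: slot_rel_def\<close>)
  then show "lc s (\<lambda>x. E x (u @ i # j # v)) p - lc s (\<lambda>x. E x (u @ j # i # v)) p
      - (\<Sum>l<d. s (c i j l) (lc s (\<lambda>x. E x (u @ l # v)) p)) \<in> N"
    by (simp add: lc_diff_fun lc_sum_fun lc_scale_fun)
qed

text \<open>The elements of the free vector space on triples of words that vanish in the third tensor
  power of the enveloping algebra; see \<open>null3_eval\<close>.\<close>

definition null3 :: "(nat list \<times> nat list \<times> nat list \<Rightarrow>\<^sub>0 'k) \<Rightarrow> bool" where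
  "null3 D \<longleftrightarrow> Poly_Mapping.keys D \<subseteq> W \<times> W \<times> W \<and>
     (\<forall>a\<in>W. \<forall>b\<in>W. \<forall>e\<in>W. lc (*) (\<lambda>(u, v, w). P u a * P v b * P w e) D = 0)"

text \<open>Expanding the three slots one after the other by \<open>lc_dual\<close> turns
  \<open>E\<close> into a combination of products of three pairings whose coefficients do not depend
  on the triple. Summed over \<open>D\<close>, each such product is a scalar that
  \<open>null3\<close> makes zero.\<close>

lemma null3_eval:
  assumes vs: "vector_space s" and N: "module.subspace s N" and D: "null3 D"
    and r1: "\<And>v w. v \<in> W \<Longrightarrow> w \<in> W \<Longrightarrow> slot_rel s N (\<lambda>u. E (u, v, w))"
    and r2: "\<And>u w. u \<in> W \<Longrightarrow> w \<in> W \<Longrightarrow> slot_rel s N (\<lambda>v. E (u, v, w))"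
    and r3: "\<And>u v. u \<in> W \<Longrightarrow> v \<in> W \<Longrightarrow> slot_rel s N (\<lambda>w. E (u, v, w))"
  shows "lc s E D \<in> N"
proof -
  interpret vector_space s by fact
  note sub = subspace_add[OF N] subspace_diff[OF N] subspace_sum[OF N] subspace_scale[OF N]
  define len :: "nat list \<times> nat list \<times> nat list \<Rightarrow> nat"
    where "len = (\<lambda>(u, v, w). length u + length v + length w)"
  \<comment> \<open>A common bound for the lengths in \<open>D\<close>, so that one set
    \<open>SW n\<close> serves every expansion; \<open>insert 0\<close> covers an empty
    \<open>D\<close>.\<close>
  define n where "n = Max (insert 0 (len ` Poly_Mapping.keys D))"
  have n: "length u \<le> n \<and> length v \<le> n \<and> length w \<le> n" if "(u, v, w) \<in> Poly_Mapping.keys D" for u v w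
  proof -
    have "len (u, v, w) \<le> n" unfolding n_def using that by (intro Max_ge) auto
    then show ?thesis by (simp add: len_def)
  qed
  define E1 where "E1 \<alpha> v w = lc s (\<lambda>u. E (u, v, w)) (dual \<alpha>)" for \<alpha> v w
  define E2 where "E2 \<alpha> \<beta> w = lc s (\<lambda>v. E1 \<alpha> v w) (dual \<beta>)" for \<alpha> \<beta> w
  define E3 where "E3 \<alpha> \<beta> \<gamma> = lc s (\<lambda>w. E2 \<alpha> \<beta> w) (dual \<gamma>)" for \<alpha> \<beta> \<gamma>
  have SW: "\<alpha> \<in> W" if "\<alpha> \<in> SW n" for \<alpha> using that by (simp add: SW_def)
  have dualW: "u \<in> W" if "\<alpha> \<in> SW n" "u \<in> Poly_Mapping.keys (dual \<alpha>)" for u \<alpha>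
    using keys_dual[OF SW[OF that(1)]] that(2) by auto
  have q2: "slot_rel s N (\<lambda>v. E1 \<alpha> v w)" if "\<alpha> \<in> SW n" "w \<in> W" for \<alpha> w
    unfolding E1_def by (intro slot_rel_lc[OF vs N] r2) (use that dualW in blast)+
  have q3: "slot_rel s N (\<lambda>w. E2 \<alpha> \<beta> w)" if "\<alpha> \<in> SW n" "\<beta> \<in> SW n" for \<alpha> \<beta>
    unfolding E2_def E1_def by (intro slot_rel_lc[OF vs N] r3) (use that dualW in blast)+
  have dual_step: "E' w - (\<Sum>\<alpha>\<in>SW n. s (P w \<alpha>) (lc s E' (dual \<alpha>))) \<in> N"
    if "slot_rel s N E'" "w \<in> W" "length w \<le> n" for E' w
    by (rule lc_dual[OF vs N _ that(2,3)]) (use that(1) in \<open>auto simp: slot_rel_def\<close>)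
  have main: "E (u, v, w) - (\<Sum>\<alpha>\<in>SW n. \<Sum>\<beta>\<in>SW n. \<Sum>\<gamma>\<in>SW n. s (P u \<alpha> * P v \<beta> * P w \<gamma>) (E3 \<alpha> \<beta> \<gamma>)) \<in> N"
    if "(u, v, w) \<in> Poly_Mapping.keys D" for u v w
  proof -
    have W: "u \<in> W" "v \<in> W" "w \<in> W" using that D by (auto simp: null3_def)
    have 3: "E2 \<alpha> \<beta> w - (\<Sum>\<gamma>\<in>SW n. s (P w \<gamma>) (E3 \<alpha> \<beta> \<gamma>)) \<in> N" if "\<alpha> \<in> SW n" "\<beta> \<in> SW n" for \<alpha> \<beta>
      unfolding E3_def by (rule dual_step) (use q3 that W n[OF \<open>(u, v, w) \<in> _\<close>] in auto)
    have 2: "E1 \<alpha> v w - (\<Sum>\<beta>\<in>SW n. s (P v \<beta>) (E2 \<alpha> \<beta> w)) \<in> N" if "\<alpha> \<in> SW n" for \<alpha>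
      unfolding E2_def by (rule dual_step) (use q2 that W n[OF \<open>(u, v, w) \<in> _\<close>] in auto)
    have 1: "E (u, v, w) - (\<Sum>\<alpha>\<in>SW n. s (P u \<alpha>) (E1 \<alpha> v w)) \<in> N"
      unfolding E1_def by (rule dual_step) (use r1 that W n[OF \<open>(u, v, w) \<in> _\<close>] in auto)
    let ?T1 = "\<Sum>\<alpha>\<in>SW n. s (P u \<alpha>) (E1 \<alpha> v w)"
    let ?T2 = "\<Sum>\<alpha>\<in>SW n. \<Sum>\<beta>\<in>SW n. s (P u \<alpha> * P v \<beta>) (E2 \<alpha> \<beta> w)"
    let ?T3 = "\<Sum>\<alpha>\<in>SW n. \<Sum>\<beta>\<in>SW n. \<Sum>\<gamma>\<in>SW n. s (P u \<alpha> * P v \<beta> * P w \<gamma>) (E3 \<alpha> \<beta> \<gamma>)"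
    have "(\<Sum>\<alpha>\<in>SW n. s (P u \<alpha>) (E1 \<alpha> v w - (\<Sum>\<beta>\<in>SW n. s (P v \<beta>) (E2 \<alpha> \<beta> w)))) \<in> N"
      by (intro sub 2)
    then have 2: "?T1 - ?T2 \<in> N"
      by (simp only: scale_right_diff_distrib sum_subtractf scale_sum_right scale_scale)
    have "(\<Sum>\<alpha>\<in>SW n. s (P u \<alpha>) (\<Sum>\<beta>\<in>SW n. s (P v \<beta>) (E2 \<alpha> \<beta> w - (\<Sum>\<gamma>\<in>SW n. s (P w \<gamma>) (E3 \<alpha> \<beta> \<gamma>))))) \<in> N"
      by (intro sub 3)
    then have 3: "?T2 - ?T3 \<in> N"
      by (simp only: scale_right_diff_distrib sum_subtractf scale_sum_right scale_scale mult.assoc)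
    have "E (u, v, w) - ?T3 = (E (u, v, w) - ?T1 + (?T1 - ?T2)) + (?T2 - ?T3)"
      by (simp only: diff_add_cancel add_diff_eq)
    with sub(1)[OF sub(1)[OF 1 2] 3] show ?thesis by (simp only:)
  qed
  have "lc s (\<lambda>x. E x - (case x of (u, v, w) \<Rightarrow> (\<Sum>\<alpha>\<in>SW n. \<Sum>\<beta>\<in>SW n. \<Sum>\<gamma>\<in>SW n. s (P u \<alpha> * P v \<beta> * P w \<gamma>) (E3 \<alpha> \<beta> \<gamma>)))) D \<in> N"
    by (rule subspace_lc[OF N]) (use main in auto)
  moreover have "lc s (\<lambda>x. case x of (u, v, w) \<Rightarrow> (\<Sum>\<alpha>\<in>SW n. \<Sum>\<beta>\<in>SW n. \<Sum>\<gamma>\<in>SW n. s (P u \<alpha> * P v \<beta> * P w \<gamma>) (E3 \<alpha> \<beta> \<gamma>))) D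
     = (\<Sum>\<alpha>\<in>SW n. \<Sum>\<beta>\<in>SW n. \<Sum>\<gamma>\<in>SW n. s (lc (*) (\<lambda>(u, v, w). P u \<alpha> * P v \<beta> * P w \<gamma>) D) (E3 \<alpha> \<beta> \<gamma>))"
    by (simp add: case_prod_unfold lc_sum_fun lc_scaled_fun)
  moreover have "\<dots> = 0"
    using D by (intro sum.neutral ballI) (simp add: null3_def SW)
  ultimately show ?thesis by (simp add: lc_diff_fun)
qed

lemma slot_rel_L: "slot_rel (\<lambda>c f. fps_const c * f) {0} (\<lambda>u. L u a)"
  unfolding slot_rel_def by (intro ballI allI impI) (subst L_left_rel, simp)

lemma subspace_zero_fps: "module.subspace (\<lambda>(c::'k) f. fps_const c * f) {0}"
  by (simp add: fps.subspace_def)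

lemma slot_rel_fps_mult:
  "slot_rel (\<lambda>c f. fps_const c * f) {0} E \<Longrightarrow> slot_rel (\<lambda>c f. fps_const c * f) {0} (\<lambda>u. g * E u)"
proof -
  have "g * x - g * y - (\<Sum>l<d. fps_const (r l) * (g * z l)) = g * (x - y - (\<Sum>l<d. fps_const (r l) * z l))"
    for x y z r
    by (simp add: algebra_simps sum_distrib_left)
  then show "slot_rel (\<lambda>c f. fps_const c * f) {0} E \<Longrightarrow> slot_rel (\<lambda>c f. fps_const c * f) {0} (\<lambda>u. g * E u)"
    by (auto simp: slot_rel_def)
qed

definition L3 :: "nat list \<Rightarrow> nat list \<Rightarrow> nat list \<Rightarrow> nat list \<times> nat list \<times> nat list \<Rightarrow> 'k fps" where
  "L3 a b e = (\<lambda>(u, v, w). L u a * L v b * L w e)"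

text \<open>\<open>null3\<close> concerns t = 0 only, but the pairing with values in power series
  obeys the same relations in its left argument, so \<open>null3_eval\<close> applies to it
  too.\<close>

lemma null3_L3: "null3 D \<Longrightarrow> lcf (L3 a b e) D = 0"
proof -
  assume "null3 D"
  have "lcf (L3 a b e) D \<in> {0}"
  proof (rule null3_eval[OF fps.vector_space_axioms subspace_zero_fps \<open>null3 D\<close>])
    show "slot_rel (\<lambda>c f. fps_const c * f) {0} (\<lambda>u. L3 a b e (u, v, w))" for v w
      using slot_rel_fps_mult[OF slot_rel_L, of "L v b * L w e" a] by (simp add: L3_def mult_ac)
    show "slot_rel (\<lambda>c f. fps_const c * f) {0} (\<lambda>v. L3 a b e (u, v, w))" for u w
      using slot_rel_fps_mult[OF slot_rel_L, of "L u a * L w e" b] by (simp add: L3_def mult_ac)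
    show "slot_rel (\<lambda>c f. fps_const c * f) {0} (\<lambda>w. L3 a b e (u, v, w))" for u v
      using slot_rel_fps_mult[OF slot_rel_L, of "L u a * L v b" e] by (simp add: L3_def mult_ac)
  qed
  then show ?thesis by simp
qed

text \<open>The uniqueness of a series represented by its pairing. Earlier members are null and
  hence invisible to the full pairing by \<open>null3_L3\<close>, so the first remaining coefficient
  is the pairing of \<open>D n\<close> at t = 0.\<close>

lemma null3_series:
  assumes keys: "\<And>n. Poly_Mapping.keys (D n) \<subseteq> W \<times> W \<times> W"
    and dvd: "\<And>n a b e. a \<in> W \<Longrightarrow> b \<in> W \<Longrightarrow> e \<in> W \<Longrightarrow>
      fps_X ^ Suc n dvd (\<Sum>q\<le>n. fps_X ^ q * lcf (L3 a b e) (D q))"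
  shows "null3 (D n)"
proof (induction n rule: less_induct)
  case (less n)
  have "lc (*) (\<lambda>(u, v, w). P u a * P v b * P w e) (D n) = 0" if "a \<in> W" "b \<in> W" "e \<in> W" for a b e
  proof -
    have "(\<Sum>q\<le>n. fps_X ^ q * lcf (L3 a b e) (D q)) = fps_X ^ n * lcf (L3 a b e) (D n)"
      using less by (subst sum.remove[of _ n]) (auto intro!: sum.neutral simp: null3_L3)
    with dvd[OF that, of n] have "fps_nth (fps_X ^ n * lcf (L3 a b e) (D n)) n = 0"
      unfolding fps_X_power_dvd_iff by simp
    then have "fps_nth (lcf (L3 a b e) (D n)) 0 = 0" by (simp add: fps_X_power_mult_nth)
    then show ?thesis
      by (simp add: fps_nth_lc L3_def case_prod_unfold L_nth_0)
  qed
  then show ?case using keys by (simp add: null3_def)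
qed

subsection \<open>The twist\<close>

text \<open>Each derivation shortens words by at most one letter, on top of the bound for
  \<open>lam\<close>.\<close>

lemma L_bound: "length u + 2 * k < length a \<Longrightarrow> fps_nth (L u a) k = 0"
proof (induction u arbitrary: a)
  case Nil
  then show ?case by (simp add: lam_bound)
next
  case (Cons x u)
  have "fps_nth (L (x # u) a) k = act d C x (\<lambda>w. fps_nth (L u w) k) a"
    by (simp add: L_def fps_nth_act)
  also have "\<dots> = 0"
    by (rule act_vanish[of "length u + 2 * k"]) (use Cons in auto)
  finally show ?case .
qed

definition pair2 :: "nat list \<Rightarrow> nat list \<Rightarrow> (nat list \<times> nat list \<Rightarrow>\<^sub>0 'k) \<Rightarrow> 'k fps" where
  "pair2 a b p = lcf (\<lambda>(u, v). L u a * L v b) p"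

definition rest :: "(nat \<Rightarrow> nat list \<times> nat list \<Rightarrow>\<^sub>0 'k) \<Rightarrow> nat \<Rightarrow> nat list \<Rightarrow> nat list \<Rightarrow> 'k fps" where
  "rest f n a b = lam (a @ b) - (\<Sum>m<n. fps_X ^ m * pair2 a b (f m))"

text \<open>Only sorted words are prescribed, since there the dual elements solve for
  \<open>r\<close> directly; \<open>rest_vanish\<close> spreads the conclusion to all words.\<close>

definition twist_step :: "(nat \<Rightarrow> nat list \<times> nat list \<Rightarrow>\<^sub>0 'k) \<Rightarrow> nat \<Rightarrow> (nat list \<times> nat list \<Rightarrow>\<^sub>0 'k) \<Rightarrow> bool" where
  "twist_step f n r \<longleftrightarrow> Poly_Mapping.keys r \<subseteq> W \<times> W \<and>
     (\<forall>a\<in>W. \<forall>b\<in>W. sorted a \<longrightarrow> sorted b \<longrightarrow>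
        lc (*) (\<lambda>(u, v). P u a * P v b) r = fps_nth (rest f n a b) n)"

text \<open>Makes the next coefficient of the twist a finite tensor instead of an infinite sum of
  dual elements.\<close>

lemma rest_bounded: "\<exists>B. \<forall>a b. length a > B \<or> length b > B \<longrightarrow> fps_nth (rest f n a b) n = 0"
proof -
  define Z where "Z = (\<Union>m<n. Poly_Mapping.keys (f m))"
  \<comment> \<open>The lengths in the earlier coefficients plus twice the order, so that both
    \<open>lam_bound\<close> and \<open>L_bound\<close> apply.\<close>
  define B where "B = Max (insert 0 ((\<lambda>(u, v). length u + length v) ` Z)) + 2 * n"
  have Z: "length u + length v + 2 * n \<le> B" if "(u, v) \<in> Poly_Mapping.keys (f m)" "m < n" for u v m
    unfolding B_def Z_def using that by (intro add_mono Max_ge) force+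
  have "fps_nth (rest f n a b) n = 0" if ab: "length a > B \<or> length b > B" for a b
  proof -
    have "fps_nth (lam (a @ b)) n = 0"
      using ab by (intro lam_bound) (auto simp: B_def)
    moreover have "fps_nth (fps_X ^ m * pair2 a b (f m)) n = 0" if "m < n" for m
    proof -
      have "fps_nth (L u a * L v b) (n - m) = 0" if "(u, v) \<in> Poly_Mapping.keys (f m)" for u v
        unfolding fps_mult_nth
      proof (rule sum.neutral, rule ballI)
        fix i assume "i \<in> {0..n - m}"
        then have i: "i \<le> n" "n - m - i \<le> n" by auto
        show "fps_nth (L u a) i * fps_nth (L v b) (n - m - i) = 0"
          using ab Z[OF that \<open>m < n\<close>] i L_bound[of u i a] L_bound[of v "n - m - i" b] by fastforce
      qed
      then show ?thesis using \<open>m < n\<close>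
        by (simp add: fps_X_power_mult_nth pair2_def fps_nth_lc) (auto simp: lc_def intro!: sum.neutral)
    qed
    ultimately show ?thesis by (simp add: rest_def fps_sum_nth)
  qed
  then show ?thesis by blast
qed

lemma twist_step_exists: "\<exists>r. twist_step f n r"
proof -
  obtain B where B: "\<And>a b. length a > B \<or> length b > B \<Longrightarrow> fps_nth (rest f n a b) n = 0"
    using rest_bounded by blast
  let ?g = "\<lambda>a b. fps_nth (rest f n a b) n"
  \<comment> \<open>Interpolation: tensors of dual elements weighted by the values to be
    attained.\<close>
  define r where "r = (\<Sum>\<alpha>\<in>SW B. \<Sum>\<beta>\<in>SW B. pm_scale (?g \<alpha> \<beta>)
     (bil (\<lambda>u v. Poly_Mapping.single (u, v) 1) (dual \<alpha>) (dual \<beta>)))"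
  have "Poly_Mapping.keys r \<subseteq> W \<times> W"
    unfolding r_def
  proof (intro keys_sum_subset order_trans[OF keys_pm_scale] keys_bil)
    fix \<alpha> \<beta> u v
    assume "\<alpha> \<in> SW B" "\<beta> \<in> SW B" "u \<in> Poly_Mapping.keys (dual \<alpha>)" "v \<in> Poly_Mapping.keys (dual \<beta>)"
    then have "u \<in> W" "v \<in> W" using keys_dual[of \<alpha>] keys_dual[of \<beta>] by (auto simp only: SW_def)
    then show "Poly_Mapping.keys (Poly_Mapping.single (u, v) (1::'k)) \<subseteq> W \<times> W" by simp
  qed
  moreover have "lc (*) (\<lambda>(u, v). P u a * P v b) r = ?g a b"
    if ab: "a \<in> W" "b \<in> W" "sorted a" "sorted b" for a b
  proof -
    have 1: "lc (*) (\<lambda>x. lc (*) (\<lambda>y. P x a * P y b) q) p = lc (*) (\<lambda>x. P x a) p * lc (*) (\<lambda>y. P y b) q" for p q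
    proof -
      have "lc (*) (\<lambda>x. lc (*) (\<lambda>y. P x a * P y b) q) p = lc (*) (\<lambda>x. lc (*) (\<lambda>y. P y b) q * P x a) p"
        by (simp only: fld.lc_scale_fun mult.commute)
      also have "\<dots> = lc (*) (\<lambda>y. P y b) q * lc (*) (\<lambda>x. P x a) p" by (rule fld.lc_scale_fun)
      finally show ?thesis by (simp only: mult.commute)
    qed
    have "lc (*) (\<lambda>(u, v). P u a * P v b) r =
      (\<Sum>\<alpha>\<in>SW B. \<Sum>\<beta>\<in>SW B. ?g \<alpha> \<beta> * (lc (*) (\<lambda>x. P x a) (dual \<alpha>) * lc (*) (\<lambda>y. P y b) (dual \<beta>)))"
      by (simp add: r_def fld.lc_sum fld.lc_scale fld.lc_bil 1)
    also have "\<dots> = (\<Sum>\<alpha>\<in>SW B. \<Sum>\<beta>\<in>SW B. if \<beta> = b then (if \<alpha> = a then ?g a b else 0) else 0)"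
      by (intro sum.cong refl) (use ab in \<open>auto simp: P_dual SW_def\<close>)
    also have "\<dots> = (if b \<in> SW B then if a \<in> SW B then ?g a b else 0 else 0)"
      by (simp add: finite_SW)
    also have "\<dots> = ?g a b" using ab B[of a b] by (auto simp: SW_def)
    finally show ?thesis .
  qed
  ultimately show ?thesis unfolding twist_step_def by blast
qed

lemma twist_exists: "\<exists>f. \<forall>n. twist_step f n (f n)"
proof (rule dependent_wellorder_choice)
  fix r :: "nat list \<times> nat list \<Rightarrow>\<^sub>0 'k" and f g :: "nat \<Rightarrow> nat list \<times> nat list \<Rightarrow>\<^sub>0 'k" and n :: nat
  assume "\<And>m. m < n \<Longrightarrow> f m = g m"
  then show "twist_step f n r = twist_step g n r" by (simp add: twist_step_def rest_def)
qed (rule twist_step_exists)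

definition F :: "nat \<Rightarrow> nat list \<times> nat list \<Rightarrow>\<^sub>0 'k" where
  "F = (SOME f. \<forall>n. twist_step f n (f n))"

lemma twist_step_F: "twist_step F n (F n)"
  unfolding F_def using someI_ex[OF twist_exists] by blast

lemma keys_F: "Poly_Mapping.keys (F n) \<subseteq> W \<times> W"
  using twist_step_F by (simp add: twist_step_def)

lemma rest_Suc: "rest F (Suc n) a b = rest F n a b - fps_X ^ n * pair2 a b (F n)"
  by (simp add: rest_def)

lemma lcf_rel:
  assumes "\<And>x. E x = E1 x + (\<Sum>l<d. g l * E2 l x) + h * E3 x"
  shows "lcf E p = lcf E1 p + (\<Sum>l<d. g l * lcf (E2 l) p) + h * lcf E3 p"
proof -
  have "lcf E p = lcf (\<lambda>x. E1 x + (\<Sum>l<d. g l * E2 l x) + h * E3 x) p"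
    by (rule fps.lc_cong) (rule assms)
  also have "\<dots> = lcf E1 p + (\<Sum>l<d. g l * lcf (E2 l) p) + h * lcf E3 p"
    by (simp only: fps.lc_add_fun fps.lc_sum_fun lc_mult_fps)
  finally show ?thesis .
qed

lemma pair2_rel:
  "pair2 (u @ i # j # v) b p = pair2 (u @ j # i # v) b p + (\<Sum>l<d. GF i j l * pair2 (u @ l # v) b p) + RF i j * pair2 (u @ v) b p"
  "pair2 b (u @ i # j # v) p = pair2 b (u @ j # i # v) p + (\<Sum>l<d. GF i j l * pair2 b (u @ l # v) p) + RF i j * pair2 b (u @ v) p"
proof -
  have 1: "(x + (\<Sum>l<d. g l * y l) + h * z) * r = x * r + (\<Sum>l<d. g l * (y l * r)) + h * (z * r)"
    for x r h z :: "'k fps" and g y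
    by (simp only: distrib_right sum_distrib_right mult.assoc)
  have 2: "r * (x + (\<Sum>l<d. g l * y l) + h * z) = r * x + (\<Sum>l<d. g l * (r * y l)) + h * (r * z)"
    for x r h z :: "'k fps" and g y
    by (simp only: distrib_left sum_distrib_left mult.left_commute[of r])
  show "pair2 (u @ i # j # v) b p = pair2 (u @ j # i # v) b p + (\<Sum>l<d. GF i j l * pair2 (u @ l # v) b p) + RF i j * pair2 (u @ v) b p"
    unfolding pair2_def case_prod_unfold by (rule lcf_rel, subst L_rel[of _ u i j v], rule 1)
  show "pair2 b (u @ i # j # v) p = pair2 b (u @ j # i # v) p + (\<Sum>l<d. GF i j l * pair2 b (u @ l # v) p) + RF i j * pair2 b (u @ v) p"
    unfolding pair2_def case_prod_unfold by (rule lcf_rel, subst L_rel[of _ u i j v], rule 2)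
qed

lemma rel_diff:
  fixes x :: "'k fps"
  assumes "a = a1 + (\<Sum>l<d. g l * a2 l) + h * a3" "b = b1 + (\<Sum>l<d. g l * b2 l) + h * b3"
  shows "a - x * b = (a1 - x * b1) + (\<Sum>l<d. g l * (a2 l - x * b2 l)) + h * (a3 - x * b3)"
proof -
  have "(\<Sum>l<d. g l * (a2 l - x * b2 l)) = (\<Sum>l<d. g l * a2 l) - x * (\<Sum>l<d. g l * b2 l)"
    by (simp add: sum_distrib_left right_diff_distrib sum_subtractf mult_ac)
  then show ?thesis unfolding assms by (simp add: algebra_simps)
qed

text \<open>\<open>lam\<close> of a concatenation and the pairings \<open>L\<close> obey the
  relations between the x in either argument, and these relations are linear.\<close>

lemma rest_rel:
  "rest F n (u @ i # j # v) b = rest F n (u @ j # i # v) b + (\<Sum>l<d. GF i j l * rest F n (u @ l # v) b) + RF i j * rest F n (u @ v) b"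
  "rest F n b (u @ i # j # v) = rest F n b (u @ j # i # v) + (\<Sum>l<d. GF i j l * rest F n b (u @ l # v)) + RF i j * rest F n b (u @ v)"
proof (induction n)
  case 0
  {
    case 1
    then show ?case using str.lam_rel[of u i j "v @ b"] by (simp only: rest_def) simp
  next
    case 2
    then show ?case using str.lam_rel[of "b @ u" i j v] by (simp only: rest_def) simp
  }
next
  case (Suc n)
  {
    case 1
    then show ?case unfolding rest_Suc by (rule rel_diff[OF Suc(1) pair2_rel(1)])
  next
    case 2
    then show ?case unfolding rest_Suc by (rule rel_diff[OF Suc(2) pair2_rel(2)])
  }
qed

text \<open>Below order \<open>n\<close> this is the induction hypothesis; at order \<open>n\<close>
  the chosen coefficient settles sorted words. A swap in either argument costs corrections with a
  factor t, which see only lower orders, so the vanishing spreads to all words.\<close>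

lemma rest_vanish: "a \<in> W \<Longrightarrow> b \<in> W \<Longrightarrow> fps_X ^ n dvd rest F n a b"
proof (induction n arbitrary: a b)
  case (Suc n)
  have low: "fps_nth (rest F (Suc n) a b) k = 0" if "k < n" "a \<in> W" "b \<in> W" for k a b
    using Suc.IH[OF that(2,3)] that(1) by (simp add: fps_X_power_dvd_iff rest_Suc fps_X_power_mult_nth)
  define Q where "Q a b \<longleftrightarrow> fps_nth (rest F (Suc n) a b) n = 0" for a b
  have sorted: "Q a b" if "a \<in> W" "b \<in> W" "sorted a" "sorted b" for a b
  proof -
    have "lc (*) (\<lambda>(u, v). P u a * P v b) (F n) = fps_nth (rest F n a b) n"
      using twist_step_F[of n] that by (auto simp: twist_step_def)
    then show ?thesis
      by (simp add: Q_def rest_Suc fps_X_power_mult_nth pair2_def fps_nth_lc case_prod_unfold L_nth_0)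
  qed
  have corr1: "fps_nth (\<Sum>l<d. GF i j l * g l) n = 0"
    if "\<And>l k. l < d \<Longrightarrow> k < n \<Longrightarrow> fps_nth (g l) k = 0" for i j g
    using that by (cases n) (simp_all add: GF_def fps_sum_nth mult.assoc)
  have corr2: "fps_nth (RF i j * h) n = 0" if "\<And>k. k < n \<Longrightarrow> fps_nth h k = 0" for i j h
    using that by (cases n) (simp_all add: RF_def fps_sum_nth mult.assoc)
  have swap1: "Q (u @ j # i # v) b" if "set (u @ i # j # v) \<subseteq> {..<d}" "b \<in> W" "Q (u @ i # j # v) b" for u i j v b
  proof -
    have W: "u @ v \<in> W" "\<And>l. l < d \<Longrightarrow> u @ l # v \<in> W" using that(1) by auto
    show ?thesis using that(3) corr1[OF low[OF _ W(2) that(2)]] corr2[OF low[OF _ W(1) that(2)]]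
      unfolding Q_def rest_rel(1)[of _ u i j v] by (simp only: fps_add_nth add_0_right)
  qed
  have swap2: "Q b (u @ j # i # v)" if "set (u @ i # j # v) \<subseteq> {..<d}" "b \<in> W" "Q b (u @ i # j # v)" for u i j v b
  proof -
    have W: "u @ v \<in> W" "\<And>l. l < d \<Longrightarrow> u @ l # v \<in> W" using that(1) by auto
    show ?thesis using that(3) corr1[OF low[OF _ that(2) W(2)]] corr2[OF low[OF _ that(2) W(1)]]
      unfolding Q_def rest_rel(2)[of _ _ u i j v] by (simp only: fps_add_nth add_0_right)
  qed
  have ab: "set (sort a) \<subseteq> {..<d}" "set (sort b) \<subseteq> {..<d}" "sort a \<in> W" "sort b \<in> W"
    using Suc.prems by auto
  \<comment> \<open>First \<open>a\<close> is unsorted while \<open>sort b\<close> stays fixed, then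
    \<open>b\<close>.\<close>
  have "Q a (sort b)"
  proof (rule swap_closed_mset[of "{..<d}" "\<lambda>a. Q a (sort b)" "sort a" a])
    show "Q (sort a) (sort b)" by (intro sorted ab sorted_sort)
  qed (use ab(1) in \<open>simp_all only: mset_sort\<close>, rule swap1[OF _ ab(4)])
  have Q: "Q a b"
    using \<open>Q a (sort b)\<close>
    by (intro swap_closed_mset[where Q = "\<lambda>b. Q a b" and w = "sort b", OF swap2[OF _ Suc.prems(1)] mset_sort ab(2)])
  show ?case unfolding fps_X_power_dvd_iff
  proof (intro allI impI)
    fix i assume "i < Suc n"
    then show "fps_nth (rest F (Suc n) a b) i = 0"
      using low[OF _ Suc.prems, of i] Q by (cases "i = n") (simp_all add: Q_def)
  qed
qed simp

end

lemma (in vector_space) lc_lc: "lc scale E (lc pm_scale h p) = lc scale (\<lambda>x. lc scale E (h x)) p"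
  by (simp only: lc_def[of pm_scale h p] lc_sum lc_scale) (rule lc_def[symmetric])

lemma keys_sum_list_subset:
  "(\<And>i. i \<in> set is \<Longrightarrow> Poly_Mapping.keys (f i) \<subseteq> A) \<Longrightarrow> Poly_Mapping.keys (\<Sum>i\<leftarrow>is. f i) \<subseteq> A"
proof (induction "is")
  case (Cons i "is")
  then show ?case using Poly_Mapping.keys_add[of "f i" "\<Sum>i\<leftarrow>is. f i"] by fastforce
qed simp

lemma keys_diff_subset:
  "Poly_Mapping.keys p \<subseteq> A \<Longrightarrow> Poly_Mapping.keys q \<subseteq> A \<Longrightarrow> Poly_Mapping.keys (p - q) \<subseteq> A"
  using keys_diff[of p q] by auto

lemma keys_lc_subset:
  assumes "\<And>x. x \<in> Poly_Mapping.keys p \<Longrightarrow> Poly_Mapping.keys (h x) \<subseteq> A"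
  shows "Poly_Mapping.keys (lc pm_scale h p) \<subseteq> A"
  unfolding lc_def by (intro keys_sum_subset order_trans[OF keys_pm_scale] assms)

section \<open>Two expansions of a triple product\<close>

context twist_data begin

lemma lcf_dvd: "(\<And>x. x \<in> Poly_Mapping.keys D \<Longrightarrow> p dvd E x) \<Longrightarrow> p dvd lcf E D"
  unfolding lc_def by (intro dvd_sum dvd_mult)

text \<open>Regrouping by total degree; the terms left over have degree at least
  \<open>n\<close>.\<close>

lemma double_series_truncate:
  fixes T :: "nat \<Rightarrow> nat \<Rightarrow> 'k fps"
  shows "fps_X ^ n dvd (\<Sum>m<n. fps_X ^ m * (\<Sum>m'<n. fps_X ^ m' * T m m')) - (\<Sum>q<n. fps_X ^ q * (\<Sum>i\<le>q. T i (q - i)))"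
proof -
  let ?g = "\<lambda>(m, m'). fps_X ^ (m + m') * T m m'"
  have "(\<Sum>m<n. fps_X ^ m * (\<Sum>m'<n. fps_X ^ m' * T m m')) = sum ?g ({..<n} \<times> {..<n})"
    by (simp add: sum_distrib_left power_add mult.assoc sum.cartesian_product)
  also have "\<dots> = sum ?g {(m, m'). m + m' < n} + sum ?g ({..<n} \<times> {..<n} - {(m, m'). m + m' < n})"
    by (subst add.commute, rule sum.subset_diff) auto
  also have "sum ?g {(m, m'). m + m' < n} = (\<Sum>q<n. \<Sum>i\<le>q. fps_X ^ (i + (q - i)) * T i (q - i))"
    by (rule sum.triangle_reindex)
  also have "\<dots> = (\<Sum>q<n. fps_X ^ q * (\<Sum>i\<le>q. T i (q - i)))"
    by (simp add: sum_distrib_left)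
  finally have "(\<Sum>m<n. fps_X ^ m * (\<Sum>m'<n. fps_X ^ m' * T m m')) - (\<Sum>q<n. fps_X ^ q * (\<Sum>i\<le>q. T i (q - i)))
     = sum ?g ({..<n} \<times> {..<n} - {(m, m'). m + m' < n})"
    by simp
  moreover have "fps_X ^ n dvd sum ?g ({..<n} \<times> {..<n} - {(m, m'). m + m' < n})"
    by (rule dvd_sum) (auto intro!: dvd_mult2 le_imp_power_dvd)
  ultimately show ?thesis by simp
qed

text \<open>The product formula for \<open>lam\<close>, transported along the action of
  \<open>v\<close> by \<open>acts_append_dvd\<close>. This is how the coproduct enters the twist
  equation.\<close>

lemma L_append:
  assumes "a \<in> W" "b \<in> W"
  shows "fps_X ^ n dvd L v (a @ b) - (\<Sum>m<n. fps_X ^ m *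
    lcf (\<lambda>(x, y). \<Sum>(v1, v2)\<leftarrow>splits v. L (v1 @ x) a * L (v2 @ y) b) (F m))"
proof -
  \<comment> \<open>Indexes the terms of the truncated twist by their order together with a pair of
    words.\<close>
  let ?Q = "SIGMA m:{..<n}. Poly_Mapping.keys (F m)"
  let ?r = "\<lambda>(m, x). fps_X ^ m * fps_const (Poly_Mapping.lookup (F m) x)"
  have acts: "acts d CF v (L x) a = L (v @ x) a" for v x a
    by (simp add: L_def[abs_def])
  have Q: "(\<Sum>q\<in>?Q. ?r q * E (snd q)) = (\<Sum>m<n. fps_X ^ m * lcf E (F m))" for E :: "_ \<Rightarrow> 'k fps"
  proof -
    have "(\<Sum>m<n. fps_X ^ m * lcf E (F m)) =
        (\<Sum>m<n. \<Sum>x\<in>Poly_Mapping.keys (F m). ?r (m, x) * E x)"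
      by (simp add: lc_def sum_distrib_left mult.assoc)
    also have "\<dots> = (\<Sum>q\<in>?Q. ?r q * E (snd q))"
      by (subst sum.Sigma) (auto simp: case_prod_unfold)
    finally show ?thesis ..
  qed
  have "fps_X ^ n dvd acts d CF v lam (a @ b) - (\<Sum>q\<in>?Q. ?r q *
     (\<Sum>(v1, v2)\<leftarrow>splits v. acts d CF v1 (L (fst (snd q))) a * acts d CF v2 (L (snd (snd q))) b))"
  proof (rule acts_append_dvd[OF _ assms])
    fix a b assume "a \<in> W" "b \<in> W"
    then have "fps_X ^ n dvd rest F n a b" by (rule rest_vanish)
    also have "rest F n a b = lam (a @ b) - (\<Sum>q\<in>?Q. ?r q * (L (fst (snd q)) a * L (snd (snd q)) b))"
      unfolding rest_def pair2_def case_prod_unfold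
      by (subst Q[of "\<lambda>x. L (fst x) a * L (snd x) b", unfolded case_prod_unfold, symmetric]) (rule refl)
    finally show "fps_X ^ n dvd lam (a @ b) - (\<Sum>q\<in>?Q. ?r q * (L (fst (snd q)) a * L (snd (snd q)) b))" .
  qed
  then show ?thesis
    unfolding acts Q[of "\<lambda>x. \<Sum>(v1, v2)\<leftarrow>splits v. L (v1 @ fst x) a * L (v2 @ snd x) b"]
    by (simp add: L_def case_prod_unfold)
qed

text \<open>The product of (\<Delta> \<otimes> id)(u \<otimes> v) with x \<otimes> y \<otimes> 1,
  written on words; \<open>\<sigma>R\<close> is that of (id \<otimes> \<Delta>)(u \<otimes> v) with
  1 \<otimes> x \<otimes> y.\<close>

definition \<sigma>L :: "nat list \<times> nat list \<Rightarrow> nat list \<times> nat list \<Rightarrow> (nat list \<times> nat list \<times> nat list \<Rightarrow>\<^sub>0 'k)" where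
  "\<sigma>L = (\<lambda>(u, v) (x, y). \<Sum>(u1, u2)\<leftarrow>splits u. Poly_Mapping.single (u1 @ x, u2 @ y, v) 1)"

definition \<sigma>R :: "nat list \<times> nat list \<Rightarrow> nat list \<times> nat list \<Rightarrow> (nat list \<times> nat list \<times> nat list \<Rightarrow>\<^sub>0 'k)" where
  "\<sigma>R = (\<lambda>(u, v) (x, y). \<Sum>(v1, v2)\<leftarrow>splits v. Poly_Mapping.single (u, v1 @ x, v2 @ y) 1)"

lemma keys_\<sigma>:
  assumes "x \<in> W \<times> W" "y \<in> W \<times> W"
  shows "Poly_Mapping.keys (\<sigma>L x y) \<subseteq> W \<times> W \<times> W" "Poly_Mapping.keys (\<sigma>R x y) \<subseteq> W \<times> W \<times> W"
proof -
  have sp: "set (fst i) \<subseteq> set u \<and> set (snd i) \<subseteq> set u" if "i \<in> set (splits u)" for i and u :: "nat list"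
    using that by (intro set_splits) simp
  have W: "set (fst x) \<subseteq> {..<d}" "set (snd x) \<subseteq> {..<d}" "set (fst y) \<subseteq> {..<d}" "set (snd y) \<subseteq> {..<d}"
    using assms by auto
  show "Poly_Mapping.keys (\<sigma>L x y) \<subseteq> W \<times> W \<times> W"
    unfolding \<sigma>L_def case_prod_unfold
  proof (rule keys_sum_list_subset)
    fix i assume "i \<in> set (splits (fst x))"
    then show "Poly_Mapping.keys (Poly_Mapping.single (fst i @ fst y, snd i @ snd y, snd x) (1::'k)) \<subseteq> W \<times> W \<times> W"
      using sp[of i "fst x"] W by auto
  qed
  show "Poly_Mapping.keys (\<sigma>R x y) \<subseteq> W \<times> W \<times> W"
    unfolding \<sigma>R_def case_prod_unfold
  proof (rule keys_sum_list_subset)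
    fix i assume "i \<in> set (splits (snd x))"
    then show "Poly_Mapping.keys (Poly_Mapping.single (fst x, fst i @ fst y, snd i @ snd y) (1::'k)) \<subseteq> W \<times> W \<times> W"
      using sp[of i "snd x"] W by auto
  qed
qed

lemma lcf_\<sigma>L: "lcf (L3 a b e) (\<sigma>L x y) = L (snd x) e * (\<Sum>(v1, v2)\<leftarrow>splits (fst x). L (v1 @ fst y) a * L (v2 @ snd y) b)"
  by (subst mult.commute[of "L (snd x) e"])
    (simp add: \<sigma>L_def fps.lc_sum_list case_prod_unfold L3_def sum_list_mult_const)

lemma lcf_\<sigma>R: "lcf (L3 a b e) (\<sigma>R x y) = L (fst x) a * (\<Sum>(v1, v2)\<leftarrow>splits (snd x). L (v1 @ fst y) b * L (v2 @ snd y) e)"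
  by (simp add: \<sigma>R_def fps.lc_sum_list case_prod_unfold L3_def sum_list_const_mult mult.assoc)

text \<open>With \<open>twR\<close>, the coefficients of t^n on the two sides of the twist equation,
  before passing to U(g).\<close>

definition twL where "twL n = (\<Sum>i\<le>n. bil \<sigma>L (F i) (F (n - i)))"
definition twR where "twR n = (\<Sum>i\<le>n. bil \<sigma>R (F i) (F (n - i)))"

text \<open>The step common to both bracketings of a triple product: expand the outer product,
  expand the resulting pairings by \<open>H\<close>, and collect equal powers of t.\<close>

lemma lam_append_series:
  assumes "a \<in> W" "b \<in> W"
    and H: "\<And>x. x \<in> W \<times> W \<Longrightarrow> fps_X ^ n dvd L (fst x) a * L (snd x) b - (\<Sum>m<n. fps_X ^ m * lcf (K x) (F m))"
    and lc: "\<And>x m. lcf (K x) (F m) = lcf (\<lambda>y. lcf E (\<sigma> x y)) (F m)"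
  shows "fps_X ^ n dvd lam (a @ b) - (\<Sum>q<n. fps_X ^ q * lcf E (\<Sum>i\<le>q. bil \<sigma> (F i) (F (q - i))))"
proof -
  let ?S = "\<lambda>x. \<Sum>m<n. fps_X ^ m * lcf (K x) (F m)"
  have 1: "fps_X ^ n dvd lam (a @ b) - (\<Sum>m<n. fps_X ^ m * lcf (\<lambda>x. L (fst x) a * L (snd x) b) (F m))"
    using rest_vanish[OF assms(1,2), of n] by (simp add: rest_def pair2_def case_prod_unfold)
  have "fps_X ^ n dvd (\<Sum>m<n. fps_X ^ m * lcf (\<lambda>x. L (fst x) a * L (snd x) b - ?S x) (F m))"
    by (intro dvd_sum dvd_mult lcf_dvd H) (use keys_F in blast)
  then have 2: "fps_X ^ n dvd (\<Sum>m<n. fps_X ^ m * lcf (\<lambda>x. L (fst x) a * L (snd x) b) (F m))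
      - (\<Sum>m<n. fps_X ^ m * lcf ?S (F m))"
    by (simp only: fps.lc_diff_fun right_diff_distrib sum_subtractf)
  have "lcf ?S (F m) = (\<Sum>m'<n. fps_X ^ m' * lcf E (bil \<sigma> (F m) (F m')))" for m
    by (simp only: fps.lc_sum_fun lc_mult_fps lc fps.lc_bil)
  with 2 have 2: "fps_X ^ n dvd (\<Sum>m<n. fps_X ^ m * lcf (\<lambda>x. L (fst x) a * L (snd x) b) (F m))
      - (\<Sum>m<n. fps_X ^ m * (\<Sum>m'<n. fps_X ^ m' * lcf E (bil \<sigma> (F m) (F m'))))"
    by (simp only:)
  have 3: "fps_X ^ n dvd (\<Sum>m<n. fps_X ^ m * (\<Sum>m'<n. fps_X ^ m' * lcf E (bil \<sigma> (F m) (F m'))))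
      - (\<Sum>q<n. fps_X ^ q * lcf E (\<Sum>i\<le>q. bil \<sigma> (F i) (F (q - i))))"
    unfolding fps.lc_sum by (rule double_series_truncate)
  from dvd_add[OF dvd_add[OF 1 2] 3] show ?thesis by simp
qed

lemma lam_twL:
  assumes "a \<in> W" "b \<in> W" "e \<in> W"
  shows "fps_X ^ n dvd lam (a @ b @ e) - (\<Sum>q<n. fps_X ^ q * lcf (L3 a b e) (twL q))"
proof -
  \<comment> \<open>The bracketing (a b) e, in which the first factor is expanded further;
    \<open>lam_twR\<close> uses a (b e).\<close>
  have "fps_X ^ n dvd lam ((a @ b) @ e) - (\<Sum>q<n. fps_X ^ q * lcf (L3 a b e) (\<Sum>i\<le>q. bil \<sigma>L (F i) (F (q - i))))"
  proof (rule lam_append_series)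
    fix x :: "nat list \<times> nat list"
    have "fps_X ^ n dvd L (snd x) e * (L (fst x) (a @ b) - (\<Sum>m<n. fps_X ^ m *
        lcf (\<lambda>(u, v). \<Sum>(v1, v2)\<leftarrow>splits (fst x). L (v1 @ u) a * L (v2 @ v) b) (F m)))"
      by (rule dvd_mult) (rule L_append[OF assms(1,2)])
    then show "fps_X ^ n dvd L (fst x) (a @ b) * L (snd x) e - (\<Sum>m<n. fps_X ^ m * lcf (\<lambda>y. lcf (L3 a b e) (\<sigma>L x y)) (F m))"
      unfolding lcf_\<sigma>L mult.commute[of "L (fst x) (a @ b)" "L (snd x) e"] lc_mult_fps
      by (simp only: right_diff_distrib sum_distrib_left mult.left_commute[of "fps_X ^ _" "L (snd x) e"] case_prod_unfold)
  qed (use assms in auto)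
  then show ?thesis by (simp add: twL_def)
qed

lemma lam_twR:
  assumes "a \<in> W" "b \<in> W" "e \<in> W"
  shows "fps_X ^ n dvd lam (a @ b @ e) - (\<Sum>q<n. fps_X ^ q * lcf (L3 a b e) (twR q))"
  unfolding twR_def
proof (rule lam_append_series)
  fix x :: "nat list \<times> nat list"
  have "fps_X ^ n dvd L (fst x) a * (L (snd x) (b @ e) - (\<Sum>m<n. fps_X ^ m *
      lcf (\<lambda>(u, v). \<Sum>(v1, v2)\<leftarrow>splits (snd x). L (v1 @ u) b * L (v2 @ v) e) (F m)))"
    by (rule dvd_mult) (rule L_append[OF assms(2,3)])
  then show "fps_X ^ n dvd L (fst x) a * L (snd x) (b @ e) - (\<Sum>m<n. fps_X ^ m * lcf (\<lambda>y. lcf (L3 a b e) (\<sigma>R x y)) (F m))"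
    unfolding lcf_\<sigma>R lc_mult_fps
    by (simp only: right_diff_distrib sum_distrib_left mult.left_commute[of "fps_X ^ _" "L (fst x) a"] case_prod_unfold)
qed (use assms in auto)

lemma keys_tw: "Poly_Mapping.keys (twL n) \<subseteq> W \<times> W \<times> W" "Poly_Mapping.keys (twR n) \<subseteq> W \<times> W \<times> W"
proof -
  have "Poly_Mapping.keys (bil \<sigma>L (F i) (F j)) \<subseteq> W \<times> W \<times> W" for i j
    by (rule keys_bil, rule keys_\<sigma>(1)) (erule subsetD[OF keys_F])+
  then show "Poly_Mapping.keys (twL n) \<subseteq> W \<times> W \<times> W"
    unfolding twL_def by (rule keys_sum_subset)
  have "Poly_Mapping.keys (bil \<sigma>R (F i) (F j)) \<subseteq> W \<times> W \<times> W" for i j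
    by (rule keys_bil, rule keys_\<sigma>(2)) (erule subsetD[OF keys_F])+
  then show "Poly_Mapping.keys (twR n) \<subseteq> W \<times> W \<times> W"
    unfolding twR_def by (rule keys_sum_subset)
qed

theorem twist_equation: "null3 (twL n - twR n)"
proof (rule null3_series)
  fix n a b e assume *: "a \<in> W" "b \<in> W" "e \<in> W"
  from dvd_diff[OF lam_twR[OF *, of "Suc n"] lam_twL[OF *, of "Suc n"]]
  show "fps_X ^ Suc n dvd (\<Sum>q\<le>n. fps_X ^ q * lcf (L3 a b e) (twL q - twR q))"
    by (simp add: fps.lc_diff right_diff_distrib sum_subtractf lessThan_Suc_atMost del: sum.lessThan_Suc)
qed (intro keys_diff_subset keys_tw)

section \<open>Counit conditions and terms of order zero and one\<close>

lemma lcf_lc: "lcf E (lc pm_scale h p) = lcf (\<lambda>x. lcf E (h x)) p"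
  by (rule fps.lc_lc)

text \<open>The defect of a counit condition, placed in the third slot of a triple with empty words
  in the others, so that \<open>null3\<close> serves for single words too.\<close>

definition counitL :: "nat \<Rightarrow> nat list \<times> nat list \<times> nat list \<Rightarrow>\<^sub>0 'k" where
  "counitL n = lc pm_scale (\<lambda>(u, v). if u = [] then Poly_Mapping.single ([], [], v) 1 else 0) (F n)
     - (if n = 0 then Poly_Mapping.single ([], [], []) 1 else 0)"

definition counitR :: "nat \<Rightarrow> nat list \<times> nat list \<times> nat list \<Rightarrow>\<^sub>0 'k" where
  "counitR n = lc pm_scale (\<lambda>(u, v). if v = [] then Poly_Mapping.single ([], [], u) 1 else 0) (F n)
     - (if n = 0 then Poly_Mapping.single ([], [], []) 1 else 0)"

text \<open>\<open>K\<close> is the pairing in which one argument of the product is the empty word.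
  The product formula then expands \<open>lam e\<close> itself, and in the two applications
  \<open>L_at_Nil\<close> reduces one tensor factor to its counit.\<close>

lemma counit_series:
  assumes dvd: "\<And>n e. e \<in> W \<Longrightarrow> fps_X ^ n dvd lam e - (\<Sum>m<n. fps_X ^ m * lcf (K e) (F m))"
    and D: "\<And>n. D n = lc pm_scale h (F n) - (if n = 0 then Poly_Mapping.single ([], [], []) 1 else 0)"
    and h: "\<And>a b e x. lcf (L3 a b e) (h x) = lam a * lam b * K e x"
    and keys: "\<And>x. x \<in> W \<times> W \<Longrightarrow> Poly_Mapping.keys (h x) \<subseteq> W \<times> W \<times> W"
  shows "null3 (D n)"
proof (rule null3_series)
  show "Poly_Mapping.keys (D n) \<subseteq> W \<times> W \<times> W" for n
    unfolding D by (intro keys_diff_subset keys_lc_subset keys, erule subsetD[OF keys_F]) simp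
  fix n a b e assume *: "a \<in> W" "b \<in> W" "e \<in> W"
  have eq: "lcf (L3 a b e) (D q) = lam a * lam b * lcf (K e) (F q) - (if q = 0 then lam a * lam b * lam e else 0)" for q
    by (simp add: D fps.lc_diff lcf_lc h lc_mult_fps) (simp add: L3_def)
  have "(\<Sum>q\<le>n. fps_X ^ q * lcf (L3 a b e) (D q))
      = (\<Sum>q\<le>n. lam a * lam b * (fps_X ^ q * lcf (K e) (F q))) - (\<Sum>q\<le>n. if q = 0 then lam a * lam b * lam e else 0)"
    unfolding eq sum_subtractf[symmetric] by (rule sum.cong) (simp_all add: right_diff_distrib mult_ac)
  also have "\<dots> = - (lam a * lam b * (lam e - (\<Sum>m<Suc n. fps_X ^ m * lcf (K e) (F m))))"
    by (simp add: lessThan_Suc_atMost sum_distrib_left right_diff_distrib del: sum.lessThan_Suc)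
  finally show "fps_X ^ Suc n dvd (\<Sum>q\<le>n. fps_X ^ q * lcf (L3 a b e) (D q))"
    using dvd[OF *(3), of "Suc n"] by (simp only: dvd_minus_iff dvd_mult)
qed

theorem null3_counitL: "null3 (counitL n)"
proof -
  define h :: "nat list \<times> nat list \<Rightarrow> nat list \<times> nat list \<times> nat list \<Rightarrow>\<^sub>0 'k" where "h = (\<lambda>(u, v). if u = [] then Poly_Mapping.single ([] :: nat list, [] :: nat list, v :: nat list) (1::'k) else 0)"
  show ?thesis
  proof (rule counit_series[where K = "\<lambda>e (u, v). L u [] * L v e" and h = h])
    show "counitL n = lc pm_scale h (F n) - (if n = 0 then Poly_Mapping.single ([], [], []) 1 else 0)" for n
      by (simp add: counitL_def h_def)
  fix n e assume "e \<in> W"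
  then show "fps_X ^ n dvd lam e - (\<Sum>m<n. fps_X ^ m * lcf (\<lambda>(u, v). L u [] * L v e) (F m))"
    using rest_vanish[of "[]" e n] by (simp add: rest_def pair2_def)
  next
    fix a b e :: "nat list" and x :: "nat list \<times> nat list"
  show "lcf (L3 a b e) (h x)
      = lam a * lam b * (case x of (u, v) \<Rightarrow> L u [] * L v e)"
    by (cases x) (simp add: h_def L3_def L_at_Nil)
  qed (auto simp: h_def split: if_splits)
qed

theorem null3_counitR: "null3 (counitR n)"
proof -
  define h :: "nat list \<times> nat list \<Rightarrow> nat list \<times> nat list \<times> nat list \<Rightarrow>\<^sub>0 'k" where "h = (\<lambda>(u, v). if v = [] then Poly_Mapping.single ([] :: nat list, [] :: nat list, u :: nat list) (1::'k) else 0)"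
  show ?thesis
  proof (rule counit_series[where K = "\<lambda>e (u, v). L u e * L v []" and h = h])
    show "counitR n = lc pm_scale h (F n) - (if n = 0 then Poly_Mapping.single ([], [], []) 1 else 0)" for n
      by (simp add: counitR_def h_def)
  fix n e assume "e \<in> W"
  then show "fps_X ^ n dvd lam e - (\<Sum>m<n. fps_X ^ m * lcf (\<lambda>(u, v). L u e * L v []) (F m))"
    using rest_vanish[of e "[]" n] by (simp add: rest_def pair2_def)
  next
    fix a b e :: "nat list" and x :: "nat list \<times> nat list"
  show "lcf (L3 a b e) (h x)
      = lam a * lam b * (case x of (u, v) \<Rightarrow> L u e * L v [])"
    by (cases x) (simp add: h_def L3_def L_at_Nil)
  qed (auto simp: h_def split: if_splits)
qed

text \<open>Lets \<open>null3\<close> serve for pairs of words.\<close>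

abbreviation emb :: "(nat list \<times> nat list \<Rightarrow>\<^sub>0 'k) \<Rightarrow> (nat list \<times> nat list \<times> nat list \<Rightarrow>\<^sub>0 'k)" where
  "emb \<equiv> lc pm_scale (\<lambda>(u, v). Poly_Mapping.single (u, v, []) 1)"

lemma lck_lc: "lc (*) E (lc pm_scale h p) = lc (*) (\<lambda>x. lc (*) E (h x)) p"
  by (rule fld.lc_lc)

lemma keys_emb_F: "Poly_Mapping.keys (emb (F n)) \<subseteq> W \<times> W \<times> W"
proof (rule keys_lc_subset)
  fix x assume "x \<in> Poly_Mapping.keys (F n)"
  then have "x \<in> W \<times> W" by (rule subsetD[OF keys_F])
  then show "Poly_Mapping.keys (case x of (u, v) \<Rightarrow> Poly_Mapping.single (u, v, []) (1::'k)) \<subseteq> W \<times> W \<times> W"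
    by auto
qed

lemma P_emb: "lc (*) (\<lambda>(u, v, w). P u a * P v b * P w e) (emb (F n)) = eps e * fps_nth (pair2 a b (F n)) 0"
proof -
  have "lc (*) (\<lambda>(u, v, w). P u a * P v b * P w e) (emb (F n)) = lc (*) (\<lambda>x. eps e * (P (fst x) a * P (snd x) b)) (F n)"
    by (subst lck_lc, rule fld.lc_cong) (simp add: case_prod_unfold P_Nil)
  also have "\<dots> = eps e * lc (*) (\<lambda>x. P (fst x) a * P (snd x) b) (F n)"
    by (rule fld.lc_scale_fun)
  finally show ?thesis by (simp only: pair2_def fps_nth_lc case_prod_unfold fps_mult_nth_0 L_nth_0)
qed

lemma rest_nth: "a \<in> W \<Longrightarrow> b \<in> W \<Longrightarrow> i < n \<Longrightarrow> fps_nth (rest F n a b) i = 0"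
  using rest_vanish[of a b n] by (simp add: fps_X_power_dvd_iff)

text \<open>At t = 0 the functional \<open>lam\<close> is \<open>eps\<close>, which is
  multiplicative, so its product formula is that of 1 \<otimes> 1.\<close>

theorem null3_F0: "null3 (emb (F 0) - Poly_Mapping.single ([], [], []) 1)"
  unfolding null3_def
proof (intro conjI ballI)
  fix a b e assume "a \<in> W" "b \<in> W" "e \<in> W"
  then have "eps (a @ b) = fps_nth (pair2 a b (F 0)) 0"
    using rest_nth[of a b 0 1] by (simp add: rest_def lam_nth_0)
  moreover have "eps (a @ b) = eps a * eps b" by (simp add: eps_def)
  ultimately show "lc (*) (\<lambda>(u, v, w). P u a * P v b * P w e) (emb (F 0) - Poly_Mapping.single ([], [], []) 1) = 0"
    by (simp add: fld.lc_diff P_emb P_Nil)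
qed (intro keys_diff_subset keys_emb_F, simp)

lemma pair2_F0: "pair2 a b (F 0) = lam a * lam b"
proof -
  have "lcf (L3 a b []) (emb (F 0)) = pair2 a b (F 0)"
    by (simp add: lcf_lc case_prod_unfold L3_def lam_Nil pair2_def)
  with null3_L3[OF null3_F0, of a b "[]"] show ?thesis
    by (simp add: fps.lc_diff) (simp add: L3_def lam_Nil)
qed

lemma P_single: "P [i] a = (if a = [i] then 1 else 0)"
proof (cases "a = []")
  case False
  then show ?thesis by (subst P_top) (auto simp: Suc_le_eq)
qed (simp add: P_at_Nil eps_def)

text \<open>At order one \<open>lam_bound\<close> leaves words of total length at most two. Those
  with an empty factor are cancelled by the contribution of \<open>F 0\<close>, and two single
  letters are given by \<open>lam_two\<close>.\<close>

lemma pair2_F1: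
  assumes "a \<in> W" "b \<in> W"
  shows "fps_nth (pair2 a b (F 1)) 0 = (\<Sum>i<d. \<Sum>j<d. R i j / 2 * (P [i] a * P [j] b))"
proof -
  have "fps_nth (pair2 a b (F 1)) 0 = fps_nth (lam (a @ b)) 1 - fps_nth (lam a * lam b) 1"
    using rest_nth[OF assms, of 1 2] by (simp add: rest_def pair2_F0 numeral_2_eq_2)
  also have "\<dots> = fps_nth (lam (a @ b)) 1 - (eps a * fps_nth (lam b) 1 + fps_nth (lam a) 1 * eps b)"
    by (simp add: fps_mult_nth lam_nth_0)
  also have "\<dots> = (\<Sum>i<d. \<Sum>j<d. R i j / 2 * (P [i] a * P [j] b))"
  proof (cases "length a = 1 \<and> length b = 1")
    case True
    then obtain i j where ab: "a = [i]" "b = [j]" by (metis One_nat_def length_0_conv length_Suc_conv)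
    then have "i < d" "j < d" using assms by auto
    have "(\<Sum>i'<d. \<Sum>j'<d. R i' j' / 2 * (P [i'] [i] * P [j'] [j]))
        = (\<Sum>i'<d. \<Sum>j'<d. if j' = j then if i' = i then R i j / 2 else 0 else 0)"
      by (intro sum.cong refl) (auto simp: P_single)
    also have "\<dots> = R i j / 2" using \<open>i < d\<close> \<open>j < d\<close> by simp
    finally have S: "(\<Sum>i'<d. \<Sum>j'<d. R i' j' / 2 * (P [i'] [i] * P [j'] [j])) = R i j / 2" .
    show ?thesis unfolding ab S append_Cons append_Nil lam_two by (simp add: eps_def)
  next
    case False
    then have z: "R i j / 2 * (P [i] a * P [j] b) = 0" for i j by (auto simp: P_single)
    have "fps_nth (lam (a @ b)) 1 - (eps a * fps_nth (lam b) 1 + fps_nth (lam a) 1 * eps b) = 0"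
    proof (cases "a = [] \<or> b = []")
      case True
      then show ?thesis by (auto simp: eps_def lam_Nil)
    next
      case nonempty: False
      then have "length (a @ b) > 2 * 1" using False by (cases a; cases b) auto
      then show ?thesis using nonempty lam_bound[of 1 "a @ b"] by (simp add: eps_def)
    qed
    then show ?thesis by (simp only: z sum.neutral_const)
  qed
  finally show ?thesis .
qed

theorem null3_F1: "null3 (emb (F 1) - (\<Sum>i<d. \<Sum>j<d. Poly_Mapping.single ([i], [j], []) (R i j / 2)))"
  unfolding null3_def
proof (intro conjI ballI)
  fix a b e assume *: "a \<in> W" "b \<in> W" "e \<in> W"
  show "lc (*) (\<lambda>(u, v, w). P u a * P v b * P w e)
      (emb (F 1) - (\<Sum>i<d. \<Sum>j<d. Poly_Mapping.single ([i], [j], []) (R i j / 2))) = 0"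
    unfolding fld.lc_diff P_emb pair2_F1[OF *(1,2)] fld.lc_sum fld.lc_single
    by (simp only: prod.case P_Nil sum_distrib_left mult_ac diff_self)
qed (intro keys_diff_subset keys_emb_F keys_sum_subset, auto)

end

section \<open>Algebras presented by records\<close>

locale vs_alg = ring A for A :: "('k::field, 'a) module" (structure) +
  assumes smult_closed [simp, intro]: "x \<in> carrier A \<Longrightarrow> c \<odot> x \<in> carrier A"
    and smult_r_distr: "x \<in> carrier A \<Longrightarrow> y \<in> carrier A \<Longrightarrow> c \<odot> (x \<oplus> y) = c \<odot> x \<oplus> c \<odot> y"
    and smult_l_distr: "x \<in> carrier A \<Longrightarrow> (c + e) \<odot> x = c \<odot> x \<oplus> e \<odot> x"
    and smult_smult: "x \<in> carrier A \<Longrightarrow> c \<odot> (e \<odot> x) = (c * e) \<odot> x"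
    and smult_one [simp]: "x \<in> carrier A \<Longrightarrow> 1 \<odot> x = x"
    and smult_mult_l: "x \<in> carrier A \<Longrightarrow> y \<in> carrier A \<Longrightarrow> (c \<odot> x) \<otimes> y = c \<odot> (x \<otimes> y)"
    and smult_mult_r: "x \<in> carrier A \<Longrightarrow> y \<in> carrier A \<Longrightarrow> x \<otimes> (c \<odot> y) = c \<odot> (x \<otimes> y)"
begin

lemma add_self_zero: "x \<in> carrier A \<Longrightarrow> x = x \<oplus> x \<Longrightarrow> x = \<zero>"
  using add.l_cancel_one[of x x] by simp

lemma smult_l_null [simp]: "x \<in> carrier A \<Longrightarrow> 0 \<odot> x = \<zero>"
  using smult_l_distr[of x 0 0] by (intro add_self_zero) auto

lemma smult_r_null [simp]: "c \<odot> \<zero> = \<zero>"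
  using smult_r_distr[of \<zero> \<zero> c] by (intro add_self_zero) auto

lemma smult_minus: "x \<in> carrier A \<Longrightarrow> (- c) \<odot> x = \<ominus> (c \<odot> x)"
  using smult_l_distr[of x "- c" c] by (intro minus_equality[symmetric]) (auto simp: r_neg)

lemma smult_minus_one: "x \<in> carrier A \<Longrightarrow> (- 1) \<odot> x = \<ominus> x"
  using smult_minus[of x 1] by simp

lemma finsum_smult:
  "finite S \<Longrightarrow> f \<in> S \<rightarrow> carrier A \<Longrightarrow> c \<odot> (\<Oplus>i\<in>S. f i) = (\<Oplus>i\<in>S. c \<odot> f i)"
  by (induction S rule: finite_induct) (auto simp: smult_r_distr Pi_def)

lemma lin_ext_superset:
  assumes "finite S" "Poly_Mapping.keys p \<subseteq> S" "f \<in> S \<rightarrow> carrier A"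
  shows "lin_ext A f p = (\<Oplus>x\<in>S. Poly_Mapping.lookup p x \<odot> f x)"
  unfolding lin_ext_def by (rule add.finprod_mono_neutral_cong_left) (use assms in \<open>auto simp: in_keys_iff Pi_def\<close>)

lemma lin_ext_closed [simp, intro]:
  "f \<in> Poly_Mapping.keys p \<rightarrow> carrier A \<Longrightarrow> lin_ext A f p \<in> carrier A"
  unfolding lin_ext_def by (intro finsum_closed) auto

lemma lin_ext_add:
  assumes "Poly_Mapping.keys p \<subseteq> S" "Poly_Mapping.keys q \<subseteq> S" "f \<in> S \<rightarrow> carrier A"
  shows "lin_ext A f (p + q) = lin_ext A f p \<oplus> lin_ext A f q"
proof -
  let ?K = "Poly_Mapping.keys p \<union> Poly_Mapping.keys q"
  have f: "f \<in> ?K \<rightarrow> carrier A" using assms by auto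
  have "lin_ext A f (p + q) = (\<Oplus>x\<in>?K. Poly_Mapping.lookup (p + q) x \<odot> f x)"
    by (rule lin_ext_superset) (use f Poly_Mapping.keys_add[of p q] in auto)
  also have "\<dots> = (\<Oplus>x\<in>?K. Poly_Mapping.lookup p x \<odot> f x \<oplus> Poly_Mapping.lookup q x \<odot> f x)"
    by (rule finsum_cong') (use f in \<open>auto simp: lookup_add smult_l_distr Pi_def\<close>)
  also have "\<dots> = (\<Oplus>x\<in>?K. Poly_Mapping.lookup p x \<odot> f x) \<oplus> (\<Oplus>x\<in>?K. Poly_Mapping.lookup q x \<odot> f x)"
    by (rule finsum_addf) (use f in auto)
  also have "\<dots> = lin_ext A f p \<oplus> lin_ext A f q"
    by (subst (1 2) lin_ext_superset[of ?K]) (use f in auto)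
  finally show ?thesis .
qed

lemma lin_ext_zero [simp]: "lin_ext A f 0 = \<zero>"
  by (simp add: lin_ext_def)

lemma lin_ext_single [simp]: "f x \<in> carrier A \<Longrightarrow> lin_ext A f (Poly_Mapping.single x c) = c \<odot> f x"
  by (cases "c = 0") (simp_all add: lin_ext_def)

lemma lin_ext_scale:
  assumes "Poly_Mapping.keys p \<subseteq> S" "f \<in> S \<rightarrow> carrier A"
  shows "lin_ext A f (pm_scale c p) = c \<odot> lin_ext A f p"
proof -
  have f: "f \<in> Poly_Mapping.keys p \<rightarrow> carrier A" using assms by auto
  have "lin_ext A f (pm_scale c p) = (\<Oplus>x\<in>Poly_Mapping.keys p. (c * Poly_Mapping.lookup p x) \<odot> f x)"
    by (subst lin_ext_superset[of "Poly_Mapping.keys p"]) (use f keys_pm_scale[of c p] in auto)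
  also have "\<dots> = c \<odot> lin_ext A f p"
    unfolding lin_ext_def
    by (subst finsum_smult) (use f in \<open>auto intro!: finsum_cong' simp: smult_smult Pi_def\<close>)
  finally show ?thesis .
qed

lemma lin_ext_diff:
  assumes "Poly_Mapping.keys p \<subseteq> S" "Poly_Mapping.keys q \<subseteq> S" "f \<in> S \<rightarrow> carrier A"
  shows "lin_ext A f (p - q) = lin_ext A f p \<ominus> lin_ext A f q"
proof -
  have q: "Poly_Mapping.keys (pm_scale (- 1) q) \<subseteq> S" using assms keys_pm_scale[of "- 1" q] by auto
  have "p - q = p + pm_scale (- 1) q" by (rule poly_mapping_eqI) (simp add: lookup_add lookup_minus)
  then have "lin_ext A f (p - q) = lin_ext A f p \<oplus> (- 1) \<odot> lin_ext A f q"
    by (simp only: lin_ext_add[OF assms(1) q assms(3)] lin_ext_scale[OF assms(2,3)])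
  also have "\<dots> = lin_ext A f p \<ominus> lin_ext A f q"
    by (subst smult_minus_one) (use assms in \<open>auto simp: a_minus_def\<close>)
  finally show ?thesis .
qed

lemma lin_ext_cong:
  "g \<in> Poly_Mapping.keys p \<rightarrow> carrier A \<Longrightarrow> (\<And>x. x \<in> Poly_Mapping.keys p \<Longrightarrow> f x = g x) \<Longrightarrow> lin_ext A f p = lin_ext A g p"
  unfolding lin_ext_def by (rule finsum_cong') (auto simp: Pi_def intro!: smult_closed)

lemma lin_ext_sum:
  assumes "\<And>i. i \<in> I \<Longrightarrow> Poly_Mapping.keys (p i) \<subseteq> S" "f \<in> S \<rightarrow> carrier A"
  shows "lin_ext A f (\<Sum>i\<in>I. p i) = (\<Oplus>i\<in>I. lin_ext A f (p i))"
  using assms(1)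
proof (induction I rule: infinite_finite_induct)
  case (insert i I)
  have "lin_ext A f (p j) \<in> carrier A" if "j \<in> insert i I" for j
    using insert.prems[OF that] assms(2) by (intro lin_ext_closed) auto
  then show ?case using insert
    by (simp add: lin_ext_add[OF _ keys_sum_subset assms(2)] Pi_def)
qed (simp_all add: finsum_infinite)

end

text \<open>Checks linear identities on basis elements while the support stays inside a
  carrier.\<close>

lemma keys_induct [consumes 1, case_names zero single add]:
  fixes p :: "'x \<Rightarrow>\<^sub>0 'k::field"
  assumes "Poly_Mapping.keys p \<subseteq> S" "Q 0"
    and "\<And>x c. x \<in> S \<Longrightarrow> Q (Poly_Mapping.single x c)"
    and "\<And>p q. Poly_Mapping.keys p \<subseteq> S \<Longrightarrow> Poly_Mapping.keys q \<subseteq> S \<Longrightarrow> Q p \<Longrightarrow> Q q \<Longrightarrow> Q (p + q)"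
  shows "Q p"
proof -
  have "Q (\<Sum>x\<in>K. Poly_Mapping.single x (g x)) \<and> Poly_Mapping.keys (\<Sum>x\<in>K. Poly_Mapping.single x (g x)) \<subseteq> S"
    if "finite K" "K \<subseteq> S" for K g
    using that
  proof (induction K rule: finite_induct)
    case (insert x K)
    then show ?case
      using assms(4)[of "Poly_Mapping.single x (g x)" "\<Sum>x\<in>K. Poly_Mapping.single x (g x)"] assms(3)[of x "g x"]
        Poly_Mapping.keys_add[of "Poly_Mapping.single x (g x)" "\<Sum>x\<in>K. Poly_Mapping.single x (g x)"]
      by (auto split: if_splits)
  qed (simp add: assms(2))
  from this[OF _ assms(1), of "Poly_Mapping.lookup p"] show ?thesis
    by (subst poly_mapping_sum_single) auto
qed

lemma linear_mapD:
  assumes "linear_map A B f"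
  shows "x \<in> carrier A \<Longrightarrow> f x \<in> carrier B"
    and "x \<in> carrier A \<Longrightarrow> y \<in> carrier A \<Longrightarrow> f (x \<oplus>\<^bsub>A\<^esub> y) = f x \<oplus>\<^bsub>B\<^esub> f y"
    and "x \<in> carrier A \<Longrightarrow> f (c \<odot>\<^bsub>A\<^esub> x) = c \<odot>\<^bsub>B\<^esub> f x"
  using assms by (auto simp: linear_map_def)

lemma linear_map_zero:
  assumes "vs_alg A" "vs_alg B" "linear_map A B f"
  shows "f \<zero>\<^bsub>A\<^esub> = \<zero>\<^bsub>B\<^esub>"
proof -
  interpret A: vs_alg A by fact
  interpret B: vs_alg B by fact
  show ?thesis using linear_mapD(3)[OF assms(3), of "\<zero>\<^bsub>A\<^esub>" 0] linear_mapD(1)[OF assms(3), of "\<zero>\<^bsub>A\<^esub>"] by simp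
qed

lemma linear_map_lin_ext:
  assumes "vs_alg A" "vs_alg B" "linear_map A B \<phi>" "f \<in> Poly_Mapping.keys p \<rightarrow> carrier A"
  shows "\<phi> (lin_ext A f p) = lin_ext B (\<lambda>x. \<phi> (f x)) p"
proof -
  interpret A: vs_alg A by fact
  interpret B: vs_alg B by fact
  note \<phi> = linear_mapD[OF assms(3)]
  have "Poly_Mapping.keys p \<subseteq> Poly_Mapping.keys p" by simp
  then show ?thesis
  proof (induction p rule: keys_induct)
    case zero
    then show ?case by (simp add: linear_map_zero[OF assms(1-3)])
  next
    case (single x c)
    then have "f x \<in> carrier A" using assms(4) by auto
    then show ?case by (simp add: \<phi>)
  next
    case (add p q)
    let ?S = "Poly_Mapping.keys p \<union> Poly_Mapping.keys q"
    have f: "f \<in> ?S \<rightarrow> carrier A" using add.hyps assms(4) by auto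
    then have "(\<lambda>x. \<phi> (f x)) \<in> ?S \<rightarrow> carrier B" using \<phi>(1) by auto
    then show ?case using f add.IH
      by (simp add: A.lin_ext_add[of p ?S] B.lin_ext_add[of p ?S] \<phi> A.lin_ext_closed Pi_def)
  qed
qed

lemma linear_map_comp:
  "linear_map A B f \<Longrightarrow> linear_map B C g \<Longrightarrow> linear_map A C (\<lambda>x. g (f x))"
  by (auto simp: linear_map_def Pi_def)

context vs_alg begin

lemma linear_map_mult_l: "a \<in> carrier A \<Longrightarrow> linear_map A A (\<lambda>x. a \<otimes> x)"
  by (auto simp: linear_map_def r_distr smult_mult_r)

lemma linear_map_mult_r: "a \<in> carrier A \<Longrightarrow> linear_map A A (\<lambda>x. x \<otimes> a)"
  by (auto simp: linear_map_def l_distr smult_mult_l)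

lemma linear_map_lin_ext_monoid:
  assumes "f \<in> carrier M \<rightarrow> carrier A"
  shows "linear_map (monoid_algebra M) A (lin_ext A f)"
  unfolding linear_map_def monoid_algebra_def
  using assms by (auto intro!: lin_ext_closed lin_ext_add[where S = "carrier M"] lin_ext_scale[where S = "carrier M"])

text \<open>Reduces a product of combinations to products of basis elements; with
  \<open>\<sigma>L\<close> and \<open>\<sigma>R\<close> it evaluates the two sides of the twist
  equation.\<close>

lemma lin_ext_bil:
  assumes "f \<in> Poly_Mapping.keys p \<rightarrow> carrier A" "g \<in> Poly_Mapping.keys q \<rightarrow> carrier A"
    and keys: "\<And>x y. x \<in> Poly_Mapping.keys p \<Longrightarrow> y \<in> Poly_Mapping.keys q \<Longrightarrow> Poly_Mapping.keys (\<sigma> x y) \<subseteq> S"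
    and h: "h \<in> S \<rightarrow> carrier A"
    and eq: "\<And>x y. x \<in> Poly_Mapping.keys p \<Longrightarrow> y \<in> Poly_Mapping.keys q \<Longrightarrow> f x \<otimes> g y = lin_ext A h (\<sigma> x y)"
  shows "lin_ext A f p \<otimes> lin_ext A g q = lin_ext A h (bil \<sigma> p q)"
proof -
  let ?K = "Poly_Mapping.keys p" and ?L = "Poly_Mapping.keys q"
  let ?p = "Poly_Mapping.lookup p" and ?q = "Poly_Mapping.lookup q"
  have k: "Poly_Mapping.keys (pm_scale (?p x * ?q y) (\<sigma> x y)) \<subseteq> S" if "x \<in> ?K" "y \<in> ?L" for x y
    by (rule order_trans[OF keys_pm_scale keys[OF that]])
  have "lin_ext A h (bil \<sigma> p q) = (\<Oplus>x\<in>?K. \<Oplus>y\<in>?L. lin_ext A h (pm_scale (?p x * ?q y) (\<sigma> x y)))"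
  proof -
    have ks: "Poly_Mapping.keys (\<Sum>y\<in>?L. pm_scale (?p x * ?q y) (\<sigma> x y)) \<subseteq> S" if "x \<in> ?K" for x
      by (rule keys_sum_subset) (rule k[OF that])
    have in2: "lin_ext A h (\<Sum>y\<in>?L. pm_scale (?p x * ?q y) (\<sigma> x y))
        = (\<Oplus>y\<in>?L. lin_ext A h (pm_scale (?p x * ?q y) (\<sigma> x y)))" if "x \<in> ?K" for x
      by (rule lin_ext_sum[OF _ h]) (rule k[OF that])
    have "lin_ext A h (bil \<sigma> p q) = (\<Oplus>x\<in>?K. lin_ext A h (\<Sum>y\<in>?L. pm_scale (?p x * ?q y) (\<sigma> x y)))"
      unfolding bil_def by (rule lin_ext_sum[OF _ h]) (rule ks)
    also have "\<dots> = (\<Oplus>x\<in>?K. \<Oplus>y\<in>?L. lin_ext A h (pm_scale (?p x * ?q y) (\<sigma> x y)))"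
    proof (rule finsum_cong'[OF refl _ in2])
      show "(\<lambda>x. \<Oplus>y\<in>?L. lin_ext A h (pm_scale (?p x * ?q y) (\<sigma> x y))) \<in> ?K \<rightarrow> carrier A"
      proof (intro Pi_I finsum_closed lin_ext_closed)
        fix x y z
        assume "x \<in> ?K" "y \<in> ?L" "z \<in> Poly_Mapping.keys (pm_scale (?p x * ?q y) (\<sigma> x y))"
        then have "z \<in> S" using k by blast
        then show "h z \<in> carrier A" using h by auto
      qed
    qed
    finally show ?thesis .
  qed
  also have "\<dots> = (\<Oplus>x\<in>?K. \<Oplus>y\<in>?L. (?p x \<odot> f x) \<otimes> (?q y \<odot> g y))"
  proof -
    have 1: "lin_ext A h (pm_scale (?p x * ?q y) (\<sigma> x y)) = (?p x \<odot> f x) \<otimes> (?q y \<odot> g y)"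
      if xy: "x \<in> ?K" "y \<in> ?L" for x y
    proof -
    have "f x \<in> carrier A" "g y \<in> carrier A" using assms xy by auto
    then show ?thesis
      by (simp add: lin_ext_scale[OF keys[OF xy] h] smult_mult_l smult_mult_r smult_smult eq[OF xy, symmetric] mult.commute)
    qed
    have 2: "f x \<in> carrier A" "g y \<in> carrier A" if "x \<in> ?K" "y \<in> ?L" for x y using assms that by auto
    show ?thesis
    proof (rule finsum_cong'[OF refl])
      show "(\<Oplus>y\<in>?L. lin_ext A h (pm_scale (?p x * ?q y) (\<sigma> x y))) = (\<Oplus>y\<in>?L. (?p x \<odot> f x) \<otimes> (?q y \<odot> g y))"
        if "x \<in> ?K" for x
        by (rule finsum_cong'[OF refl]) (use 1 2 that in auto)
    qed (use 2 in \<open>auto intro!: finsum_closed\<close>)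
  qed
  also have "\<dots> = (\<Oplus>x\<in>?K. (?p x \<odot> f x) \<otimes> lin_ext A g q)"
    unfolding lin_ext_def
  proof (rule finsum_cong'[OF refl])
    show "(\<lambda>x. (?p x \<odot> f x) \<otimes> (\<Oplus>y\<in>?L. ?q y \<odot> g y)) \<in> ?K \<rightarrow> carrier A"
      using assms(1,2) by (auto intro!: m_closed finsum_closed smult_closed)
    fix x assume "x \<in> ?K"
    then show "(\<Oplus>y\<in>?L. (?p x \<odot> f x) \<otimes> (?q y \<odot> g y)) = (?p x \<odot> f x) \<otimes> (\<Oplus>y\<in>?L. ?q y \<odot> g y)"
      by (intro finsum_rdistr[symmetric]) (use assms(1,2) in auto)
  qed
  also have "\<dots> = lin_ext A f p \<otimes> lin_ext A g q"
    unfolding lin_ext_def[of A f p]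
    by (intro finsum_ldistr[symmetric]) (use assms in auto)
  finally show ?thesis ..
qed

end

section \<open>Monoid algebras\<close>

lemma bil_lc: "bil \<sigma> p q = lc pm_scale (\<lambda>x. lc pm_scale (\<sigma> x) q) p"
  by (simp add: bil_def lc_def pm.scale_sum_right)

lemma bil_assoc:
  assumes "\<And>x y z. x \<in> Poly_Mapping.keys p \<Longrightarrow> y \<in> Poly_Mapping.keys q \<Longrightarrow> z \<in> Poly_Mapping.keys r \<Longrightarrow> m (m x y) z = m x (m y z)"
  shows "bil (\<lambda>x y. Poly_Mapping.single (m x y) 1) (bil (\<lambda>x y. Poly_Mapping.single (m x y) 1) p q) r
    = bil (\<lambda>x y. Poly_Mapping.single (m x y) 1) p (bil (\<lambda>x y. Poly_Mapping.single (m x y) (1::'k::field)) q r)"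
proof -
  let ?s = "\<lambda>x y. Poly_Mapping.single (m x y) (1::'k)"
  have "bil ?s (bil ?s p q) r = lc pm_scale (\<lambda>x. lc pm_scale (\<lambda>y. lc pm_scale (\<lambda>z. ?s (m x y) z) r) q) p"
    unfolding bil_lc[of ?s _ r] pm.lc_bil by simp
  also have "\<dots> = lc pm_scale (\<lambda>x. lc pm_scale (\<lambda>y. lc pm_scale (\<lambda>z. ?s x (m y z)) r) q) p"
    by (intro pm.lc_cong) (simp add: assms)
  also have "\<dots> = bil ?s p (bil ?s q r)"
    unfolding bil_lc[of ?s p] pm.lc_bil by simp
  finally show ?thesis .
qed

lemma bil_linear:
  "bil \<sigma> (p + p') q = bil \<sigma> p q + bil \<sigma> p' q"
  "bil \<sigma> p (q + q') = bil \<sigma> p q + bil \<sigma> p q'"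
  "bil \<sigma> (pm_scale c p) q = pm_scale c (bil \<sigma> p q)"
  "bil \<sigma> p (pm_scale c q) = pm_scale c (bil \<sigma> p q)"
  unfolding bil_lc by (simp_all only: pm.lc_add pm.lc_scale pm.lc_add_fun pm.lc_scale_fun)

lemma bil_single: "bil \<sigma> (Poly_Mapping.single x 1) (Poly_Mapping.single y 1) = \<sigma> x y"
  by (simp add: bil_lc)

lemma lc_single_id: "lc pm_scale (\<lambda>x. Poly_Mapping.single x 1) p = p"
  by (simp add: lc_def poly_mapping_sum_single[symmetric])

lemma monoid_algebra_simps:
  "carrier (monoid_algebra M) = {p. Poly_Mapping.keys p \<subseteq> carrier M}"
  "p \<otimes>\<^bsub>monoid_algebra M\<^esub> q = bil (\<lambda>u v. Poly_Mapping.single (u \<otimes>\<^bsub>M\<^esub> v) 1) p q"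
  "\<one>\<^bsub>monoid_algebra M\<^esub> = Poly_Mapping.single \<one>\<^bsub>M\<^esub> 1"
  "\<zero>\<^bsub>monoid_algebra M\<^esub> = 0"
  "p \<oplus>\<^bsub>monoid_algebra M\<^esub> q = p + q"
  "c \<odot>\<^bsub>monoid_algebra M\<^esub> p = pm_scale c p"
  by (simp_all add: monoid_algebra_def bil_def)

lemma monoid_algebra_vs_alg:
  assumes "monoid M"
  shows "vs_alg (monoid_algebra M :: ('k::field, _) module)"
proof -
  interpret M: monoid M by fact
  let ?A = "monoid_algebra M :: ('k, _) module"
  let ?s = "\<lambda>u v. Poly_Mapping.single (u \<otimes>\<^bsub>M\<^esub> v) (1::'k)"
  have add: "Poly_Mapping.keys (p + q) \<subseteq> carrier M"
    if "Poly_Mapping.keys p \<subseteq> carrier M" "Poly_Mapping.keys q \<subseteq> carrier M" for p q :: "_ \<Rightarrow>\<^sub>0 'k"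
    using that Poly_Mapping.keys_add[of p q] by auto
  have scale: "Poly_Mapping.keys (pm_scale c p) \<subseteq> carrier M"
    if "Poly_Mapping.keys p \<subseteq> carrier M" for c and p :: "_ \<Rightarrow>\<^sub>0 'k"
    using that keys_pm_scale[of c p] by auto
  have mult: "Poly_Mapping.keys (bil ?s p q) \<subseteq> carrier M"
    if "Poly_Mapping.keys p \<subseteq> carrier M" "Poly_Mapping.keys q \<subseteq> carrier M" for p q :: "_ \<Rightarrow>\<^sub>0 'k"
    by (rule keys_bil) (use that in auto)
  have one: "bil ?s (Poly_Mapping.single \<one>\<^bsub>M\<^esub> 1) p = p" "bil ?s p (Poly_Mapping.single \<one>\<^bsub>M\<^esub> 1) = p"
    if p: "Poly_Mapping.keys p \<subseteq> carrier M" for p :: "_ \<Rightarrow>\<^sub>0 'k"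
  proof -
    have "bil ?s (Poly_Mapping.single \<one>\<^bsub>M\<^esub> 1) p = lc pm_scale (\<lambda>x. Poly_Mapping.single x 1) p"
      unfolding bil_lc pm.lc_single pm.scale_one by (rule pm.lc_cong) (use p in auto)
    then show "bil ?s (Poly_Mapping.single \<one>\<^bsub>M\<^esub> 1) p = p" by (simp add: lc_single_id)
    have "bil ?s p (Poly_Mapping.single \<one>\<^bsub>M\<^esub> 1) = lc pm_scale (\<lambda>x. Poly_Mapping.single x 1) p"
      unfolding bil_lc pm.lc_single pm.scale_one by (rule pm.lc_cong) (use p in auto)
    then show "bil ?s p (Poly_Mapping.single \<one>\<^bsub>M\<^esub> 1) = p" by (simp add: lc_single_id)
  qed
  have "ring ?A"
  proof (rule ringI)
    show "abelian_group ?A"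
      by (rule abelian_groupI) (auto simp: monoid_algebra_simps add add_ac keys_minus intro!: exI[of _ "- _"] bexI[of _ "- _"])
    show "monoid ?A"
      by (rule monoidI) (auto simp: monoid_algebra_simps mult one intro!: bil_assoc M.m_assoc)
  qed (simp_all add: monoid_algebra_simps bil_linear)
  then show ?thesis
    by (intro vs_alg.intro vs_alg_axioms.intro)
      (simp_all add: monoid_algebra_simps scale bil_linear pm.scale_right_distrib pm.scale_left_distrib)
qed

section \<open>Quotients\<close>

text \<open>\<open>quotient_algebra\<close> copies the ring operations of the factor ring into a
  record of another type, so the ring axioms have to be carried over.\<close>

lemma ring_cong:
  assumes "ring R" "carrier S = carrier R" "monoid.mult S = monoid.mult R" "one S = one R" "zero S = zero R" "add S = add R"
  shows "ring S"
proof -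
  interpret R: ring R by fact
  show ?thesis
  proof (rule ringI)
    show "abelian_group S"
      by (rule abelian_groupI) (use assms R.a_assoc R.a_comm R.add.l_inv_ex in auto)
    show "monoid S"
      by (rule monoidI) (use assms R.m_assoc in auto)
  qed (use assms R.l_distr R.r_distr in auto)
qed

locale alg_ideal = vs_alg A + ideal I A for I and A :: "('k::field, 'a) module" (structure)
begin

abbreviation "Q \<equiv> quotient_algebra A I"
abbreviation cls where "cls x \<equiv> I +> x"

lemma cls_eq_iff: "x \<in> carrier A \<Longrightarrow> y \<in> carrier A \<Longrightarrow> cls x = cls y \<longleftrightarrow> x \<ominus> y \<in> I"
proof -
  assume xy: "x \<in> carrier A" "y \<in> carrier A"
  note mem = a_rcos_module_minus[OF ring_axioms xy(2,1)]
  show ?thesis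
  proof
    assume "cls x = cls y"
    then show "x \<ominus> y \<in> I" using a_rcos_self[OF xy(1)] mem by simp
  next
    assume "x \<ominus> y \<in> I"
    then have "x \<in> cls y" using mem by simp
    from a_repr_independence[OF this xy(2) a_subgroup] show "cls x = cls y" by simp
  qed
qed

text \<open>Scaling is multiplication by a multiple of the unit.\<close>

lemma smult_ideal: "x \<in> I \<Longrightarrow> c \<odot> x \<in> I"
  using I_l_closed[of x "c \<odot> \<one>"] a_subset by (auto simp: smult_mult_l)

lemma cls_closed [simp, intro]: "x \<in> carrier A \<Longrightarrow> cls x \<in> carrier Q"
  by (simp add: quotient_algebra_def FactRing_def a_rcosetsI[OF a_subset])

lemma cls_cases: "X \<in> carrier Q \<Longrightarrow> \<exists>x\<in>carrier A. X = cls x"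
  by (auto simp: quotient_algebra_def FactRing_def A_RCOSETS_def')

lemma cls_add: "x \<in> carrier A \<Longrightarrow> y \<in> carrier A \<Longrightarrow> cls x \<oplus>\<^bsub>Q\<^esub> cls y = cls (x \<oplus> y)"
  by (simp add: quotient_algebra_def FactRing_def a_rcos_sum)

lemma cls_mult: "x \<in> carrier A \<Longrightarrow> y \<in> carrier A \<Longrightarrow> cls x \<otimes>\<^bsub>Q\<^esub> cls y = cls (x \<otimes> y)"
  by (simp add: quotient_algebra_def FactRing_def rcoset_mult_add)

lemma cls_one: "\<one>\<^bsub>Q\<^esub> = cls \<one>"
  by (simp add: quotient_algebra_def FactRing_def)

lemma cls_zero: "\<zero>\<^bsub>Q\<^esub> = cls \<zero>"
  using a_rcos_const[OF zero_closed] by (simp add: quotient_algebra_def FactRing_def)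

lemma cls_self: "x \<in> carrier A \<Longrightarrow> x \<in> cls x"
  by (rule a_rcos_self)

lemma cls_memD: "x \<in> carrier A \<Longrightarrow> y \<in> cls x \<Longrightarrow> y \<in> carrier A \<and> y \<ominus> x \<in> I"
  using a_rcos_module_minus[OF ring_axioms, of x y] a_r_coset_subset_G[OF a_subset, of x] by auto

lemma cls_smult: "x \<in> carrier A \<Longrightarrow> c \<odot>\<^bsub>Q\<^esub> cls x = cls (c \<odot> x)"
proof -
  assume x: "x \<in> carrier A"
  have "cls (c \<odot> y) = cls (c \<odot> x)" if "y \<in> cls x" for y
  proof -
    have y: "y \<in> carrier A" "y \<ominus> x \<in> I" using cls_memD[OF x that] by auto
    have "c \<odot> y \<ominus> c \<odot> x = c \<odot> (y \<ominus> x)"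
      using x y(1) by (simp add: a_minus_def smult_r_distr smult_minus_one[symmetric] smult_smult mult.commute)
    then show ?thesis using x y smult_ideal[OF y(2)] by (simp add: cls_eq_iff)
  qed
  \<comment> \<open>All members of the union are the same coset, so it collapses to that
    coset.\<close>
  then have "(\<Union>y\<in>cls x. cls (c \<odot> y)) = (\<Union>y\<in>cls x. cls (c \<odot> x))" by (rule SUP_cong[OF refl])
  also have "\<dots> = cls (c \<odot> x)" using cls_self[OF x] by (metis UN_constant empty_iff)
  finally show ?thesis by (simp add: quotient_algebra_def)
qed

lemma Q_vs_alg: "vs_alg Q"
proof -
  have "ring Q"
    by (rule ring_cong[OF quotient_is_ring]) (simp_all add: quotient_algebra_def)
  then show ?thesis
  proof (intro vs_alg.intro vs_alg_axioms.intro)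
    fix X Y c e assume "X \<in> carrier Q" "Y \<in> carrier Q"
    then obtain x y where xy: "x \<in> carrier A" "y \<in> carrier A" "X = cls x" "Y = cls y" using cls_cases by blast
    then show "c \<odot>\<^bsub>Q\<^esub> (X \<oplus>\<^bsub>Q\<^esub> Y) = c \<odot>\<^bsub>Q\<^esub> X \<oplus>\<^bsub>Q\<^esub> c \<odot>\<^bsub>Q\<^esub> Y"
      "(c \<odot>\<^bsub>Q\<^esub> X) \<otimes>\<^bsub>Q\<^esub> Y = c \<odot>\<^bsub>Q\<^esub> (X \<otimes>\<^bsub>Q\<^esub> Y)" "X \<otimes>\<^bsub>Q\<^esub> (c \<odot>\<^bsub>Q\<^esub> Y) = c \<odot>\<^bsub>Q\<^esub> (X \<otimes>\<^bsub>Q\<^esub> Y)"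
      by (simp_all add: cls_add cls_mult cls_smult smult_r_distr smult_mult_l smult_mult_r)
  next
    fix X c e assume "X \<in> carrier Q"
    then obtain x where x: "x \<in> carrier A" "X = cls x" using cls_cases by blast
    then show "c \<odot>\<^bsub>Q\<^esub> X \<in> carrier Q" "(c + e) \<odot>\<^bsub>Q\<^esub> X = c \<odot>\<^bsub>Q\<^esub> X \<oplus>\<^bsub>Q\<^esub> e \<odot>\<^bsub>Q\<^esub> X"
      "c \<odot>\<^bsub>Q\<^esub> (e \<odot>\<^bsub>Q\<^esub> X) = (c * e) \<odot>\<^bsub>Q\<^esub> X" "1 \<odot>\<^bsub>Q\<^esub> X = X"
      by (simp_all add: cls_add cls_smult smult_l_distr smult_smult)
  qed
qed

text \<open>The image of a coset is a singleton, which gives \<open>the_elem\<close> in the lifts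
  its meaning.\<close>

lemma quotient_map:
  assumes B: "vs_alg B" and f: "linear_map A B f" and I: "\<And>x. x \<in> I \<Longrightarrow> f x = \<zero>\<^bsub>B\<^esub>" and x: "x \<in> carrier A"
  shows "the_elem (f ` cls x) = f x"
proof -
  interpret B: vs_alg B by fact
  note fD = linear_mapD[OF f]
  have "f y = f x" if "y \<in> cls x" for y
  proof -
    have y: "y \<in> carrier A" "y \<ominus> x \<in> I" using cls_memD[OF x that] by auto
    then have "y = (y \<ominus> x) \<oplus> x" using x by (simp add: a_minus_def a_assoc l_neg)
    then have "f y = f (y \<ominus> x) \<oplus>\<^bsub>B\<^esub> f x" using x y fD(2)[of "y \<ominus> x" x] by simp
    then show ?thesis using I[OF y(2)] fD(1)[OF x] by simp
  qed
  then have "f ` cls x = (\<lambda>_. f x) ` cls x" by (rule image_cong[OF refl])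
  also have "\<dots> = {f x}" by (rule image_constant[OF cls_self[OF x]])
  finally have "f ` cls x = {f x}" .
  then show ?thesis by simp
qed

lemma linear_map_quotient:
  assumes B: "vs_alg B" and f: "linear_map A B f" and I: "\<And>x. x \<in> I \<Longrightarrow> f x = \<zero>\<^bsub>B\<^esub>"
  shows "linear_map Q B (\<lambda>X. the_elem (f ` X))"
  unfolding linear_map_def
proof (intro conjI ballI allI Pi_I)
  fix X assume "X \<in> carrier Q"
  then obtain x where x: "x \<in> carrier A" "X = cls x" using cls_cases by blast
  then show "the_elem (f ` X) \<in> carrier B" by (simp add: quotient_map[OF assms] linear_mapD[OF f])
  show "the_elem (f ` (c \<odot>\<^bsub>Q\<^esub> X)) = c \<odot>\<^bsub>B\<^esub> the_elem (f ` X)" for c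
    using x by (simp add: cls_smult quotient_map[OF assms] linear_mapD[OF f])
  fix Y assume "Y \<in> carrier Q"
  then obtain y where y: "y \<in> carrier A" "Y = cls y" using cls_cases by blast
  show "the_elem (f ` (X \<oplus>\<^bsub>Q\<^esub> Y)) = the_elem (f ` X) \<oplus>\<^bsub>B\<^esub> the_elem (f ` Y)"
    using x y by (simp add: cls_add quotient_map[OF assms] linear_mapD[OF f])
qed

end

section \<open>Tensor products\<close>

definition bilinear_map :: "('k::field, 'a) module \<Rightarrow> ('k, 'b) module \<Rightarrow> ('k, 'c) module \<Rightarrow> ('a \<Rightarrow> 'b \<Rightarrow> 'c) \<Rightarrow> bool" where
  "bilinear_map A B C f \<longleftrightarrow> (\<forall>a\<in>carrier A. linear_map B C (f a)) \<and> (\<forall>b\<in>carrier B. linear_map A C (\<lambda>a. f a b))"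

lemma bil_diff:
  "bil \<sigma> (p - p') q = bil \<sigma> p q - bil \<sigma> p' q"
  "bil \<sigma> p (q - q') = bil \<sigma> p q - bil \<sigma> p q'"
  unfolding bil_lc by (simp_all only: pm.lc_diff pm.lc_diff_fun)

lemma bil_zero [simp]: "bil \<sigma> 0 q = 0" "bil \<sigma> p 0 = 0"
  by (simp_all add: bil_def)

lemma bil_single_scale:
  "bil \<sigma> (Poly_Mapping.single x c) q = pm_scale c (bil \<sigma> (Poly_Mapping.single x 1) q)"
  "bil \<sigma> p (Poly_Mapping.single y c) = pm_scale c (bil \<sigma> p (Poly_Mapping.single y 1))"
  using bil_linear(3)[of \<sigma> c "Poly_Mapping.single x 1" q] bil_linear(4)[of \<sigma> p c "Poly_Mapping.single y 1"] by simp_all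

text \<open>By bilinearity it is enough to multiply spanning elements by basis elements on either
  side.\<close>

lemma ideal_span:
  fixes M (structure) and R :: "('m \<Rightarrow>\<^sub>0 'k::field) set"
  assumes "monoid M" and R: "\<And>p. p \<in> R \<Longrightarrow> Poly_Mapping.keys p \<subseteq> carrier M"
    and l: "\<And>x p. x \<in> carrier M \<Longrightarrow> p \<in> R \<Longrightarrow>
      Poly_Mapping.single x 1 \<otimes>\<^bsub>monoid_algebra M\<^esub> p \<in> pm.span R"
    and r: "\<And>x p. x \<in> carrier M \<Longrightarrow> p \<in> R \<Longrightarrow>
      p \<otimes>\<^bsub>monoid_algebra M\<^esub> Poly_Mapping.single x 1 \<in> pm.span R"
  shows "alg_ideal (pm.span R) (monoid_algebra M)"
proof -
  let ?A = "monoid_algebra M :: ('k, _) module"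
  let ?s = "\<lambda>u v. Poly_Mapping.single (u \<otimes>\<^bsub>M\<^esub> v) (1::'k)"
  interpret A: vs_alg ?A by (rule monoid_algebra_vs_alg) fact
  note sub = pm.span_add pm.span_scale pm.span_zero
  have carr: "pm.span R \<subseteq> carrier ?A"
  proof (rule pm.span_minimal)
    show "pm.subspace (carrier ?A)"
      using A.a_closed A.zero_closed A.smult_closed
      by (auto simp: pm.subspace_def monoid_algebra_simps(4-6))
  qed (use R in \<open>auto simp: monoid_algebra_simps\<close>)
  have L: "bil ?s p q \<in> pm.span R" if p: "p \<in> R" and q: "Poly_Mapping.keys q \<subseteq> carrier M" for p q
    using q
  proof (induction q rule: keys_induct)
    case (single x c)
    show ?case using r[OF single p] by (subst bil_single_scale(2)) (intro sub, simp add: monoid_algebra_simps)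
  qed (simp_all add: bil_linear sub)
  have Rr: "bil ?s q p \<in> pm.span R" if p: "p \<in> R" and q: "Poly_Mapping.keys q \<subseteq> carrier M" for p q
    using q
  proof (induction q rule: keys_induct)
    case (single x c)
    show ?case using l[OF single p] by (subst bil_single_scale(1)) (intro sub, simp add: monoid_algebra_simps)
  qed (simp_all add: bil_linear sub)
  have L2: "bil ?s p q \<in> pm.span R" if p: "p \<in> pm.span R" and q: "Poly_Mapping.keys q \<subseteq> carrier M" for p q
    using p
  proof (rule pm.span_induct)
    show "pm.subspace {p. bil ?s p q \<in> pm.span R}"
      by (auto simp: pm.subspace_def bil_linear sub)
  qed (use L q in auto)
  have R2: "bil ?s q p \<in> pm.span R" if p: "p \<in> pm.span R" and q: "Poly_Mapping.keys q \<subseteq> carrier M" for p q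
    using p
  proof (rule pm.span_induct)
    show "pm.subspace {p. bil ?s q p \<in> pm.span R}"
      by (auto simp: pm.subspace_def bil_linear sub)
  qed (use Rr q in auto)
  have "ideal (pm.span R) ?A"
  proof (rule idealI[OF A.ring_axioms])
    show "subgroup (pm.span R) (add_monoid ?A)"
    proof (rule A.add.subgroupI)
      fix p assume p: "p \<in> pm.span R"
      then have "\<ominus>\<^bsub>?A\<^esub> p = pm_scale (- 1) p"
        using A.smult_minus_one[of p] carr by (auto simp: monoid_algebra_simps(6))
      then show "\<ominus>\<^bsub>?A\<^esub> p \<in> pm.span R" using p by (simp add: pm.span_neg)
    qed (use carr pm.span_zero[of R] in \<open>auto simp: monoid_algebra_simps pm.span_add\<close>)
  qed (auto simp: monoid_algebra_simps L2 R2)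
  then show ?thesis by (intro alg_ideal.intro A.vs_alg_axioms)
qed

locale tensor_pair = A: vs_alg A + B: vs_alg B
  for A :: "('k::field, 'a) module" and B :: "('k, 'b) module"
begin

abbreviation "K \<equiv> tensor_kernel A B"
abbreviation "TA \<equiv> monoid_algebra (A \<times>\<times> B) :: ('k, 'a \<times> 'b \<Rightarrow>\<^sub>0 'k) module"
abbreviation T where "T \<equiv> tensor_product A B"
abbreviation ten where "ten a b \<equiv> tensor A B a b"

lemma monoid_AB: "monoid (A \<times>\<times> B)"
  by (intro DirProd_monoid A.monoid_axioms B.monoid_axioms)

lemma carrier_AB: "carrier (A \<times>\<times> B) = carrier A \<times> carrier B"
  by (simp add: DirProd_def)

lemma mult_AB: "(a, b) \<otimes>\<^bsub>A \<times>\<times> B\<^esub> (a', b') = (a \<otimes>\<^bsub>A\<^esub> a', b \<otimes>\<^bsub>B\<^esub> b')"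
  by (simp add: DirProd_def)

lemma kernel_base:
  "a \<in> carrier A \<Longrightarrow> a' \<in> carrier A \<Longrightarrow> b \<in> carrier B \<Longrightarrow>
    Poly_Mapping.single (a \<oplus>\<^bsub>A\<^esub> a', b) 1 - Poly_Mapping.single (a, b) 1 - Poly_Mapping.single (a', b) 1 \<in> K"
  "a \<in> carrier A \<Longrightarrow> b \<in> carrier B \<Longrightarrow> b' \<in> carrier B \<Longrightarrow>
    Poly_Mapping.single (a, b \<oplus>\<^bsub>B\<^esub> b') 1 - Poly_Mapping.single (a, b) 1 - Poly_Mapping.single (a, b') 1 \<in> K"
  "a \<in> carrier A \<Longrightarrow> b \<in> carrier B \<Longrightarrow>
    Poly_Mapping.single (c \<odot>\<^bsub>A\<^esub> a, b) 1 - pm_scale c (Poly_Mapping.single (a, b) 1) \<in> K"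
  "a \<in> carrier A \<Longrightarrow> b \<in> carrier B \<Longrightarrow>
    Poly_Mapping.single (a, c \<odot>\<^bsub>B\<^esub> b) 1 - pm_scale c (Poly_Mapping.single (a, b) 1) \<in> K"
  unfolding tensor_kernel_def tensor_relations_def
  by (intro pm.span_base; auto simp del: pm_scale_single)+

lemma relations_cases [consumes 1, case_names add_l add_r smult_l smult_r]:
  assumes "p \<in> tensor_relations A B"
  obtains a a' b where "a \<in> carrier A" "a' \<in> carrier A" "b \<in> carrier B"
      "p = Poly_Mapping.single (a \<oplus>\<^bsub>A\<^esub> a', b) 1 - Poly_Mapping.single (a, b) 1 - Poly_Mapping.single (a', b) 1"
  | a b b' where "a \<in> carrier A" "b \<in> carrier B" "b' \<in> carrier B"
      "p = Poly_Mapping.single (a, b \<oplus>\<^bsub>B\<^esub> b') 1 - Poly_Mapping.single (a, b) 1 - Poly_Mapping.single (a, b') 1"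
  | c a b where "a \<in> carrier A" "b \<in> carrier B"
      "p = Poly_Mapping.single (c \<odot>\<^bsub>A\<^esub> a, b) 1 - pm_scale c (Poly_Mapping.single (a, b) 1)"
  | c a b where "a \<in> carrier A" "b \<in> carrier B"
      "p = Poly_Mapping.single (a, c \<odot>\<^bsub>B\<^esub> b) 1 - pm_scale c (Poly_Mapping.single (a, b) 1)"
  using assms unfolding tensor_relations_def Un_iff mem_Collect_eq by (elim disjE exE conjE) metis+

lemma relations_keys: "p \<in> tensor_relations A B \<Longrightarrow> Poly_Mapping.keys p \<subseteq> carrier A \<times> carrier B"
  by (cases p rule: relations_cases) (simp_all add: keys_diff_subset)

sublocale alg_ideal K TA
  unfolding tensor_kernel_def
proof (rule ideal_span[OF monoid_AB])
  fix p assume "p \<in> tensor_relations A B"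
  then show "Poly_Mapping.keys p \<subseteq> carrier (A \<times>\<times> B)" using relations_keys carrier_AB by metis
next
  fix x p assume "x \<in> carrier (A \<times>\<times> B)" and p: "p \<in> tensor_relations A B"
  then obtain u v where uv: "x = (u, v)" "u \<in> carrier A" "v \<in> carrier B" by (auto simp: carrier_AB)
  from p show "Poly_Mapping.single x 1 \<otimes>\<^bsub>TA\<^esub> p \<in> pm.span (tensor_relations A B)"
    by (cases p rule: relations_cases)
      (use uv in \<open>simp_all add: monoid_algebra_simps bil_diff bil_linear bil_single mult_AB A.r_distr B.r_distr
         A.smult_mult_r B.smult_mult_r kernel_base[unfolded tensor_kernel_def] del: pm_scale_single\<close>)
  from p show "p \<otimes>\<^bsub>TA\<^esub> Poly_Mapping.single x 1 \<in> pm.span (tensor_relations A B)"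
    by (cases p rule: relations_cases)
      (use uv in \<open>simp_all add: monoid_algebra_simps bil_diff bil_linear bil_single mult_AB A.l_distr B.l_distr
         A.smult_mult_l B.smult_mult_l kernel_base[unfolded tensor_kernel_def] del: pm_scale_single\<close>)
qed

lemma Q_eq: "Q = T" by (simp add: tensor_product_def)

lemma ten_eq: "ten a b = cls (Poly_Mapping.single (a, b) 1)"
  by (simp add: tensor_def)

lemma T_vs_alg: "vs_alg T"
  using Q_vs_alg by (simp add: Q_eq)

lemma single_closed: "a \<in> carrier A \<Longrightarrow> b \<in> carrier B \<Longrightarrow> Poly_Mapping.single (a, b) c \<in> carrier TA"
  by (simp add: monoid_algebra_simps carrier_AB)

lemma ten_closed [simp, intro]: "a \<in> carrier A \<Longrightarrow> b \<in> carrier B \<Longrightarrow> ten a b \<in> carrier T"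
  using cls_closed[OF single_closed] by (simp add: ten_eq Q_eq)

lemma TA_minus: "p \<in> carrier TA \<Longrightarrow> q \<in> carrier TA \<Longrightarrow> p \<ominus>\<^bsub>TA\<^esub> q = p - q"
proof -
  assume "p \<in> carrier TA" "q \<in> carrier TA"
  then have "p \<ominus>\<^bsub>TA\<^esub> q = p + pm_scale (- 1) q"
    unfolding a_minus_def using smult_minus_one[of q] by (simp add: monoid_algebra_simps(5,6))
  also have "\<dots> = p - q" by (rule poly_mapping_eqI) (simp add: lookup_add lookup_minus)
  finally show ?thesis .
qed

lemma cls_eqI: "p \<in> carrier TA \<Longrightarrow> q \<in> carrier TA \<Longrightarrow> p - q \<in> K \<Longrightarrow> cls p = cls q"
  by (simp add: cls_eq_iff TA_minus)

lemma ten_add_l: "a \<in> carrier A \<Longrightarrow> a' \<in> carrier A \<Longrightarrow> b \<in> carrier B \<Longrightarrow>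
    ten (a \<oplus>\<^bsub>A\<^esub> a') b = ten a b \<oplus>\<^bsub>T\<^esub> ten a' b"
  unfolding ten_eq Q_eq[symmetric]
  using kernel_base(1)[of a a' b] abelian_monoid.a_closed[OF abelian_monoid_axioms single_closed single_closed, of a b a' b]
  by (subst cls_add, simp_all only: single_closed)
    (intro cls_eqI single_closed A.a_closed, simp_all add: monoid_algebra_simps(5) diff_diff_eq)

lemma ten_add_r: "a \<in> carrier A \<Longrightarrow> b \<in> carrier B \<Longrightarrow> b' \<in> carrier B \<Longrightarrow>
    ten a (b \<oplus>\<^bsub>B\<^esub> b') = ten a b \<oplus>\<^bsub>T\<^esub> ten a b'"
  unfolding ten_eq Q_eq[symmetric]
  using kernel_base(2)[of a b b'] abelian_monoid.a_closed[OF abelian_monoid_axioms single_closed single_closed, of a b a b']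
  by (subst cls_add, simp_all only: single_closed)
    (intro cls_eqI single_closed B.a_closed, simp_all add: monoid_algebra_simps(5) diff_diff_eq)

lemma ten_smult_l: "a \<in> carrier A \<Longrightarrow> b \<in> carrier B \<Longrightarrow> ten (c \<odot>\<^bsub>A\<^esub> a) b = c \<odot>\<^bsub>T\<^esub> ten a b"
  unfolding ten_eq Q_eq[symmetric]
  using kernel_base(3)[of a b c]
  by (subst cls_smult, simp_all only: single_closed monoid_algebra_simps(6) pm_scale_single)
    (intro cls_eqI single_closed A.smult_closed, simp_all)

lemma ten_smult_r: "a \<in> carrier A \<Longrightarrow> b \<in> carrier B \<Longrightarrow> ten a (c \<odot>\<^bsub>B\<^esub> b) = c \<odot>\<^bsub>T\<^esub> ten a b"
  unfolding ten_eq Q_eq[symmetric]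
  using kernel_base(4)[of a b c]
  by (subst cls_smult, simp_all only: single_closed monoid_algebra_simps(6) pm_scale_single)
    (intro cls_eqI single_closed B.smult_closed, simp_all)

lemma ten_mult: "a \<in> carrier A \<Longrightarrow> a' \<in> carrier A \<Longrightarrow> b \<in> carrier B \<Longrightarrow> b' \<in> carrier B \<Longrightarrow>
    ten a b \<otimes>\<^bsub>T\<^esub> ten a' b' = ten (a \<otimes>\<^bsub>A\<^esub> a') (b \<otimes>\<^bsub>B\<^esub> b')"
  unfolding ten_eq Q_eq[symmetric]
  by (subst cls_mult) (auto simp: single_closed monoid_algebra_simps(2) bil_single mult_AB)

lemma T_one: "\<one>\<^bsub>T\<^esub> = ten \<one>\<^bsub>A\<^esub> \<one>\<^bsub>B\<^esub>"
  unfolding ten_eq Q_eq[symmetric] cls_one by (simp add: monoid_algebra_simps(3) DirProd_def)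

context
  fixes C :: "('k, 'c) module" and f
  assumes C: "vs_alg C" and f: "bilinear_map A B C f"
begin

interpretation C: vs_alg C by (rule C)

lemma f_simps:
  "a \<in> carrier A \<Longrightarrow> b \<in> carrier B \<Longrightarrow> f a b \<in> carrier C"
  "a \<in> carrier A \<Longrightarrow> a' \<in> carrier A \<Longrightarrow> b \<in> carrier B \<Longrightarrow> f (a \<oplus>\<^bsub>A\<^esub> a') b = f a b \<oplus>\<^bsub>C\<^esub> f a' b"
  "a \<in> carrier A \<Longrightarrow> b \<in> carrier B \<Longrightarrow> b' \<in> carrier B \<Longrightarrow> f a (b \<oplus>\<^bsub>B\<^esub> b') = f a b \<oplus>\<^bsub>C\<^esub> f a b'"
  "a \<in> carrier A \<Longrightarrow> b \<in> carrier B \<Longrightarrow> f (c \<odot>\<^bsub>A\<^esub> a) b = c \<odot>\<^bsub>C\<^esub> f a b"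
  "a \<in> carrier A \<Longrightarrow> b \<in> carrier B \<Longrightarrow> f a (c \<odot>\<^bsub>B\<^esub> b) = c \<odot>\<^bsub>C\<^esub> f a b"
  using f by (auto simp: bilinear_map_def linear_map_def)

lemma lift_linear: "linear_map TA C (lin_ext C (\<lambda>(a, b). f a b))"
  by (rule C.linear_map_lin_ext_monoid) (auto simp: carrier_AB f_simps)

lemma lift_kernel:
  assumes "p \<in> K"
  shows "lin_ext C (\<lambda>(a, b). f a b) p = \<zero>\<^bsub>C\<^esub>"
proof -
  let ?l = "lin_ext C (\<lambda>(a, b). f a b)"
  let ?N = "{p. Poly_Mapping.keys p \<subseteq> carrier A \<times> carrier B \<and> ?l p = \<zero>\<^bsub>C\<^esub>}"
  have F: "(\<lambda>(a, b). f a b) \<in> carrier A \<times> carrier B \<rightarrow> carrier C" by (auto simp: f_simps)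
  have "K \<subseteq> ?N"
    unfolding tensor_kernel_def
  proof (rule pm.span_minimal)
    show "pm.subspace ?N"
      by (auto simp: pm.subspace_def C.lin_ext_add[OF _ _ F] C.lin_ext_scale[OF _ F]
          dest!: keys_pm_scale[THEN subsetD] Poly_Mapping.keys_add[THEN subsetD])
    show "tensor_relations A B \<subseteq> ?N"
    proof
      fix p assume p: "p \<in> tensor_relations A B"
      have minus: "?l (x - y) = ?l x \<ominus>\<^bsub>C\<^esub> ?l y" if "Poly_Mapping.keys x \<subseteq> carrier A \<times> carrier B" "Poly_Mapping.keys y \<subseteq> carrier A \<times> carrier B" for x y
        by (rule C.lin_ext_diff[OF that F])
      have "?l p = \<zero>\<^bsub>C\<^esub>"
        using p
      proof (cases p rule: relations_cases)
        case (add_l a a' b)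
        then show ?thesis
          by (simp add: minus keys_diff_subset f_simps a_minus_def C.minus_add C.r_neg C.add.m_ac C.r_neg1 C.r_neg2)
      next
        case (add_r a b b')
        then show ?thesis
          by (simp add: minus keys_diff_subset f_simps a_minus_def C.minus_add C.r_neg C.add.m_ac C.r_neg1 C.r_neg2)
      next
        case (smult_l c a b)
        then show ?thesis by (simp add: minus f_simps a_minus_def C.r_neg)
      next
        case (smult_r c a b)
        then show ?thesis by (simp add: minus f_simps a_minus_def C.r_neg)
      qed
      then show "p \<in> ?N" using relations_keys[OF p] by simp
    qed
  qed
  then show ?thesis using assms by blast
qed

lemma lift_ten: "a \<in> carrier A \<Longrightarrow> b \<in> carrier B \<Longrightarrow> tensor_lift C f (ten a b) = f a b"
  unfolding tensor_lift_def ten_eq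
  by (subst quotient_map[OF C lift_linear lift_kernel]) (simp_all add: single_closed f_simps)

lemma lift_T_linear: "linear_map T C (tensor_lift C f)"
  using linear_map_quotient[OF C lift_linear lift_kernel]
  by (simp add: tensor_lift_def[abs_def] Q_eq)

end

end

lemma tensor_map_props:
  assumes "tensor_pair A B" "tensor_pair C D" "linear_map A C f" "linear_map B D g"
  shows "linear_map (tensor_product A B) (tensor_product C D) (tensor_map C D f g)"
    and "a \<in> carrier A \<Longrightarrow> b \<in> carrier B \<Longrightarrow> tensor_map C D f g (tensor A B a b) = tensor C D (f a) (g b)"
proof -
  interpret AB: tensor_pair A B by fact
  interpret CD: tensor_pair C D by fact
  note f = linear_mapD[OF assms(3)] and g = linear_mapD[OF assms(4)]
  have "bilinear_map A B CD.T (\<lambda>a b. CD.ten (f a) (g b))"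
    by (auto simp: bilinear_map_def linear_map_def f g CD.ten_add_l CD.ten_add_r CD.ten_smult_l CD.ten_smult_r)
  from AB.lift_T_linear[OF CD.T_vs_alg this] AB.lift_ten[OF CD.T_vs_alg this]
  show "linear_map AB.T CD.T (tensor_map C D f g)"
    "a \<in> carrier A \<Longrightarrow> b \<in> carrier B \<Longrightarrow> tensor_map C D f g (tensor A B a b) = tensor C D (f a) (g b)"
    by (auto simp: tensor_map_def)
qed

lemma tensor_assoc_props:
  assumes "tensor_pair A B" "tensor_pair B C" "tensor_pair (tensor_product A B) C" "tensor_pair A (tensor_product B C)"
  shows "linear_map (tensor_product A (tensor_product B C)) (tensor_product (tensor_product A B) C) (tensor_assoc A B C)"
    and "a \<in> carrier A \<Longrightarrow> b \<in> carrier B \<Longrightarrow> e \<in> carrier C \<Longrightarrow>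
      tensor_assoc A B C (tensor A (tensor_product B C) a (tensor B C b e)) = tensor (tensor_product A B) C (tensor A B a b) e"
proof -
  interpret AB: tensor_pair A B by fact
  interpret BC: tensor_pair B C by fact
  interpret AB_C: tensor_pair AB.T C by fact
  interpret A_BC: tensor_pair A BC.T by fact
  let ?T = "AB_C.T"
  let ?f = "\<lambda>a. tensor_lift ?T (\<lambda>b c. AB_C.ten (AB.ten a b) c)"
  interpret TT: vs_alg ?T by (rule AB_C.T_vs_alg)
  have 1: "bilinear_map B C ?T (\<lambda>b c. AB_C.ten (AB.ten a b) c)" if "a \<in> carrier A" for a
    using that by (auto simp: bilinear_map_def linear_map_def AB_C.ten_add_l AB_C.ten_add_r AB_C.ten_smult_l
        AB_C.ten_smult_r AB.ten_add_r AB.ten_smult_r)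
  have lin: "linear_map BC.T ?T (?f a)" if "a \<in> carrier A" for a
    by (rule BC.lift_T_linear[OF AB_C.T_vs_alg 1[OF that]])
  have val: "?f a (BC.ten b e) = AB_C.ten (AB.ten a b) e" if "a \<in> carrier A" "b \<in> carrier B" "e \<in> carrier C" for a b e
    by (rule BC.lift_ten[OF AB_C.T_vs_alg 1[OF that(1)] that(2,3)])
  \<comment> \<open>Elements of the inner tensor product need not be pure tensors; this formula on
    representatives gives access to linearity in \<open>a\<close>.\<close>
  have cls: "?f a (BC.cls p) = lin_ext ?T (\<lambda>(b, e). AB_C.ten (AB.ten a b) e) p" if "a \<in> carrier A" "p \<in> carrier BC.TA" for a p
    unfolding tensor_lift_def
    by (rule BC.quotient_map[OF AB_C.T_vs_alg BC.lift_linear[OF AB_C.T_vs_alg 1] BC.lift_kernel[OF AB_C.T_vs_alg 1]]) (use that in auto)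
  have 2: "bilinear_map A BC.T ?T ?f"
    unfolding bilinear_map_def
  proof (intro conjI ballI lin)
    fix X assume "X \<in> carrier BC.T"
    then obtain p where p: "p \<in> carrier BC.TA" "X = BC.cls p" using BC.cls_cases by (auto simp: BC.Q_eq)
    have keys: "Poly_Mapping.keys p \<subseteq> carrier B \<times> carrier C"
      using p(1) by (simp add: monoid_algebra_simps BC.carrier_AB)
    show "linear_map A ?T (\<lambda>a. ?f a X)"
      unfolding linear_map_def
    proof (intro conjI Pi_I ballI allI)
      fix a a' c assume a: "a \<in> carrier A"
      show "?f a X \<in> carrier ?T" using linear_mapD(1)[OF lin[OF a]] p by (simp add: BC.Q_eq[symmetric])
      show "?f (c \<odot>\<^bsub>A\<^esub> a) X = c \<odot>\<^bsub>?T\<^esub> ?f a X" for c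
        unfolding p(2) cls[OF a p(1)] cls[OF AB.A.smult_closed[OF a] p(1)]
        using keys
      proof (induction p rule: keys_induct)
        case (single x e)
        then show ?case using a by (auto simp: AB.ten_smult_l AB_C.ten_smult_l TT.smult_smult mult.commute)
      next
        case (add p q)
        then show ?case using a
          by (subst (1 2) TT.lin_ext_add[where S = "carrier B \<times> carrier C"]) 
             (auto intro!: TT.smult_r_distr[symmetric] TT.lin_ext_closed)
      qed simp
      assume a': "a' \<in> carrier A"
      show "?f (a \<oplus>\<^bsub>A\<^esub> a') X = ?f a X \<oplus>\<^bsub>?T\<^esub> ?f a' X"
        unfolding p(2) cls[OF a p(1)] cls[OF a' p(1)] cls[OF AB.A.a_closed[OF a a'] p(1)]
        using keys
      proof (induction p rule: keys_induct)
        case (single x e)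
        then show ?case using a a' by (auto simp: AB.ten_add_l AB_C.ten_add_l TT.smult_r_distr)
      next
        case (add p q)
        have c: "lin_ext ?T (\<lambda>(b, e). AB_C.ten (AB.ten a b) e) p \<in> carrier ?T" if "a \<in> carrier A" "Poly_Mapping.keys p \<subseteq> carrier B \<times> carrier C" for a p
          using that by (intro TT.lin_ext_closed) auto
        show ?case using a a' add
          by (subst (1 2 3) TT.lin_ext_add[where S = "carrier B \<times> carrier C"]) 
             (auto simp: TT.add.m_ac c)
      qed simp
    qed
  qed
  show "linear_map A_BC.T ?T (tensor_assoc A B C)"
    unfolding tensor_assoc_def Let_def by (rule A_BC.lift_T_linear[OF AB_C.T_vs_alg 2])
  show "tensor_assoc A B C (A_BC.ten a (BC.ten b e)) = AB_C.ten (AB.ten a b) e"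
    if "a \<in> carrier A" "b \<in> carrier B" "e \<in> carrier C"
    unfolding tensor_assoc_def Let_def using that
    by (subst A_BC.lift_ten[OF AB_C.T_vs_alg 2]) (auto simp: val)
qed

lemma (in ring) add_minus_minus:
  assumes "a \<in> carrier R" "b \<in> carrier R"
  shows "a \<oplus> b \<ominus> a \<ominus> b = \<zero>"
proof -
  have "a \<oplus> b \<ominus> a \<ominus> b = (a \<oplus> b) \<oplus> \<ominus> (a \<oplus> b)"
    using assms by (simp add: a_minus_def a_assoc minus_add)
  then show ?thesis using assms by (simp add: r_neg)
qed

lemma (in ring) diff_zero_iff: "a \<in> carrier R \<Longrightarrow> b \<in> carrier R \<Longrightarrow> a \<ominus> b = \<zero> \<longleftrightarrow> a = b"
proof -
  assume ab: "a \<in> carrier R" "b \<in> carrier R"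
  have "a = (a \<ominus> b) \<oplus> b" using ab by (simp add: a_minus_def a_assoc l_neg)
  then show ?thesis using ab by (auto simp: a_minus_def r_neg)
qed

section \<open>Quotients of the tensor algebra\<close>

lemma monoid_word_monoid: "monoid word_monoid"
  by (rule monoidI) (auto simp: word_monoid_def)

lemma free_algebra_vs_alg: "vs_alg (free_algebra :: ('k::field, 'g list \<Rightarrow>\<^sub>0 'k) module)"
  by (rule monoid_algebra_vs_alg[OF monoid_word_monoid])

lemma carrier_free [simp]: "carrier free_algebra = UNIV"
  by (simp add: monoid_algebra_simps word_monoid_def)

lemma free_one: "\<one>\<^bsub>free_algebra\<^esub> = word []"
  by (simp add: monoid_algebra_simps word_monoid_def)

lemma free_mult: "p \<otimes>\<^bsub>free_algebra\<^esub> q = bil (\<lambda>u v. word (u @ v)) p q"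
  by (simp add: monoid_algebra_simps word_monoid_def)

definition surround :: "'g list \<Rightarrow> 'g list \<Rightarrow> ('g list \<Rightarrow>\<^sub>0 'k::field) \<Rightarrow> ('g list \<Rightarrow>\<^sub>0 'k)" where
  "surround u v p = lc pm_scale (\<lambda>w. word (u @ w @ v)) p"

lemma surround_mult:
  "word x \<otimes>\<^bsub>free_algebra\<^esub> surround u v p = surround (x @ u) v p"
  "surround u v p \<otimes>\<^bsub>free_algebra\<^esub> word x = surround u (v @ x) p"
proof -
  have "bil (\<lambda>u v. word (u @ v)) (word x) (lc pm_scale (\<lambda>w. word (u @ w @ v)) p)
     = lc pm_scale (\<lambda>w. word ((x @ u) @ w @ v)) p"
    unfolding bil_lc by (simp add: pm.lc_lc)
  then show "word x \<otimes>\<^bsub>free_algebra\<^esub> surround u v p = surround (x @ u) v p"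
    unfolding free_mult surround_def .
  have "bil (\<lambda>u v. word (u @ v)) (lc pm_scale (\<lambda>w. word (u @ w @ v)) p) (word x)
     = lc pm_scale (\<lambda>w. word (u @ w @ v @ x)) p"
    unfolding bil_lc by (simp add: pm.lc_lc)
  then show "surround u v p \<otimes>\<^bsub>free_algebra\<^esub> word x = surround u (v @ x) p"
    unfolding free_mult surround_def .
qed

locale tensor_quotient =
  fixes scale :: "'k::field \<Rightarrow> 'g::ab_group_add \<Rightarrow> 'g" and R :: "('g list \<Rightarrow>\<^sub>0 'k) set"
begin

abbreviation "TT \<equiv> free_algebra :: ('k, 'g list \<Rightarrow>\<^sub>0 'k) module"
abbreviation "rels \<equiv> linear_relations scale \<union> R"

sublocale alg_ideal "relation_ideal scale R" TT
proof -
  interpret T: vs_alg TT by (rule free_algebra_vs_alg)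
  have "ideal (relation_ideal scale R) TT"
    unfolding relation_ideal_def by (rule T.genideal_ideal) simp
  then show "alg_ideal (relation_ideal scale R) TT" by (intro alg_ideal.intro T.vs_alg_axioms)
qed

lemma Q_eq: "Q = tensor_algebra_mod scale R" by (simp add: tensor_algebra_mod_def)

lemma cls_eq: "cls = tensor_algebra_class scale R" by (rule ext) (simp add: tensor_algebra_class_def)

lemma rels_ideal: "p \<in> rels \<Longrightarrow> p \<in> relation_ideal scale R"
  unfolding relation_ideal_def using genideal_self[of rels] by auto

text \<open>\<open>surround\<close> multiplies by words from both sides. The span of these multiples
  of the relations is already an ideal, so a linear map needs to be checked only on them.\<close>

lemma relation_ideal_span: "relation_ideal scale R \<subseteq> pm.span {surround u v p | u v p. p \<in> rels}"
proof -
  let ?S = "{surround u v p | u v p. p \<in> rels}"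
  interpret S: alg_ideal "pm.span ?S" TT
  proof (rule ideal_span[OF monoid_word_monoid])
    fix x p assume "p \<in> ?S"
    then obtain u v q where p: "p = surround u v q" "q \<in> rels" by blast
    have S: "surround u v q \<in> pm.span ?S" for u v by (rule pm.span_base) (use p(2) in blast)
    show "word x \<otimes>\<^bsub>TT\<^esub> p \<in> pm.span ?S" "p \<otimes>\<^bsub>TT\<^esub> word x \<in> pm.span ?S"
      unfolding p(1) surround_mult by (rule S)+
  qed (simp add: word_monoid_def)
  show ?thesis
    unfolding relation_ideal_def
  proof (rule genideal_minimal)
    show "rels \<subseteq> pm.span ?S"
    proof
      fix p assume "p \<in> rels"
      moreover have "p = surround [] [] p" by (simp add: surround_def lc_single_id)
      ultimately show "p \<in> pm.span ?S" by (intro pm.span_base) blast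
    qed
  qed (rule S.ideal_axioms)
qed

lemma ideal_kill:
  assumes B: "vs_alg B" and f: "\<And>w. f w \<in> carrier B"
    and rel: "\<And>u v p. p \<in> rels \<Longrightarrow> lin_ext B (\<lambda>w. f (u @ w @ v)) p = \<zero>\<^bsub>B\<^esub>"
    and x: "x \<in> relation_ideal scale R"
  shows "lin_ext B f x = \<zero>\<^bsub>B\<^esub>"
proof -
  interpret B: vs_alg B by fact
  have F: "f \<in> UNIV \<rightarrow> carrier B" using f by auto
  have "pm.span {surround u v p | u v p. p \<in> rels} \<subseteq> {x. lin_ext B f x = \<zero>\<^bsub>B\<^esub>}"
  proof (rule pm.span_minimal)
    show "pm.subspace {x. lin_ext B f x = \<zero>\<^bsub>B\<^esub>}"
      by (auto simp: pm.subspace_def B.lin_ext_add[OF _ _ F] B.lin_ext_scale[OF _ F])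
    have "lin_ext B f (surround u v p) = lin_ext B (\<lambda>w. f (u @ w @ v)) p" for u v p
    proof -
      have "Poly_Mapping.keys p \<subseteq> UNIV" by simp
      then show ?thesis unfolding surround_def
        by (induction p rule: keys_induct)
          (use f in \<open>simp_all add: pm.lc_add B.lin_ext_add[where S = UNIV] Pi_def\<close>)
    qed
    then show "{surround u v p | u v p. p \<in> rels} \<subseteq> {x. lin_ext B f x = \<zero>\<^bsub>B\<^esub>}"
      using rel by auto
  qed
  then show ?thesis using relation_ideal_span x by blast
qed

lemma lin_ext_linear_rels:
  assumes B: "vs_alg B" and f: "\<And>x. f [x] \<in> carrier B" and p: "p \<in> linear_relations scale"
    and add: "\<And>x y. f [x + y] = f [x] \<oplus>\<^bsub>B\<^esub> f [y]" and scale: "\<And>c x. f [scale c x] = c \<odot>\<^bsub>B\<^esub> f [x]"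
  shows "lin_ext B f p = \<zero>\<^bsub>B\<^esub>"
proof -
  interpret B: vs_alg B by fact
  note minus = B.lin_ext_diff[where S = "{w. length w = 1}"]
  have F: "f \<in> {w. length w = 1} \<rightarrow> carrier B" using f by (auto simp: length_Suc_conv)
  from p consider x y where "p = word [x + y] - word [x] - word [y]"
    | c x where "p = word [scale c x] - pm_scale c (word [x])"
    by (auto simp: linear_relations_def)
  then show ?thesis
  proof cases
    case 1
    then show ?thesis
      by (simp add: minus[OF _ _ F] keys_diff_subset f add B.add_minus_minus)
  next
    case 2
    then show ?thesis by (simp add: minus[OF _ _ F] f scale a_minus_def B.r_neg)
  qed
qed

abbreviation gen :: "'g \<Rightarrow> ('g list \<Rightarrow>\<^sub>0 'k) set" where "gen x \<equiv> cls (word [x])"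

lemma cls_word_append: "cls (word (u @ v)) = cls (word u) \<otimes>\<^bsub>Q\<^esub> cls (word v)"
  by (subst cls_mult) (simp_all add: free_mult bil_single)

lemma TT_minus: "p \<ominus>\<^bsub>TT\<^esub> q = p - q"
  unfolding a_minus_def using smult_minus_one[of q] by (simp add: monoid_algebra_simps(5,6))

lemma gen_add: "gen (x + y) = gen x \<oplus>\<^bsub>Q\<^esub> gen y"
proof -
  have "word [x + y] - word [x] - word [y] \<in> relation_ideal scale R"
    by (rule rels_ideal) (auto simp: linear_relations_def)
  then show ?thesis
    by (subst cls_add, simp, simp, subst cls_eq_iff)
      (simp_all add: monoid_algebra_simps(5) TT_minus diff_diff_eq)
qed

lemma gen_scale: "gen (scale c x) = c \<odot>\<^bsub>Q\<^esub> gen x"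
proof -
  have "word [scale c x] - pm_scale c (word [x]) \<in> relation_ideal scale R"
    by (rule rels_ideal) (auto simp: linear_relations_def)
  then show ?thesis
    by (subst cls_smult, simp, subst cls_eq_iff)
      (simp_all add: monoid_algebra_simps(6) TT_minus del: pm_scale_single)
qed

text \<open>The universal property of a quotient of the tensor algebra: a linear map into
  \<open>B\<close> that is compatible with \<open>R\<close> extends to products of
  generators.\<close>

context
  fixes B :: "('k, 'b) module" and g :: "'g \<Rightarrow> 'b"
  assumes B: "vs_alg B" and g: "\<And>x. g x \<in> carrier B"
    and g_add: "\<And>x y. g (x + y) = g x \<oplus>\<^bsub>B\<^esub> g y" and g_scale: "\<And>c x. g (scale c x) = c \<odot>\<^bsub>B\<^esub> g x"
    and g_rel: "\<And>p. p \<in> R \<Longrightarrow> lin_ext B (\<lambda>w. foldr (\<lambda>x a. g x \<otimes>\<^bsub>B\<^esub> a) w \<one>\<^bsub>B\<^esub>) p = \<zero>\<^bsub>B\<^esub>"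
begin

interpretation B: vs_alg B by (rule B)

abbreviation fw where "fw w \<equiv> foldr (\<lambda>x a. g x \<otimes>\<^bsub>B\<^esub> a) w \<one>\<^bsub>B\<^esub>"

lemma fw_closed: "fw w \<in> carrier B"
  by (induction w) (auto simp: g)

lemma fw_append: "fw (u @ v) = fw u \<otimes>\<^bsub>B\<^esub> fw v"
  by (induction u) (simp_all add: fw_closed[simplified] g B.m_assoc del: foldr_append add: foldr_append[where xs = "[]"])

lemma fw_kill: "p \<in> relation_ideal scale R \<Longrightarrow> lin_ext B fw p = \<zero>\<^bsub>B\<^esub>"
proof (rule ideal_kill[OF B fw_closed])
  fix u v p assume p: "p \<in> rels"
  have lin: "linear_map B B (\<lambda>x. fw u \<otimes>\<^bsub>B\<^esub> (x \<otimes>\<^bsub>B\<^esub> fw v))"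
    by (rule linear_map_comp[OF B.linear_map_mult_r B.linear_map_mult_l]) (rule fw_closed)+
  have "lin_ext B fw p = \<zero>\<^bsub>B\<^esub>"
    using p unfolding Un_iff
  proof
    assume lin: "p \<in> linear_relations scale"
    show ?thesis by (rule lin_ext_linear_rels[OF B _ lin]) (simp_all add: g g_add g_scale)
  qed (rule g_rel)
  then show "lin_ext B (\<lambda>w. fw (u @ w @ v)) p = \<zero>\<^bsub>B\<^esub>"
    unfolding fw_append
    by (subst linear_map_lin_ext[OF B B lin, symmetric]) (simp_all add: fw_closed)
qed

lemma fw_linear: "linear_map TT B (lin_ext B fw)"
  by (rule B.linear_map_lin_ext_monoid) (auto simp: fw_closed)

lemma quotient_lift_linear: "linear_map Q B (quotient_lift B g)"
  using linear_map_quotient[OF B fw_linear fw_kill]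
  by (simp add: quotient_lift_def[abs_def] free_algebra_lift_def[abs_def])

lemma quotient_lift_word: "quotient_lift B g (cls (word w)) = fw w"
  unfolding quotient_lift_def free_algebra_lift_def
  by (subst quotient_map[OF B fw_linear fw_kill]) (simp_all add: fw_closed)

end

end

lemma ground_field_vs_alg: "vs_alg (ground_field :: ('k::field, 'k) module)"
proof -
  have "ring (ground_field :: ('k, 'k) module)"
  proof (rule ringI)
    show "abelian_group (ground_field :: ('k, 'k) module)"
      by (rule abelian_groupI) (auto simp: ground_field_def add_ac intro: exI[of _ "- _"] left_minus)
    show "monoid (ground_field :: ('k, 'k) module)"
      by (rule monoidI) (auto simp: ground_field_def)
  qed (auto simp: ground_field_def algebra_simps)
  moreover have "vs_alg_axioms (ground_field :: ('k, 'k) module)"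
    unfolding vs_alg_axioms_def
    by (intro conjI allI impI) (simp_all add: ground_field_def distrib_left distrib_right)
  ultimately show ?thesis by (rule vs_alg.intro)
qed

section \<open>The universal enveloping algebra\<close>

context lie_algebra begin

abbreviation "Lrel \<equiv> lie_relations bracket :: ('g list \<Rightarrow>\<^sub>0 'k) set"

sublocale ue: tensor_quotient scale Lrel .

abbreviation "U \<equiv> uea scale bracket"
abbreviation \<iota> where "\<iota> x \<equiv> uea_incl scale bracket x"

lemma ue_Q: "ue.Q = U" by (simp add: ue.Q_eq uea_def)
lemma \<iota>_eq: "\<iota> x = ue.gen x" by (simp add: uea_incl_def ue.cls_eq)

lemma U_vs_alg: "vs_alg U"
  using ue.Q_vs_alg by (simp add: ue_Q)

sublocale U: vs_alg U by (rule U_vs_alg)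

sublocale UU: tensor_pair U U by (intro tensor_pair.intro U_vs_alg)

abbreviation "UU \<equiv> tensor_product U U"

sublocale UUr: vs_alg UU by (rule UU.T_vs_alg)

sublocale UUU: tensor_pair UU U by (intro tensor_pair.intro U_vs_alg UU.T_vs_alg)

sublocale U_UU: tensor_pair U UU by (intro tensor_pair.intro U_vs_alg UU.T_vs_alg)

abbreviation "UUU \<equiv> tensor_product UU U"

sublocale UUUr: vs_alg UUU by (rule UUU.T_vs_alg)

lemma word_closed [simp, intro]: "ue.cls (word w) \<in> carrier U"
  using ue.cls_closed[of "word w"] by (simp add: ue_Q)

lemma word_append: "ue.cls (word (u @ v)) = ue.cls (word u) \<otimes>\<^bsub>U\<^esub> ue.cls (word v)"
  using ue.cls_word_append[of u v] by (simp add: ue_Q)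

lemma word_Nil: "ue.cls (word []) = \<one>\<^bsub>U\<^esub>"
  using ue.cls_one unfolding ue_Q free_one ..

lemma \<iota>_closed [simp, intro]: "\<iota> x \<in> carrier U"
  by (simp add: \<iota>_eq)

lemma \<iota>_add: "\<iota> (x + y) = \<iota> x \<oplus>\<^bsub>U\<^esub> \<iota> y"
  using ue.gen_add by (simp add: \<iota>_eq ue_Q)

lemma \<iota>_scale: "\<iota> (scale c x) = c \<odot>\<^bsub>U\<^esub> \<iota> x"
  using ue.gen_scale by (simp add: \<iota>_eq ue_Q)

lemma \<iota>_bracket: "\<iota> x \<otimes>\<^bsub>U\<^esub> \<iota> y \<ominus>\<^bsub>U\<^esub> \<iota> y \<otimes>\<^bsub>U\<^esub> \<iota> x = \<iota> (bracket x y)"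
proof -
  let ?p = "word [x, y] - word [y, x] - word [bracket x y]"
  have "?p \<in> relation_ideal scale Lrel"
    by (rule ue.rels_ideal) (auto simp: lie_relations_def)
  then have "ue.cls ?p = \<zero>\<^bsub>U\<^esub>"
    using ue.a_rcos_const ue.cls_zero ue.zero_closed by (metis ue_Q ue.additive_subgroup_axioms additive_subgroup.zero_closed)
  moreover have "ue.cls (p - q) = ue.cls p \<ominus>\<^bsub>U\<^esub> ue.cls q" for p q
  proof -
    have "p - q = p + pm_scale (- 1) q" by (rule poly_mapping_eqI) (simp add: lookup_add lookup_minus)
    then have "ue.cls (p - q) = ue.cls p \<oplus>\<^bsub>U\<^esub> (- 1) \<odot>\<^bsub>U\<^esub> ue.cls q"
      using ue.cls_add[of p "pm_scale (- 1) q"] ue.cls_smult[of q "- 1"]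
      by (simp add: ue_Q monoid_algebra_simps(5,6))
    then show ?thesis using ue.cls_closed[of q] by (simp add: U.smult_minus_one ue_Q a_minus_def)
  qed
  ultimately have "(\<iota> x \<otimes>\<^bsub>U\<^esub> \<iota> y \<ominus>\<^bsub>U\<^esub> \<iota> y \<otimes>\<^bsub>U\<^esub> \<iota> x) \<ominus>\<^bsub>U\<^esub> \<iota> (bracket x y) = \<zero>\<^bsub>U\<^esub>"
    using word_append[of "[x]" "[y]"] word_append[of "[y]" "[x]"] by (simp add: \<iota>_eq)
  then show ?thesis by (simp add: U.diff_zero_iff)
qed

subsection \<open>Coproduct and counit\<close>

abbreviation prim :: "'g \<Rightarrow> _" where
  "prim x \<equiv> UU.ten (\<iota> x) \<one>\<^bsub>U\<^esub> \<oplus>\<^bsub>UU\<^esub> UU.ten \<one>\<^bsub>U\<^esub> (\<iota> x)"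

text \<open>The mixed terms of the product are symmetric in \<open>x\<close> and \<open>y\<close>
  and cancel in the commutator.\<close>

lemma prim_commutator: "prim x \<otimes>\<^bsub>UU\<^esub> prim y \<ominus>\<^bsub>UU\<^esub> prim y \<otimes>\<^bsub>UU\<^esub> prim x = prim (bracket x y)"
proof -
  have m: "prim x \<otimes>\<^bsub>UU\<^esub> prim y = UU.ten (\<iota> x \<otimes>\<^bsub>U\<^esub> \<iota> y) \<one>\<^bsub>U\<^esub> \<oplus>\<^bsub>UU\<^esub> UU.ten \<one>\<^bsub>U\<^esub> (\<iota> x \<otimes>\<^bsub>U\<^esub> \<iota> y)
      \<oplus>\<^bsub>UU\<^esub> (UU.ten (\<iota> x) (\<iota> y) \<oplus>\<^bsub>UU\<^esub> UU.ten (\<iota> y) (\<iota> x))" for x y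
    by (simp add: UUr.l_distr UUr.r_distr UU.ten_mult UUr.a_ac)
  have diff: "(a \<oplus>\<^bsub>UU\<^esub> b \<oplus>\<^bsub>UU\<^esub> s) \<ominus>\<^bsub>UU\<^esub> (a' \<oplus>\<^bsub>UU\<^esub> b' \<oplus>\<^bsub>UU\<^esub> s) = (a \<ominus>\<^bsub>UU\<^esub> a') \<oplus>\<^bsub>UU\<^esub> (b \<ominus>\<^bsub>UU\<^esub> b')"
    if "a \<in> carrier UU" "b \<in> carrier UU" "a' \<in> carrier UU" "b' \<in> carrier UU" "s \<in> carrier UU" for a b a' b' s
    using that by (simp add: a_minus_def UUr.minus_add UUr.a_ac UUr.r_neg UUr.r_neg1 UUr.r_neg2)
  have ml: "UU.ten (a \<ominus>\<^bsub>U\<^esub> a') b = UU.ten a b \<ominus>\<^bsub>UU\<^esub> UU.ten a' b"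
    and mr: "UU.ten b (a \<ominus>\<^bsub>U\<^esub> a') = UU.ten b a \<ominus>\<^bsub>UU\<^esub> UU.ten b a'"
    if "a \<in> carrier U" "a' \<in> carrier U" "b \<in> carrier U" for a a' b
    using that by (simp_all add: a_minus_def U.smult_minus_one[symmetric] UUr.smult_minus_one[symmetric]
        UU.ten_add_l UU.ten_add_r UU.ten_smult_l UU.ten_smult_r)
  have "prim x \<otimes>\<^bsub>UU\<^esub> prim y \<ominus>\<^bsub>UU\<^esub> prim y \<otimes>\<^bsub>UU\<^esub> prim x
     = UU.ten (\<iota> x \<otimes>\<^bsub>U\<^esub> \<iota> y \<ominus>\<^bsub>U\<^esub> \<iota> y \<otimes>\<^bsub>U\<^esub> \<iota> x) \<one>\<^bsub>U\<^esub> \<oplus>\<^bsub>UU\<^esub> UU.ten \<one>\<^bsub>U\<^esub> (\<iota> x \<otimes>\<^bsub>U\<^esub> \<iota> y \<ominus>\<^bsub>U\<^esub> \<iota> y \<otimes>\<^bsub>U\<^esub> \<iota> x)"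
    unfolding m[of x y] m[of y x] UUr.a_comm[OF UU.ten_closed[OF \<iota>_closed \<iota>_closed] UU.ten_closed[OF \<iota>_closed \<iota>_closed], of y x x y]
    by (subst diff) (simp_all add: ml mr)
  then show ?thesis by (simp add: \<iota>_bracket)
qed

lemma lie_rel_kill:
  assumes B: "vs_alg B" and g: "\<And>x. g x \<in> carrier B"
    and br: "\<And>x y. g x \<otimes>\<^bsub>B\<^esub> g y \<ominus>\<^bsub>B\<^esub> g y \<otimes>\<^bsub>B\<^esub> g x = g (bracket x y)"
    and p: "p \<in> Lrel"
  shows "lin_ext B (\<lambda>w. foldr (\<lambda>x a. g x \<otimes>\<^bsub>B\<^esub> a) w \<one>\<^bsub>B\<^esub>) p = \<zero>\<^bsub>B\<^esub>"
proof -
  interpret B: vs_alg B by fact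
  let ?f = "\<lambda>w. foldr (\<lambda>x a. g x \<otimes>\<^bsub>B\<^esub> a) w \<one>\<^bsub>B\<^esub>"
  have F: "?f w \<in> carrier B" for w by (induction w) (auto simp: g)
  then have F': "?f \<in> UNIV \<rightarrow> carrier B" by auto
  obtain x y where "p = word [x, y] - word [y, x] - word [bracket x y]" using p by (auto simp: lie_relations_def)
  then show ?thesis
    by (simp add: B.lin_ext_diff[OF _ _ F'] B.lin_ext_single[where f = ?f] F g br B.diff_zero_iff)
qed

abbreviation "\<Delta> \<equiv> uea_coproduct scale bracket"

lemma prim_closed: "prim x \<in> carrier UU" by simp

lemma prim_add: "prim (x + y) = prim x \<oplus>\<^bsub>UU\<^esub> prim y"
  by (simp add: \<iota>_add UU.ten_add_l UU.ten_add_r UUr.a_ac)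

lemma prim_scale: "prim (scale c x) = c \<odot>\<^bsub>UU\<^esub> prim x"
  by (simp add: \<iota>_scale UU.ten_smult_l UU.ten_smult_r UUr.smult_r_distr)

lemma coproduct_linear: "linear_map U UU \<Delta>"
  using ue.quotient_lift_linear[OF UU.T_vs_alg prim_closed prim_add prim_scale
      lie_rel_kill[OF UU.T_vs_alg prim_closed prim_commutator]]
  by (simp add: uea_coproduct_def Let_def ue_Q)

lemma coproduct_word: "\<Delta> (ue.cls (word w)) = foldr (\<lambda>x a. prim x \<otimes>\<^bsub>UU\<^esub> a) w \<one>\<^bsub>UU\<^esub>"
  using ue.quotient_lift_word[OF UU.T_vs_alg prim_closed prim_add prim_scale
      lie_rel_kill[OF UU.T_vs_alg prim_closed prim_commutator]]
  by (simp add: uea_coproduct_def Let_def)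

lemma
  shows counit_linear: "linear_map U ground_field uea_counit"
    and counit_word: "uea_counit (ue.cls (word w)) = (if w = [] then 1 else 0)"
proof -
  let ?g = "\<lambda>x::'g. 0 :: 'k"
  have g: "?g x \<in> carrier ground_field" "?g (x + y) = ?g x \<oplus>\<^bsub>ground_field\<^esub> ?g y"
    "?g (scale c x) = c \<odot>\<^bsub>ground_field\<^esub> ?g x"
    "?g x \<otimes>\<^bsub>ground_field\<^esub> ?g y \<ominus>\<^bsub>ground_field\<^esub> ?g y \<otimes>\<^bsub>ground_field\<^esub> ?g x = ?g (bracket x y)" for x y c
    using ring.diff_zero_iff[OF vs_alg.axioms(1)[OF ground_field_vs_alg], of "0::'k" 0]
    by (simp_all add: ground_field_def)
  note * = ground_field_vs_alg g(1,2,3) lie_rel_kill[OF ground_field_vs_alg g(1,4)]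
  show "linear_map U ground_field uea_counit"
    using ue.quotient_lift_linear[OF *] by (simp add: uea_counit_def ue_Q)
  show "uea_counit (ue.cls (word w)) = (if w = [] then 1 else 0)"
    using ue.quotient_lift_word[OF *, of w] by (cases w) (simp_all add: uea_counit_def ground_field_def)
qed

end

section \<open>Twists from twist data\<close>

lemma (in vs_alg) lin_ext_lc:
  assumes "\<And>x. x \<in> Poly_Mapping.keys p \<Longrightarrow> Poly_Mapping.keys (h x) \<subseteq> S" "f \<in> S \<rightarrow> carrier A"
  shows "lin_ext A f (lc pm_scale h p) = lin_ext A (\<lambda>x. lin_ext A f (h x)) p"
proof -
  have "Poly_Mapping.keys p \<subseteq> Poly_Mapping.keys p" by simp
  then show ?thesis
  proof (induction p rule: keys_induct)
    case (single x c)
    then have "Poly_Mapping.keys (h x) \<subseteq> S" by (rule assms(1))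
    then show ?case using assms(2)
      by (subst lin_ext_single) (auto simp: lin_ext_scale[where S = S])
  next
    case (add q q')
    have k: "Poly_Mapping.keys (lc pm_scale h q) \<subseteq> S" if "Poly_Mapping.keys q \<subseteq> Poly_Mapping.keys p" for q
      by (rule keys_lc_subset) (use that assms(1) in blast)
    have c: "(\<lambda>x. lin_ext A f (h x)) \<in> Poly_Mapping.keys p \<rightarrow> carrier A"
      by (intro Pi_I lin_ext_closed) (use assms in blast)
    show ?case
      unfolding pm.lc_add lin_ext_add[OF k[OF add.hyps(1)] k[OF add.hyps(2)] assms(2)]
        lin_ext_add[OF add.hyps c] add.IH ..
  qed simp
qed

text \<open>The vectors \<open>y\<close> realise the abstract structure constants in g, so that
  words in the indices become elements of U(g).\<close>

locale lie_twist = lie_algebra scale bracket + twist_data d C c \<Gamma> R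
  for scale :: "'k::field_char_0 \<Rightarrow> 'g::ab_group_add \<Rightarrow> 'g" and bracket and d and C c \<Gamma> :: "nat \<Rightarrow> nat \<Rightarrow> nat \<Rightarrow> 'k" and R +
  fixes y :: "nat \<Rightarrow> 'g"
  assumes y_bracket: "i < d \<Longrightarrow> j < d \<Longrightarrow> bracket (y i) (y j) = (\<Sum>l<d. scale (c i j l) (y l))"
begin

definition ev :: "nat list \<Rightarrow> ('g list \<Rightarrow>\<^sub>0 'k) set" where
  "ev w = ue.cls (word (map y w))"

lemma ev_closed [simp, intro]: "ev w \<in> carrier U"
  by (simp add: ev_def)

lemma ev_append: "ev (u @ v) = ev u \<otimes>\<^bsub>U\<^esub> ev v"
  by (simp add: ev_def word_append)

lemma ev_Nil: "ev [] = \<one>\<^bsub>U\<^esub>"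
  by (simp add: ev_def word_Nil)

lemma ev_single: "ev [i] = \<iota> (y i)"
  by (simp add: ev_def \<iota>_eq)

text \<open>The relators of U(h), with \<open>\<chi>\<close> inserting a word into one slot of a
  triple.\<close>

definition rel :: "(nat list \<Rightarrow> 'x) \<Rightarrow> nat list \<Rightarrow> nat \<Rightarrow> nat \<Rightarrow> nat list \<Rightarrow> ('x \<Rightarrow>\<^sub>0 'k)" where
  "rel \<chi> u i j v = Poly_Mapping.single (\<chi> (u @ i # j # v)) 1 - Poly_Mapping.single (\<chi> (u @ j # i # v)) 1
     - (\<Sum>l<d. pm_scale (c i j l) (Poly_Mapping.single (\<chi> (u @ l # v)) 1))"

lemma \<iota>_zero: "\<iota> 0 = \<zero>\<^bsub>U\<^esub>"
  using \<iota>_scale[of 0 0] by simp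

lemma \<iota>_sum: "finite I \<Longrightarrow> \<iota> (\<Sum>l\<in>I. f l) = (\<Oplus>\<^bsub>U\<^esub>l\<in>I. \<iota> (f l))"
  by (induction I rule: finite_induct) (auto simp: \<iota>_add \<iota>_zero Pi_def)

text \<open>A map that factors linearly through \<open>ev\<close> kills the relators because
  \<open>\<iota>\<close> turns brackets into commutators.\<close>

lemma lin_ext_rel:
  assumes B: "vs_alg B" and \<phi>: "linear_map U B \<phi>" and E: "\<And>w. E (\<chi> w) = \<phi> (ev w)" and ij: "i < d" "j < d"
  shows "lin_ext B E (rel \<chi> u i j v) = \<zero>\<^bsub>B\<^esub>"
proof -
  interpret B: vs_alg B by fact
  note \<phi>D = linear_mapD[OF \<phi>]
  let ?\<psi> = "\<lambda>x. \<phi> (ev u \<otimes>\<^bsub>U\<^esub> (x \<otimes>\<^bsub>U\<^esub> ev v))"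
  have \<psi>: "linear_map U B ?\<psi>"
    by (intro linear_map_comp[OF linear_map_comp[OF U.linear_map_mult_r U.linear_map_mult_l] \<phi>]) auto
  note \<psi>D = linear_mapD[OF \<psi>]
  have E3: "E (\<chi> (u @ w @ v)) = ?\<psi> (ev w)" for w
    by (simp add: E ev_append)
  have F: "E \<in> range \<chi> \<rightarrow> carrier B" using E \<phi>D(1) by auto
  have sum_cl: "lin_ext B E (\<Sum>l<d. pm_scale (c i j l) (Poly_Mapping.single (\<chi> (u @ l # v)) 1)) = ?\<psi> (\<iota> (bracket (y i) (y j)))"
  proof -
    have cl: "E (\<chi> w) \<in> carrier B" for w by (simp add: E \<phi>D(1))
    have "lin_ext B E (\<Sum>l<d. pm_scale (c i j l) (Poly_Mapping.single (\<chi> (u @ l # v)) 1))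
        = (\<Oplus>\<^bsub>B\<^esub>l\<in>{..<d}. c i j l \<odot>\<^bsub>B\<^esub> E (\<chi> (u @ l # v)))"
      by (subst B.lin_ext_sum[OF _ F]) (auto simp: B.lin_ext_single cl intro!: B.finsum_cong')
    also have "\<dots> = lin_ext B (\<lambda>l. ?\<psi> (\<iota> (y l))) (\<Sum>l<d. Poly_Mapping.single l (c i j l))"
      using E3[of "[_]"] cl by (subst B.lin_ext_sum[where S = UNIV]) (auto simp: ev_single \<psi>D(1) intro!: B.finsum_cong')
    also have "\<dots> = ?\<psi> (lin_ext U (\<lambda>l. \<iota> (y l)) (\<Sum>l<d. Poly_Mapping.single l (c i j l)))"
      by (rule linear_map_lin_ext[OF U_vs_alg B \<psi>, symmetric]) auto
    also have "lin_ext U (\<lambda>l. \<iota> (y l)) (\<Sum>l<d. Poly_Mapping.single l (c i j l)) = \<iota> (bracket (y i) (y j))"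
      by (subst U.lin_ext_sum[where S = UNIV]) (auto simp: y_bracket[OF ij] \<iota>_sum \<iota>_scale intro!: U.finsum_cong')
    finally show ?thesis .
  qed
  have minus: "?\<psi> (a \<ominus>\<^bsub>U\<^esub> b) = ?\<psi> a \<ominus>\<^bsub>B\<^esub> ?\<psi> b" if "a \<in> carrier U" "b \<in> carrier U" for a b
    using that by (simp add: a_minus_def U.smult_minus_one[symmetric] B.smult_minus_one[symmetric] \<psi>D
        del: U.smult_mult_l U.smult_mult_r)
  have kS: "Poly_Mapping.keys (\<Sum>l<d. pm_scale (c i j l) (Poly_Mapping.single (\<chi> (u @ l # v)) (1::'k))) \<subseteq> range \<chi>"
    by (intro keys_sum_subset order_trans[OF keys_pm_scale]) auto
  have 1: "E (\<chi> (u @ i # j # v)) = ?\<psi> (\<iota> (y i) \<otimes>\<^bsub>U\<^esub> \<iota> (y j))" for i j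
    using E3[of "[i, j]"] ev_append[of "[i]" "[j]"] by (simp add: ev_single)
  have "lin_ext B E (rel \<chi> u i j v) = E (\<chi> (u @ i # j # v)) \<ominus>\<^bsub>B\<^esub> E (\<chi> (u @ j # i # v)) \<ominus>\<^bsub>B\<^esub> ?\<psi> (\<iota> (bracket (y i) (y j)))"
    unfolding rel_def sum_cl[symmetric]
    by (subst B.lin_ext_diff[OF keys_diff_subset kS F], simp, simp, subst B.lin_ext_diff[OF _ _ F])
      (simp_all add: B.lin_ext_single E \<phi>D(1))
  also have "\<dots> = \<zero>\<^bsub>B\<^esub>"
    unfolding 1 by (subst minus[symmetric], simp, simp, subst minus[symmetric], simp_all add: \<iota>_bracket del: U.smult_mult_l)
      (simp add: U.diff_zero_iff a_minus_def linear_map_zero[OF U_vs_alg B \<psi>, simplified] U.r_neg)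
  finally show ?thesis .
qed

text \<open>The passage from scalars to algebras: \<open>null3_eval\<close> is used with formal
  combinations of triples as target and the kernel of the linear extension of \<open>E\<close> as
  subspace.\<close>

lemma null3_kill:
  assumes B: "vs_alg B" and E: "\<And>x. E x \<in> carrier B" and D: "null3 D"
    and 1: "\<And>b e. \<exists>\<phi>. linear_map U B \<phi> \<and> (\<forall>w. E (w, b, e) = \<phi> (ev w))"
    and 2: "\<And>a e. \<exists>\<phi>. linear_map U B \<phi> \<and> (\<forall>w. E (a, w, e) = \<phi> (ev w))"
    and 3: "\<And>a b. \<exists>\<phi>. linear_map U B \<phi> \<and> (\<forall>w. E (a, b, w) = \<phi> (ev w))"
  shows "lin_ext B E D = \<zero>\<^bsub>B\<^esub>"
proof -
  interpret B: vs_alg B by fact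
  have F: "E \<in> UNIV \<rightarrow> carrier B" using E by auto
  let ?N = "{D. lin_ext B E D = \<zero>\<^bsub>B\<^esub>}"
  have N: "pm.subspace ?N"
    by (auto simp: pm.subspace_def B.lin_ext_add[OF _ _ F] B.lin_ext_scale[OF _ F])
  have rel: "slot_rel pm_scale ?N (\<lambda>w. Poly_Mapping.single (\<chi> w) 1)"
    if "\<exists>\<phi>. linear_map U B \<phi> \<and> (\<forall>w. E (\<chi> w) = \<phi> (ev w))" for \<chi>
    using that lin_ext_rel[OF B, where E = E and \<chi> = \<chi>] unfolding slot_rel_def rel_def by blast
  have "lc pm_scale (\<lambda>x. Poly_Mapping.single x 1) D \<in> ?N"
    by (rule null3_eval[OF pm.vector_space_axioms N D]) (rule rel, rule 1 2 3)+
  then show ?thesis by (simp add: lc_single_id)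
qed

definition E2 where "E2 = (\<lambda>(u, v). UU.ten (ev u) (ev v))"
definition E3 where "E3 = (\<lambda>(u, v, w). UUU.ten (UU.ten (ev u) (ev v)) (ev w))"

lemma E2_closed: "E2 x \<in> carrier UU" by (cases x) (simp add: E2_def)
lemma E3_closed: "E3 x \<in> carrier UUU" by (cases x) (simp add: E3_def)

definition twist :: "nat \<Rightarrow> _" where "twist n = lin_ext UU E2 (F n)"

lemma twist_closed [simp, intro]: "twist n \<in> carrier UU"
  unfolding twist_def by (intro UUr.lin_ext_closed) (simp add: E2_closed)

lemma lin_ext_UUU_F: "f \<in> UNIV \<rightarrow> carrier UUU \<Longrightarrow> lin_ext UUU f p \<in> carrier UUU"
  by (intro UUUr.lin_ext_closed) auto

abbreviation split_pm :: "nat list \<Rightarrow> (nat list \<times> nat list \<Rightarrow>\<^sub>0 'k)" where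
  "split_pm w \<equiv> (\<Sum>x\<leftarrow>splits w. Poly_Mapping.single x 1)"

lemma split_pm_Cons:
  "split_pm (i # w) = lc pm_scale (\<lambda>(u, v). Poly_Mapping.single (i # u, v) 1 + Poly_Mapping.single (u, i # v) 1) (split_pm w)"
  by (simp add: pm.lc_sum_list case_prod_unfold sum_list_addf o_def)

text \<open>Generators are primitive and \<Delta> takes words to products, so the letters distribute
  as in \<open>splits\<close>.\<close>

lemma coproduct_ev: "\<Delta> (ev w) = lin_ext UU E2 (split_pm w)"
proof (induction w)
  case Nil
  have "lin_ext UU E2 (Poly_Mapping.single ([], []) 1) = E2 ([], [])"
    by (simp add: UUr.lin_ext_single[of E2] E2_closed)
  then show ?case using coproduct_word[of "[]"] by (simp add: ev_def UU.T_one E2_def word_Nil)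
next
  case (Cons i w)
  have E: "E2 \<in> UNIV \<rightarrow> carrier UU" by (simp add: E2_closed)
  have "\<Delta> (ev (i # w)) = prim (y i) \<otimes>\<^bsub>UU\<^esub> \<Delta> (ev w)"
    by (simp add: ev_def coproduct_word)
  also have "\<dots> = lin_ext UU (\<lambda>x. prim (y i) \<otimes>\<^bsub>UU\<^esub> E2 x) (split_pm w)"
    unfolding Cons.IH by (rule linear_map_lin_ext[OF UU.T_vs_alg UU.T_vs_alg UUr.linear_map_mult_l]) (simp_all add: E2_closed)
  also have "\<dots> = lin_ext UU (\<lambda>x. lin_ext UU E2 (case x of (u, v) \<Rightarrow> Poly_Mapping.single (i # u, v) 1 + Poly_Mapping.single (u, i # v) 1)) (split_pm w)"
  proof (rule UUr.lin_ext_cong)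
    fix x :: "nat list \<times> nat list"
    obtain u v where x: "x = (u, v)" by (cases x)
    have c: "ev (i # u) = \<iota> (y i) \<otimes>\<^bsub>U\<^esub> ev u" for u
      using ev_append[of "[i]" u] by (simp add: ev_single)
    show "prim (y i) \<otimes>\<^bsub>UU\<^esub> E2 x = lin_ext UU E2 (case x of (u, v) \<Rightarrow> Poly_Mapping.single (i # u, v) 1 + Poly_Mapping.single (u, i # v) 1)"
      by (simp add: x UUr.lin_ext_add[where S = UNIV, OF _ _ E] UUr.lin_ext_single[of E2] E2_closed)
        (simp add: E2_def c UUr.l_distr UU.ten_mult)
  qed (auto intro!: UUr.lin_ext_closed simp: E2_closed)
  also have "\<dots> = lin_ext UU E2 (split_pm (i # w))"
    unfolding split_pm_Cons by (rule UUr.lin_ext_lc[symmetric, where S = UNIV]) (simp_all add: E2_closed)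
  finally show ?case .
qed

lemma UUr_props: "tensor_pair UU U" "tensor_pair U U" "tensor_pair U UU"
  by (intro tensor_pair.intro U_vs_alg UU.T_vs_alg)+

lemma id_linear: "linear_map A A id"
  by (simp add: linear_map_def)

lemma E3_mult: "E3 (u, v, w) \<otimes>\<^bsub>UUU\<^esub> E3 (u', v', w') = E3 (u @ u', v @ v', w @ w')"
  by (simp add: E3_def UUU.ten_mult UU.ten_mult ev_append)

lemma linear_first: "b \<in> carrier U \<Longrightarrow> linear_map UU UUU (\<lambda>X. UUU.ten X b)"
  by (auto simp: linear_map_def UUU.ten_add_l UUU.ten_smult_l)

text \<open>Links the triple tensor power with the combinations of word triples in
  \<open>twist_equation\<close>; \<open>right_side\<close> does the same for the other
  bracketing.\<close>

lemma left_side: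
  "tensor_map UU U \<Delta> id (twist m) \<otimes>\<^bsub>UUU\<^esub> UUU.ten (twist n) \<one>\<^bsub>U\<^esub> = lin_ext UUU E3 (bil \<sigma>L (F m) (F n))"
proof -
  note tm = tensor_map_props[OF UUr_props(2,1) coproduct_linear id_linear]
  have E3: "E3 \<in> UNIV \<rightarrow> carrier UUU" by (simp add: E3_closed)
  have ten: "UUU.ten (\<Delta> (ev u)) (ev v) = lin_ext UUU (\<lambda>(u1, u2). E3 (u1, u2, v)) (split_pm u)" for u v
    unfolding coproduct_ev
    by (subst linear_map_lin_ext[OF UU.T_vs_alg UUU.T_vs_alg linear_first])
      (simp_all add: E2_closed E2_def E3_def case_prod_unfold)
  have l: "tensor_map UU U \<Delta> id (twist m) = lin_ext UUU (\<lambda>(u, v). UUU.ten (\<Delta> (ev u)) (ev v)) (F m)"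
    unfolding twist_def
    by (subst linear_map_lin_ext[OF UU.T_vs_alg UUU.T_vs_alg tm(1)])
      (simp_all add: E2_closed E2_def case_prod_unfold tm(2))
  have r: "UUU.ten (twist n) \<one>\<^bsub>U\<^esub> = lin_ext UUU (\<lambda>(x, y). E3 (x, y, [])) (F n)"
    unfolding twist_def
    by (subst linear_map_lin_ext[OF UU.T_vs_alg UUU.T_vs_alg linear_first])
      (simp_all add: E2_closed E2_def E3_def case_prod_unfold ev_Nil)
  show ?thesis unfolding l r
  proof (rule UUUr.lin_ext_bil[where S = UNIV, OF _ _ _ E3])
    fix p q :: "nat list \<times> nat list"
    obtain u v x y where pq: "p = (u, v)" "q = (x, y)" by (cases p, cases q)
    have "UUU.ten (\<Delta> (ev u)) (ev v) \<otimes>\<^bsub>UUU\<^esub> E3 (x, y, [])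
       = lin_ext UUU (\<lambda>(u1, u2). E3 (u1 @ x, u2 @ y, v)) (split_pm u)"
      unfolding ten
      by (subst linear_map_lin_ext[OF UUU.T_vs_alg UUU.T_vs_alg UUUr.linear_map_mult_r])
        (simp_all add: E3_closed case_prod_unfold E3_mult)
    also have "\<dots> = lin_ext UUU (\<lambda>p. lin_ext UUU E3 (case p of (u1, u2) \<Rightarrow> Poly_Mapping.single (u1 @ x, u2 @ y, v) 1)) (split_pm u)"
      by (rule UUUr.lin_ext_cong) (auto simp: UUUr.lin_ext_single[of E3] E3_closed case_prod_unfold)
    also have "\<dots> = lin_ext UUU E3 (lc pm_scale (\<lambda>(u1, u2). Poly_Mapping.single (u1 @ x, u2 @ y, v) 1) (split_pm u))"
      by (rule UUUr.lin_ext_lc[symmetric, where S = UNIV]) (simp_all add: E3_closed)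
    also have "lc pm_scale (\<lambda>(u1, u2). Poly_Mapping.single (u1 @ x, u2 @ y, v) 1) (split_pm u) = \<sigma>L p q"
      by (simp add: pq \<sigma>L_def pm.lc_sum_list)
    finally show "(case p of (u, v) \<Rightarrow> UUU.ten (\<Delta> (ev u)) (ev v)) \<otimes>\<^bsub>UUU\<^esub> (case q of (x, y) \<Rightarrow> E3 (x, y, [])) = lin_ext UUU E3 (\<sigma>L p q)"
      by (simp add: pq)
  qed (auto simp: E3_closed linear_mapD(1)[OF coproduct_linear])
qed

abbreviation "assoc \<equiv> tensor_assoc U U U"

lemmas assoc_linear = tensor_assoc_props(1)[OF UUr_props(2,2,1,3)]
  and assoc_ten = tensor_assoc_props(2)[OF UUr_props(2,2,1,3)]

lemma linear_second: "a \<in> carrier U \<Longrightarrow> linear_map UU UUU (\<lambda>X. assoc (U_UU.ten a X))"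
proof -
  assume a: "a \<in> carrier U"
  have "linear_map UU U_UU.T (\<lambda>X. U_UU.ten a X)"
    using a by (auto simp: linear_map_def U_UU.ten_add_r U_UU.ten_smult_r)
  then show ?thesis by (rule linear_map_comp) (rule assoc_linear)
qed

lemma right_side:
  "assoc (tensor_map U UU id \<Delta> (twist m)) \<otimes>\<^bsub>UUU\<^esub> assoc (U_UU.ten \<one>\<^bsub>U\<^esub> (twist n)) = lin_ext UUU E3 (bil \<sigma>R (F m) (F n))"
proof -
  note tm = tensor_map_props[OF UUr_props(2,3) id_linear coproduct_linear]
  have tml: "linear_map UU UUU (\<lambda>X. assoc (tensor_map U UU id \<Delta> X))"
    by (rule linear_map_comp[OF tm(1) assoc_linear])
  have E3: "E3 \<in> UNIV \<rightarrow> carrier UUU" by (simp add: E3_closed)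
  have ten: "assoc (U_UU.ten (ev u) (\<Delta> (ev v))) = lin_ext UUU (\<lambda>(v1, v2). E3 (u, v1, v2)) (split_pm v)" for u v
    unfolding coproduct_ev
    by (subst linear_map_lin_ext[OF UU.T_vs_alg UUU.T_vs_alg linear_second])
      (simp_all add: E2_closed E2_def E3_def case_prod_unfold assoc_ten)
  have l: "assoc (tensor_map U UU id \<Delta> (twist m)) = lin_ext UUU (\<lambda>(u, v). assoc (U_UU.ten (ev u) (\<Delta> (ev v)))) (F m)"
    unfolding twist_def
    by (subst linear_map_lin_ext[OF UU.T_vs_alg UUU.T_vs_alg tml])
      (simp_all add: E2_closed E2_def case_prod_unfold tm(2))
  have r: "assoc (U_UU.ten \<one>\<^bsub>U\<^esub> (twist n)) = lin_ext UUU (\<lambda>(x, y). E3 ([], x, y)) (F n)"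
    unfolding twist_def
    by (subst linear_map_lin_ext[OF UU.T_vs_alg UUU.T_vs_alg linear_second])
      (simp_all add: E2_closed E2_def E3_def case_prod_unfold ev_Nil assoc_ten)
  show ?thesis unfolding l r
  proof (rule UUUr.lin_ext_bil[where S = UNIV, OF _ _ _ E3])
    fix p q :: "nat list \<times> nat list"
    obtain u v x y where pq: "p = (u, v)" "q = (x, y)" by (cases p, cases q)
    have m: "E3 (u, z) \<otimes>\<^bsub>UUU\<^esub> E3 ([], x, y) = E3 (u, fst z @ x, snd z @ y)" for z
      by (cases z) (simp add: E3_mult)
    have "assoc (U_UU.ten (ev u) (\<Delta> (ev v))) \<otimes>\<^bsub>UUU\<^esub> E3 ([], x, y)
       = lin_ext UUU (\<lambda>(v1, v2). E3 (u, v1 @ x, v2 @ y)) (split_pm v)"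
      unfolding ten
      by (subst linear_map_lin_ext[OF UUU.T_vs_alg UUU.T_vs_alg UUUr.linear_map_mult_r])
        (simp_all add: E3_closed case_prod_unfold m)
    also have "\<dots> = lin_ext UUU (\<lambda>p. lin_ext UUU E3 (case p of (v1, v2) \<Rightarrow> Poly_Mapping.single (u, v1 @ x, v2 @ y) 1)) (split_pm v)"
      by (rule UUUr.lin_ext_cong) (auto simp: UUUr.lin_ext_single[of E3] E3_closed case_prod_unfold)
    also have "\<dots> = lin_ext UUU E3 (lc pm_scale (\<lambda>(v1, v2). Poly_Mapping.single (u, v1 @ x, v2 @ y) 1) (split_pm v))"
      by (rule UUUr.lin_ext_lc[symmetric, where S = UNIV]) (simp_all add: E3_closed)
    also have "lc pm_scale (\<lambda>(v1, v2). Poly_Mapping.single (u, v1 @ x, v2 @ y) 1) (split_pm v) = \<sigma>R p q"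
      by (simp add: pq \<sigma>R_def pm.lc_sum_list)
    finally show "(case p of (u, v) \<Rightarrow> assoc (U_UU.ten (ev u) (\<Delta> (ev v)))) \<otimes>\<^bsub>UUU\<^esub> (case q of (x, y) \<Rightarrow> E3 ([], x, y)) = lin_ext UUU E3 (\<sigma>R p q)"
      by (simp add: pq)
  qed (auto simp: E3_closed linear_mapD(1)[OF linear_second] linear_mapD(1)[OF coproduct_linear])
qed

lemma E3_slots:
  "\<exists>\<phi>. linear_map U UUU \<phi> \<and> (\<forall>w. E3 (w, b, e) = \<phi> (ev w))"
  "\<exists>\<phi>. linear_map U UUU \<phi> \<and> (\<forall>w. E3 (b, w, e) = \<phi> (ev w))"
  "\<exists>\<phi>. linear_map U UUU \<phi> \<and> (\<forall>w. E3 (b, e, w) = \<phi> (ev w))"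
proof -
  show "\<exists>\<phi>. linear_map U UUU \<phi> \<and> (\<forall>w. E3 (w, b, e) = \<phi> (ev w))"
    by (rule exI[of _ "\<lambda>X. UUU.ten (UU.ten X (ev b)) (ev e)"])
      (auto simp: E3_def linear_map_def UUU.ten_add_l UUU.ten_smult_l UU.ten_add_l UU.ten_smult_l)
  show "\<exists>\<phi>. linear_map U UUU \<phi> \<and> (\<forall>w. E3 (b, w, e) = \<phi> (ev w))"
    by (rule exI[of _ "\<lambda>X. UUU.ten (UU.ten (ev b) X) (ev e)"])
      (auto simp: E3_def linear_map_def UUU.ten_add_l UUU.ten_smult_l UU.ten_add_r UU.ten_smult_r)
  show "\<exists>\<phi>. linear_map U UUU \<phi> \<and> (\<forall>w. E3 (b, e, w) = \<phi> (ev w))"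
    by (rule exI[of _ "\<lambda>X. UUU.ten (UU.ten (ev b) (ev e)) X"])
      (auto simp: E3_def linear_map_def UUU.ten_add_r UUU.ten_smult_r)
qed

theorem twist_cocycle:
  "(\<Oplus>\<^bsub>UUU\<^esub>i\<in>{..n}. tensor_map UU U \<Delta> id (twist i) \<otimes>\<^bsub>UUU\<^esub> UUU.ten (twist (n - i)) \<one>\<^bsub>U\<^esub>)
   = (\<Oplus>\<^bsub>UUU\<^esub>i\<in>{..n}. assoc (tensor_map U UU id \<Delta> (twist i)) \<otimes>\<^bsub>UUU\<^esub> assoc (U_UU.ten \<one>\<^bsub>U\<^esub> (twist (n - i))))"
proof -
  have E3: "E3 \<in> UNIV \<rightarrow> carrier UUU" by (simp add: E3_closed)
  have "lin_ext UUU E3 (twL n - twR n) = \<zero>\<^bsub>UUU\<^esub>"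
    by (rule null3_kill[OF UUU.T_vs_alg E3_closed twist_equation]) (rule E3_slots)+
  then have "lin_ext UUU E3 (twL n) = lin_ext UUU E3 (twR n)"
    using UUUr.lin_ext_diff[of "twL n" UNIV "twR n" E3] E3 by (simp add: UUUr.diff_zero_iff lin_ext_UUU_F)
  then show ?thesis
    unfolding left_side right_side twL_def twR_def
    by (simp add: UUUr.lin_ext_sum[where S = UNIV] E3)
qed

theorem twist_counit:
  "tensor_lift U (\<lambda>a b. uea_counit a \<odot>\<^bsub>U\<^esub> b) (twist n) = (if n = 0 then \<one>\<^bsub>U\<^esub> else \<zero>\<^bsub>U\<^esub>)"
  "tensor_lift U (\<lambda>a b. uea_counit b \<odot>\<^bsub>U\<^esub> a) (twist n) = (if n = 0 then \<one>\<^bsub>U\<^esub> else \<zero>\<^bsub>U\<^esub>)"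
proof -
  \<comment> \<open>Multiplies the three slots. In \<open>counitL\<close> and \<open>counitR\<close>
    the first two hold empty words, so the product returns the third.\<close>
  define E where "E = (\<lambda>(u, v, w). ev u \<otimes>\<^bsub>U\<^esub> (ev v \<otimes>\<^bsub>U\<^esub> ev w))"
  have Ec: "E x \<in> carrier U" for x by (cases x) (simp add: E_def)
  then have EF: "E \<in> UNIV \<rightarrow> carrier U" by auto
  have slots: "\<exists>\<phi>. linear_map U U \<phi> \<and> (\<forall>w. E (w, b, e) = \<phi> (ev w))"
    "\<exists>\<phi>. linear_map U U \<phi> \<and> (\<forall>w. E (b, w, e) = \<phi> (ev w))"
    "\<exists>\<phi>. linear_map U U \<phi> \<and> (\<forall>w. E (b, e, w) = \<phi> (ev w))" for b e
  proof -
    show "\<exists>\<phi>. linear_map U U \<phi> \<and> (\<forall>w. E (w, b, e) = \<phi> (ev w))"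
      by (rule exI[of _ "\<lambda>X. X \<otimes>\<^bsub>U\<^esub> (ev b \<otimes>\<^bsub>U\<^esub> ev e)"]) (simp add: E_def U.linear_map_mult_r)
    show "\<exists>\<phi>. linear_map U U \<phi> \<and> (\<forall>w. E (b, w, e) = \<phi> (ev w))"
      by (rule exI[of _ "\<lambda>X. ev b \<otimes>\<^bsub>U\<^esub> (X \<otimes>\<^bsub>U\<^esub> ev e)"])
        (simp add: E_def linear_map_comp[OF U.linear_map_mult_r U.linear_map_mult_l])
    show "\<exists>\<phi>. linear_map U U \<phi> \<and> (\<forall>w. E (b, e, w) = \<phi> (ev w))"
      by (rule exI[of _ "\<lambda>X. ev b \<otimes>\<^bsub>U\<^esub> (ev e \<otimes>\<^bsub>U\<^esub> X)"])
        (simp add: E_def linear_map_comp[OF U.linear_map_mult_l U.linear_map_mult_l])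
  qed
  have eps: "x \<in> carrier U \<Longrightarrow> z \<in> carrier U \<Longrightarrow> uea_counit (x \<oplus>\<^bsub>U\<^esub> z) = uea_counit x + uea_counit z"
    "x \<in> carrier U \<Longrightarrow> uea_counit (e \<odot>\<^bsub>U\<^esub> x) = e * uea_counit x" for x z e
    using linear_mapD(2,3)[OF counit_linear] by (auto simp: ground_field_def)
  have b1: "bilinear_map U U U (\<lambda>a b. uea_counit a \<odot>\<^bsub>U\<^esub> b)"
    and b2: "bilinear_map U U U (\<lambda>a b. uea_counit b \<odot>\<^bsub>U\<^esub> a)"
    by (auto simp: bilinear_map_def linear_map_def eps U.smult_r_distr U.smult_l_distr U.smult_smult mult.commute)
  have gen: "lin_ext U f (F n) = (if n = 0 then \<one>\<^bsub>U\<^esub> else \<zero>\<^bsub>U\<^esub>)"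
    if D: "null3 (lc pm_scale h (F n) - (if n = 0 then Poly_Mapping.single ([], [], []) 1 else 0))"
      and h: "\<And>x. f x = lin_ext U E (h x)" for h f
  proof -
    have "lin_ext U E (lc pm_scale h (F n) - (if n = 0 then Poly_Mapping.single ([], [], []) 1 else 0)) = \<zero>\<^bsub>U\<^esub>"
      by (rule null3_kill[OF U_vs_alg Ec D]) (rule slots)+
    then have "lin_ext U E (lc pm_scale h (F n)) = lin_ext U E (if n = 0 then Poly_Mapping.single ([], [], []) 1 else 0)"
      using U.lin_ext_diff[of "lc pm_scale h (F n)" UNIV "if n = 0 then Poly_Mapping.single ([], [], []) 1 else 0" E] EF
      by (simp add: U.diff_zero_iff U.lin_ext_closed Ec)
    also have "\<dots> = (if n = 0 then \<one>\<^bsub>U\<^esub> else \<zero>\<^bsub>U\<^esub>)"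
      by (simp add: U.lin_ext_single[of E] Ec) (simp add: E_def ev_Nil)
    finally show ?thesis
      unfolding h by (subst U.lin_ext_lc[symmetric, where S = UNIV]) (simp_all add: Ec)
  qed
  have "tensor_lift U (\<lambda>a b. uea_counit a \<odot>\<^bsub>U\<^esub> b) (twist n) = lin_ext U (\<lambda>(u, v). (if u = [] then 1 else 0) \<odot>\<^bsub>U\<^esub> ev v) (F n)"
    unfolding twist_def
    by (subst linear_map_lin_ext[OF UU.T_vs_alg U_vs_alg UU.lift_T_linear[OF U_vs_alg b1]])
      (simp_all add: E2_closed E2_def case_prod_unfold UU.lift_ten[OF U_vs_alg b1] counit_word ev_def)
  also have "\<dots> = (if n = 0 then \<one>\<^bsub>U\<^esub> else \<zero>\<^bsub>U\<^esub>)"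
    by (rule gen[OF null3_counitL[unfolded counitL_def]])
      (auto simp: U.lin_ext_single[of E] Ec case_prod_unfold, simp_all add: E_def ev_Nil)
  finally show "tensor_lift U (\<lambda>a b. uea_counit a \<odot>\<^bsub>U\<^esub> b) (twist n) = (if n = 0 then \<one>\<^bsub>U\<^esub> else \<zero>\<^bsub>U\<^esub>)" .
  have "tensor_lift U (\<lambda>a b. uea_counit b \<odot>\<^bsub>U\<^esub> a) (twist n) = lin_ext U (\<lambda>(u, v). (if v = [] then 1 else 0) \<odot>\<^bsub>U\<^esub> ev u) (F n)"
    unfolding twist_def
    by (subst linear_map_lin_ext[OF UU.T_vs_alg U_vs_alg UU.lift_T_linear[OF U_vs_alg b2]])
      (simp_all add: E2_closed E2_def case_prod_unfold UU.lift_ten[OF U_vs_alg b2] counit_word ev_def)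
  also have "\<dots> = (if n = 0 then \<one>\<^bsub>U\<^esub> else \<zero>\<^bsub>U\<^esub>)"
    by (rule gen[OF null3_counitR[unfolded counitR_def]])
      (auto simp: U.lin_ext_single[of E] Ec case_prod_unfold, simp_all add: E_def ev_Nil)
  finally show "tensor_lift U (\<lambda>a b. uea_counit b \<odot>\<^bsub>U\<^esub> a) (twist n) = (if n = 0 then \<one>\<^bsub>U\<^esub> else \<zero>\<^bsub>U\<^esub>)" .
qed

theorem twist_low_order:
  "twist 0 = \<one>\<^bsub>UU\<^esub>"
  "twist 1 = lin_ext UU E2 (\<Sum>i<d. \<Sum>j<d. Poly_Mapping.single ([i], [j]) (R i j / 2))"
proof -
  \<comment> \<open>After \<open>emb\<close> the third slot is empty, so multiplying it into the
    second recovers the pair.\<close>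
  define E where "E = (\<lambda>(u, v, w). UU.ten (ev u) (ev v \<otimes>\<^bsub>U\<^esub> ev w))"
  have Ec: "E x \<in> carrier UU" for x by (cases x) (simp add: E_def)
  then have EF: "E \<in> UNIV \<rightarrow> carrier UU" by auto
  have E2': "E2 x = lin_ext UU E (case x of (u, v) \<Rightarrow> Poly_Mapping.single (u, v, []) 1)" for x
    by (cases x) (simp add: UUr.lin_ext_single[of E] Ec, simp add: E_def E2_def ev_Nil)
  have l: "linear_map U UU (\<lambda>X. UU.ten a (f X))" if "a \<in> carrier U" "linear_map U U f" for a f
    using linear_mapD[OF that(2)] that(1) by (simp add: linear_map_def UU.ten_add_r UU.ten_smult_r)
  have slots: "\<exists>\<phi>. linear_map U UU \<phi> \<and> (\<forall>w. E (w, b, e) = \<phi> (ev w))"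
    "\<exists>\<phi>. linear_map U UU \<phi> \<and> (\<forall>w. E (b, w, e) = \<phi> (ev w))"
    "\<exists>\<phi>. linear_map U UU \<phi> \<and> (\<forall>w. E (b, e, w) = \<phi> (ev w))" for b e
  proof -
    show "\<exists>\<phi>. linear_map U UU \<phi> \<and> (\<forall>w. E (w, b, e) = \<phi> (ev w))"
      by (rule exI[of _ "\<lambda>X. UU.ten X (ev b \<otimes>\<^bsub>U\<^esub> ev e)"]) (auto simp: E_def linear_map_def UU.ten_add_l UU.ten_smult_l)
    show "\<exists>\<phi>. linear_map U UU \<phi> \<and> (\<forall>w. E (b, w, e) = \<phi> (ev w))"
      by (rule exI[of _ "\<lambda>X. UU.ten (ev b) (X \<otimes>\<^bsub>U\<^esub> ev e)"]) (auto simp: E_def intro!: l U.linear_map_mult_r)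
    show "\<exists>\<phi>. linear_map U UU \<phi> \<and> (\<forall>w. E (b, e, w) = \<phi> (ev w))"
      by (rule exI[of _ "\<lambda>X. UU.ten (ev b) (ev e \<otimes>\<^bsub>U\<^esub> X)"]) (auto simp: E_def intro!: l U.linear_map_mult_l)
  qed
  have tw: "twist n = lin_ext UU E (emb (F n))" for n
    unfolding twist_def E2'[abs_def] by (rule UUr.lin_ext_lc[symmetric, where S = UNIV]) (simp_all add: Ec)
  have eq: "lin_ext UU E p = lin_ext UU E q" if "null3 (p - q)" for p q
    using null3_kill[OF UU.T_vs_alg Ec that slots] UUr.lin_ext_diff[of p UNIV q E] EF
    by (simp add: UUr.diff_zero_iff UUr.lin_ext_closed Ec)
  show "twist 0 = \<one>\<^bsub>UU\<^esub>"
    unfolding tw eq[OF null3_F0] by (subst UUr.lin_ext_single) (simp_all add: Ec, simp add: E_def ev_Nil UU.T_one)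
  have "twist 1 = lin_ext UU E (\<Sum>i<d. \<Sum>j<d. Poly_Mapping.single ([i], [j], []) (R i j / 2))"
    unfolding tw by (rule eq[OF null3_F1])
  also have "(\<Sum>i<d. \<Sum>j<d. Poly_Mapping.single ([i], [j], []) (R i j / 2)) = emb (\<Sum>i<d. \<Sum>j<d. Poly_Mapping.single ([i], [j]) (R i j / 2))"
    by (simp add: pm.lc_sum)
  also have "lin_ext UU E \<dots> = lin_ext UU E2 (\<Sum>i<d. \<Sum>j<d. Poly_Mapping.single ([i], [j]) (R i j / 2))"
    unfolding E2'[abs_def] by (rule UUr.lin_ext_lc[where S = UNIV]) (simp_all add: Ec)
  finally show "twist 1 = lin_ext UU E2 (\<Sum>i<d. \<Sum>j<d. Poly_Mapping.single ([i], [j]) (R i j / 2))" .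
qed

end

section \<open>Formal power series over a ring\<close>

context ring begin

definition conv :: "(nat \<Rightarrow> 'a) \<Rightarrow> (nat \<Rightarrow> 'a) \<Rightarrow> nat \<Rightarrow> 'a" where
  "conv F G n = (\<Oplus>i\<in>{..n}. F i \<otimes> G (n - i))"

text \<open>Up to a fixed order the product only involves truncations, which are polynomials.\<close>

lemma conv_assoc:
  assumes "F \<in> UNIV \<rightarrow> carrier R" "G \<in> UNIV \<rightarrow> carrier R" "H \<in> UNIV \<rightarrow> carrier R"
  shows "conv (conv F G) H = conv F (conv G H)"
proof
  fix N
  interpret UP: UP_ring R "UP R" by unfold_locales
  define t where "t F = (\<lambda>n. if n \<le> N then F n else \<zero>)" for F :: "nat \<Rightarrow> 'a"
  have t: "t F \<in> carrier (UP R)" if "F \<in> UNIV \<rightarrow> carrier R" for F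
    using that by (auto simp: t_def UP_def up_def Pi_def bound_def intro!: exI[of _ N])
  have mult: "(p \<otimes>\<^bsub>UP R\<^esub> q) n = conv p q n" if "p \<in> carrier (UP R)" "q \<in> carrier (UP R)" for p q n
    using that by (simp add: UP_def conv_def)
  have cl: "p n \<in> carrier R" if "p \<in> carrier (UP R)" for p n
    using that by (auto simp: UP_def up_def)
  have conv_eq: "conv F G n = conv F' G' n"
    if "\<And>i. i \<le> n \<Longrightarrow> F i = F' i \<and> G i = G' i" "\<And>i. i \<le> n \<Longrightarrow> F' i \<in> carrier R \<and> G' i \<in> carrier R" for F G F' G' n
    unfolding conv_def by (rule finsum_cong') (use that in auto)
  have tc: "conv F G n = (t F \<otimes>\<^bsub>UP R\<^esub> t G) n"
    if "F \<in> UNIV \<rightarrow> carrier R" "G \<in> UNIV \<rightarrow> carrier R" "n \<le> N" for F G n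
    unfolding mult[OF t[OF that(1)] t[OF that(2)]]
    by (rule conv_eq) (use that cl[OF t] in \<open>auto simp: t_def\<close>)
  have "conv (conv F G) H N = ((t F \<otimes>\<^bsub>UP R\<^esub> t G) \<otimes>\<^bsub>UP R\<^esub> t H) N"
    unfolding mult[OF UP.UP_mult_closed[OF t[OF assms(1)] t[OF assms(2)]] t[OF assms(3)]]
    by (rule conv_eq) (use tc[OF assms(1,2)] cl t assms in \<open>auto simp: t_def\<close>)
  also have "\<dots> = (t F \<otimes>\<^bsub>UP R\<^esub> (t G \<otimes>\<^bsub>UP R\<^esub> t H)) N"
    by (simp add: UP.UP_m_assoc t assms)
  also have "\<dots> = conv F (conv G H) N"
    unfolding mult[OF t[OF assms(1)] UP.UP_mult_closed[OF t[OF assms(2)] t[OF assms(3)]]]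
    by (rule conv_eq[symmetric]) (use tc[OF assms(2,3)] cl t assms in \<open>auto simp: t_def\<close>)
  finally show "conv (conv F G) H N = conv F (conv G H) N" .
qed

lemma conv_one:
  assumes "F \<in> UNIV \<rightarrow> carrier R"
  shows "conv F (\<lambda>n. if n = 0 then \<one> else \<zero>) = F" "conv (\<lambda>n. if n = 0 then \<one> else \<zero>) F = F"
proof -
  have Fc: "F i \<in> carrier R" for i using assms by auto
  show "conv F (\<lambda>n. if n = 0 then \<one> else \<zero>) = F"
  proof
    fix n
    have "conv F (\<lambda>n. if n = 0 then \<one> else \<zero>) n = (\<Oplus>i\<in>{..n}. if n = i then F i else \<zero>)"
      unfolding conv_def by (rule finsum_cong') (auto simp: Fc)
    then show "conv F (\<lambda>n. if n = 0 then \<one> else \<zero>) n = F n"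
      using finsum_singleton[of n "{..n}" F] assms by auto
  qed
  show "conv (\<lambda>n. if n = 0 then \<one> else \<zero>) F = F"
  proof
    fix n
    have "conv (\<lambda>n. if n = 0 then \<one> else \<zero>) F n = (\<Oplus>i\<in>{..n}. if 0 = i then F (n - i) else \<zero>)"
      unfolding conv_def by (rule finsum_cong') (auto simp: Fc)
    then show "conv (\<lambda>n. if n = 0 then \<one> else \<zero>) F n = F n"
      using finsum_singleton[of 0 "{..n}" "\<lambda>i. F (n - i)"] assms by auto
  qed
qed

text \<open>As the constant term is 1, the coefficients of the inverse can be solved for one after
  the other.\<close>

lemma conv_right_inverse:
  assumes F: "F \<in> UNIV \<rightarrow> carrier R" "F 0 = \<one>"
  obtains G where "G \<in> UNIV \<rightarrow> carrier R" "G 0 = \<one>" "conv F G = (\<lambda>n. if n = 0 then \<one> else \<zero>)"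
proof -
  have Fc: "F i \<in> carrier R" for i using F(1) by auto
  \<comment> \<open>Membership in the carrier is chosen together with the recursion, and the
    equation is demanded only if all earlier values lie in the carrier, where the laws of finite
    sums hold.\<close>
  have "\<exists>G. \<forall>n. G n \<in> carrier R \<and> ((\<forall>m<n. G m \<in> carrier R) \<longrightarrow>
      G n = (if n = 0 then \<one> else \<ominus> (\<Oplus>i\<in>{1..n}. F i \<otimes> G (n - i))))"
  proof (rule dependent_wellorder_choice)
    fix r and f g :: "nat \<Rightarrow> 'a" and n :: nat
    assume fg: "\<And>m. m < n \<Longrightarrow> f m = g m"
    have "(\<Oplus>i\<in>{1..n}. F i \<otimes> f (n - i)) = (\<Oplus>i\<in>{1..n}. F i \<otimes> g (n - i))" if "\<forall>m<n. g m \<in> carrier R"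
      by (rule finsum_cong') (use that fg in \<open>auto intro!: m_closed Fc\<close>)
    then show "(r \<in> carrier R \<and> ((\<forall>m<n. f m \<in> carrier R) \<longrightarrow> r = (if n = 0 then \<one> else \<ominus> (\<Oplus>i\<in>{1..n}. F i \<otimes> f (n - i))))) =
        (r \<in> carrier R \<and> ((\<forall>m<n. g m \<in> carrier R) \<longrightarrow> r = (if n = 0 then \<one> else \<ominus> (\<Oplus>i\<in>{1..n}. F i \<otimes> g (n - i)))))"
      using fg by auto
  next
    fix n and f :: "nat \<Rightarrow> 'a"
    have "\<ominus> (\<Oplus>i\<in>{1..n}. F i \<otimes> f (n - i)) \<in> carrier R" if "\<forall>m<n. f m \<in> carrier R"
      by (intro a_inv_closed finsum_closed Pi_I m_closed) (use that F in auto)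
    then show "\<exists>r. r \<in> carrier R \<and> ((\<forall>m<n. f m \<in> carrier R) \<longrightarrow> r = (if n = 0 then \<one> else \<ominus> (\<Oplus>i\<in>{1..n}. F i \<otimes> f (n - i))))"
      by (cases "\<forall>m<n. f m \<in> carrier R") auto
  qed
  then obtain G where G: "\<And>n. G n \<in> carrier R" "\<And>n. G n = (if n = 0 then \<one> else \<ominus> (\<Oplus>i\<in>{1..n}. F i \<otimes> G (n - i)))"
    by blast
  have "conv F G n = (if n = 0 then \<one> else \<zero>)" for n
  proof (cases n)
    case 0
    then show ?thesis using F G(2)[of 0] by (simp add: conv_def)
  next
    case (Suc m)
    have s: "{..n} = insert 0 {1..n}" by auto
    have cl: "(\<Oplus>i\<in>{1..n}. F i \<otimes> G (n - i)) \<in> carrier R"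
      by (intro finsum_closed Pi_I m_closed Fc G(1))
    have "conv F G n = F 0 \<otimes> G (n - 0) \<oplus> (\<Oplus>i\<in>{1..n}. F i \<otimes> G (n - i))"
      unfolding conv_def s by (subst finsum_insert) (auto intro!: m_closed Fc G(1))
    also have "\<dots> = G n \<oplus> (\<Oplus>i\<in>{1..n}. F i \<otimes> G (n - i))" using F(2) G(1) by simp
    also have "G n = \<ominus> (\<Oplus>i\<in>{1..n}. F i \<otimes> G (n - i))" using G(2)[of n] Suc by simp
    also have "\<ominus> (\<Oplus>i\<in>{1..n}. F i \<otimes> G (n - i)) \<oplus> (\<Oplus>i\<in>{1..n}. F i \<otimes> G (n - i)) = \<zero>"
      by (rule l_neg[OF cl])
    finally show ?thesis using Suc by simp
  qed
  then show ?thesis using that[of G] G(1) G(2)[of 0] by auto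
qed

end

text \<open>The right inverse has constant term 1 and so has a right inverse itself, which by
  associativity is the original series.\<close>

lemma (in vs_alg) power_series_unit:
  assumes F: "F \<in> UNIV \<rightarrow> carrier A" "F 0 = \<one>"
  shows "F \<in> Units (power_series_ring A)"
proof -
  obtain G where G: "G \<in> UNIV \<rightarrow> carrier A" "G 0 = \<one>" "conv F G = (\<lambda>n. if n = 0 then \<one> else \<zero>)"
    by (rule conv_right_inverse[OF F])
  obtain H where H: "H \<in> UNIV \<rightarrow> carrier A" "conv G H = (\<lambda>n. if n = 0 then \<one> else \<zero>)"
    by (rule conv_right_inverse[OF G(1,2)])
  have "H = conv (conv F G) H" by (simp only: G(3) conv_one(2)[OF H(1)])
  also have "\<dots> = F" by (simp only: conv_assoc[OF F(1) G(1) H(1)] H(2) conv_one(1)[OF F(1)])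
  finally have "conv G F = (\<lambda>n. if n = 0 then \<one> else \<zero>)" using H by simp
  then show ?thesis
    unfolding Units_def power_series_ring_def
    using F G by (auto simp: conv_def[abs_def] intro!: bexI[of _ G])
qed

context lie_twist begin

theorem formal_twist_twist: "formal_twist scale bracket twist"
  unfolding formal_twist_def Let_def
proof (intro conjI)
  have tw: "twist \<in> UNIV \<rightarrow> carrier UU" by auto
  show "twist \<in> Units (power_series_ring UU)"
    by (rule UUr.power_series_unit[OF tw twist_low_order(1)])
  show "(\<lambda>n. tensor_map UU U \<Delta> id (twist n)) \<otimes>\<^bsub>power_series_ring UUU\<^esub> (\<lambda>n. UUU.ten (twist n) \<one>\<^bsub>U\<^esub>)
    = (\<lambda>n. assoc (tensor_map U UU id \<Delta> (twist n))) \<otimes>\<^bsub>power_series_ring UUU\<^esub> (\<lambda>n. assoc (U_UU.ten \<one>\<^bsub>U\<^esub> (twist n)))"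
    by (rule ext) (simp add: power_series_ring_def twist_cocycle)
qed (simp_all add: twist_counit twist_low_order(1) power_series_ring_def)

end

section \<open>The classical Yang--Baxter equation\<close>

lemma ground_field_simps:
  "carrier ground_field = UNIV" "x \<oplus>\<^bsub>ground_field\<^esub> y = x + y" "\<zero>\<^bsub>ground_field\<^esub> = 0"
  "x \<odot>\<^bsub>ground_field\<^esub> y = x * y"
  by (simp_all add: ground_field_def)

lemma finsum_ground_field: "finsum (ground_field :: ('k::field, 'k) module) f S = sum f S"
proof -
  interpret G: vs_alg "ground_field :: ('k, 'k) module" by (rule ground_field_vs_alg)
  show ?thesis
    by (induction S rule: infinite_finite_induct)
      (simp_all add: G.finsum_infinite G.finsum_insert ground_field_simps)
qed

lemma lin_ext_ground_field: "lin_ext ground_field f p = lc (*) f p"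
  by (simp add: lin_ext_def finsum_ground_field lc_def ground_field_simps)

lemma gerstenhaber_bracketD:
  assumes "gerstenhaber_bracket A G B"
  shows "a \<in> carrier A \<Longrightarrow> linear_map A A (B a)" "a \<in> carrier A \<Longrightarrow> linear_map A A (\<lambda>b. B b a)"
    and "a \<in> G k \<Longrightarrow> b \<in> G l \<Longrightarrow> B a b = (- ((- 1) ^ ((k + 1) * (l + 1)))) \<odot>\<^bsub>A\<^esub> B b a"
    and "a \<in> G k \<Longrightarrow> b \<in> G l \<Longrightarrow> e \<in> carrier A \<Longrightarrow> B a (b \<otimes>\<^bsub>A\<^esub> e) =
      (B a b \<otimes>\<^bsub>A\<^esub> e) \<oplus>\<^bsub>A\<^esub> (((- 1) ^ ((k + 1) * l)) \<odot>\<^bsub>A\<^esub> (b \<otimes>\<^bsub>A\<^esub> B a e))"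
  using assms unfolding gerstenhaber_bracket_def by blast+

context lie_algebra begin

text \<open>Functionals stand in for coordinates: vectors and tensors over g are compared through
  the values of functionals on them.\<close>

definition linf :: "('g \<Rightarrow> 'k) \<Rightarrow> bool" where
  "linf a \<longleftrightarrow> (\<forall>x y. a (x + y) = a x + a y) \<and> (\<forall>t x. a (scale t x) = t * a x)"

lemma linfD: "linf a \<Longrightarrow> a (x + y) = a x + a y" "linf a \<Longrightarrow> a (scale t x) = t * a x"
  by (auto simp: linf_def)

lemma linf_zero: "linf a \<Longrightarrow> a 0 = 0"
  using linfD(2)[of a 0 0] by simp

lemma linf_minus: "linf a \<Longrightarrow> a (- x) = - a x"
  using linfD(2)[of a "-1" x] by simp

lemma linf_diff: "linf a \<Longrightarrow> a (x - y) = a x - a y"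
  using linfD(1)[of a x "- y"] by (simp add: linf_minus)

lemma linf_sum: "linf a \<Longrightarrow> a (\<Sum>i\<in>I. f i) = (\<Sum>i\<in>I. a (f i))"
  by (induction I rule: infinite_finite_induct) (simp_all add: linfD linf_zero)

lemma bracket_lin:
  "bracket (x + y) z = bracket x z + bracket y z" "bracket z (x + y) = bracket z x + bracket z y"
  "bracket (scale t x) z = scale t (bracket x z)" "bracket z (scale t x) = scale t (bracket z x)"
proof -
  interpret l: Vector_Spaces.linear scale scale "\<lambda>x. bracket x z" by (rule bracket_linear_left)
  interpret r: Vector_Spaces.linear scale scale "bracket z" by (rule bracket_linear_right)
  show "bracket (x + y) z = bracket x z + bracket y z" "bracket z (x + y) = bracket z x + bracket z y"
    "bracket (scale t x) z = scale t (bracket x z)" "bracket z (scale t x) = scale t (bracket z x)"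
    by (simp_all add: l.add r.add l.scale r.scale)
qed

lemma bracket_anti: "bracket x y = - bracket y x"
  using bracket_alternating[of "x + y"] bracket_alternating[of x] bracket_alternating[of y]
  by (simp add: bracket_lin eq_neg_iff_add_eq_0 add.commute)

lemma linf_bracket_l: "linf a \<Longrightarrow> linf (\<lambda>x. a (bracket x z))"
  and linf_bracket_r: "linf a \<Longrightarrow> linf (\<lambda>x. a (bracket z x))"
  by (simp_all add: linf_def bracket_lin)

interpretation ext: tensor_quotient scale "alternating_relations :: ('g list \<Rightarrow>\<^sub>0 'k) set" .

abbreviation "\<Lambda> \<equiv> exterior_algebra scale"

lemma ext_Q: "ext.Q = \<Lambda>" by (simp add: ext.Q_eq exterior_algebra_def)

lemma \<Lambda>_vs_alg: "vs_alg \<Lambda>" using ext.Q_vs_alg by (simp add: ext_Q)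

interpretation \<Lambda>: vs_alg \<Lambda> by (rule \<Lambda>_vs_alg)

lemma exterior_incl_eq: "exterior_incl scale x = ext.gen x"
  by (simp add: exterior_incl_def ext.cls_eq)

lemma exterior_power_eq: "exterior_power scale k = ext.cls ` {p. \<forall>w\<in>Poly_Mapping.keys p. length w = k}"
  by (simp add: exterior_power_def ext.cls_eq)

lemma cls_lin_ext: "ext.cls p = lin_ext \<Lambda> (\<lambda>w. ext.cls (word w)) p"
proof -
  have c: "ext.cls q \<in> carrier \<Lambda>" for q using ext.cls_closed[of q] by (simp add: ext_Q)
  have "Poly_Mapping.keys p \<subseteq> UNIV" by simp
  then show ?thesis
  proof (induction p rule: keys_induct)
    case zero
    then show ?case using ext.cls_zero by (simp add: ext_Q monoid_algebra_simps(4))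
  next
    case (single w t)
    then show ?case using ext.cls_smult[of "word w" t]
      by (simp add: \<Lambda>.lin_ext_single[where f = "\<lambda>w. ext.cls (word w)"] c ext_Q monoid_algebra_simps(6))
  next
    case (add p q)
    then show ?case using ext.cls_add[of p q]
      by (subst \<Lambda>.lin_ext_add[where S = UNIV]) (simp_all add: c ext_Q monoid_algebra_simps(5))
  qed
qed

text \<open>The pairing of the wedge of \<open>a\<close>, \<open>b\<close>, \<open>e\<close> with
  the wedge of \<open>x\<close>, \<open>y\<close>, \<open>z\<close>, expanded as a
  determinant.\<close>

definition det3 :: "('g \<Rightarrow> 'k) \<Rightarrow> ('g \<Rightarrow> 'k) \<Rightarrow> ('g \<Rightarrow> 'k) \<Rightarrow> 'g \<Rightarrow> 'g \<Rightarrow> 'g \<Rightarrow> 'k" where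
  "det3 a b e x y z = a x * (b y * e z - e y * b z) - b x * (a y * e z - e y * a z) + e x * (a y * b z - b y * a z)"

definition det3_word :: "('g \<Rightarrow> 'k) \<Rightarrow> ('g \<Rightarrow> 'k) \<Rightarrow> ('g \<Rightarrow> 'k) \<Rightarrow> 'g list \<Rightarrow> 'k" where
  "det3_word a b e w = (if length w = 3 then det3 a b e (w ! 0) (w ! 1) (w ! 2) else 0)"

lemma length3_cases:
  assumes "length (u @ [x] @ v) = 3"
  obtains y z where "u = []" "v = [y, z]" | y z where "u = [y]" "v = [z]" | y z where "u = [y, z]" "v = []"
proof -
  from assms have "length u + length v = 2" by simp
  then consider "length u = 0" "length v = 2" | "length u = 1" "length v = 1" | "length u = 2" "length v = 0" by linarith
  then show ?thesis
    by cases (auto simp: numeral_2_eq_2 length_Suc_conv intro: that)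
qed

lemma det3_linear:
  assumes "linf a" "linf b" "linf e"
  shows "det3 a b e (x + x') y z = det3 a b e x y z + det3 a b e x' y z"
    "det3 a b e y (x + x') z = det3 a b e y x z + det3 a b e y x' z"
    "det3 a b e y z (x + x') = det3 a b e y z x + det3 a b e y z x'"
    "det3 a b e (scale t x) y z = t * det3 a b e x y z"
    "det3 a b e y (scale t x) z = t * det3 a b e y x z"
    "det3 a b e y z (scale t x) = t * det3 a b e y z x"
  unfolding det3_def linfD[OF assms(1)] linfD[OF assms(2)] linfD[OF assms(3)]
  by (simp_all only: ring_distribs left_diff_distrib right_diff_distrib mult_ac add_ac diff_conv_add_uminus
      minus_add_distrib mult_minus_left mult_minus_right minus_minus)

lemma det3_word_linear:
  assumes "linf a" "linf b" "linf e"
  shows "det3_word a b e (u @ [x + y] @ v) = det3_word a b e (u @ [x] @ v) + det3_word a b e (u @ [y] @ v)"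
    and "det3_word a b e (u @ [scale t x] @ v) = t * det3_word a b e (u @ [x] @ v)"
proof -
  have "det3_word a b e (u @ [x + y] @ v) = det3_word a b e (u @ [x] @ v) + det3_word a b e (u @ [y] @ v)
    \<and> det3_word a b e (u @ [scale t x] @ v) = t * det3_word a b e (u @ [x] @ v)"
  proof (cases "length (u @ [x] @ v) = 3")
    case True
    then show ?thesis
      by (rule length3_cases) (simp_all add: det3_word_def det3_linear[OF assms] numeral_2_eq_2)
  qed (simp add: det3_word_def)
  then show "det3_word a b e (u @ [x + y] @ v) = det3_word a b e (u @ [x] @ v) + det3_word a b e (u @ [y] @ v)"
    "det3_word a b e (u @ [scale t x] @ v) = t * det3_word a b e (u @ [x] @ v)" by blast+
qed

lemma det3_word_alternating: "det3_word a b e (u @ [x, x] @ v) = 0"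
proof (cases "length (u @ [x, x] @ v) = 3")
  case True
  then consider z where "u = []" "v = [z]" | z where "u = [z]" "v = []"
    by (cases u; cases v) auto
  then show ?thesis by cases (simp_all add: det3_word_def det3_def numeral_2_eq_2 algebra_simps)
qed (simp add: det3_word_def)

text \<open>These functionals extract the coordinates of [[r, r]] in degree three; multilinearity
  and alternation let them descend to the exterior algebra.\<close>

lemma det3_functional:
  assumes "linf a" "linf b" "linf e"
  obtains \<phi> where "linear_map \<Lambda> ground_field \<phi>" "\<And>w. \<phi> (ext.cls (word w)) = det3_word a b e w"
proof -
  interpret G: vs_alg "ground_field :: ('k, 'k) module" by (rule ground_field_vs_alg)
  let ?f = "det3_word a b e"
  have lin: "linear_map ext.TT ground_field (lin_ext ground_field ?f)"
    by (rule G.linear_map_lin_ext_monoid) (simp add: ground_field_simps)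
  have kill: "lin_ext ground_field ?f p = \<zero>\<^bsub>ground_field\<^esub>" if "p \<in> relation_ideal scale alternating_relations" for p
  proof (rule ext.ideal_kill[OF ground_field_vs_alg _ _ that])
    fix u v p assume "p \<in> ext.rels"
    then show "lin_ext ground_field (\<lambda>w. ?f (u @ w @ v)) p = \<zero>\<^bsub>ground_field\<^esub>"
      unfolding Un_iff
    proof
      assume lin: "p \<in> linear_relations scale"
      show ?thesis
        by (rule ext.lin_ext_linear_rels[OF ground_field_vs_alg _ lin])
          (simp_all add: det3_word_linear[OF assms, simplified] ground_field_simps)
    next
      assume "p \<in> alternating_relations"
      then obtain x where "p = word [x, x]" by (auto simp: alternating_relations_def)
      then show ?thesis using det3_word_alternating[of a b e u x v]
        by (simp add: lin_ext_ground_field) (simp add: ground_field_simps)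
    qed
  qed (simp add: ground_field_simps)
  show ?thesis
  proof (rule that)
    show "linear_map \<Lambda> ground_field (\<lambda>X. the_elem (lin_ext ground_field ?f ` X))"
      using ext.linear_map_quotient[OF ground_field_vs_alg lin kill] by (simp add: ext_Q)
    show "the_elem (lin_ext ground_field ?f ` ext.cls (word w)) = ?f w" for w
      by (subst ext.quotient_map[OF ground_field_vs_alg lin kill]) (simp_all add: lin_ext_ground_field)
  qed
qed

text \<open>The Leibniz rule splits the second argument, graded antisymmetry makes the first
  argument accessible to it, and what remains are brackets of generators.\<close>

lemma schouten_det:
  assumes B: "schouten_bracket scale bracket B"
    and \<phi>: "linear_map \<Lambda> ground_field \<phi>" "\<And>w. \<phi> (ext.cls (word w)) = f w"
  shows "\<phi> (B (ext.cls (word [x, y])) (ext.cls (word [u, v]))) =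
    - (f [bracket u x, y, v] + f [x, bracket u y, v]) + (f [u, bracket v x, y] + f [u, x, bracket v y])"
proof -
  let ?w = "\<lambda>w. ext.cls (word w)"
  have c [simp]: "?w w \<in> carrier \<Lambda>" for w using ext.cls_closed[of "word w"] by (simp add: ext_Q)
  have app: "?w u \<otimes>\<^bsub>\<Lambda>\<^esub> ?w v = ?w (u @ v)" for u v using ext.cls_word_append[of u v] by (simp add: ext_Q)
  have mem: "?w w \<in> exterior_power scale (length w)" for w
    unfolding exterior_power_eq by (rule imageI) simp
  have mem1: "?w [x] \<in> exterior_power scale 1" for x using mem[of "[x]"] by simp
  have mem2: "?w [x, y] \<in> exterior_power scale 2" for x y using mem[of "[x, y]"] by (simp add: numeral_2_eq_2)
  from B have gb: "gerstenhaber_bracket \<Lambda> (exterior_power scale) B"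
    and br: "\<And>x y. B (?w [x]) (?w [y]) = ?w [bracket x y]"
    by (auto simp: schouten_bracket_def exterior_incl_eq)
  \<comment> \<open>Degrees 2 and 1: the exponent (2 + 1) (1 + 1) is even, hence the factor
    -1.\<close>
  have anti: "B (?w [x, y]) (?w [u]) = (- 1) \<odot>\<^bsub>\<Lambda>\<^esub> B (?w [u]) (?w [x, y])" for x y u
    using gerstenhaber_bracketD(3)[OF gb mem2[of x y] mem1[of u]] by simp
  have leib: "B a (?w [u] \<otimes>\<^bsub>\<Lambda>\<^esub> ?w [v]) = (B a (?w [u]) \<otimes>\<^bsub>\<Lambda>\<^esub> ?w [v]) \<oplus>\<^bsub>\<Lambda>\<^esub> (((- 1) ^ ((k + 1) * 1)) \<odot>\<^bsub>\<Lambda>\<^esub> (?w [u] \<otimes>\<^bsub>\<Lambda>\<^esub> B a (?w [v])))"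
    if "a \<in> exterior_power scale k" for a k u v
    by (rule gerstenhaber_bracketD(4)[OF gb that mem1 c])
  have b1: "B (?w [u]) (?w [x, y]) = ?w [bracket u x, y] \<oplus>\<^bsub>\<Lambda>\<^esub> ?w [x, bracket u y]" for u x y
    using leib[OF mem1[of u], of x y] by (simp add: br app)
  have "B (?w [x, y]) (?w [u, v]) = ((- 1) \<odot>\<^bsub>\<Lambda>\<^esub> (?w [bracket u x, y, v] \<oplus>\<^bsub>\<Lambda>\<^esub> ?w [x, bracket u y, v]))
      \<oplus>\<^bsub>\<Lambda>\<^esub> (?w [u, bracket v x, y] \<oplus>\<^bsub>\<Lambda>\<^esub> ?w [u, x, bracket v y])"
    using leib[OF mem2[of x y], of u v]
    by (simp add: anti b1 app \<Lambda>.smult_mult_l \<Lambda>.smult_mult_r \<Lambda>.l_distr \<Lambda>.r_distr \<Lambda>.smult_smult numeral_2_eq_2)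
  then show ?thesis
    using linear_mapD[OF \<phi>(1)] by (simp add: \<phi>(2)) (simp add: ground_field_simps)
qed

text \<open>The contraction of the second factor of r with \<open>a\<close>, a word
  \<open>[x, y]\<close> standing for x \<otimes> y - y \<otimes> x.\<close>

definition rvec :: "('g list \<Rightarrow>\<^sub>0 'k) \<Rightarrow> ('g \<Rightarrow> 'k) \<Rightarrow> 'g" where
  "rvec p a = (\<Sum>w\<in>Poly_Mapping.keys p. scale (Poly_Mapping.lookup p w) (scale (a (w ! 1)) (w ! 0) - scale (a (w ! 0)) (w ! 1)))"

text \<open>The classical Yang-Baxter equation contracted with three functionals. When [[r, r]] is
  expanded bilinearly, each pair of words contributes the cyclic expression symmetrised in the two
  words, whence the factor 2.\<close>

theorem schouten_cybe:
  assumes B: "schouten_bracket scale bracket B" and p: "\<And>w. w \<in> Poly_Mapping.keys p \<Longrightarrow> length w = 2"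
    and zero: "B (ext.cls p) (ext.cls p) = \<zero>\<^bsub>\<Lambda>\<^esub>" and lin: "linf a" "linf b" "linf e"
  shows "2 * (e (bracket (rvec p a) (rvec p b)) + a (bracket (rvec p b) (rvec p e)) + b (bracket (rvec p e) (rvec p a))) = 0"
proof -
  obtain \<phi> where \<phi>: "linear_map \<Lambda> ground_field \<phi>" "\<And>w. \<phi> (ext.cls (word w)) = det3_word a b e w"
    using det3_functional[OF lin] by blast
  let ?w = "\<lambda>w. ext.cls (word w)"
  let ?K = "Poly_Mapping.keys p" and ?p = "Poly_Mapping.lookup p"
  have c: "?w w \<in> carrier \<Lambda>" for w using ext.cls_closed[of "word w"] by (simp add: ext_Q)
  have cp: "ext.cls p \<in> carrier \<Lambda>" using ext.cls_closed[of p] by (simp add: ext_Q)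
  have Bl: "linear_map \<Lambda> \<Lambda> (B X)" "linear_map \<Lambda> \<Lambda> (\<lambda>Y. B Y X)" if "X \<in> carrier \<Lambda>" for X
    using B that by (auto simp: schouten_bracket_def dest: gerstenhaber_bracketD(1,2))
  define T where "T w w' = \<phi> (B (?w w) (?w w'))" for w w'
  have "\<phi> (B (ext.cls p) (ext.cls p)) = lin_ext ground_field (\<lambda>w. \<phi> (B (?w w) (ext.cls p))) p"
    by (subst (1) cls_lin_ext)
      (rule linear_map_lin_ext[OF \<Lambda>_vs_alg ground_field_vs_alg linear_map_comp[OF Bl(2)[OF cp] \<phi>(1)]], simp add: c)
  also have "\<dots> = lin_ext ground_field (\<lambda>w. lin_ext ground_field (\<lambda>w'. T w w') p) p"
    unfolding T_def
    by (subst cls_lin_ext, subst linear_map_lin_ext[OF \<Lambda>_vs_alg ground_field_vs_alg linear_map_comp[OF Bl(1)[OF c] \<phi>(1)]])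
      (simp_all add: c)
  finally have sum0: "(\<Sum>w\<in>?K. \<Sum>w'\<in>?K. ?p w * ?p w' * T w w') = 0"
    using linear_map_zero[OF \<Lambda>_vs_alg ground_field_vs_alg \<phi>(1)]
    by (simp add: zero lin_ext_ground_field lc_def sum_distrib_left mult.assoc) (simp add: ground_field_simps)
  define rv where "rv w a = scale (a (w ! 1)) (w ! 0) - scale (a (w ! 0)) (w ! 1)" for w :: "'g list" and a :: "'g \<Rightarrow> 'k"
  define S where "S w w' = e (bracket (rv w a) (rv w' b)) + a (bracket (rv w b) (rv w' e)) + b (bracket (rv w e) (rv w' a))" for w w'
  have bl: "bracket (scale s x - scale t y) (scale s' u - scale t' v) = scale (s * s') (bracket x u) - scale (s * t') (bracket x v)
      - scale (t * s') (bracket y u) + scale (t * t') (bracket y v)" for s t s' t' x y u v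
  proof -
    have 1: "bracket (x - y) z = bracket x z - bracket y z" "bracket z (x - y) = bracket z x - bracket z y" for x y z
      using bracket_lin(1)[of x "scale (-1) y" z] bracket_lin(3)[of "-1" y z]
        bracket_lin(2)[of z x "scale (-1) y"] bracket_lin(4)[of z "-1" y] by simp_all
    show ?thesis by (simp add: 1 bracket_lin algebra_simps)
  qed
  \<comment> \<open>A polynomial identity in the values of the functionals, once all brackets are
    written as [x, u], [x, v], [y, u], [y, v].\<close>
  have TS: "T w w' = S w w' + S w' w" if w1: "w \<in> ?K" and w2: "w' \<in> ?K" for w w'
  proof -
    obtain x y where w: "w = [x, y]" using p[OF w1] by (auto simp: numeral_2_eq_2 length_Suc_conv)
    obtain u v where w': "w' = [u, v]" using p[OF w2] by (auto simp: numeral_2_eq_2 length_Suc_conv)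
    have T: "T [x, y] [u, v] = - (det3 a b e (bracket u x) y v + det3 a b e x (bracket u y) v)
        + (det3 a b e u (bracket v x) y + det3 a b e u x (bracket v y))"
      unfolding T_def schouten_det[OF B \<phi>] by (simp add: det3_word_def numeral_2_eq_2)
    have neg: "h (bracket u x) = - h (bracket x u)" "h (bracket u y) = - h (bracket y u)"
       "h (bracket v x) = - h (bracket x v)" "h (bracket v y) = - h (bracket y v)" if "linf h" for h
      using linf_minus[OF that] bracket_anti[of u x] bracket_anti[of u y] bracket_anti[of v x] bracket_anti[of v y] by simp_all
    have exp: "h (bracket (rv [x, y] f) (rv [u, v] g)) = f y * g v * h (bracket x u) - f y * g u * h (bracket x v)
       - f x * g v * h (bracket y u) + f x * g u * h (bracket y v)" if "linf h" for h f g and x y u v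
      by (simp add: rv_def bl linfD[OF that] linf_diff[OF that])
    show ?thesis
      unfolding w w' T S_def exp[OF lin(1)] exp[OF lin(2)] exp[OF lin(3)] neg[OF lin(1)] neg[OF lin(2)] neg[OF lin(3)] det3_def
      by (simp add: algebra_simps)
  qed
  have rvec: "rvec p f = (\<Sum>w\<in>?K. scale (?p w) (rv w f))" for f
    by (simp add: rvec_def rv_def)
  have br_sum: "h (bracket (\<Sum>w\<in>?K. scale (?p w) (f w)) (\<Sum>w\<in>?K. scale (?p w) (g w))) = (\<Sum>w\<in>?K. \<Sum>w'\<in>?K. ?p w * ?p w' * h (bracket (f w) (g w')))"
    if "linf h" for h f g
    by (simp add: linf_sum[OF linf_bracket_l[OF that]] linf_sum[OF linf_bracket_r[OF that]]
        linfD(2)[OF linf_bracket_l[OF that]] linfD(2)[OF linf_bracket_r[OF that]] sum_distrib_left mult.assoc)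
      (subst sum.swap, simp add: mult.left_commute)
  have "e (bracket (rvec p a) (rvec p b)) + a (bracket (rvec p b) (rvec p e)) + b (bracket (rvec p e) (rvec p a))
     = (\<Sum>w\<in>?K. \<Sum>w'\<in>?K. ?p w * ?p w' * S w w')"
    unfolding rvec br_sum[OF lin(1)] br_sum[OF lin(2)] br_sum[OF lin(3)] S_def
    by (simp add: distrib_left sum.distrib)
  moreover have "(\<Sum>w\<in>?K. \<Sum>w'\<in>?K. ?p w * ?p w' * S w' w) = (\<Sum>w\<in>?K. \<Sum>w'\<in>?K. ?p w * ?p w' * S w w')"
    by (subst sum.swap) (simp add: mult_ac)
  moreover have "(\<Sum>w\<in>?K. \<Sum>w'\<in>?K. ?p w * ?p w' * T w w')
      = (\<Sum>w\<in>?K. \<Sum>w'\<in>?K. ?p w * ?p w' * S w w') + (\<Sum>w\<in>?K. \<Sum>w'\<in>?K. ?p w * ?p w' * S w' w)"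
    unfolding sum.distrib[symmetric] by (intro sum.cong refl) (simp add: TS distrib_left)
  ultimately show ?thesis using sum0 by simp
qed

text \<open>The expression on words is bilinear and alternating in degree two and zero in the other
  degrees, so it is independent of the representative.\<close>

lemma antisymmetric_tensor_cls:
  "antisymmetric_tensor scale bracket (ext.cls p) =
    lin_ext UU (\<lambda>w. case w of [x, y] \<Rightarrow> UU.ten (\<iota> x) (\<iota> y) \<ominus>\<^bsub>UU\<^esub> UU.ten (\<iota> y) (\<iota> x) | _ \<Rightarrow> \<zero>\<^bsub>UU\<^esub>) p"
proof -
  define g where "g x y = UU.ten (\<iota> x) (\<iota> y) \<ominus>\<^bsub>UU\<^esub> UU.ten (\<iota> y) (\<iota> x)" for x y
  let ?f = "\<lambda>w. case w of [x, y] \<Rightarrow> g x y | _ \<Rightarrow> \<zero>\<^bsub>UU\<^esub>"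
  have gc: "g x y \<in> carrier UU" for x y by (simp add: g_def)
  then have fc: "?f w \<in> carrier UU" for w by (auto split: list.split)
  have g_add: "g (x + x') y = g x y \<oplus>\<^bsub>UU\<^esub> g x' y" "g y (x + x') = g y x \<oplus>\<^bsub>UU\<^esub> g y x'" for x x' y
    by (simp_all add: g_def \<iota>_add UU.ten_add_l UU.ten_add_r a_minus_def UUr.minus_add UUr.a_ac)
  have g_scale: "g (scale t x) y = t \<odot>\<^bsub>UU\<^esub> g x y" "g y (scale t x) = t \<odot>\<^bsub>UU\<^esub> g y x" for t x y
    by (simp_all add: g_def \<iota>_scale UU.ten_smult_l UU.ten_smult_r a_minus_def UUr.smult_minus_one[symmetric]
        UUr.smult_r_distr UUr.smult_smult mult.commute)
  have g_alt: "g x x = \<zero>\<^bsub>UU\<^esub>" for x by (simp add: g_def a_minus_def UUr.r_neg)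
  have f_cases: "?f (u @ [x] @ v) = (case (u, v) of ([], [y]) \<Rightarrow> g x y | ([y], []) \<Rightarrow> g y x | _ \<Rightarrow> \<zero>\<^bsub>UU\<^esub>)" for u x v
    by (auto split: list.split)
  have lin: "linear_map ext.TT UU (lin_ext UU ?f)"
    by (rule UUr.linear_map_lin_ext_monoid) (simp add: fc)
  have kill: "lin_ext UU ?f p = \<zero>\<^bsub>UU\<^esub>" if "p \<in> relation_ideal scale alternating_relations" for p
  proof (rule ext.ideal_kill[OF UU.T_vs_alg fc _ that])
    fix u v p assume "p \<in> ext.rels"
    then show "lin_ext UU (\<lambda>w. ?f (u @ w @ v)) p = \<zero>\<^bsub>UU\<^esub>"
      unfolding Un_iff
    proof
      assume lin: "p \<in> linear_relations scale"
      show ?thesis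
        by (rule ext.lin_ext_linear_rels[OF UU.T_vs_alg fc lin])
          (unfold f_cases, auto simp: g_add g_scale split: list.split)
    next
      assume "p \<in> alternating_relations"
      then obtain x where "p = word [x, x]" by (auto simp: alternating_relations_def)
      moreover have "?f (u @ [x, x] @ v) = \<zero>\<^bsub>UU\<^esub>" by (cases u; cases v) (auto simp: g_alt split: list.split)
      ultimately show ?thesis by (simp add: UUr.lin_ext_single[where f = "\<lambda>w. ?f (u @ w @ v)"])
    qed
  qed
  show ?thesis
    unfolding antisymmetric_tensor_def Let_def g_def[symmetric]
    by (rule ext.quotient_map[OF UU.T_vs_alg lin kill]) simp_all
qed

lemma classical_r_matrixE:
  assumes "classical_r_matrix scale bracket r"
  obtains p where "\<And>w. w \<in> Poly_Mapping.keys p \<Longrightarrow> length w = 2"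
    "antisymmetric_tensor scale bracket r =
      lin_ext UU (\<lambda>w. case w of [x, y] \<Rightarrow> UU.ten (\<iota> x) (\<iota> y) \<ominus>\<^bsub>UU\<^esub> UU.ten (\<iota> y) (\<iota> x) | _ \<Rightarrow> \<zero>\<^bsub>UU\<^esub>) p"
    "\<And>a b e. linf a \<Longrightarrow> linf b \<Longrightarrow> linf e \<Longrightarrow>
      2 * (e (bracket (rvec p a) (rvec p b)) + a (bracket (rvec p b) (rvec p e)) + b (bracket (rvec p e) (rvec p a))) = 0"
proof -
  from assms obtain B p where B: "schouten_bracket scale bracket B" "B r r = \<zero>\<^bsub>\<Lambda>\<^esub>"
    and p: "r = ext.cls p" "\<And>w. w \<in> Poly_Mapping.keys p \<Longrightarrow> length w = 2"
    unfolding classical_r_matrix_def exterior_power_eq by blast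
  show ?thesis
    by (rule that[OF p(2)], assumption, simp only: p(1) antisymmetric_tensor_cls)
      (rule schouten_cybe[OF B(1) p(2) B(2)[unfolded p(1)]])
qed

end

section \<open>Reduction to a nondegenerate subalgebra\<close>

lemma sum_sum_insert:
  fixes f :: "'i \<Rightarrow> 'i \<Rightarrow> 'b::comm_monoid_add"
  assumes "finite I" "m \<notin> I"
  shows "(\<Sum>i\<in>insert m I. \<Sum>j\<in>insert m I. f i j) = f m m + (\<Sum>j\<in>I. f m j) + (\<Sum>i\<in>I. f i m) + (\<Sum>i\<in>I. \<Sum>j\<in>I. f i j)"
  using assms by (simp add: sum.distrib add_ac)

context lie_algebra begin

text \<open>A tensor in \<open>g \<otimes> g\<close> is represented by the bilinear form \<open>\<phi>\<close> on linear functionals that it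
  induces, here for the antisymmetric tensor with coefficients \<open>R\<close> on the vectors \<open>y\<close>.\<close>

definition bivec :: "(('g \<Rightarrow> 'k) \<Rightarrow> ('g \<Rightarrow> 'k) \<Rightarrow> 'k) \<Rightarrow> nat set \<Rightarrow> (nat \<Rightarrow> 'g) \<Rightarrow> (nat \<Rightarrow> nat \<Rightarrow> 'k) \<Rightarrow> bool" where
  "bivec \<phi> I y R \<longleftrightarrow> finite I \<and> (\<forall>i j. R j i = - R i j) \<and> (\<forall>i. R i i = 0) \<and>
     (\<forall>a b. linf a \<longrightarrow> linf b \<longrightarrow> \<phi> a b = (\<Sum>i\<in>I. \<Sum>j\<in>I. R i j * (a (y i) * b (y j))))"

lemma bivecD:
  assumes "bivec \<phi> I y R"
  shows "finite I" "R j i = - R i j" "R i i = 0"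
    "linf a \<Longrightarrow> linf b \<Longrightarrow> \<phi> a b = (\<Sum>i\<in>I. \<Sum>j\<in>I. R i j * (a (y i) * b (y j)))"
  using assms unfolding bivec_def by blast+

text \<open>\<open>u\<close> and \<open>v\<close> receive two fresh indices even if they are
  combinations of earlier vectors; \<open>bivec_minimal\<close> removes such redundancy.\<close>

lemma bivec_add:
  assumes "bivec \<phi> I y R"
  shows "\<exists>I y R. bivec (\<lambda>a b. \<phi> a b + t * (a u * b v - a v * b u)) I y R"
proof -
  note fin = bivecD(1)[OF assms] and anti = bivecD(2)[OF assms] and diag = bivecD(3)[OF assms] and val = bivecD(4)[OF assms]
  obtain m where m: "m \<notin> I" using fin ex_new_if_finite[of I] by auto
  have "finite (insert m I)" using fin by simp
  then obtain n where n: "n \<notin> insert m I" using ex_new_if_finite[of "insert m I"] by auto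
  define y' where "y' = y(m := u, n := v)"
  define R' where "R' i j = (if i \<in> I \<and> j \<in> I then R i j else if i = m \<and> j = n then t else if i = n \<and> j = m then - t else 0)" for i j
  have y': "y' i = y i" if "i \<in> I" for i using that m n by (auto simp: y'_def)
  have ym: "y' m = u" "y' n = v" using n by (auto simp: y'_def)
  have R': "R' i j = R i j" if "i \<in> I" "j \<in> I" for i j using that by (simp add: R'_def)
  have R0: "R' m j = 0" "R' j m = 0" "R' n j = 0" "R' j n = 0" "R' m m = 0" "R' n n = 0" if "j \<in> I" for j
    using that m n by (auto simp: R'_def)
  have R0': "R' m m = 0" "R' n n = 0" "R' m n = t" "R' n m = - t" using m n by (auto simp: R'_def)
  have "bivec (\<lambda>a b. \<phi> a b + t * (a u * b v - a v * b u)) (insert n (insert m I)) y' R'"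
    unfolding bivec_def
  proof (intro conjI allI impI)
    show "finite (insert n (insert m I))" using fin by simp
    show "R' j i = - R' i j" for i j using m n by (auto simp: R'_def anti[of j i])
    show "R' i i = 0" for i using m n by (auto simp: R'_def diag)
    fix a b assume lin: "linf a" "linf b"
    have "(\<Sum>i\<in>insert n (insert m I). \<Sum>j\<in>insert n (insert m I). R' i j * (a (y' i) * b (y' j)))
      = - t * (a v * b u) + t * (a u * b v) + (\<Sum>i\<in>I. \<Sum>j\<in>I. R' i j * (a (y' i) * b (y' j)))"
      using fin m n by (simp add: sum_sum_insert R0 R0' ym)
    also have "(\<Sum>i\<in>I. \<Sum>j\<in>I. R' i j * (a (y' i) * b (y' j))) = \<phi> a b"
      by (simp add: R' y' val[OF lin])
    finally show "\<phi> a b + t * (a u * b v - a v * b u) = (\<Sum>i\<in>insert n (insert m I). \<Sum>j\<in>insert n (insert m I). R' i j * (a (y' i) * b (y' j)))"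
      by (simp add: algebra_simps)
  qed
  then show ?thesis by blast
qed

lemma bivec_exists:
  "finite K \<Longrightarrow> \<exists>I y R. bivec (\<lambda>a b. \<Sum>w\<in>K. t w * (a (w ! 0) * b (w ! 1) - a (w ! 1) * b (w ! 0))) I y R"
proof (induction K rule: finite_induct)
  case empty
  have "bivec (\<lambda>a b. 0) {} (\<lambda>_. 0) (\<lambda>_ _. 0)" by (simp add: bivec_def)
  then show ?case by (simp only: sum.empty) blast
next
  case (insert w K)
  then obtain I y R where "bivec (\<lambda>a b. \<Sum>w\<in>K. t w * (a (w ! 0) * b (w ! 1) - a (w ! 1) * b (w ! 0))) I y R" by blast
  from bivec_add[OF this, of "t w" "w ! 0" "w ! 1"] show ?case
    using insert.hyps by (simp add: add.commute)
qed

text \<open>A kernel vector q of the matrix, scaled to q_m = 1, allows y_i to be replaced by y_i -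
  q_i y_m without changing the tensor, and the vector with index m becomes zero.\<close>

lemma bivec_reduce_kernel:
  assumes r: "bivec \<phi> I y R" and k: "\<And>j. j \<in> I \<Longrightarrow> (\<Sum>i\<in>I. k i * R i j) = 0" and m: "m \<in> I" "k m \<noteq> 0"
  shows "\<exists>y' R'. bivec \<phi> (I - {m}) y' R'"
proof -
  let ?J = "I - {m}"
  define q where "q i = k i / k m" for i
  note finI = bivecD(1)[OF r] and anti = bivecD(2)[OF r] and diag = bivecD(3)[OF r] and val = bivecD(4)[OF r]
  have I: "I = insert m ?J" and fin: "finite ?J" using m finI by auto
  have Q: "(\<Sum>i\<in>?J. q i * R i j) = - R m j" if "j \<in> I" for j
  proof -
    have "k m * R m j + (\<Sum>i\<in>?J. k i * R i j) = 0"
      using k[OF that] m finI by (simp add: sum.remove[of I m])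
    then have "(k m * R m j + (\<Sum>i\<in>?J. k i * R i j)) / k m = 0" by simp
    then show ?thesis using m by (simp add: q_def add_divide_distrib sum_divide_distrib eq_neg_iff_add_eq_0 add.commute)
  qed
  have Q': "(\<Sum>j\<in>?J. R i j * q j) = - R i m" if "i \<in> I" for i
  proof -
    have "(\<Sum>j\<in>?J. R i j * q j) = - (\<Sum>j\<in>?J. q j * R j i)"
      unfolding sum_negf[symmetric] by (rule sum.cong) (simp_all add: anti[of i] mult.commute)
    then show ?thesis using Q[OF that] anti[of m i] by simp
  qed
  define y' where "y' i = y i - scale (q i) (y m)" for i
  have "bivec \<phi> ?J y' R"
    unfolding bivec_def
  proof (intro conjI allI impI fin anti diag)
    fix a b assume lin: "linf a" "linf b"
    let ?A = "\<lambda>i. a (y i)" and ?B = "\<lambda>i. b (y i)"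
    have "(\<Sum>i\<in>?J. \<Sum>j\<in>?J. R i j * (a (y' i) * b (y' j)))
      = (\<Sum>i\<in>?J. \<Sum>j\<in>?J. R i j * (?A i * ?B j)) - ?A m * (\<Sum>j\<in>?J. (\<Sum>i\<in>?J. q i * R i j) * ?B j)
        - ?B m * (\<Sum>i\<in>?J. (\<Sum>j\<in>?J. R i j * q j) * ?A i) + ?A m * ?B m * (\<Sum>j\<in>?J. (\<Sum>i\<in>?J. q i * R i j) * q j)"
    proof -
      have "(\<Sum>i\<in>?J. \<Sum>j\<in>?J. R i j * (a (y' i) * b (y' j))) = (\<Sum>i\<in>?J. \<Sum>j\<in>?J. R i j * (?A i * ?B j) - ?A m * (q i * R i j * ?B j)
          - ?B m * (R i j * q j * ?A i) + ?A m * ?B m * (q i * R i j * q j))"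
        by (intro sum.cong refl) (simp add: y'_def linf_diff[OF lin(1)] linf_diff[OF lin(2)] linfD(2)[OF lin(1)] linfD(2)[OF lin(2)] algebra_simps)
      also have "\<dots> = (\<Sum>i\<in>?J. \<Sum>j\<in>?J. R i j * (?A i * ?B j)) - ?A m * (\<Sum>i\<in>?J. \<Sum>j\<in>?J. q i * R i j * ?B j)
          - ?B m * (\<Sum>i\<in>?J. \<Sum>j\<in>?J. R i j * q j * ?A i) + ?A m * ?B m * (\<Sum>i\<in>?J. \<Sum>j\<in>?J. q i * R i j * q j)"
        by (simp only: sum.distrib sum_subtractf sum_distrib_left)
      also have "(\<Sum>i\<in>?J. \<Sum>j\<in>?J. q i * R i j * ?B j) = (\<Sum>j\<in>?J. (\<Sum>i\<in>?J. q i * R i j) * ?B j)"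
        by (subst sum.swap) (simp add: sum_distrib_right)
      also have "(\<Sum>i\<in>?J. \<Sum>j\<in>?J. q i * R i j * q j) = (\<Sum>j\<in>?J. (\<Sum>i\<in>?J. q i * R i j) * q j)"
        by (subst sum.swap) (simp add: sum_distrib_right)
      also have "(\<Sum>i\<in>?J. \<Sum>j\<in>?J. R i j * q j * ?A i) = (\<Sum>i\<in>?J. (\<Sum>j\<in>?J. R i j * q j) * ?A i)"
        by (simp add: sum_distrib_right)
      finally show ?thesis .
    qed
    also have "(\<Sum>j\<in>?J. (\<Sum>i\<in>?J. q i * R i j) * q j) = (\<Sum>j\<in>?J. - (R m j * q j))"
      by (intro sum.cong refl) (simp add: Q)
    also have "\<dots> = R m m" using Q'[OF m(1)] by (simp add: sum_negf)
    also have "(\<Sum>j\<in>?J. (\<Sum>i\<in>?J. q i * R i j) * ?B j) = - (\<Sum>j\<in>?J. R m j * ?B j)"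
      by (simp add: Q sum_negf)
    also have "(\<Sum>i\<in>?J. (\<Sum>j\<in>?J. R i j * q j) * ?A i) = - (\<Sum>i\<in>?J. R i m * ?A i)"
      by (simp add: Q' sum_negf)
    finally have "(\<Sum>i\<in>?J. \<Sum>j\<in>?J. R i j * (a (y' i) * b (y' j)))
      = R m m * (?A m * ?B m) + (\<Sum>j\<in>?J. R m j * (?A m * ?B j)) + (\<Sum>i\<in>?J. R i m * (?A i * ?B m)) + (\<Sum>i\<in>?J. \<Sum>j\<in>?J. R i j * (?A i * ?B j))"
      by (simp add: diag sum_distrib_left mult_ac add_ac)
    also have "\<dots> = \<phi> a b"
      using sum_sum_insert[OF fin, of m "\<lambda>i j. R i j * (?A i * ?B j)"] I by (simp add: val[OF lin])
    finally show "\<phi> a b = (\<Sum>i\<in>?J. \<Sum>j\<in>?J. R i j * (a (y' i) * b (y' j)))" ..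
  qed
  then show ?thesis by blast
qed

text \<open>The linear relation expresses y_m through the other vectors, and the result is
  substituted into the tensor.\<close>

lemma bivec_reduce_dependent:
  assumes r: "bivec \<phi> I y R" and k: "(\<Sum>i\<in>I. scale (k i) (y i)) = 0" and m: "m \<in> I" "k m \<noteq> 0"
  shows "\<exists>y' R'. bivec \<phi> (I - {m}) y' R'"
proof -
  let ?J = "I - {m}"
  define s where "s i = - k i / k m" for i
  note finI = bivecD(1)[OF r] and anti = bivecD(2)[OF r] and diag = bivecD(3)[OF r] and val = bivecD(4)[OF r]
  have I: "I = insert m ?J" and fin: "finite ?J" using m finI by auto
  have ym: "a (y m) = (\<Sum>i\<in>?J. s i * a (y i))" if a: "linf a" for a
  proof -
    have "(\<Sum>i\<in>I. k i * a (y i)) = 0"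
      using arg_cong[OF k, of a] by (simp add: linf_sum[OF a] linfD(2)[OF a] linf_zero[OF a])
    then have "k m * a (y m) + (\<Sum>i\<in>?J. k i * a (y i)) = 0"
      using m finI by (simp add: sum.remove[of I m])
    then have "(k m * a (y m) + (\<Sum>i\<in>?J. k i * a (y i))) / k m = 0" by simp
    then show ?thesis using m by (simp add: s_def add_divide_distrib sum_divide_distrib sum_negf eq_neg_iff_add_eq_0)
  qed
  \<comment> \<open>The term s_i s_j R_mm of the substitution is zero.\<close>
  define R' where "R' i j = R i j + s i * R m j + R i m * s j" for i j
  have "bivec \<phi> ?J y R'"
    unfolding bivec_def
  proof (intro conjI allI impI fin)
    show "R' j i = - R' i j" for i j
      using anti[of i j] anti[of m j] anti[of m i] by (simp add: R'_def algebra_simps)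
    show "R' i i = 0" for i
      using anti[of m i] by (simp add: R'_def diag algebra_simps)
    fix a b assume lin: "linf a" "linf b"
    let ?A = "\<lambda>i. a (y i)" and ?B = "\<lambda>i. b (y i)"
    have "(\<Sum>i\<in>?J. \<Sum>j\<in>?J. R' i j * (?A i * ?B j)) = (\<Sum>i\<in>?J. \<Sum>j\<in>?J. R i j * (?A i * ?B j))
       + (\<Sum>i\<in>?J. \<Sum>j\<in>?J. (s i * ?A i) * (R m j * ?B j)) + (\<Sum>i\<in>?J. \<Sum>j\<in>?J. (R i m * ?A i) * (s j * ?B j))"
      by (simp add: R'_def sum.distrib algebra_simps)
    also have "(\<Sum>i\<in>?J. \<Sum>j\<in>?J. (s i * ?A i) * (R m j * ?B j)) = ?A m * (\<Sum>j\<in>?J. R m j * ?B j)"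
      unfolding ym[OF lin(1)] sum_product ..
    also have "(\<Sum>i\<in>?J. \<Sum>j\<in>?J. (R i m * ?A i) * (s j * ?B j)) = (\<Sum>i\<in>?J. R i m * ?A i) * ?B m"
      unfolding ym[OF lin(2)] sum_product ..
    finally have "(\<Sum>i\<in>?J. \<Sum>j\<in>?J. R' i j * (?A i * ?B j))
      = R m m * (?A m * ?B m) + (\<Sum>j\<in>?J. R m j * (?A m * ?B j)) + (\<Sum>i\<in>?J. R i m * (?A i * ?B m)) + (\<Sum>i\<in>?J. \<Sum>j\<in>?J. R i j * (?A i * ?B j))"
      by (simp add: diag sum_distrib_left sum_distrib_right mult_ac add_ac)
    also have "\<dots> = \<phi> a b"
      using sum_sum_insert[OF fin, of m "\<lambda>i j. R i j * (?A i * ?B j)"] I by (simp add: val[OF lin])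
    finally show "\<phi> a b = (\<Sum>i\<in>?J. \<Sum>j\<in>?J. R' i j * (?A i * ?B j))" ..
  qed
  then show ?thesis by blast
qed

text \<open>A presentation with the fewest vectors admits neither reduction, hence has independent
  vectors and a nondegenerate matrix. Values beyond \<open>d\<close> are set to zero so that the
  identities of \<open>twist_data\<close> hold for all indices.\<close>

lemma bivec_minimal:
  assumes "bivec \<phi> I0 y0 R0"
  obtains d y R where "bivec \<phi> {..<d} y R"
    "\<And>i. i \<ge> d \<Longrightarrow> y i = 0" "\<And>i j. i \<ge> d \<or> j \<ge> d \<Longrightarrow> R i j = 0"
    "\<And>k i. (\<Sum>i<d. scale (k i) (y i)) = 0 \<Longrightarrow> i < d \<Longrightarrow> k i = 0"
    "\<And>k i. (\<And>j. j < d \<Longrightarrow> (\<Sum>i<d. k i * R i j) = 0) \<Longrightarrow> i < d \<Longrightarrow> k i = 0"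
proof -
  define P where "P n \<longleftrightarrow> (\<exists>I y R. bivec \<phi> I y R \<and> card I = n)" for n
  have "P (card I0)" unfolding P_def using assms by blast
  define d where "d = (LEAST n. P n)"
  have "P d" unfolding d_def using \<open>P (card I0)\<close> by (rule LeastI)
  then obtain I y R where r: "bivec \<phi> I y R" and d: "card I = d" by (auto simp: P_def)
  have minimal: "\<not> bivec \<phi> (I - {m}) y' R'" if "m \<in> I" for m y' R'
  proof
    assume "bivec \<phi> (I - {m}) y' R'"
    then have "P (card (I - {m}))" by (auto simp: P_def)
    then have "d \<le> card (I - {m})" unfolding d_def by (rule Least_le)
    moreover have "card (I - {m}) < card I"
      by (rule psubset_card_mono) (use bivecD(1)[OF r] that in auto)
    ultimately show False using d by simp
  qed
  have indep: "k m = 0" if "(\<Sum>i\<in>I. scale (k i) (y i)) = 0" "m \<in> I" for k m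
    using bivec_reduce_dependent[OF r that] minimal[OF that(2)] by blast
  have nondeg: "k m = 0" if "\<And>j. j \<in> I \<Longrightarrow> (\<Sum>i\<in>I. k i * R i j) = 0" "m \<in> I" for k m
    using bivec_reduce_kernel[OF r that] minimal[OF that(2)] by blast
  have "finite I" by (rule bivecD(1)[OF r])
  then obtain h where h: "bij_betw h {..<d} I"
    using d ex_bij_betw_nat_finite[of I] by (auto simp: lessThan_atLeast0)
  have hI: "h i \<in> I" if "i < d" for i using h that by (auto simp: bij_betw_def)
  have re: "(\<Sum>i<d. f (h i)) = sum f I" for f :: "nat \<Rightarrow> 'c::comm_monoid_add"
    using sum.reindex_bij_betw[OF h] .
  define g where "g = inv_into {..<d} h"
  have g: "g (h i) = i" if "i < d" for i
    using h that by (simp add: g_def bij_betw_def inv_into_f_f)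
  define y' where "y' i = (if i < d then y (h i) else 0)" for i
  define R' where "R' i j = (if i < d \<and> j < d then R (h i) (h j) else 0)" for i j
  have 1: "bivec \<phi> {..<d} y' R'"
    unfolding bivec_def
  proof (intro conjI allI impI)
    show "R' j i = - R' i j" "R' i i = 0" for i j
      using bivecD(2)[OF r, of "h j" "h i"] by (simp_all add: R'_def bivecD(3)[OF r])
    fix a b assume "linf a" "linf b"
    then have "\<phi> a b = (\<Sum>i\<in>I. \<Sum>j\<in>I. R i j * (a (y i) * b (y j)))" by (rule bivecD(4)[OF r])
    also have "\<dots> = (\<Sum>i<d. \<Sum>j<d. R' i j * (a (y' i) * b (y' j)))"
      by (simp add: re[symmetric] R'_def y'_def)
    finally show "\<phi> a b = (\<Sum>i<d. \<Sum>j<d. R' i j * (a (y' i) * b (y' j)))" .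
  qed simp
  have 2: "k i = 0" if "(\<Sum>i<d. scale (k i) (y' i)) = 0" "i < d" for k i
  proof -
    have "(\<Sum>i\<in>I. scale (k (g i)) (y i)) = 0"
      using that(1) by (simp add: re[symmetric] y'_def g)
    from indep[OF this hI[OF that(2)]] show ?thesis using that(2) by (simp add: g)
  qed
  have 3: "k i = 0" if "\<And>j. j < d \<Longrightarrow> (\<Sum>i<d. k i * R' i j) = 0" "i < d" for k i
  proof -
    have "(\<Sum>i\<in>I. k (g i) * R i j) = 0" if j: "j \<in> I" for j
    proof -
      obtain j' where j': "j' < d" "j = h j'" using h j by (auto simp: bij_betw_def)
      show ?thesis using \<open>\<And>j. j < d \<Longrightarrow> (\<Sum>i<d. k i * R' i j) = 0\<close>[OF j'(1)] j' by (simp add: re[symmetric] R'_def g)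
    qed
    from nondeg[OF this hI[OF that(2)]] show ?thesis using that(2) by (simp add: g)
  qed
  show ?thesis
  proof (rule that[OF 1])
    show "y' i = 0" if "i \<ge> d" for i using that by (simp add: y'_def)
    show "R' i j = 0" if "i \<ge> d \<or> j \<ge> d" for i j using that by (auto simp: R'_def)
    show "k i = 0" if "(\<Sum>i<d. scale (k i) (y' i)) = 0" "i < d" for k i using that by (rule 2)
    show "k i = 0" if "\<And>j. j < d \<Longrightarrow> (\<Sum>i<d. k i * R' i j) = 0" "i < d" for k i using that by (rule 3)
  qed
qed

section \<open>Functionals and coordinates\<close>

lemma linf_extend:
  assumes "independent B"
  obtains a where "linf a" "\<And>x. x \<in> B \<Longrightarrow> a x = f x"
proof -
  interpret vp: vector_space_pair scale "(*) :: 'k \<Rightarrow> 'k \<Rightarrow> 'k" by unfold_locales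
  obtain a where a: "Vector_Spaces.linear scale (*) a" "\<forall>x\<in>B. a x = f x"
    using vp.linear_independent_extend[OF assms] by blast
  interpret l: Vector_Spaces.linear scale "(*)" a by (rule a)
  show ?thesis by (rule that[of a]) (auto simp: linf_def l.add l.scale a(2))
qed

lemma linf_separate: "(\<And>a. linf a \<Longrightarrow> a v = 0) \<Longrightarrow> v = 0"
proof (rule ccontr)
  assume v: "\<And>a. linf a \<Longrightarrow> a v = 0" "v \<noteq> 0"
  then have "independent {v}" by simp
  then obtain a where a: "linf a" "a v = 1" by (rule linf_extend[of "{v}" "\<lambda>_. 1"]) auto
  show False using v(1)[OF a(1)] a(2) by simp
qed

lemma indep_family:
  fixes d :: nat
  assumes "\<forall>k. (\<Sum>i<d. scale (k i) (z i)) = 0 \<longrightarrow> (\<forall>i<d. k i = 0)"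
  shows "inj_on z {..<d}" "independent (z ` {..<d})"
proof -
  show inj: "inj_on z {..<d}"
  proof (rule inj_onI, rule ccontr)
    fix i j assume ij: "i \<in> {..<d}" "j \<in> {..<d}" "z i = z j" "i \<noteq> j"
    have "(\<Sum>l<d. scale ((if l = i then 1 else 0) - (if l = j then 1 else 0)) (z l))
       = (\<Sum>l<d. if l = i then z i else 0) - (\<Sum>l<d. if l = j then z j else 0)"
      unfolding sum_subtractf[symmetric] by (rule sum.cong) (auto simp: scale_left_diff_distrib)
    also have "\<dots> = z i - z j"
      using ij(1,2) sum.delta[of "{..<d}" i "\<lambda>_. z i"] sum.delta[of "{..<d}" j "\<lambda>_. z j"] by simp
    also have "\<dots> = 0" using ij(3) by simp
    finally have "(if i = i then 1 else 0) - (if i = j then 1 else 0) = (0 :: 'k)"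
      using assms[rule_format, of "\<lambda>l. (if l = i then 1 else 0) - (if l = j then 1 else 0)" i] ij(1) by blast
    then show False using ij(4) by simp
  qed
  show "independent (z ` {..<d})"
  proof
    assume "dependent (z ` {..<d})"
    then obtain u v where u: "v \<in> z ` {..<d}" "u v \<noteq> 0" "(\<Sum>v\<in>z ` {..<d}. scale (u v) v) = 0"
      using dependent_finite[of "z ` {..<d}"] by auto
    have "(\<Sum>i<d. scale (u (z i)) (z i)) = 0" using u(3) inj by (simp add: sum.reindex)
    then have "u (z i) = 0" if "i < d" for i using assms[rule_format, of "\<lambda>i. u (z i)"] that by blast
    then show False using u by auto
  qed
qed

text \<open>Coordinates with respect to the family, extended from its span to all of g.\<close>

lemma dual_functionals:
  fixes d :: nat
  assumes indep: "\<forall>k. (\<Sum>i<d. scale (k i) (z i)) = 0 \<longrightarrow> (\<forall>i<d. k i = 0)"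
  obtains zs where "\<And>i. linf (zs i)" "\<And>i j. j < d \<Longrightarrow> zs i (z j) = (if i = j then 1 else 0)" "\<And>i v. i \<ge> d \<Longrightarrow> zs i v = 0"
    "\<And>v. v \<in> span (z ` {..<d}) \<Longrightarrow> v = (\<Sum>i<d. scale (zs i v) (z i))"
proof -
  note inj = indep_family(1)[OF indep] and ind = indep_family(2)[OF indep]
  have "\<exists>a. linf a \<and> (\<forall>j<d. a (z j) = (if i = j then 1 else 0))" for i
  proof -
    obtain a where "linf a" "\<And>x. x \<in> z ` {..<d} \<Longrightarrow> a x = (if i = inv_into {..<d} z x then 1 else 0)"
      using linf_extend[OF ind, where f = "\<lambda>x. if i = inv_into {..<d} z x then 1 else 0"] by blast
    then show ?thesis using inj by (intro exI[of _ a]) (auto simp: inv_into_f_f)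
  qed
  then obtain f where f: "\<And>i. linf (f i)" "\<And>i j. j < d \<Longrightarrow> f i (z j) = (if i = j then 1 else 0)" by metis
  define zs where "zs i = (if i < d then f i else (\<lambda>_. 0))" for i
  have lin: "linf (zs i)" for i using f(1) by (auto simp: zs_def linf_def)
  have val: "zs i (z j) = (if i = j then 1 else 0)" if "j < d" for i j using f(2) that by (auto simp: zs_def)
  have "v = (\<Sum>i<d. scale (zs i v) (z i))" if "v \<in> span (z ` {..<d})" for v
    using that
  proof (rule span_induct)
    show "subspace {v. v = (\<Sum>i<d. scale (zs i v) (z i))}"
    proof (rule subspaceI)
      fix x y t assume x: "x \<in> {v. v = (\<Sum>i<d. scale (zs i v) (z i))}" 
      have "(\<Sum>i<d. scale (zs i (scale t x)) (z i)) = scale t (\<Sum>i<d. scale (zs i x) (z i))"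
        by (simp add: linfD(2)[OF lin] scale_sum_right)
      then show "scale t x \<in> {v. v = (\<Sum>i<d. scale (zs i v) (z i))}" using x by simp
      assume y: "y \<in> {v. v = (\<Sum>i<d. scale (zs i v) (z i))}"
      have "(\<Sum>i<d. scale (zs i (x + y)) (z i)) = (\<Sum>i<d. scale (zs i x) (z i)) + (\<Sum>i<d. scale (zs i y) (z i))"
        by (simp add: linfD(1)[OF lin] scale_left_distrib sum.distrib)
      then show "x + y \<in> {v. v = (\<Sum>i<d. scale (zs i v) (z i))}" using x y by simp
    qed (simp add: linf_zero[OF lin])
    fix v assume "v \<in> z ` {..<d}"
    then obtain j where j: "j < d" "v = z j" by auto
    have "(\<Sum>i<d. scale (zs i v) (z i)) = (\<Sum>i<d. if i = j then z j else 0)"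
      unfolding j(2) by (rule sum.cong) (auto simp: val j)
    then show "v = (\<Sum>i<d. scale (zs i v) (z i))" using j by simp
  qed
  with lin val show ?thesis by (intro that[of zs]) (auto simp: zs_def)
qed

end

text \<open>Apart from antisymmetry, the identities of \<open>twist_data\<close> are read off in the
  coordinates \<open>xs\<close> and \<open>ys\<close> of h: the representation, derivation and
  Jacobi laws come from the Jacobi identity, the others from the cocycle property of \<omega>, which
  is the Yang-Baxter equation.\<close>

lemma twist_data_exists:
  fixes scale :: "'k::field_char_0 \<Rightarrow> 'g::ab_group_add \<Rightarrow> 'g"
  assumes la: "lie_algebra scale bracket"
    and cybe: "\<And>a b e. lie_algebra.linf scale a \<Longrightarrow> lie_algebra.linf scale b \<Longrightarrow> lie_algebra.linf scale e \<Longrightarrow>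
      2 * (e (bracket (lie_algebra.rvec scale p a) (lie_algebra.rvec scale p b))
        + a (bracket (lie_algebra.rvec scale p b) (lie_algebra.rvec scale p e))
        + b (bracket (lie_algebra.rvec scale p e) (lie_algebra.rvec scale p a))) = 0"
  obtains d y R C c \<Gamma> where "lie_twist scale bracket d C c \<Gamma> R y"
    "\<And>a b. lie_algebra.linf scale a \<Longrightarrow> lie_algebra.linf scale b \<Longrightarrow>
      (\<Sum>w\<in>Poly_Mapping.keys p. Poly_Mapping.lookup p w * (a (w ! 0) * b (w ! 1) - a (w ! 1) * b (w ! 0)))
      = (\<Sum>i<d. \<Sum>j<d. R i j * (a (y i) * b (y j)))"
proof -
  interpret lie_algebra scale bracket by (rule la)
  let ?\<phi> = "\<lambda>a b. \<Sum>w\<in>Poly_Mapping.keys p. Poly_Mapping.lookup p w * (a (w ! 0) * b (w ! 1) - a (w ! 1) * b (w ! 0))"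
  obtain I0 y0 R0 where "bivec ?\<phi> I0 y0 R0" 
    using bivec_exists[where t = "Poly_Mapping.lookup p", OF finite_keys[of p]] by blast
  then obtain d y R where biv: "bivec ?\<phi> {..<d} y R"
    and y0: "\<And>i. i \<ge> d \<Longrightarrow> y i = 0" and R0: "\<And>i j. i \<ge> d \<or> j \<ge> d \<Longrightarrow> R i j = 0"
    and y_indep: "\<And>k i. (\<Sum>i<d. scale (k i) (y i)) = 0 \<Longrightarrow> i < d \<Longrightarrow> k i = 0"
    and R_nondeg: "\<And>k i. (\<And>j. j < d \<Longrightarrow> (\<Sum>i<d. k i * R i j) = 0) \<Longrightarrow> i < d \<Longrightarrow> k i = 0"
    by (rule bivec_minimal) blast
  have R_anti: "R j i = - R i j" for i j by (rule bivecD(2)[OF biv])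
  have rep: "?\<phi> a b = (\<Sum>i<d. \<Sum>j<d. R i j * (a (y i) * b (y j)))" if "linf a" "linf b" for a b
    by (rule bivecD(4)[OF biv that])
  have y_ind: "\<forall>k. (\<Sum>i<d. scale (k i) (y i)) = 0 \<longrightarrow> (\<forall>i<d. k i = 0)" using y_indep by blast
  \<comment> \<open>The contraction of r with the coordinate functional \<open>ys j\<close>, see
    \<open>rvec_ys\<close>.\<close>
  define x where "x j = (\<Sum>i<d. scale (R i j) (y i))" for j
  have x0: "x j = 0" if "j \<ge> d" for j using that R0 by (simp add: x_def)
  have x_indep: "k i = 0" if k: "(\<Sum>j<d. scale (k j) (x j)) = 0" "i < d" for k i
  proof (rule R_nondeg[OF _ k(2)])
    fix j assume j: "j < d"
    have "(\<Sum>j<d. scale (k j) (x j)) = (\<Sum>i<d. scale (\<Sum>j<d. k j * R i j) (y i))"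
      unfolding x_def scale_sum_right scale_sum_left by (subst sum.swap) simp
    with k(1) have "(\<Sum>l<d. k l * R j l) = 0" using y_indep[of "\<lambda>i. \<Sum>j<d. k j * R i j" j] j by simp
    moreover have "(\<Sum>l<d. k l * R l j) = - (\<Sum>l<d. k l * R j l)"
      unfolding sum_negf[symmetric] by (rule sum.cong) (simp_all add: R_anti[of _ j])
    ultimately show "(\<Sum>l<d. k l * R l j) = 0" by simp
  qed
  have x_ind: "\<forall>k. (\<Sum>i<d. scale (k i) (x i)) = 0 \<longrightarrow> (\<forall>i<d. k i = 0)" using x_indep by blast
  let ?H = "span (y ` {..<d})"
  have y_H: "y i \<in> ?H" for i
    using y0[of i] by (cases "i < d") (auto intro: span_base span_zero)
  have x_H: "x j \<in> ?H" for j
    unfolding x_def by (intro span_sum span_scale y_H)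
  have H_eq: "?H = span (x ` {..<d})"
  proof
    show "span (x ` {..<d}) \<subseteq> ?H" by (rule span_minimal) (use x_H in auto)
    \<comment> \<open>Dimension count: inside a space spanned by \<open>d\<close> vectors,
      \<open>d\<close> independent vectors leave no room for another.\<close>
    have "y i \<in> span (x ` {..<d})" if "i < d" for i
    proof (rule ccontr)
      assume n: "y i \<notin> span (x ` {..<d})"
      have ind: "independent (insert (y i) (x ` {..<d}))"
        by (rule independent_insertI[OF n indep_family(2)[OF x_ind]])
      have new: "y i \<notin> x ` {..<d}" using n by (rule contrapos_nn) (rule span_base)
      have "insert (y i) (x ` {..<d}) \<subseteq> ?H" using x_H y_H by auto
      then have "card (insert (y i) (x ` {..<d})) \<le> card (y ` {..<d})"
        using independent_span_bound[OF _ ind] by simp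
      then show False
        using new card_image[OF indep_family(1)[OF x_ind]] card_image[OF indep_family(1)[OF y_ind]] by simp
    qed
    then show "?H \<subseteq> span (x ` {..<d})" by (intro span_minimal) auto
  qed
  obtain ys where ys: "\<And>i. linf (ys i)" "\<And>i j. j < d \<Longrightarrow> ys i (y j) = (if i = j then 1 else 0)" "\<And>i v. i \<ge> d \<Longrightarrow> ys i v = 0"
    and ys_exp: "\<And>v. v \<in> ?H \<Longrightarrow> v = (\<Sum>i<d. scale (ys i v) (y i))"
    by (rule dual_functionals[OF y_ind]) blast
  obtain xs where xs: "\<And>i. linf (xs i)" "\<And>i j. j < d \<Longrightarrow> xs i (x j) = (if i = j then 1 else 0)" "\<And>i v. i \<ge> d \<Longrightarrow> xs i v = 0"
    and xs_exp: "\<And>v. v \<in> ?H \<Longrightarrow> v = (\<Sum>i<d. scale (xs i v) (x i))"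
    unfolding H_eq by (rule dual_functionals[OF x_ind]) blast
  have E1: "f v = (\<Sum>l<d. xs l v * f (x l))" if "v \<in> ?H" "linf f" for f v
    by (subst xs_exp[OF that(1)]) (simp add: linf_sum[OF that(2)] linfD(2)[OF that(2)])
  have E2: "f v = (\<Sum>l<d. ys l v * f (y l))" if "v \<in> ?H" "linf f" for f v
    by (subst ys_exp[OF that(1)]) (simp add: linf_sum[OF that(2)] linfD(2)[OF that(2)])
  have ys_x: "ys l (x j) = R l j" for l j
  proof (cases "l < d")
    case True
    have "ys l (x j) = (\<Sum>i<d. R i j * ys l (y i))" by (simp add: x_def linf_sum[OF ys(1)] linfD(2)[OF ys(1)])
    also have "\<dots> = (\<Sum>i<d. if i = l then R l j else 0)" by (rule sum.cong) (auto simp: ys(2))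
    finally show ?thesis using True by simp
  qed (simp add: ys(3) R0)
  \<comment> \<open>Functionals separate points, so the equality is tested by applying
    \<open>b\<close> to both sides, where it becomes \<open>rep\<close>.\<close>
  have rvec: "rvec p a = (\<Sum>j<d. scale (a (y j)) (x j))" if a: "linf a" for a
  proof -
    have "b (rvec p a - (\<Sum>j<d. scale (a (y j)) (x j))) = 0" if b: "linf b" for b
    proof -
      have "b (rvec p a) = ?\<phi> b a"
        by (simp add: rvec_def linf_sum[OF b] linfD(2)[OF b] linf_diff[OF b] mult.commute)
      also have "\<dots> = b (\<Sum>j<d. scale (a (y j)) (x j))"
        unfolding rep[OF b a] x_def
        by (simp add: linf_sum[OF b] linfD(2)[OF b] sum_distrib_left) (subst sum.swap, simp add: mult_ac)
      finally show ?thesis by (simp add: linf_diff[OF b])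
    qed
    then show ?thesis using linf_separate[of "rvec p a - (\<Sum>j<d. scale (a (y j)) (x j))"] by simp
  qed
  have rvec_ys: "rvec p (ys i) = x i" for i
  proof (cases "i < d")
    case True
    have "rvec p (ys i) = (\<Sum>j<d. if j = i then x i else 0)"
      unfolding rvec[OF ys(1)] by (rule sum.cong) (auto simp: ys(2))
    then show ?thesis using True by simp
  qed (simp add: rvec[OF ys(1)] ys(3) x0)
  \<comment> \<open>The Yang-Baxter equation at three coordinate functionals; the factor 2 cancels
    in characteristic 0.\<close>
  have cyc: "ys k (bracket (x i) (x j)) + ys i (bracket (x j) (x k)) + ys j (bracket (x k) (x i)) = 0" for i j k
    using cybe[OF ys(1)[of i] ys(1)[of j] ys(1)[of k]] unfolding rvec_ys mult_eq_0_iff by simp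
  have br0: "bracket 0 v = 0" "bracket v 0 = 0" for v
    using bracket_lin(3)[of 0 0 v] bracket_lin(4)[of v 0 0] by simp_all
  \<comment> \<open>A functional that vanishes on h and is 1 at the bracket has contraction zero
    with r; the Yang-Baxter equation then makes it vanish at the bracket.\<close>
  have xx_H: "bracket (x i) (x j) \<in> ?H" for i j
  proof (rule ccontr)
    assume n: "bracket (x i) (x j) \<notin> ?H"
    have "independent (insert (bracket (x i) (x j)) (y ` {..<d}))"
      by (rule independent_insertI[OF n indep_family(2)[OF y_ind]])
    then obtain a where a: "linf a" "\<And>v. v \<in> insert (bracket (x i) (x j)) (y ` {..<d}) \<Longrightarrow> a v = (if v = bracket (x i) (x j) then 1 else 0)"
      using linf_extend[where f = "\<lambda>v. if v = bracket (x i) (x j) then 1 else 0"] by blast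
    have "a (y l) = 0" if "l < d" for l
      using a(2)[of "y l"] that n y_H[of l] by auto
    then have "rvec p a = 0" by (simp add: rvec[OF a(1)])
    then have "a (bracket (x i) (x j)) = 0"
      using cybe[OF ys(1)[of i] ys(1)[of j] a(1)] by (simp add: rvec_ys br0 linf_zero[OF ys(1)])
    then show False using a(2) by simp
  qed
  have br_H: "bracket u v \<in> ?H" if "u \<in> ?H" "v \<in> ?H" for u v
  proof -
    have "bracket u v = (\<Sum>i<d. \<Sum>j<d. scale (xs i u * xs j v) (bracket (x i) (x j)))"
    proof (rule ccontr)
      assume "\<not> ?thesis"
      then have "bracket u v - (\<Sum>i<d. \<Sum>j<d. scale (xs i u * xs j v) (bracket (x i) (x j))) \<noteq> 0" by simp
      moreover have "a (bracket u v - (\<Sum>i<d. \<Sum>j<d. scale (xs i u * xs j v) (bracket (x i) (x j)))) = 0" if a: "linf a" for a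
        using E1[OF \<open>u \<in> ?H\<close> linf_bracket_l[OF a, of v]] E1[OF \<open>v \<in> ?H\<close> linf_bracket_r[OF a]]
        by (simp add: linf_diff[OF a] linf_sum[OF a] linfD(2)[OF a] sum_distrib_left mult.assoc)
      ultimately show False using linf_separate by blast
    qed
    also have "\<dots> \<in> ?H" by (intro span_sum span_scale xx_H)
    finally show ?thesis .
  qed
  \<comment> \<open>The inverse of r: contraction with r takes \<open>ys i\<close> to
    \<open>x i\<close>, and by \<open>\<omega>_x\<close> the form takes \<open>x i\<close> back to
    \<open>ys i\<close>. Together with \<open>\<omega>_x'\<close> this makes it antisymmetric on
    h.\<close>
  define \<omega> where "\<omega> v w = (\<Sum>l<d. xs l v * ys l w)" for v w
  have \<omega>_lin: "linf (\<lambda>v. \<omega> (f v) w)" "linf (\<lambda>v. \<omega> w (f v))"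
    if "\<And>u v. f (u + v) = f u + f v" "\<And>t v. f (scale t v) = scale t (f v)" for f w
    by (simp_all add: linf_def \<omega>_def that linfD[OF xs(1)] linfD[OF ys(1)] sum.distrib sum_distrib_left algebra_simps)
  have \<omega>_y: "\<omega> v (y i) = xs i v" for v i
  proof (cases "i < d")
    case True
    have "\<omega> v (y i) = (\<Sum>l<d. if l = i then xs i v else 0)"
      unfolding \<omega>_def by (rule sum.cong) (auto simp: ys(2) True)
    then show ?thesis using True by simp
  qed (simp add: \<omega>_def y0 linf_zero[OF ys(1)] xs(3))
  have \<omega>_x: "\<omega> (x k) w = ys k w" for k w
  proof (cases "k < d")
    case True
    have "\<omega> (x k) w = (\<Sum>l<d. if l = k then ys k w else 0)"
      unfolding \<omega>_def by (rule sum.cong) (auto simp: xs(2) True)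
    then show ?thesis using True by simp
  qed (simp add: \<omega>_def x0 linf_zero[OF xs(1)] ys(3))
  have \<omega>_x': "\<omega> v (x b) = - ys b v" if v: "v \<in> ?H" for v b
  proof -
    have "ys b v = (\<Sum>l<d. xs l v * R b l)" using E1[OF v ys(1)] by (simp add: ys_x)
    also have "\<dots> = - \<omega> v (x b)"
      unfolding \<omega>_def sum_negf[symmetric] by (rule sum.cong) (simp_all add: ys_x R_anti[of b])
    finally show ?thesis by simp
  qed
  have lin0: "f v = 0" if "linf f" "\<And>i. f (x i) = 0" "v \<in> ?H" for f v
    using E1[OF that(3,1)] that(2) by simp
  \<comment> \<open>The cocycle defect. Being trilinear, it is determined on h by its values on the
    basis x, where it is \<open>cyc\<close> up to sign.\<close>
  define Z where "Z u v w = \<omega> (bracket u v) w + \<omega> (bracket v w) u + \<omega> (bracket w u) v" for u v w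
  have linf_add: "linf (\<lambda>v. f v + g v + h v)" if "linf f" "linf g" "linf h" for f g h
    using that by (auto simp: linf_def algebra_simps)
  have Z_lin: "linf (\<lambda>u. Z u v w)" "linf (\<lambda>u. Z v u w)" "linf (\<lambda>u. Z v w u)" for v w
    unfolding Z_def by (intro linf_add \<omega>_lin; simp add: bracket_lin)+
  have Zxxx: "Z (x i) (x j) (x k) = 0" for i j k
  proof -
    have "Z (x i) (x j) (x k) = - (ys k (bracket (x i) (x j)) + ys i (bracket (x j) (x k)) + ys j (bracket (x k) (x i)))"
      by (simp add: Z_def \<omega>_x'[OF xx_H])
    then show ?thesis by (simp only: cyc minus_zero)
  qed
  have Z: "Z u v w = 0" if "u \<in> ?H" "v \<in> ?H" "w \<in> ?H" for u v w
    by (rule lin0[OF Z_lin(1) _ that(1)], rule lin0[OF Z_lin(2) _ that(2)], rule lin0[OF Z_lin(3) _ that(3)], rule Zxxx)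
  have jac: "bracket (bracket u v) w = bracket (bracket u w) v + bracket u (bracket v w)" for u v w
  proof -
    have "bracket v (bracket w u) = bracket (bracket u w) v"
      using bracket_anti[of v "bracket w u"] bracket_anti[of w u] bracket_lin(3)[of "- 1" "bracket u w" v] by simp
    then show ?thesis
      using bracket_jacobi[of u v w] bracket_anti[of w "bracket u v"] by (simp add: algebra_simps)
  qed
  have neg: "f (bracket u v) = - f (bracket v u)" if "linf f" for f u v
    using bracket_anti[of u v] linf_minus[OF that] by simp
  define C where "C k i l = xs l (bracket (x k) (y i))" for k i l
  define c where "c i j k = ys k (bracket (y i) (y j))" for i j k
  define \<Gamma> where "\<Gamma> i j l = xs l (bracket (x i) (x j))" for i j l
  note br_mem = br_H x_H y_H
  have twd: "twist_data d C c \<Gamma> R"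
  proof
    show "C x y z = 0" "c x y z = 0" "\<Gamma> x y z = 0" if "z \<ge> d" for x y z
      using that by (simp_all add: C_def c_def \<Gamma>_def xs(3) ys(3))
    show "(\<Sum>l<d. C i j l * C l k m) - (\<Sum>l<d. C i k l * C l j m) = (\<Sum>l<d. c j k l * C i l m)" if "m < d" for i j k m
    proof -
      have "(\<Sum>l<d. C i j l * C l k m) = xs m (bracket (bracket (x i) (y j)) (y k))" for j k
        using E1[OF _ linf_bracket_l[OF xs(1)]] by (simp add: C_def br_mem)
      moreover have "(\<Sum>l<d. c j k l * C i l m) = xs m (bracket (x i) (bracket (y j) (y k)))"
        using E2[OF _ linf_bracket_r[OF xs(1)]] by (simp add: C_def c_def br_mem)
      ultimately show ?thesis using jac[of "x i" "y j" "y k"] by (simp add: linfD(1)[OF xs(1)])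
    qed
    \<comment> \<open>The cocycle condition at x_i, y_j, y_k; the next identity involving
      \<open>R\<close> is the one at x_i, x_j, y_k.\<close>
    show "C i j k - C i k j = c j k i" for i j k
      using Z[OF x_H y_H y_H, of i j k] neg[OF xs(1), of _ "y k" "x i"]
      by (simp add: Z_def \<omega>_y \<omega>_x' br_mem C_def c_def algebra_simps)
    show "(\<Sum>l<d. C i k l * \<Gamma> l j m) + (\<Sum>l<d. C j k l * \<Gamma> i l m) = (\<Sum>l<d. \<Gamma> i j l * C l k m)" if "m < d" for i j k m
    proof -
      have "(\<Sum>l<d. C i k l * \<Gamma> l j m) = xs m (bracket (bracket (x i) (y k)) (x j))"
        using E1[OF _ linf_bracket_l[OF xs(1)]] by (simp add: C_def \<Gamma>_def br_mem)
      moreover have "(\<Sum>l<d. C j k l * \<Gamma> i l m) = xs m (bracket (x i) (bracket (x j) (y k)))"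
        using E1[OF _ linf_bracket_r[OF xs(1)]] by (simp add: C_def \<Gamma>_def br_mem)
      moreover have "(\<Sum>l<d. \<Gamma> i j l * C l k m) = xs m (bracket (bracket (x i) (x j)) (y k))"
        using E1[OF _ linf_bracket_l[OF xs(1)]] by (simp add: C_def \<Gamma>_def br_mem)
      ultimately show ?thesis using jac[of "x i" "x j" "y k"] by (simp add: linfD(1)[OF xs(1)])
    qed
    show "(\<Sum>l<d. C i k l * R l j) + (\<Sum>l<d. C j k l * R i l) = \<Gamma> i j k" for i j k
    proof -
      have "(\<Sum>l<d. C i k l * R l j) = - ys j (bracket (x i) (y k))"
        unfolding \<omega>_x'[OF br_H[OF x_H y_H], symmetric] by (simp add: \<omega>_def C_def ys_x)
      moreover have "(\<Sum>l<d. C j k l * R i l) = ys i (bracket (x j) (y k))"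
        using E1[OF br_H[OF x_H y_H] ys(1)] by (simp add: C_def ys_x)
      ultimately show ?thesis
        using Z[OF x_H x_H y_H, of i j k] neg[OF ys(1), of j "y k" "x i"]
        by (simp add: Z_def \<omega>_y \<omega>_x' br_mem \<Gamma>_def algebra_simps)
    qed
    show "\<Gamma> j i l = - \<Gamma> i j l" for i j l by (simp add: \<Gamma>_def neg[OF xs(1), of l "x j"])
    show "R j i = - R i j" for i j by (rule R_anti)
    show "(\<Sum>m<d. \<Gamma> i j m * \<Gamma> m k l) + (\<Sum>m<d. \<Gamma> j k m * \<Gamma> m i l) + (\<Sum>m<d. \<Gamma> k i m * \<Gamma> m j l) = 0" for i j k l
    proof -
      have "(\<Sum>m<d. \<Gamma> i j m * \<Gamma> m k l) = xs l (bracket (bracket (x i) (x j)) (x k))" for i j k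
        using E1[OF _ linf_bracket_l[OF xs(1)]] by (simp add: \<Gamma>_def br_mem)
      moreover have "xs l (bracket (x k) (bracket (x i) (x j))) + xs l (bracket (x i) (bracket (x j) (x k)))
          + xs l (bracket (x j) (bracket (x k) (x i))) = 0"
        using arg_cong[OF bracket_jacobi[of "x k" "x i" "x j"], of "xs l"] by (simp add: linfD(1)[OF xs(1)] linf_zero[OF xs(1)])
      ultimately show ?thesis
        unfolding neg[OF xs(1), of l "x k"] neg[OF xs(1), of l "x i"] neg[OF xs(1), of l "x j"]
        by (simp only: minus_add_distrib[symmetric] neg_equal_0_iff_equal)
    qed
    show "(\<Sum>m<d. \<Gamma> i j m * R m k) + (\<Sum>m<d. \<Gamma> j k m * R m i) + (\<Sum>m<d. \<Gamma> k i m * R m j) = 0" for i j k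
    proof -
      have "(\<Sum>m<d. \<Gamma> i j m * R m k) = - ys k (bracket (x i) (x j))" for i j k
        unfolding \<omega>_x'[OF xx_H, symmetric] by (simp add: \<omega>_def \<Gamma>_def ys_x)
      then show ?thesis using cyc[of j k i] cyc[of k i j] by (simp only: minus_add_distrib[symmetric] neg_equal_0_iff_equal)
    qed
  qed
  have "lie_twist scale bracket d C c \<Gamma> R y"
    by (intro lie_twist.intro la twd lie_twist_axioms.intro) (simp add: c_def ys_exp[OF br_H[OF y_H y_H], symmetric])
  then show ?thesis using rep by (rule that)
qed

section \<open>Tensors determined by their values on functionals\<close>

context finite_dimensional_lie_algebra begin

lemma finite_basis:
  obtains B \<beta> where "finite B" "\<And>b. linf (\<beta> b)" "\<And>v. v = (\<Sum>b\<in>B. scale (\<beta> b v) b)"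
proof -
  obtain S where S: "finite S" "span S = UNIV" using finite_dimensional by blast
  obtain B where B: "B \<subseteq> S" "independent B" "S \<subseteq> span B"
    using maximal_independent_subset[of S] by blast
  have sp: "v \<in> span B" for v
    using S(2) span_mono[OF B(3)] by (auto simp: span_span)
  have fin: "finite B" using B(1) S(1) by (rule finite_subset)
  show ?thesis
  proof (rule that[OF fin, of "\<lambda>b v. representation B v b"])
    show "linf (\<lambda>v. representation B v b)" for b
      by (simp add: linf_def representation_add[OF B(2) sp sp] representation_scale[OF B(2) sp])
    show "v = (\<Sum>b\<in>B. scale (representation B v b) b)" for v
      using sum_representation_eq[OF B(2) sp fin order_refl, of v] by simp
  qed
qed

text \<open>Both tensors are expanded in one finite basis of g, whose coordinates are functionals.
  This converts the equality of bilinear forms supplied by \<open>bivec\<close> into an equality in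
  U \<otimes> U.\<close>

lemma lin_ext_ten_eqI:
  assumes "\<And>a b. linf a \<Longrightarrow> linf b \<Longrightarrow> lc (*) (\<lambda>(u, v). a u * b v) q = lc (*) (\<lambda>(u, v). a u * b v) q'"
  shows "lin_ext UU (\<lambda>(u, v). UU.ten (\<iota> u) (\<iota> v)) q = lin_ext UU (\<lambda>(u, v). UU.ten (\<iota> u) (\<iota> v)) q'"
proof -
  obtain B \<beta> where B: "finite B" "\<And>b. linf (\<beta> b)" and exp: "\<And>v. v = (\<Sum>b\<in>B. scale (\<beta> b v) b)"
    by (rule finite_basis) blast
  have lin_sum: "\<phi> (\<Sum>b\<in>I. scale (f b) b) = (\<Oplus>\<^bsub>UU\<^esub>b\<in>I. f b \<odot>\<^bsub>UU\<^esub> \<phi> b)"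
    if "finite I" and \<phi>: "\<And>u. \<phi> u \<in> carrier UU" "\<And>u v. \<phi> (u + v) = \<phi> u \<oplus>\<^bsub>UU\<^esub> \<phi> v" "\<And>t u. \<phi> (scale t u) = t \<odot>\<^bsub>UU\<^esub> \<phi> u"
    for \<phi> :: "'b \<Rightarrow> _" and I f
    using that(1)
  proof (induction I rule: finite_induct)
    case empty
    then show ?case using \<phi>(3)[of 0 0] by (simp add: \<phi>(1))
  next
    case (insert b I)
    then show ?case by (subst UUr.finsum_insert) (auto simp: \<phi>)
  qed
  have ten: "UU.ten (\<iota> u) (\<iota> v) = (\<Oplus>\<^bsub>UU\<^esub>b\<in>B. \<Oplus>\<^bsub>UU\<^esub>b'\<in>B. (\<beta> b u * \<beta> b' v) \<odot>\<^bsub>UU\<^esub> UU.ten (\<iota> b) (\<iota> b'))" for u v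
  proof -
    have "UU.ten (\<iota> u) (\<iota> v) = (\<Oplus>\<^bsub>UU\<^esub>b\<in>B. \<beta> b u \<odot>\<^bsub>UU\<^esub> UU.ten (\<iota> b) (\<iota> v))"
      by (subst exp[of u], rule lin_sum[of B "\<lambda>u. UU.ten (\<iota> u) (\<iota> v)", OF B(1)])
        (simp_all add: \<iota>_add \<iota>_scale UU.ten_add_l UU.ten_smult_l)
    also have "\<dots> = (\<Oplus>\<^bsub>UU\<^esub>b\<in>B. \<Oplus>\<^bsub>UU\<^esub>b'\<in>B. (\<beta> b u * \<beta> b' v) \<odot>\<^bsub>UU\<^esub> UU.ten (\<iota> b) (\<iota> b'))"
    proof (rule UUr.finsum_cong')
      fix b
      have "UU.ten (\<iota> b) (\<iota> v) = (\<Oplus>\<^bsub>UU\<^esub>b'\<in>B. \<beta> b' v \<odot>\<^bsub>UU\<^esub> UU.ten (\<iota> b) (\<iota> b'))"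
        by (subst exp[of v], rule lin_sum[of B "\<lambda>v. UU.ten (\<iota> b) (\<iota> v)", OF B(1)])
          (simp_all add: \<iota>_add \<iota>_scale UU.ten_add_r UU.ten_smult_r)
      then show "\<beta> b u \<odot>\<^bsub>UU\<^esub> UU.ten (\<iota> b) (\<iota> v) = (\<Oplus>\<^bsub>UU\<^esub>b'\<in>B. (\<beta> b u * \<beta> b' v) \<odot>\<^bsub>UU\<^esub> UU.ten (\<iota> b) (\<iota> b'))"
        by (simp add: UUr.finsum_smult B(1) UUr.smult_smult)
    qed (auto intro!: UUr.finsum_closed)
    finally show ?thesis .
  qed
  have "lin_ext UU (\<lambda>(u, v). UU.ten (\<iota> u) (\<iota> v)) q =
      (\<Oplus>\<^bsub>UU\<^esub>b\<in>B. \<Oplus>\<^bsub>UU\<^esub>b'\<in>B. lc (*) (\<lambda>(u, v). \<beta> b u * \<beta> b' v) q \<odot>\<^bsub>UU\<^esub> UU.ten (\<iota> b) (\<iota> b'))" for q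
    using subset_UNIV[of "Poly_Mapping.keys q"]
  proof (induction q rule: keys_induct)
    case zero
    show ?case by (simp add: UUr.finsum_zero)
  next
    case (single x c)
    obtain u v where x: "x = (u, v)" by (cases x)
    have "c \<odot>\<^bsub>UU\<^esub> UU.ten (\<iota> u) (\<iota> v) = (\<Oplus>\<^bsub>UU\<^esub>b\<in>B. \<Oplus>\<^bsub>UU\<^esub>b'\<in>B. (c * (\<beta> b u * \<beta> b' v)) \<odot>\<^bsub>UU\<^esub> UU.ten (\<iota> b) (\<iota> b'))"
      by (subst ten) (simp add: UUr.finsum_smult B(1) UUr.smult_smult UUr.finsum_closed Pi_def)
    then show ?case unfolding x by (subst UUr.lin_ext_single) simp_all
  next
    case (add p q)
    have c: "(\<lambda>(u, v). UU.ten (\<iota> u) (\<iota> v)) \<in> UNIV \<rightarrow> carrier UU" by auto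
    show ?case
      unfolding UUr.lin_ext_add[OF add.hyps(1,2) c] add.IH fld.lc_add
      by (simp add: UUr.smult_l_distr UUr.finsum_addf UUr.finsum_closed Pi_def)
  qed
  then show ?thesis by (simp add: assms[OF B(2) B(2)])
qed

end

theorem corollary4p7:
  fixes scale :: "'k::field_char_0 \<Rightarrow> 'g::ab_group_add \<Rightarrow> 'g"
    and bracket :: "'g \<Rightarrow> 'g \<Rightarrow> 'g"
    and r :: "('g list \<Rightarrow>\<^sub>0 'k) set"
  assumes "finite_dimensional_lie_algebra scale bracket"
    and "classical_r_matrix scale bracket r"
  defines "U \<equiv> uea scale bracket"
  defines "UU \<equiv> tensor_product U U"
  shows "\<exists>F :: nat \<Rightarrow> (('g list \<Rightarrow>\<^sub>0 'k) set \<times> ('g list \<Rightarrow>\<^sub>0 'k) set \<Rightarrow>\<^sub>0 'k) set.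
    formal_twist scale bracket F \<and>
    F 0 = tensor U U \<one>\<^bsub>U\<^esub> \<one>\<^bsub>U\<^esub> \<and>
    F 1 = (1 / 2) \<odot>\<^bsub>UU\<^esub> antisymmetric_tensor scale bracket r"
proof -
  interpret fd: finite_dimensional_lie_algebra scale bracket by fact
  obtain p where p: "\<And>w. w \<in> Poly_Mapping.keys p \<Longrightarrow> length w = 2"
    and r: "antisymmetric_tensor scale bracket r =
      lin_ext fd.UU (\<lambda>w. case w of [x, y] \<Rightarrow> fd.UU.ten (fd.\<iota> x) (fd.\<iota> y) \<ominus>\<^bsub>fd.UU\<^esub> fd.UU.ten (fd.\<iota> y) (fd.\<iota> x) | _ \<Rightarrow> \<zero>\<^bsub>fd.UU\<^esub>) p"
    and cybe: "\<And>a b e. fd.linf a \<Longrightarrow> fd.linf b \<Longrightarrow> fd.linf e \<Longrightarrow>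
      2 * (e (bracket (fd.rvec p a) (fd.rvec p b)) + a (bracket (fd.rvec p b) (fd.rvec p e)) + b (bracket (fd.rvec p e) (fd.rvec p a))) = 0"
    by (rule fd.classical_r_matrixE[OF assms(2)]) blast
  obtain d y R C c \<Gamma> where lt: "lie_twist scale bracket d C c \<Gamma> R y"
    and rep: "\<And>a b. fd.linf a \<Longrightarrow> fd.linf b \<Longrightarrow>
      (\<Sum>w\<in>Poly_Mapping.keys p. Poly_Mapping.lookup p w * (a (w ! 0) * b (w ! 1) - a (w ! 1) * b (w ! 0)))
      = (\<Sum>i<d. \<Sum>j<d. R i j * (a (y i) * b (y j)))"
    by (rule twist_data_exists[where p = p, OF fd.lie_algebra_axioms], rule cybe, assumption+, blast)
  interpret tw: lie_twist scale bracket d C c \<Gamma> R y by (rule lt)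
  define g where "g = (\<lambda>(u, v). fd.UU.ten (fd.\<iota> u) (fd.\<iota> v))"
  have g: "g x \<in> carrier fd.UU" for x by (cases x) (simp add: g_def)
  then have gf: "g \<in> UNIV \<rightarrow> carrier fd.UU" by auto
  \<comment> \<open>The antisymmetrisation of a two-letter word, as a formal combination of pairs of
    vectors; \<open>q\<close> is the same tensor in the reduced presentation.\<close>
  define f :: "'g list \<Rightarrow> 'g \<times> 'g \<Rightarrow>\<^sub>0 'k" where
    "f w = (case w of [x, y] \<Rightarrow> Poly_Mapping.single (x, y) 1 - Poly_Mapping.single (y, x) 1 | _ \<Rightarrow> 0)" for w
  define q where "q = (\<Sum>i<d. \<Sum>j<d. Poly_Mapping.single (y i, y j) (R i j))"
  have "antisymmetric_tensor scale bracket r = lin_ext fd.UU (\<lambda>w. lin_ext fd.UU g (f w)) p"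
    unfolding r
  proof (rule fd.UUr.lin_ext_cong)
    fix w assume "w \<in> Poly_Mapping.keys p"
    then obtain u v where w: "w = [u, v]" using p[of w] by (auto simp: numeral_2_eq_2 length_Suc_conv)
    show "(case w of [x, y] \<Rightarrow> fd.UU.ten (fd.\<iota> x) (fd.\<iota> y) \<ominus>\<^bsub>fd.UU\<^esub> fd.UU.ten (fd.\<iota> y) (fd.\<iota> x) | _ \<Rightarrow> \<zero>\<^bsub>fd.UU\<^esub>)
      = lin_ext fd.UU g (f w)"
      by (simp add: w f_def fd.UUr.lin_ext_diff[where S = UNIV, OF _ _ gf] fd.UUr.lin_ext_single[of g] g) (simp add: g_def)
  qed (use g in auto)
  also have "\<dots> = lin_ext fd.UU g (lc pm_scale f p)"
    by (rule fd.UUr.lin_ext_lc[symmetric, where S = UNIV]) (simp_all add: g)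
  also have "\<dots> = lin_ext fd.UU g q"
    unfolding g_def
  proof (rule fd.lin_ext_ten_eqI)
    fix a b assume ab: "fd.linf a" "fd.linf b"
    have "lc (*) (\<lambda>(u, v). a u * b v) (lc pm_scale f p) = lc (*) (\<lambda>w. lc (*) (\<lambda>(u, v). a u * b v) (f w)) p"
      by (rule fld.lc_lc)
    also have "\<dots> = (\<Sum>w\<in>Poly_Mapping.keys p. Poly_Mapping.lookup p w * (a (w ! 0) * b (w ! 1) - a (w ! 1) * b (w ! 0)))"
      unfolding lc_def
    proof (rule sum.cong[OF refl])
      fix w assume "w \<in> Poly_Mapping.keys p"
      then obtain u v where w: "w = [u, v]" using p[of w] by (auto simp: numeral_2_eq_2 length_Suc_conv)
      show "Poly_Mapping.lookup p w * (\<Sum>x\<in>Poly_Mapping.keys (f w). Poly_Mapping.lookup (f w) x * (case x of (u, v) \<Rightarrow> a u * b v))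
        = Poly_Mapping.lookup p w * (a (w ! 0) * b (w ! 1) - a (w ! 1) * b (w ! 0))"
        unfolding lc_def[symmetric] w f_def by (simp add: fld.lc_diff)
    qed
    also have "\<dots> = lc (*) (\<lambda>(u, v). a u * b v) q"
      unfolding rep[OF ab] by (simp add: q_def fld.lc_sum)
    finally show "lc (*) (\<lambda>(u, v). a u * b v) (lc pm_scale f p) = lc (*) (\<lambda>(u, v). a u * b v) q" .
  qed
  finally have "(1 / 2) \<odot>\<^bsub>fd.UU\<^esub> antisymmetric_tensor scale bracket r = lin_ext fd.UU g (pm_scale (1 / 2) q)"
    by (simp add: fd.UUr.lin_ext_scale[where S = UNIV, OF _ gf])
  \<comment> \<open>Indices become one-letter words to match \<open>twist_low_order\<close>, and
    \<open>hd\<close> recovers them.\<close>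
  also have "pm_scale (1 / 2) q = lc pm_scale (\<lambda>(u, v). Poly_Mapping.single (y (hd u), y (hd v)) 1)
      (\<Sum>i<d. \<Sum>j<d. Poly_Mapping.single ([i], [j]) (R i j / 2))"
    by (simp add: q_def pm.lc_sum pm.scale_sum_right)
  also have "lin_ext fd.UU g \<dots> = lin_ext fd.UU (\<lambda>x. lin_ext fd.UU g (case x of (u, v) \<Rightarrow> Poly_Mapping.single (y (hd u), y (hd v)) 1))
      (\<Sum>i<d. \<Sum>j<d. Poly_Mapping.single ([i], [j]) (R i j / 2))"
    by (rule fd.UUr.lin_ext_lc[where S = UNIV]) (simp_all add: g)
  also have "\<dots> = tw.twist 1"
    unfolding tw.twist_low_order(2)
  proof (rule fd.UUr.lin_ext_cong)
    fix x assume x: "x \<in> Poly_Mapping.keys (\<Sum>i<d. \<Sum>j<d. Poly_Mapping.single ([i], [j]) (R i j / 2))"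
    have "Poly_Mapping.keys (\<Sum>i<d. \<Sum>j<d. Poly_Mapping.single ([i], [j]) (R i j / 2)) \<subseteq> {([i], [j]) | i j. True}"
      by (intro keys_sum_subset) auto
    with x obtain i j where x: "x = ([i], [j])" by auto
    show "lin_ext fd.UU g (case x of (u, v) \<Rightarrow> Poly_Mapping.single (y (hd u), y (hd v)) 1) = tw.E2 x"
      by (simp add: x fd.UUr.lin_ext_single[of g] g) (simp add: g_def tw.E2_def tw.ev_single)
  qed (simp add: tw.E2_closed)
  finally have "tw.twist 1 = (1 / 2) \<odot>\<^bsub>fd.UU\<^esub> antisymmetric_tensor scale bracket r" ..
  moreover have "tw.twist 0 = fd.UU.ten \<one>\<^bsub>fd.U\<^esub> \<one>\<^bsub>fd.U\<^esub>"
    by (simp only: tw.twist_low_order(1) fd.UU.T_one)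
  ultimately show ?thesis
    unfolding U_def UU_def by (intro exI[of _ tw.twist] conjI tw.formal_twist_twist)
qed

end
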